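(* As $n\to\infty$, the following convergences in distribution hold in $D([0,1])$: $$\sqrt{n}\,B_0^{(n)} \longrightarrow \sqrt{\beta'^{-1}}\,B_0, \qquad \sqrt{n}\,\mathcal B_0^{(n)} \longrightarrow \sqrt{1+\beta'^{-1}}\,B_0 .$$
   Context: For each $n$, $U=(U_{ij})_{1\le i,j\le n}$ is a Haar distributed random matrix in the unitary group $\mathbb U(n)$ (unitary case, $\beta'=1$) or in the orthogonal group $\mathbb O(n)$ (orthogonal case, $\beta'=1/2$). $R_1,\dots,R_n$ are i.i.d. random variables uniform on $[0,1]$, independent of $U$. Define the processes $$B_0^{(n)}(s)=\sum_{i=1}^{\lfloor ns\rfloor}\left(|U_{i1}|^2-\frac1n\right),\qquad \mathcal B_0^{(n)}(s)=\sum_{i=1}^n |U_{i1}|^2\left(\mathbf 1_{R_i\le s}-s\right),\qquad s\in[0,1].$$ $B_0$ is the standard Brownian bridge: the centered Gaussian process with continuous paths on $[0,1]$ and covariance $\mathbb E(B_0(s)B_0(s'))=s\wedge s'-ss'$. $D([0,1])$ is the space of càdlàg functions on $[0,1]$ with the Skorokhod topology. *)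

theory Defs
  imports "HOL-Probability.Probability" "Jordan_Normal_Form.Schur_Decomposition"
begin

section \<open>The Skorokhod space on the unit interval\<close>

text \<open>Paths are total functions on the reals; being extensional on the unit interval makes
  equality of paths coincide with equality on the interval.\<close>

definition skorokhod_space :: "(real \<Rightarrow> real) set" where
  "skorokhod_space = {x \<in> extensional {0..1}.
     (\<forall>t\<in>{0..<1}. (x \<longlongrightarrow> x t) (at_right t)) \<and>
     (\<forall>t\<in>{0<..1}. \<exists>l. (x \<longlongrightarrow> l) (at_left t))}"

definition time_changes :: "(real \<Rightarrow> real) set" where
  "time_changes = {\<gamma>. strict_mono_on {0..1} \<gamma> \<and> continuous_on {0..1} \<gamma> \<and> \<gamma> ` {0..1} = {0..1}}"

text \<open>Skorokhod's metric in the form given by Billingsley.  The value 0 outside the space is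
  only there because the locale of metric spaces requires nonnegativity and symmetry everywhere.\<close>

definition skorokhod_bounds :: "(real \<Rightarrow> real) \<Rightarrow> (real \<Rightarrow> real) \<Rightarrow> real set" where
  "skorokhod_bounds x y = {\<epsilon>. 0 \<le> \<epsilon> \<and> (\<exists>\<gamma>\<in>time_changes.
     (\<forall>t\<in>{0..1}. \<bar>\<gamma> t - t\<bar> \<le> \<epsilon>) \<and> (\<forall>t\<in>{0..1}. \<bar>x t - y (\<gamma> t)\<bar> \<le> \<epsilon>))}"

definition skorokhod_dist :: "(real \<Rightarrow> real) \<Rightarrow> (real \<Rightarrow> real) \<Rightarrow> real" where
  "skorokhod_dist x y = (if x \<in> skorokhod_space \<and> y \<in> skorokhod_space
     then Inf (skorokhod_bounds x y) else 0)"

lemma skorokhod_space_bounded: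
  assumes "x \<in> skorokhod_space"
  obtains B where "\<And>t. t \<in> {0..1} \<Longrightarrow> \<bar>x t\<bar> \<le> B"
proof -
  have "\<exists>a b B. a < t \<and> t < b \<and> (\<forall>s\<in>{a<..<b} \<inter> {0..1}. \<bar>x s\<bar> \<le> B)" if t: "t \<in> {0..1}" for t
  proof -
    have "\<exists>b>t. \<exists>B. \<forall>s\<in>{t<..<b} \<inter> {0..1}. \<bar>x s\<bar> \<le> B"
    proof (cases "t < 1")
      case True
      with assms t have "(x \<longlongrightarrow> x t) (at_right t)" by (auto simp: skorokhod_space_def)
      then have "\<forall>\<^sub>F s in at_right t. dist (x s) (x t) < 1" by (rule tendstoD) simp
      then obtain b where b: "b > t" "\<And>s. t < s \<Longrightarrow> s < b \<Longrightarrow> dist (x s) (x t) < 1"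
        unfolding eventually_at_right_field by auto
      have "\<forall>s\<in>{t<..<b} \<inter> {0..1}. \<bar>x s\<bar> \<le> \<bar>x t\<bar> + 1"
        using b(2) by (force simp: dist_real_def)
      with b(1) show ?thesis by blast
    next
      case False
      then have "\<forall>s\<in>{t<..<t+1} \<inter> {0..1}. \<bar>x s\<bar> \<le> 0" by auto
      then show ?thesis by (intro exI[of _ "t + 1"] exI[of _ 0] conjI) auto
    qed
    moreover have "\<exists>a<t. \<exists>B. \<forall>s\<in>{a<..<t} \<inter> {0..1}. \<bar>x s\<bar> \<le> B"
    proof (cases "t > 0")
      case True
      with t have "t \<in> {0<..1}" by simp
      with assms obtain l where "(x \<longlongrightarrow> l) (at_left t)" unfolding skorokhod_space_def by blast
      then have "\<forall>\<^sub>F s in at_left t. dist (x s) l < 1" by (rule tendstoD) simp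
      then obtain a where a: "a < t" "\<And>s. a < s \<Longrightarrow> s < t \<Longrightarrow> dist (x s) l < 1"
        unfolding eventually_at_left_field by auto
      have "\<forall>s\<in>{a<..<t} \<inter> {0..1}. \<bar>x s\<bar> \<le> \<bar>l\<bar> + 1"
        using a(2) by (force simp: dist_real_def)
      with a(1) show ?thesis by blast
    next
      case False
      then have "\<forall>s\<in>{t-1<..<t} \<inter> {0..1}. \<bar>x s\<bar> \<le> 0" by auto
      then show ?thesis by (intro exI[of _ "t - 1"] exI[of _ 0] conjI) auto
    qed
    ultimately obtain a b B1 B2 where *: "a < t" "t < b"
      "\<forall>s\<in>{t<..<b} \<inter> {0..1}. \<bar>x s\<bar> \<le> B1" "\<forall>s\<in>{a<..<t} \<inter> {0..1}. \<bar>x s\<bar> \<le> B2" by blast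
    have "\<bar>x s\<bar> \<le> max \<bar>x t\<bar> (max B1 B2)" if "s \<in> {a<..<b} \<inter> {0..1}" for s
    proof -
      consider "s = t" | "s > t" | "s < t" by linarith
      then show ?thesis
      proof cases
        case 1 then show ?thesis by simp
      next
        case 2 with that *(3) have "\<bar>x s\<bar> \<le> B1" by auto
        then show ?thesis by simp
      next
        case 3 with that *(4) have "\<bar>x s\<bar> \<le> B2" by auto
        then show ?thesis by simp
      qed
    qed
    with *(1,2) show ?thesis by blast
  qed
  then obtain a b B where abB: "\<And>t. t \<in> {0..1} \<Longrightarrow> a t < t" "\<And>t. t \<in> {0..1} \<Longrightarrow> t < b t"
      "\<And>t s. t \<in> {0..1} \<Longrightarrow> s\<in>{a t<..<b t} \<inter> {0..1} \<Longrightarrow> \<bar>x s\<bar> \<le> B t" by metis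
  have "{0..1::real} \<subseteq> (\<Union>t\<in>{0..1}. {a t<..<b t})" using abB(1,2) by force
  then obtain C where C: "C \<subseteq> {0..1}" "finite C" "{0..1} \<subseteq> (\<Union>t\<in>C. {a t<..<b t})"
    by (rule compactE_image[OF compact_Icc, rotated]) auto
  have "\<bar>x s\<bar> \<le> (\<Sum>t\<in>C. \<bar>B t\<bar>)" if "s \<in> {0..1}" for s
  proof -
    from that C obtain t where t: "t \<in> C" "s \<in> {a t<..<b t}" by blast
    with C that have "\<bar>x s\<bar> \<le> B t" by (intro abB(3)) auto
    also have "\<dots> \<le> \<bar>B t\<bar>" by simp
    also have "\<dots> \<le> (\<Sum>t\<in>C. \<bar>B t\<bar>)" using t C by (intro member_le_sum) auto
    finally show ?thesis .
  qed
  then show ?thesis by (rule that)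
qed

lemma time_changes_id: "(\<lambda>t. t) \<in> time_changes"
  by (auto simp: time_changes_def strict_mono_on_def)

lemma time_changes_comp:
  assumes "\<gamma> \<in> time_changes" "\<mu> \<in> time_changes"
  shows "(\<lambda>t. \<mu> (\<gamma> t)) \<in> time_changes"
proof -
  have "(\<lambda>t. \<mu> (\<gamma> t)) ` {0..1} = {0..1}"
    using assms unfolding time_changes_def by (simp add: image_image[symmetric])
  moreover have "continuous_on {0..1} (\<lambda>t. \<mu> (\<gamma> t))"
    using assms unfolding time_changes_def
    by (auto intro: continuous_on_compose2[of "{0..1}" \<mu>])
  moreover have "strict_mono_on {0..1} (\<lambda>t. \<mu> (\<gamma> t))"
    using assms unfolding time_changes_def
    by (intro strict_mono_onI) (auto intro!: strict_mono_onD[of "{0..1}" \<mu>] strict_mono_onD[of "{0..1}" \<gamma>])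
  ultimately show ?thesis by (simp add: time_changes_def)
qed

lemma time_changes_inv:
  assumes "\<gamma> \<in> time_changes"
  obtains \<mu> where "\<mu> \<in> time_changes" "\<And>t. t \<in> {0..1} \<Longrightarrow> \<gamma> (\<mu> t) = t"
proof -
  have sm: "strict_mono_on {0..1} \<gamma>" and co: "continuous_on {0..1} \<gamma>" and im: "\<gamma> ` {0..1} = {0..1}"
    using assms by (auto simp: time_changes_def)
  have inj: "inj_on \<gamma> {0..1}" using sm by (rule strict_mono_on_imp_inj_on)
  let ?m = "inv_into {0..1} \<gamma>"
  have l: "\<gamma> (?m t) = t" "?m t \<in> {0..1}" if "t \<in> {0..1}" for t
    using that im by (auto intro: f_inv_into_f inv_into_into simp del: atLeastAtMost_iff)
  have "strict_mono_on {0..1} ?m"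
  proof (rule strict_mono_onI)
    fix r s :: real assume rs: "r \<in> {0..1}" "s \<in> {0..1}" "r < s"
    show "?m r < ?m s"
    proof (rule ccontr)
      assume "\<not> ?m r < ?m s"
      then have "\<gamma> (?m s) \<le> \<gamma> (?m r)"
        using strict_mono_on_leD[OF sm l(2)[OF rs(2)] l(2)[OF rs(1)]] by simp
      with l(1) rs show False by simp
    qed
  qed
  moreover have "continuous_on {0..1} ?m"
    using continuous_on_inv[OF co compact_Icc, of ?m] inj im by simp
  moreover have "?m ` {0..1} = {0..1}"
    using inv_into_image_cancel[OF inj order_refl] im by simp
  ultimately have "?m \<in> time_changes" by (simp add: time_changes_def)
  with l(1) that show ?thesis by blast
qed

lemma time_changes_Icc: "\<gamma> \<in> time_changes \<Longrightarrow> t \<in> {0..1} \<Longrightarrow> \<gamma> t \<in> {0..1}"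
  unfolding time_changes_def by blast

lemma time_changes_1:
  assumes "\<gamma> \<in> time_changes" shows "\<gamma> 1 = 1"
proof -
  from assms have "1 \<in> \<gamma> ` {0..1}" by (simp add: time_changes_def)
  then obtain t where t: "t \<in> {0..1}" "\<gamma> t = 1" by force
  have "\<gamma> 1 \<le> 1" using time_changes_Icc[OF assms, of 1] by simp
  moreover have "t < 1 \<Longrightarrow> \<gamma> t < \<gamma> 1"
    using assms t(1) by (auto simp: time_changes_def strict_mono_on_def)
  ultimately show ?thesis using t by (cases "t = 1") auto
qed

lemma skorokhod_bounds_bdd_below: "bdd_below (skorokhod_bounds x y)"
  by (auto simp: skorokhod_bounds_def intro: bdd_belowI[of _ 0])

lemma skorokhod_bounds_nonempty:
  assumes "x \<in> skorokhod_space" "y \<in> skorokhod_space"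
  shows "skorokhod_bounds x y \<noteq> {}"
proof -
  obtain B where B: "\<And>t. t \<in> {0..1} \<Longrightarrow> \<bar>x t\<bar> \<le> B" using skorokhod_space_bounded assms(1) by blast
  obtain C where C: "\<And>t. t \<in> {0..1} \<Longrightarrow> \<bar>y t\<bar> \<le> C" using skorokhod_space_bounded assms(2) by blast
  have "0 \<le> B + C" using B[of 0] C[of 0] by simp
  moreover have "\<forall>t\<in>{0..1}. \<bar>x t - y t\<bar> \<le> B + C" 
    by (intro ballI order_trans[OF abs_triangle_ineq4] add_mono B C)
  ultimately have "B + C \<in> skorokhod_bounds x y"
    using time_changes_id by (auto simp: skorokhod_bounds_def intro!: bexI[of _ "\<lambda>t. t"])
  then show ?thesis by blast
qed

lemma skorokhod_bounds_sym: "skorokhod_bounds x y \<subseteq> skorokhod_bounds y x"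
proof
  fix e assume "e \<in> skorokhod_bounds x y"
  then obtain l where e: "0 \<le> e" and l: "l \<in> time_changes" "\<forall>t\<in>{0..1}. \<bar>l t - t\<bar> \<le> e"
    "\<forall>t\<in>{0..1}. \<bar>x t - y (l t)\<bar> \<le> e" by (auto simp: skorokhod_bounds_def)
  obtain m where m: "m \<in> time_changes" "\<And>t. t \<in> {0..1} \<Longrightarrow> l (m t) = t"
    using time_changes_inv[OF l(1)] by blast
  have "\<bar>m t - t\<bar> \<le> e" "\<bar>y t - x (m t)\<bar> \<le> e" if t: "t \<in> {0..1}" for t
    using l(2,3) m(2)[OF t] time_changes_Icc[OF m(1) t] by (metis abs_minus_commute)+
  with e m(1) show "e \<in> skorokhod_bounds y x" unfolding skorokhod_bounds_def by blast
qed

lemma skorokhod_bounds_add: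
  assumes "e \<in> skorokhod_bounds x y" "f \<in> skorokhod_bounds y z"
  shows "e + f \<in> skorokhod_bounds x z"
proof -
  obtain l where e: "0 \<le> e" and l: "l \<in> time_changes" "\<And>t. t\<in>{0..1} \<Longrightarrow> \<bar>l t - t\<bar> \<le> e"
    "\<And>t. t\<in>{0..1} \<Longrightarrow> \<bar>x t - y (l t)\<bar> \<le> e" using assms(1) by (auto simp: skorokhod_bounds_def)
  obtain m where f: "0 \<le> f" and m: "m \<in> time_changes" "\<And>t. t\<in>{0..1} \<Longrightarrow> \<bar>m t - t\<bar> \<le> f"
    "\<And>t. t\<in>{0..1} \<Longrightarrow> \<bar>y t - z (m t)\<bar> \<le> f" using assms(2) by (auto simp: skorokhod_bounds_def)
  have "\<bar>m (l t) - t\<bar> \<le> e + f" "\<bar>x t - z (m (l t))\<bar> \<le> e + f" if t: "t \<in> {0..1}" for t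
    using l(2,3)[OF t] m(2,3)[OF time_changes_Icc[OF l(1) t]] by linarith+
  with e f time_changes_comp[OF l(1) m(1)] show ?thesis
    by (auto simp: skorokhod_bounds_def intro!: bexI[of _ "\<lambda>t. m (l t)"])
qed

lemma skorokhod_dist_zero_imp_eq:
  assumes xy: "x \<in> skorokhod_space" "y \<in> skorokhod_space" and 0: "skorokhod_dist x y = 0"
  shows "x = y"
proof -
  have ex: "\<exists>l\<in>time_changes. (\<forall>t\<in>{0..1}. \<bar>l t - t\<bar> \<le> e) \<and> (\<forall>t\<in>{0..1}. \<bar>x t - y (l t)\<bar> \<le> e)"
    if "e > 0" for e
  proof -
    have "Inf (skorokhod_bounds x y) < e" using 0 xy that by (simp add: skorokhod_dist_def)
    then obtain f where "f \<in> skorokhod_bounds x y" "f < e"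
      using skorokhod_bounds_nonempty[OF xy] by (meson cInf_lessD)
    then show ?thesis unfolding skorokhod_bounds_def by force
  qed
  have "x t = y t" if t: "t \<in> {0..1}" for t
  proof (cases "t = 1")
    case True
    have "\<bar>x 1 - y 1\<bar> \<le> e" if "e > 0" for e
    proof -
      from ex[OF that] obtain l where l: "l \<in> time_changes" "\<forall>t\<in>{0..1}. \<bar>x t - y (l t)\<bar> \<le> e" by blast
      then have "\<bar>x 1 - y (l 1)\<bar> \<le> e" by simp
      then show ?thesis using time_changes_1[OF l(1)] by simp
    qed
    then show ?thesis using True dense_ge[of 0 "\<bar>x t - y t\<bar>"] by simp
  next
    case False
    with t have t1: "0 \<le> t" "t < 1" by auto
    have lim: "(x \<longlongrightarrow> x t) (at_right t)" "(y \<longlongrightarrow> y t) (at_right t)"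
      using xy t1 by (auto simp: skorokhod_space_def)
    have "\<bar>x t - y t\<bar> \<le> e" if e: "e > 0" for e
    proof -
      have e3: "e / 3 > 0" using e by simp
      obtain b where b: "b > t" "\<And>s. t < s \<Longrightarrow> s < b \<Longrightarrow> dist (x s) (x t) < e/3"
        using tendstoD[OF lim(1) e3] unfolding eventually_at_right_field by blast
      obtain c where c: "c > t" "\<And>s. t < s \<Longrightarrow> s < c \<Longrightarrow> dist (y s) (y t) < e/3"
        using tendstoD[OF lim(2) e3] unfolding eventually_at_right_field by blast
      define d where "d = min (min b c) 1"
      define s where "s = (t + d) / 2"
      have d: "t < d" "d \<le> b" "d \<le> c" "d \<le> 1" using b(1) c(1) t1 by (auto simp: d_def)
      have s: "t < s" "s < d" using d(1) by (auto simp: s_def)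
      define f where "f = min (e/3) (min (s - t) (d - s) / 2)"
      have "f > 0" using e s by (auto simp: f_def)
      then obtain l where l: "l \<in> time_changes" "\<forall>t\<in>{0..1}. \<bar>l t - t\<bar> \<le> f"
        "\<forall>t\<in>{0..1}. \<bar>x t - y (l t)\<bar> \<le> f" using ex by blast
      have sI: "s \<in> {0..1}" using s d t1 by simp
      have ls: "\<bar>l s - s\<bar> \<le> f" "\<bar>x s - y (l s)\<bar> \<le> f" using l sI by blast+
      have "f < s - t" "f < d - s" "f \<le> e/3" using s by (auto simp: f_def min_def)
      then have "t < l s" "l s < c" using ls(1) d by linarith+
      then have "dist (y (l s)) (y t) < e/3" by (rule c(2))
      moreover have "dist (x s) (x t) < e/3" using s d by (intro b(2)) auto
      ultimately show ?thesis using ls(2) \<open>f \<le> e/3\<close> unfolding dist_real_def by linarith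
    qed
    then show ?thesis using dense_ge[of 0 "\<bar>x t - y t\<bar>"] by simp
  qed
  with xy show ?thesis unfolding skorokhod_space_def by (auto intro: extensionalityI)
qed

lemma Metric_space_skorokhod: "Metric_space skorokhod_space skorokhod_dist"
proof
  fix x y z :: "real \<Rightarrow> real"
  have ge0: "0 \<le> Inf (skorokhod_bounds x y)" if "x \<in> skorokhod_space" "y \<in> skorokhod_space"
    using skorokhod_bounds_nonempty[OF that]
    by (intro cInf_greatest) (auto simp: skorokhod_bounds_def)
  then show nn: "0 \<le> skorokhod_dist x y" by (simp add: skorokhod_dist_def)
  show "skorokhod_dist x y = skorokhod_dist y x"
    using skorokhod_bounds_sym[of x y] skorokhod_bounds_sym[of y x] by (auto simp: skorokhod_dist_def)
  show "skorokhod_dist x y = 0 \<longleftrightarrow> x = y" if xy: "x \<in> skorokhod_space" "y \<in> skorokhod_space"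
  proof
    assume "x = y"
    moreover have "0 \<in> skorokhod_bounds x x"
      using time_changes_id by (auto simp: skorokhod_bounds_def intro!: bexI[of _ "\<lambda>t. t"])
    then have "Inf (skorokhod_bounds x x) \<le> 0"
      by (rule cInf_lower[OF _ skorokhod_bounds_bdd_below])
    ultimately show "skorokhod_dist x y = 0" using ge0 xy by (auto simp: skorokhod_dist_def)
  qed (rule skorokhod_dist_zero_imp_eq[OF xy])
  assume D: "x \<in> skorokhod_space" "y \<in> skorokhod_space" "z \<in> skorokhod_space"
  have "Inf (skorokhod_bounds x z) - f \<le> Inf (skorokhod_bounds x y)"
    if f: "f \<in> skorokhod_bounds y z" for f
    using cInf_lower[OF skorokhod_bounds_add[OF _ f] skorokhod_bounds_bdd_below]
    by (intro cInf_greatest[OF skorokhod_bounds_nonempty[OF D(1,2)]]) (simp add: algebra_simps)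
  then have "Inf (skorokhod_bounds x z) - Inf (skorokhod_bounds x y) \<le> Inf (skorokhod_bounds y z)"
    by (intro cInf_greatest[OF skorokhod_bounds_nonempty[OF D(2,3)]]) (simp add: algebra_simps)
  then show "skorokhod_dist x z \<le> skorokhod_dist x y + skorokhod_dist y z"
    using D by (simp add: skorokhod_dist_def algebra_simps)
qed

definition skorokhod_topology :: "(real \<Rightarrow> real) topology" where
  "skorokhod_topology = Metric_space.mtopology skorokhod_space skorokhod_dist"


section \<open>Convergence in distribution\<close>

definition borel_of_topology :: "'c topology \<Rightarrow> 'c measure" where
  "borel_of_topology T = sigma (topspace T) {S. openin T S}"

text \<open>The random elements may live on different probability spaces.  That they are random
  elements, i.e. Borel measurable, is part of the assertion.\<close>

definition converges_in_distribution ::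
  "'c topology \<Rightarrow> (nat \<Rightarrow> 'a measure) \<Rightarrow> (nat \<Rightarrow> 'a \<Rightarrow> 'c) \<Rightarrow> 'b measure \<Rightarrow> ('b \<Rightarrow> 'c) \<Rightarrow> bool" where
  "converges_in_distribution T M X N Y \<longleftrightarrow>
     (\<forall>n. X n \<in> M n \<rightarrow>\<^sub>M borel_of_topology T) \<and> Y \<in> N \<rightarrow>\<^sub>M borel_of_topology T \<and>
     (\<forall>f. continuous_map T (euclideanreal) f \<and> bounded (f ` topspace T) \<longrightarrow>
        (\<lambda>n. \<integral>\<omega>. f (X n \<omega>) \<partial>M n) \<longlonglongrightarrow> (\<integral>\<omega>. f (Y \<omega>) \<partial>N))"


section \<open>Haar distributed random matrices\<close>

definition unitary_group :: "nat \<Rightarrow> complex mat set" where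
  "unitary_group n = {A \<in> carrier_mat n n. A * mat_adjoint A = 1\<^sub>m n \<and> mat_adjoint A * A = 1\<^sub>m n}"

text \<open>Real matrices are viewed as complex matrices with real entries, so that both cases
  concern random complex matrices.\<close>

definition orthogonal_group :: "nat \<Rightarrow> complex mat set" where
  "orthogonal_group n = {A \<in> carrier_mat n n. (\<forall>i<n. \<forall>j<n. A $$ (i, j) \<in> \<real>) \<and>
     A * transpose_mat A = 1\<^sub>m n \<and> transpose_mat A * A = 1\<^sub>m n}"

text \<open>The sigma-algebra generated by the entries, which is the Borel sigma-algebra of the
  finite-dimensional space of \<open>n \<times> n\<close> matrices.\<close>

definition mat_borel :: "nat \<Rightarrow> complex mat measure" where
  "mat_borel n = vimage_algebra (carrier_mat n n)
     (\<lambda>A. \<lambda>(i, j)\<in>{..<n} \<times> {..<n}. A $$ (i, j)) (\<Pi>\<^sub>M _\<in>{..<n} \<times> {..<n}. borel)"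

text \<open>For a compact matrix group \<open>G\<close> the Haar probability measure is the unique
  probability measure on \<open>G\<close> invariant under left translations.\<close>

definition haar_distributed ::
  "'a measure \<Rightarrow> nat \<Rightarrow> complex mat set \<Rightarrow> ('a \<Rightarrow> complex mat) \<Rightarrow> bool" where
  "haar_distributed M n G X \<longleftrightarrow> prob_space M \<and>
     X \<in> M \<rightarrow>\<^sub>M restrict_space (mat_borel n) G \<and>
     (\<forall>A\<in>G. distr M (restrict_space (mat_borel n) G) (\<lambda>\<omega>. A * X \<omega>) =
            distr M (restrict_space (mat_borel n) G) X)"


section \<open>The uniform variables and the two processes\<close>

definition iid_uniform :: "'a measure \<Rightarrow> nat \<Rightarrow> (nat \<Rightarrow> 'a \<Rightarrow> real) \<Rightarrow> bool" where
  "iid_uniform M n R \<longleftrightarrow> prob_space.indep_vars M (\<lambda>_. borel) R {..<n} \<and>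
     (\<forall>i<n. distr M borel (R i) = uniform_measure lborel {0..1})"

text \<open>The library's notion of independence of two random variables requires them to have the
  same type, hence the formulation by events.\<close>

definition independent_variables ::
  "'a measure \<Rightarrow> 'c measure \<Rightarrow> ('a \<Rightarrow> 'c) \<Rightarrow> 'd measure \<Rightarrow> ('a \<Rightarrow> 'd) \<Rightarrow> bool" where
  "independent_variables M S X T Y \<longleftrightarrow> X \<in> M \<rightarrow>\<^sub>M S \<and> Y \<in> M \<rightarrow>\<^sub>M T \<and>
     prob_space.indep_set M {X -` A \<inter> space M | A. A \<in> sets S} {Y -` A \<inter> space M | A. A \<in> sets T}"

definition haar_setting :: "'a measure \<Rightarrow> nat \<Rightarrow> complex mat set \<Rightarrow>
    ('a \<Rightarrow> complex mat) \<Rightarrow> (nat \<Rightarrow> 'a \<Rightarrow> real) \<Rightarrow> bool" where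
  "haar_setting M n G U R \<longleftrightarrow> haar_distributed M n G U \<and> iid_uniform M n R \<and>
     independent_variables M (restrict_space (mat_borel n) G) U
       (\<Pi>\<^sub>M _\<in>{..<n}. borel) (\<lambda>\<omega>. \<lambda>i\<in>{..<n}. R i \<omega>)"

text \<open>Indices start at 0: the entry \<open>U $$ (i, 0)\<close> and \<open>R i\<close> stand for
  the entry in row \<open>i + 1\<close> of the first column and the \<open>i + 1\<close>-st uniform
  variable.\<close>

definition bridge_process :: "nat \<Rightarrow> ('a \<Rightarrow> complex mat) \<Rightarrow> 'a \<Rightarrow> real \<Rightarrow> real" where
  "bridge_process n U \<omega> s = (\<Sum>i<nat \<lfloor>real n * s\<rfloor>. (cmod (U \<omega> $$ (i, 0)))\<^sup>2 - 1 / real n)"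

definition randomized_bridge_process ::
  "nat \<Rightarrow> ('a \<Rightarrow> complex mat) \<Rightarrow> (nat \<Rightarrow> 'a \<Rightarrow> real) \<Rightarrow> 'a \<Rightarrow> real \<Rightarrow> real" where
  "randomized_bridge_process n U R \<omega> s =
     (\<Sum>i<n. (cmod (U \<omega> $$ (i, 0)))\<^sup>2 * (indicator {..s} (R i \<omega>) - s))"


section \<open>The Brownian bridge\<close>

text \<open>Degenerate normal laws are included; they occur at the end points of the bridge.\<close>

definition gaussian_variable :: "'b measure \<Rightarrow> ('b \<Rightarrow> real) \<Rightarrow> bool" where
  "gaussian_variable N X \<longleftrightarrow> X \<in> borel_measurable N \<and>
     (\<exists>\<mu> \<sigma>. (\<sigma> > 0 \<and> distributed N lborel X (normal_density \<mu> \<sigma>)) \<or> (AE \<omega> in N. X \<omega> = \<mu>))"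

definition gaussian_process :: "'b measure \<Rightarrow> 'i set \<Rightarrow> ('i \<Rightarrow> 'b \<Rightarrow> real) \<Rightarrow> bool" where
  "gaussian_process N I X \<longleftrightarrow> prob_space N \<and>
     (\<forall>J c. finite J \<and> J \<subseteq> I \<longrightarrow> gaussian_variable N (\<lambda>\<omega>. \<Sum>t\<in>J. c t * X t \<omega>))"

definition brownian_bridge :: "'b measure \<Rightarrow> (real \<Rightarrow> 'b \<Rightarrow> real) \<Rightarrow> bool" where
  "brownian_bridge N B \<longleftrightarrow> gaussian_process N {0..1} B \<and>
     (\<forall>s\<in>{0..1}. (\<integral>\<omega>. B s \<omega> \<partial>N) = 0) \<and>
     (\<forall>s\<in>{0..1}. \<forall>s'\<in>{0..1}. (\<integral>\<omega>. B s \<omega> * B s' \<omega> \<partial>N) = min s s' - s * s') \<and>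
     (\<forall>\<omega>\<in>space N. continuous_on {0..1} (\<lambda>s. B s \<omega>))"

end

theory Submission
  imports Defs "HOL-Real_Asymp.Real_Asymp"
begin

text \<open>
  Let \<open>A\<^sub>i = |U\<^sub>i\<^sub>1|\<^sup>2\<close> be the squared moduli of the first column. Invariance under permutation
  matrices makes the \<open>A\<^sub>i\<close> exchangeable, and invariance under plane rotations (together with
  \<open>\<Sum>A\<^sub>i = 1\<close>) controls their moments up to order four. In particular \<open>n \<Sum>A\<^sub>i\<^sup>2\<close> concentrates at
  \<open>\<kappa> = 1 + 1 / \<beta>'\<close>, and \<open>n\<^sup>2 \<Sum>A\<^sub>i\<^sup>4\<close> tends to 0.

  Given the column, the randomized bridge is a sum of independent centered variables, so its
  finite-dimensional distributions are asymptotically those of \<open>\<surd>\<kappa>\<close> times the bridge. The same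
  conditional argument applies to \<open>\<Sum>(A\<^sub>i - 1/n) 1(R\<^sub>i \<le> s)\<close>, with \<open>\<kappa> - 1\<close> in place of \<open>\<kappa>\<close>. By
  exchangeability this sum has the law of the partial sum of \<open>A\<^sub>i - 1/n\<close> up to the number of
  \<open>R\<^sub>i \<le> s\<close>, which is within \<open>O(\<surd>n)\<close> of \<open>ns\<close>; this yields the non-randomized bridge.

  Tightness comes from fourth moment bounds for increments of length at least \<open>1/n\<close>, chained along
  dyadic points. Between grid points both processes decrease at most at rate \<open>\<surd>n\<close>, which controls
  the remaining oscillation.
\<close>

section \<open>The Skorokhod metric\<close>

text \<open>The squared moduli have a Dirichlet law, but it is never computed. \<kappa> enters only
  as the ratio of E A_i^2 to E A_i A_k, which rotations by 45 degrees with averaged phases fix at 2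
  (unitary) or 3 (orthogonal), the fourth moments of a standard complex and a standard real
  Gaussian. The obstacle is that the weights are dependent, so no limit theorem for independent
  summands applies to them; the uniform variables supply the independence, also for the process in
  which they do not occur. Subtracting 1/n from each weight lowers the conditional variance from
  \<open>n * Q\<close> to \<open>n * Q - 1\<close>, which is the difference between the two limiting
  factors. A moment bound \<open>C * (t - s)^2\<close> cannot hold for increments shorter than 1/n,
  since a single jump already has a fourth moment of order 1/n^2; this is why chaining stops there
  and a one-sided bound has to finish. Convergence in distribution is tested on Lipschitz functions
  only, so closeness to a sampled path outside a small event and finite-dimensional limits suffice,
  without extraction of subsequences.\<close>

interpretation skorokhod: Metric_space skorokhod_space skorokhod_dist
  by (rule Metric_space_skorokhod)

lemma topspace_skorokhod [simp]: "topspace skorokhod_topology = skorokhod_space"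
  by (simp add: skorokhod_topology_def)

lemma space_borel_skorokhod [simp]: "space (borel_of_topology skorokhod_topology) = skorokhod_space"
  using openin_subset[of skorokhod_topology]
  by (simp add: borel_of_topology_def space_measure_of_conv)

lemma measurable_borel_of_topologyI:
  assumes "\<And>\<omega>. \<omega> \<in> space M \<Longrightarrow> X \<omega> \<in> topspace T"
    and "\<And>S. openin T S \<Longrightarrow> X -` S \<inter> space M \<in> sets M"
  shows "X \<in> M \<rightarrow>\<^sub>M borel_of_topology T"
  unfolding borel_of_topology_def using assms openin_subset[of T]
  by (intro measurable_measure_of) auto

lemma open_in_borel_of_topology:
  "openin T S \<Longrightarrow> S \<in> sets (borel_of_topology T)"
  unfolding borel_of_topology_def using openin_subset[of T]
  by (subst sets_measure_of) auto

lemma skorokhod_dist_le_sup: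
  assumes "x \<in> skorokhod_space" "y \<in> skorokhod_space" "0 \<le> e" "\<And>t. t \<in> {0..1} \<Longrightarrow> \<bar>x t - y t\<bar> \<le> e"
  shows "skorokhod_dist x y \<le> e"
proof -
  have "e \<in> skorokhod_bounds x y"
    using assms time_changes_id by (auto simp: skorokhod_bounds_def intro!: bexI[of _ "\<lambda>t. t"])
  then show ?thesis
    using assms skorokhod_bounds_bdd_below by (simp add: skorokhod_dist_def cInf_lower)
qed

section \<open>Sampling a cadlag path on a regular grid\<close>

text \<open>\<open>a j\<close> is the value on the cell from j/k to (j+1)/k. The point 1 is a cell
  of its own, so k + 1 coordinates matter. For k = 0 the path is constant.\<close>

definition step_path :: "nat \<Rightarrow> (nat \<Rightarrow> real) \<Rightarrow> real \<Rightarrow> real" where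
  "step_path k a = (\<lambda>s\<in>{0..1}. a (nat \<lfloor>real k * s\<rfloor>))"

lemma step_path_in_skorokhod_space: "step_path k a \<in> skorokhod_space"
proof (cases "k = 0")
  case True
  have c: "(step_path k a \<longlongrightarrow> step_path k a 0) (at t within S)" if "eventually (\<lambda>s. s \<in> {0..1}) (at t within S)" for t S
    by (rule tendsto_eventually, rule eventually_mono[OF that]) (simp add: step_path_def True)
  have "(step_path k a \<longlongrightarrow> step_path k a t) (at_right t)" if "t \<in> {0..<1}" for t
  proof -
    have "eventually (\<lambda>s. s \<in> {0..1}) (at_right t)"
      using that unfolding eventually_at_right_field by (intro exI[of _ 1]) auto
    from c[OF this] that show ?thesis by (simp add: step_path_def True)
  qed
  moreover have "\<exists>l. (step_path k a \<longlongrightarrow> l) (at_left t)" if "t \<in> {0<..1}" for t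
  proof -
    have "eventually (\<lambda>s. s \<in> {0..1}) (at_left t)"
      using that unfolding eventually_at_left_field by (intro exI[of _ 0]) auto
    from c[OF this] show ?thesis by blast
  qed
  ultimately show ?thesis by (auto simp: skorokhod_space_def step_path_def)
next
  case False
  then have k: "real k > 0" by simp
  have "(step_path k a \<longlongrightarrow> step_path k a t) (at_right t)" if t: "t \<in> {0..<1}" for t
  proof (rule tendsto_eventually, unfold eventually_at_right_field, intro exI[of _ "min 1 ((of_int \<lfloor>k * t\<rfloor> + 1) / k)"] conjI allI impI)
    show "t < min 1 ((of_int \<lfloor>k * t\<rfloor> + 1) / k)" using t k by (simp add: field_simps) linarith
    fix y assume y: "t < y" "y < min 1 ((of_int \<lfloor>k * t\<rfloor> + 1) / k)"
    have "k * t \<le> k * y" using y k by simp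
    moreover have "k * y < of_int \<lfloor>k * t\<rfloor> + 1" using y k by (simp add: field_simps)
    ultimately have "\<lfloor>k * y\<rfloor> = \<lfloor>k * t\<rfloor>" by linarith
    with y t show "step_path k a y = step_path k a t" by (simp add: step_path_def)
  qed
  \<comment> \<open>At a grid point the left limit is the value on the preceding cell, hence the
    ceiling minus one in place of the floor.\<close>
  moreover have "\<exists>l. (step_path k a \<longlongrightarrow> l) (at_left t)" if t: "t \<in> {0<..1}" for t
  proof (intro exI[of _ "a (nat (\<lceil>k * t\<rceil> - 1))"] tendsto_eventually, unfold eventually_at_left_field, 
      intro exI[of _ "(of_int \<lceil>k * t\<rceil> - 1) / k"] conjI allI impI)
    show "(of_int \<lceil>k * t\<rceil> - 1) / k < t" using t k by (simp add: field_simps) linarith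
    have pos: "0 < k * t" using t k by simp
    fix y assume y: "(of_int \<lceil>k * t\<rceil> - 1) / k < y" "y < t"
    have 1: "k * y < k * t" using y k by simp
    have 2: "of_int \<lceil>k * t\<rceil> - 1 < k * y" using y k by (simp add: field_simps)
    have "\<lfloor>k * y\<rfloor> = \<lceil>k * t\<rceil> - 1" using 1 2 by linarith
    moreover have "0 \<le> y"
    proof -
      have "0 \<le> (of_int \<lceil>k * t\<rceil> - 1) / real k" using pos k zero_less_ceiling[of "k * t"] by simp
      with y show ?thesis by linarith
    qed
    ultimately show "step_path k a y = a (nat (\<lceil>k * t\<rceil> - 1))" using y t by (simp add: step_path_def)
  qed
  ultimately show ?thesis by (auto simp: skorokhod_space_def step_path_def)
qed

text \<open>A time change on one piece \<open>{a..b}\<close> that aligns \<open>x\<close> with its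
  own samples at multiples of 1/k. The endpoints go to themselves rounded up to the grid, so that
  neighbouring pieces agree where they meet; \<open>b\<close> is left out of the error condition
  because \<open>x\<close> may jump there.\<close>

definition grid_change :: "(real \<Rightarrow> real) \<Rightarrow> real \<Rightarrow> nat \<Rightarrow> real \<Rightarrow> real \<Rightarrow> (real \<Rightarrow> real) \<Rightarrow> bool" where
  "grid_change x e k a b \<gamma> \<longleftrightarrow> strict_mono_on {a..b} \<gamma> \<and> continuous_on {a..b} \<gamma> \<and>
     \<gamma> a = of_int \<lceil>k * a\<rceil> / k \<and> \<gamma> b = of_int \<lceil>k * b\<rceil> / k \<and> (\<forall>t\<in>{a..b}. \<bar>\<gamma> t - t\<bar> \<le> 1 / k) \<and>
     (\<forall>t\<in>{a..<b}. \<bar>x t - x (of_int \<lfloor>k * \<gamma> t\<rfloor> / k)\<bar> \<le> e)"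

text \<open>Both pieces send \<open>b\<close> to the same grid point, so the union is continuous and
  increasing; the error at \<open>b\<close> itself is controlled by the right piece.\<close>

lemma grid_change_glue:
  assumes ab: "grid_change x e k a b \<gamma>" and bc: "grid_change x e k b c \<mu>" and le: "a \<le> b" "b \<le> c"
  shows "grid_change x e k a c (\<lambda>t. if t \<le> b then \<gamma> t else \<mu> t)"
proof -
  let ?g = "\<lambda>t. if t \<le> b then \<gamma> t else \<mu> t"
  have eq: "\<gamma> b = \<mu> b" using ab bc by (simp add: grid_change_def)
  have sm: "strict_mono_on {a..b} \<gamma>" "strict_mono_on {b..c} \<mu>" using ab bc by (simp_all add: grid_change_def)
  have "strict_mono_on {a..c} ?g"
  proof (rule strict_mono_onI)
    fix r s assume rs: "r \<in> {a..c}" "s \<in> {a..c}" "r < s"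
    consider "s \<le> b" | "b < r" | "r \<le> b" "b < s" by linarith
    then show "?g r < ?g s"
    proof cases
      case 1 with rs strict_mono_onD[OF sm(1), of r s] show ?thesis by simp
    next
      case 2 with rs strict_mono_onD[OF sm(2), of r s] show ?thesis by simp
    next
      case 3
      then have "\<gamma> r \<le> \<gamma> b" using rs le by (intro strict_mono_on_leD[OF sm(1)]) auto
      moreover have "\<mu> b < \<mu> s" using strict_mono_onD[OF sm(2), of b s] 3 rs le by simp
      ultimately show ?thesis using 3 eq by simp
    qed
  qed
  moreover have "continuous_on {a..c} ?g"
  proof -
    have "continuous_on ({a..b} \<union> {b..c}) ?g"
    proof (rule continuous_on_If)
      show "continuous_on {a..b} \<gamma>" "continuous_on {b..c} \<mu>" using ab bc by (simp_all add: grid_change_def)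
      fix x assume "x \<in> {a..b}" "\<not> x \<le> b" then show "\<gamma> x = \<mu> x" by simp
    next
      fix x assume "x \<in> {b..c}" "x \<le> b" then have "x = b" by simp
      then show "\<gamma> x = \<mu> x" using eq by simp
    qed auto
    with le show ?thesis by (simp add: ivl_disj_un_two_touch)
  qed
  moreover have "\<forall>t\<in>{a..c}. \<bar>?g t - t\<bar> \<le> 1 / k" "\<forall>t\<in>{a..<c}. \<bar>x t - x (of_int \<lfloor>k * ?g t\<rfloor> / k)\<bar> \<le> e"
  proof -
    show "\<forall>t\<in>{a..c}. \<bar>?g t - t\<bar> \<le> 1 / k" using ab bc unfolding grid_change_def by simp
    have "\<bar>x t - x (of_int \<lfloor>k * ?g t\<rfloor> / k)\<bar> \<le> e" if t: "t \<in> {a..<c}" for t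
    proof (cases "t < b")
      case True with t ab show ?thesis unfolding grid_change_def by simp
    next
      case False
      then have "?g t = \<mu> t" using eq by (cases "t = b") auto
      with False t bc show ?thesis unfolding grid_change_def by simp
    qed
    then show "\<forall>t\<in>{a..<c}. \<bar>x t - x (of_int \<lfloor>k * ?g t\<rfloor> / k)\<bar> \<le> e" by blast
  qed
  moreover have "?g a = of_int \<lceil>k * a\<rceil> / k" "?g c = of_int \<lceil>k * c\<rceil> / k"
    using ab bc le eq unfolding grid_change_def by (cases "c = b"; simp)+
  ultimately show ?thesis unfolding grid_change_def by blast
qed

lemma ceiling_div_bounds:
  assumes "k > 0"
  shows "a \<le> of_int \<lceil>k * a\<rceil> / real k" "of_int \<lceil>k * a\<rceil> / real k \<le> a + 1 / k"
proof -
  have "k * a \<le> of_int \<lceil>k * a\<rceil>" "of_int \<lceil>k * a\<rceil> \<le> k * a + 1" by linarith+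
  with assms show "a \<le> of_int \<lceil>k * a\<rceil> / real k" "of_int \<lceil>k * a\<rceil> / real k \<le> a + 1 / k"
    by (simp_all add: field_simps)
qed

text \<open>An affine map suffices when \<open>x\<close> is nearly constant on
  \<open>{a..<b}\<close>: it carries the interval onto the rounded one, and every grid point used
  for sampling stays inside \<open>{a..<b}\<close>. The condition \<open>1 < k * (b - a)\<close>
  keeps the rounded endpoints apart.\<close>

lemma grid_change_linear:
  assumes k: "k > 0" and ab: "0 \<le> a" "a < b" "1 < k * (b - a)"
    and osc: "\<And>s t. a \<le> s \<Longrightarrow> s < b \<Longrightarrow> a \<le> t \<Longrightarrow> t < b \<Longrightarrow> \<bar>x s - x t\<bar> \<le> e"
  shows "\<exists>\<gamma>. grid_change x e k a b \<gamma>"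
proof -
  define u v where "u = of_int \<lceil>k * a\<rceil> / real k" and "v = of_int \<lceil>k * b\<rceil> / real k"
  have u: "a \<le> u" "u \<le> a + 1 / k" and v: "b \<le> v" "v \<le> b + 1 / k"
    using ceiling_div_bounds[OF k] unfolding u_def v_def by auto
  have uv: "u < v"
  proof -
    have "a + 1 / k < b" using ab k by (simp add: field_simps)
    with u v show ?thesis by linarith
  qed
  define g where "g t = u + (t - a) / (b - a) * (v - u)" for t
  have gb: "g b = v" "g a = u" using ab by (simp_all add: g_def)
  have sm: "g s < g t" if "s < t" for s t
    using that ab uv by (simp add: g_def divide_strict_right_mono mult_strict_right_mono)
  have close: "\<bar>g t - t\<bar> \<le> 1 / k" if t: "t \<in> {a..b}" for t
  proof -
    define l where "l = (t - a) / (b - a)"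
    have l: "0 \<le> l" "l \<le> 1" using t ab by (auto simp: l_def)
    have "(1 - l) * (u - a) + l * (v - b) \<le> (1 - l) * (1 / k) + l * (1 / k)"
      using u v l by (intro add_mono mult_left_mono) auto
    also have "\<dots> = 1 / k" by (simp only: distrib_right[symmetric]) simp
    finally have "(1 - l) * (u - a) + l * (v - b) \<le> 1 / k" .
    moreover have "0 \<le> (1 - l) * (u - a) + l * (v - b)" using u v l by auto
    moreover have "l * (b - a) = t - a" using ab by (simp add: l_def)
    \<comment> \<open>The displacement is a convex combination of the displacements of the
      endpoints, each between 0 and 1/k.\<close>
    then have "g t - t = (1 - l) * (u - a) + l * (v - b)"
      by (simp add: g_def l_def[symmetric] algebra_simps)
    ultimately show ?thesis by simp
  qed
  have "\<bar>x t - x (of_int \<lfloor>k * g t\<rfloor> / k)\<bar> \<le> e" if t: "t \<in> {a..<b}" for t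
  proof (rule osc)
    show "a \<le> t" "t < b" using t by auto
    have "g a \<le> g t" using t sm[of a t] by (cases "a = t") auto
    then have "of_int \<lceil>k * a\<rceil> \<le> k * g t" using k unfolding gb u_def by (simp add: field_simps)
    then have "\<lceil>k * a\<rceil> \<le> \<lfloor>k * g t\<rfloor>" by (simp add: le_floor_iff)
    then have "k * a \<le> of_int \<lfloor>k * g t\<rfloor>" by linarith
    then show "a \<le> of_int \<lfloor>k * g t\<rfloor> / k" using k by (simp add: field_simps)
    have "g t < g b" using t by (intro sm) auto
    then have "k * g t < of_int \<lceil>k * b\<rceil>" using k unfolding gb v_def by (simp add: field_simps)
    \<comment> \<open>Rounding up is what makes this work: an integer below
      \<open>\<lceil>k * b\<rceil>\<close> is below \<open>k * b\<close> itself.\<close>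
    then have "\<lfloor>k * g t\<rfloor> < \<lceil>k * b\<rceil>" by linarith
    then have "of_int \<lfloor>k * g t\<rfloor> < k * b" by linarith
    then show "of_int \<lfloor>k * g t\<rfloor> / k < b" using k by (simp add: field_simps)
  qed
  moreover have "strict_mono_on {a..b} g" by (rule strict_mono_onI) (rule sm)
  moreover have "continuous_on {a..b} g" unfolding g_def by (intro continuous_intros) (use ab in auto)
  ultimately have "grid_change x e k a b g"
    using close gb by (auto simp: grid_change_def u_def v_def)
  then show ?thesis by blast
qed

text \<open>A cadlag path oscillates by at most \<open>e\<close> on each of finitely many half-open
  pieces. Instead of choosing these, the bisection principle is applied to the property of an
  interval that a grid change exists for all large k. Near each point t the left limit controls the
  piece ending at t, and right continuity the piece starting there.\<close>

lemma eventually_grid_change: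
  assumes x: "x \<in> skorokhod_space" and e: "e > 0"
  shows "eventually (\<lambda>k. \<exists>\<gamma>. grid_change x e k 0 1 \<gamma>) sequentially"
proof -
  \<comment> \<open>The guard makes \<open>P\<close> vacuous on intervals that leave the unit
    interval, over which the local condition of the bisection principle also ranges.\<close>
  define P where "P a b \<longleftrightarrow> (0 \<le> a \<longrightarrow> b \<le> 1 \<longrightarrow> eventually (\<lambda>k. \<exists>\<gamma>. grid_change x e k a b \<gamma>) sequentially)" for a b
  have trans: "P a c" if "P a b" "P b c" "a \<le> b" "b \<le> c" for a b c
    unfolding P_def
  proof (intro impI)
    assume "0 \<le> a" "c \<le> 1"
    with that have "eventually (\<lambda>k. \<exists>\<gamma>. grid_change x e k a b \<gamma>) sequentially"
      "eventually (\<lambda>k. \<exists>\<gamma>. grid_change x e k b c \<gamma>) sequentially" by (auto simp: P_def)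
    then show "eventually (\<lambda>k. \<exists>\<gamma>. grid_change x e k a c \<gamma>) sequentially"
      by eventually_elim (use grid_change_glue that in blast)
  qed
  have refl: "grid_change x e k a a (\<lambda>t. of_int \<lceil>k * a\<rceil> / k)" if "k > 0" for a k
  proof -
    have "a \<le> of_int \<lceil>k * a\<rceil> / real k" "of_int \<lceil>k * a\<rceil> / real k \<le> a + 1 / k"
      using ceiling_div_bounds[OF that] by auto
    then show ?thesis by (auto simp: grid_change_def strict_mono_on_def)
  qed
  have lin: "P a b" if ab: "a \<le> b"
    and osc: "\<And>s t. a \<le> s \<Longrightarrow> s < b \<Longrightarrow> a \<le> t \<Longrightarrow> t < b \<Longrightarrow> b \<le> 1 \<Longrightarrow> \<bar>x s - x t\<bar> \<le> e" for a b
  proof (cases "a = b")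
    case True
    have "eventually (\<lambda>k::nat. k > 0) sequentially" by (rule eventually_gt_at_top)
    then show ?thesis unfolding P_def True by (blast intro: eventually_mono refl)
  next
    case False
    with ab have ab: "a < b" by simp
    obtain m :: nat where m: "1 / (b - a) < m" using reals_Archimedean2 by blast
    have ev: "eventually (\<lambda>k::nat. k > m) sequentially" by (rule eventually_gt_at_top)
    show ?thesis unfolding P_def
    proof (intro impI, rule eventually_mono[OF ev])
      fix k assume h: "0 \<le> a" "b \<le> 1" and k: "m < k"
      have "1 / (b - a) < k" using m k by linarith
      then have "1 < k * (b - a)" using ab by (simp add: field_simps)
      then show "\<exists>\<gamma>. grid_change x e k a b \<gamma>" using h k ab osc by (intro grid_change_linear) auto
    qed
  qed
  have "P 0 1"
  proof (rule Bolzano)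
    show "\<And>a b c. P a b \<Longrightarrow> P b c \<Longrightarrow> a \<le> b \<Longrightarrow> b \<le> c \<Longrightarrow> P a c" by (rule trans)
  next
    fix t :: real assume t: "0 \<le> t" "t \<le> 1"
    have "\<exists>d>0. \<forall>s. t \<le> s \<and> s < t + d \<and> s < 1 \<longrightarrow> \<bar>x s - x t\<bar> \<le> e / 2"
    proof (cases "t < 1")
      case True
      with x t have "(x \<longlongrightarrow> x t) (at_right t)" by (auto simp: skorokhod_space_def)
      from tendstoD[OF this, of "e / 2"] e
      obtain b where b: "b > t" "\<And>s. t < s \<Longrightarrow> s < b \<Longrightarrow> dist (x s) (x t) < e / 2"
        unfolding eventually_at_right_field by auto
      have "\<bar>x s - x t\<bar> \<le> e / 2" if "t \<le> s" "s < t + (b - t)" for s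
        using b(2)[of s] that e by (cases "s = t") (auto simp: dist_real_def)
      with b(1) show ?thesis by (intro exI[of _ "b - t"]) auto
    qed (auto intro: exI[of _ 1])
    then obtain d where d: "d > 0" "\<And>s. t \<le> s \<Longrightarrow> s < t + d \<Longrightarrow> s < 1 \<Longrightarrow> \<bar>x s - x t\<bar> \<le> e / 2" by blast
    have "\<exists>l. \<exists>d'>0. \<forall>s. 0 \<le> s \<and> t - d' < s \<and> s < t \<longrightarrow> \<bar>x s - l\<bar> \<le> e / 2"
    proof (cases "t > 0")
      case True
      with t have "t \<in> {0<..1}" by simp
      with x obtain l where "(x \<longlongrightarrow> l) (at_left t)" unfolding skorokhod_space_def by blast
      from tendstoD[OF this, of "e / 2"] e
      obtain b where b: "b < t" "\<And>s. b < s \<Longrightarrow> s < t \<Longrightarrow> dist (x s) l < e / 2"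
        unfolding eventually_at_left_field by auto
      have "\<bar>x s - l\<bar> \<le> e / 2" if "t - (t - b) < s" "s < t" for s
        using b(2)[of s] that by (auto simp: dist_real_def)
      with b(1) show ?thesis by (intro exI[of _ l] exI[of _ "t - b"]) auto
    qed (auto intro: exI[of _ 1])
    then obtain l d' where d': "d' > 0" "\<And>s. 0 \<le> s \<Longrightarrow> t - d' < s \<Longrightarrow> s < t \<Longrightarrow> \<bar>x s - l\<bar> \<le> e / 2" by blast
    show "\<exists>d>0. \<forall>a b. a \<le> t \<and> t \<le> b \<and> b - a < d \<longrightarrow> P a b"
    proof (intro exI[of _ "min d d'"] conjI allI impI)
      show "0 < min d d'" using d d' by simp
      fix a b assume ab: "a \<le> t \<and> t \<le> b \<and> b - a < min d d'"
      show "P a b"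
      proof (cases "0 \<le> a \<and> b \<le> 1")
        case True
        have "P a t"
        proof (rule lin)
          fix r s assume "a \<le> r" "r < t" "a \<le> s" "s < t"
          then have "\<bar>x r - l\<bar> \<le> e / 2" "\<bar>x s - l\<bar> \<le> e / 2" using ab True d'(2)[of r] d'(2)[of s] by auto
          then show "\<bar>x r - x s\<bar> \<le> e" by linarith
        qed (use ab in auto)
        moreover have "P t b"
        proof (rule lin)
          fix r s assume "t \<le> r" "r < b" "t \<le> s" "s < b" "b \<le> 1"
          then have "\<bar>x r - x t\<bar> \<le> e / 2" "\<bar>x s - x t\<bar> \<le> e / 2" using ab True d(2)[of r] d(2)[of s] by auto
          then show "\<bar>x r - x s\<bar> \<le> e" by linarith
        qed (use ab in auto)
        ultimately show ?thesis using trans ab by blast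
      qed (auto simp: P_def)
    qed
  qed simp
  then show ?thesis by (simp add: P_def)
qed

text \<open>In the supremum norm the samples need not converge when a jump lies off the grid; the
  time change moves the jump to the next grid point, at a cost of at most 1/k.\<close>

lemma step_path_tendsto_skorokhod:
  assumes x: "x \<in> skorokhod_space" and e: "e > 0"
  shows "eventually (\<lambda>k. skorokhod_dist (step_path k (\<lambda>j. x (j / k))) x < e) sequentially"
proof -
  have e2: "e / 2 > 0" using e by simp
  obtain m :: nat where m: "2 / e < m" using reals_Archimedean2 by blast
  have ev: "eventually (\<lambda>k::nat. k > m) sequentially" by (rule eventually_gt_at_top)
  from eventually_grid_change[OF x e2] ev show ?thesis
  proof eventually_elim
    case (elim k)
    then obtain \<gamma> where g: "grid_change x (e / 2) k 0 1 \<gamma>" by blast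
    let ?y = "step_path k (\<lambda>j. x (j / k))"
    have k: "real k > 0" "1 / k < e / 2"
    proof -
      have "2 / e < k" using m elim by linarith
      moreover have "0 < 2 / e" using e by simp
      ultimately show "real k > 0" by linarith
      with \<open>2 / e < k\<close> show "1 / k < e / 2" using e by (simp add: field_simps)
    qed
    have g01: "\<gamma> 0 = 0" "\<gamma> 1 = 1" using g k by (auto simp: grid_change_def)
    have sm: "strict_mono_on {0..1} \<gamma>" and co: "continuous_on {0..1} \<gamma>" using g by (auto simp: grid_change_def)
    have im: "\<gamma> ` {0..1} = {0..1}"
    proof
      show "\<gamma> ` {0..1} \<subseteq> {0..1}"
        using strict_mono_on_leD[OF sm, of 0] strict_mono_on_leD[OF sm, of _ 1] g01 by force
      show "{0..1} \<subseteq> \<gamma> ` {0..1}"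
      proof
        fix y :: real assume "y \<in> {0..1}"
        then show "y \<in> \<gamma> ` {0..1}" using IVT'[of \<gamma> 0 y 1] g01 co by force
      qed
    qed
    then have tc: "\<gamma> \<in> time_changes" using sm co by (simp add: time_changes_def)
    have "\<bar>x t - ?y (\<gamma> t)\<bar> \<le> e / 2" if t: "t \<in> {0..1}" for t
    proof -
      have gt: "\<gamma> t \<in> {0..1}" using im t by blast
      then have "0 \<le> \<lfloor>k * \<gamma> t\<rfloor>" by simp
      then have y: "?y (\<gamma> t) = x (of_int \<lfloor>k * \<gamma> t\<rfloor> / k)" using gt by (simp add: step_path_def)
      show ?thesis
      proof (cases "t = 1")
        case True
        \<comment> \<open>The error condition of \<open>grid_change\<close> says nothing at 1; there
          the sample is exact because \<open>\<gamma> 1 = 1\<close> is a grid point.\<close>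
        then show ?thesis unfolding y using g01 k e by simp
      next
        case False
        with t g show ?thesis unfolding y by (auto simp: grid_change_def)
      qed
    qed
    moreover have "\<bar>\<gamma> t - t\<bar> \<le> e / 2" if t: "t \<in> {0..1}" for t
    proof -
      have "\<bar>\<gamma> t - t\<bar> \<le> 1 / k" using g t unfolding grid_change_def by blast
      with k show ?thesis by linarith
    qed
    ultimately have "e / 2 \<in> skorokhod_bounds x ?y"
      using tc e unfolding skorokhod_bounds_def mem_Collect_eq
      by (intro conjI bexI[of _ \<gamma>] ballI) auto
    then have "Inf (skorokhod_bounds x ?y) \<le> e / 2"
      by (rule cInf_lower) (rule skorokhod_bounds_bdd_below)
    then have "skorokhod_dist x ?y \<le> e / 2"
      unfolding skorokhod_dist_def using x step_path_in_skorokhod_space by simp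
    then show ?case using e skorokhod.commute[of x ?y] by simp
  qed
qed

section \<open>Borel measurability of random paths\<close>

text \<open>The path depends on k + 1 coordinates only and moves in the Skorokhod metric by no more
  than the largest change of these, so a basic open set of the product topology fits around each
  point of the preimage.\<close>

lemma open_vimage_step_path:
  assumes O: "openin skorokhod_topology S"
  shows "open {a. step_path k a \<in> S}"
proof (rule Topological_Spaces.openI)
  fix a assume "a \<in> {a. step_path k a \<in> S}"
  then obtain r where r: "r > 0" "skorokhod.mball (step_path k a) r \<subseteq> S"
    using O by (auto simp: skorokhod_topology_def skorokhod.openin_mtopology)
  let ?T = "\<Inter>j\<le>k. {b. \<bar>b j - a j\<bar> < r / 2}"
  have "open ?T"
  proof (rule open_INT)
    show "\<forall>j\<in>{..k}. open {b. \<bar>b j - a j\<bar> < r / 2}"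
      by (intro ballI open_Collect_less continuous_intros continuous_on_product_coordinates)
  qed simp
  moreover have "a \<in> ?T" using r by simp
  moreover have "?T \<subseteq> {a. step_path k a \<in> S}"
  proof
    fix b assume b: "b \<in> ?T"
    have "skorokhod_dist (step_path k a) (step_path k b) \<le> r / 2"
    proof (rule skorokhod_dist_le_sup)
      fix t :: real assume t: "t \<in> {0..1}"
      have "real k * t \<le> k" using t by (simp add: mult_left_le)
      then have "nat \<lfloor>real k * t\<rfloor> \<in> {..k}" using floor_mono[of "real k * t" k] by simp
      with b have "\<bar>b (nat \<lfloor>real k * t\<rfloor>) - a (nat \<lfloor>real k * t\<rfloor>)\<bar> < r / 2" by blast
      then have "\<bar>a (nat \<lfloor>real k * t\<rfloor>) - b (nat \<lfloor>real k * t\<rfloor>)\<bar> \<le> r / 2" by linarith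
      then show "\<bar>step_path k a t - step_path k b t\<bar> \<le> r / 2"
        unfolding step_path_def using t by (simp only: restrict_apply if_True)
    qed (use r step_path_in_skorokhod_space in auto)
    then have "step_path k b \<in> skorokhod.mball (step_path k a) r"
      using r step_path_in_skorokhod_space by (simp add: skorokhod.in_mball)
    with r show "b \<in> {a. step_path k a \<in> S}" by blast
  qed
  ultimately show "\<exists>T. open T \<and> a \<in> T \<and> T \<subseteq> {a. step_path k a \<in> S}" by blast
qed

lemma measurable_step_path:
  assumes "\<And>j. Y j \<in> borel_measurable M"
  shows "(\<lambda>\<omega>. step_path k (\<lambda>j. Y j \<omega>)) \<in> M \<rightarrow>\<^sub>M borel_of_topology skorokhod_topology"
proof (rule measurable_borel_of_topologyI)
  fix S assume "openin skorokhod_topology S"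
  then have "{a. step_path k a \<in> S} \<in> sets borel" by (intro borel_open open_vimage_step_path)
  moreover have "(\<lambda>\<omega> j. Y j \<omega>) \<in> borel_measurable M"
    using assms by (intro measurable_coordinatewise_then_product)
  ultimately have "(\<lambda>\<omega> j. Y j \<omega>) -` {a. step_path k a \<in> S} \<inter> space M \<in> sets M" by (rule measurable_sets[rotated])
  then show "(\<lambda>\<omega>. step_path k (\<lambda>j. Y j \<omega>)) -` S \<inter> space M \<in> sets M"
    by (simp add: vimage_def)
qed (simp add: step_path_in_skorokhod_space)

text \<open>Measurability of all evaluations gives Borel measurability: the sampled paths are
  measurable functions of finitely many evaluations and converge to \<open>X\<close>, and membership
  of a limit in an open set is a countable condition on the sequence.\<close>

lemma measurable_skorokhod:
  assumes X: "\<And>\<omega>. \<omega> \<in> space M \<Longrightarrow> X \<omega> \<in> skorokhod_space"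
    and meas: "\<And>s. s \<in> {0..1} \<Longrightarrow> (\<lambda>\<omega>. X \<omega> s) \<in> borel_measurable M"
  shows "X \<in> M \<rightarrow>\<^sub>M borel_of_topology skorokhod_topology"
proof (rule measurable_borel_of_topologyI)
  fix S assume O: "openin skorokhod_topology S"
  \<comment> \<open>Indices above \<open>k\<close> never enter the step path, but
    \<open>meas\<close> covers only times in the unit interval, so they get the value 0.\<close>
  define p where "p k \<omega> = step_path k (\<lambda>j. X \<omega> (if j \<le> k then j / k else 0))" for k \<omega>
  have p_eq: "p k \<omega> = step_path k (\<lambda>j. X \<omega> (j / k))" for k \<omega>
  proof
    fix t
    show "p k \<omega> t = step_path k (\<lambda>j. X \<omega> (j / k)) t"
    proof (cases "t \<in> {0..1}")
      case True
      then have "real k * t \<le> k" by (simp add: mult_left_le)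
      then have "nat \<lfloor>real k * t\<rfloor> \<le> k" using floor_mono[of "real k * t" k] by simp
      then show ?thesis by (simp add: p_def step_path_def)
    qed (simp only: p_def step_path_def restrict_apply if_False)
  qed
  have p_meas: "p k \<in> M \<rightarrow>\<^sub>M borel_of_topology skorokhod_topology" for k
    unfolding p_def by (rule measurable_step_path) (auto intro!: meas simp: divide_le_eq)
  \<comment> \<open>Points whose ball of radius 1/(m + 1) lies in \<open>S\<close>. The limit is in
    \<open>S\<close> exactly when, for one m, the approximations are eventually in
    \<open>F m\<close>; the fixed radius keeps the limit off the boundary of
    \<open>S\<close>.\<close>
  define F where "F m = {x \<in> skorokhod_space. skorokhod.mball x (1 / Suc m) \<subseteq> S}" for m
  have F: "F m \<in> sets (borel_of_topology skorokhod_topology)" for m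
  proof -
    let ?G = "\<Union>y\<in>skorokhod_space - S. skorokhod.mball y (1 / Suc m)"
    have "openin skorokhod_topology ?G" unfolding skorokhod_topology_def by blast
    then have "?G \<in> sets (borel_of_topology skorokhod_topology)" by (rule open_in_borel_of_topology)
    then have "space (borel_of_topology skorokhod_topology) - ?G \<in> sets (borel_of_topology skorokhod_topology)"
      by (rule sets.compl_sets)
    moreover have "F m = skorokhod_space - ?G"
      unfolding F_def by (auto simp: skorokhod.in_mball skorokhod.commute)
    ultimately show ?thesis by simp
  qed
  have "X \<omega> \<in> S \<longleftrightarrow> (\<exists>m. \<exists>K. \<forall>k\<ge>K. p k \<omega> \<in> F m)" if \<omega>: "\<omega> \<in> space M" for \<omega>
  proof -
    note lim = step_path_tendsto_skorokhod[OF X[OF \<omega>], folded p_eq]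
    show ?thesis
    proof
      assume "X \<omega> \<in> S"
      then obtain r where r: "r > 0" "skorokhod.mball (X \<omega>) r \<subseteq> S"
        using O by (auto simp: skorokhod_topology_def skorokhod.openin_mtopology)
      from r obtain m where m: "1 / Suc m < r / 2"
        using reals_Archimedean[of "r / 2"] by (auto simp: inverse_eq_divide)
      from r have "r / 2 > 0" by simp
      from lim[OF this] obtain K where K: "\<And>k. k \<ge> K \<Longrightarrow> skorokhod_dist (p k \<omega>) (X \<omega>) < r / 2"
        unfolding eventually_sequentially by blast
      have "p k \<omega> \<in> F m" if k: "k \<ge> K" for k
      proof -
        have pk: "p k \<omega> \<in> skorokhod_space" by (simp add: p_def step_path_in_skorokhod_space)
        have "skorokhod.mball (p k \<omega>) (1 / Suc m) \<subseteq> skorokhod.mball (X \<omega>) r"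
        proof
          fix y assume "y \<in> skorokhod.mball (p k \<omega>) (1 / Suc m)"
          then have y: "y \<in> skorokhod_space" "skorokhod_dist (p k \<omega>) y < 1 / Suc m" by (auto simp: skorokhod.in_mball)
          have "skorokhod_dist (X \<omega>) y \<le> skorokhod_dist (X \<omega>) (p k \<omega>) + skorokhod_dist (p k \<omega>) y"
            using X[OF \<omega>] pk y by (intro skorokhod.triangle) auto
          with K[OF k] y m have "skorokhod_dist (X \<omega>) y < r" by (simp add: skorokhod.commute)
          with y X[OF \<omega>] show "y \<in> skorokhod.mball (X \<omega>) r" by (simp add: skorokhod.in_mball)
        qed
        with r pk show ?thesis unfolding F_def by blast
      qed
      then show "\<exists>m. \<exists>K. \<forall>k\<ge>K. p k \<omega> \<in> F m" by blast
    next
      assume "\<exists>m. \<exists>K. \<forall>k\<ge>K. p k \<omega> \<in> F m"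
      then obtain m K where K: "\<And>k. k \<ge> K \<Longrightarrow> p k \<omega> \<in> F m" by blast
      have "1 / real (Suc m) > 0" by simp
      from lim[OF this] obtain K' where K': "\<And>k. k \<ge> K' \<Longrightarrow> skorokhod_dist (p k \<omega>) (X \<omega>) < 1 / Suc m"
        unfolding eventually_sequentially by blast
      define k where "k = max K K'"
      have "p k \<omega> \<in> F m" "skorokhod_dist (p k \<omega>) (X \<omega>) < 1 / Suc m" using K[of k] K'[of k] by (auto simp: k_def)
      then show "X \<omega> \<in> S" using X[OF \<omega>] unfolding F_def by (auto simp: skorokhod.in_mball)
    qed
  qed
  then have "X -` S \<inter> space M = {\<omega> \<in> space M. \<exists>m. \<exists>K. \<forall>k\<ge>K. p k \<omega> \<in> F m}"
    by auto
  also have "\<dots> \<in> sets M"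
  proof -
    have [measurable]: "Measurable.pred M (\<lambda>\<omega>. p k \<omega> \<in> F m)" for k m
      using p_meas F by (rule pred_sets2[rotated])
    show ?thesis by measurable
  qed
  finally show "X -` S \<inter> space M \<in> sets M" .
qed (use X in simp)

section \<open>Lipschitz test functions and trigonometric polynomials\<close>

lemma continuous_map_borel_measurable:
  assumes "continuous_map T euclideanreal f"
  shows "f \<in> borel_measurable (borel_of_topology T)"
proof (rule borel_measurableI)
  fix S :: "real set" assume "open S"
  with assms have "openin T {x \<in> topspace T. f x \<in> S}" by (auto simp: continuous_map_def)
  moreover have "space (borel_of_topology T) = topspace T"
    by (simp add: borel_of_topology_def space_measure_of_conv)
  moreover from calculation have "f -` S \<inter> space (borel_of_topology T) = {x \<in> topspace T. f x \<in> S}" by auto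
  ultimately show "f -` S \<inter> space (borel_of_topology T) \<in> sets (borel_of_topology T)"
    by (simp add: open_in_borel_of_topology)
qed

lemma lipschitz_continuous_map_skorokhod:
  assumes "\<And>x y. x \<in> skorokhod_space \<Longrightarrow> y \<in> skorokhod_space \<Longrightarrow> \<bar>g x - g y\<bar> \<le> L * skorokhod_dist x y"
  shows "continuous_map skorokhod_topology euclideanreal g"
  unfolding continuous_map_def
proof (intro conjI allI impI)
  fix U :: "real set" assume "openin euclideanreal U"
  then have U: "open U" by simp
  have "\<exists>r>0. skorokhod.mball x r \<subseteq> {x \<in> skorokhod_space. g x \<in> U}"
    if x: "x \<in> skorokhod_space" "g x \<in> U" for x
  proof -
    obtain e where e: "e > 0" "\<And>y. dist y (g x) < e \<Longrightarrow> y \<in> U" using U x unfolding open_dist by blast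
    show ?thesis
    proof (intro exI[of _ "e / (\<bar>L\<bar> + 1)"] conjI subsetI)
      show "0 < e / (\<bar>L\<bar> + 1)" using e by simp
      fix y assume "y \<in> skorokhod.mball x (e / (\<bar>L\<bar> + 1))"
      then have y: "y \<in> skorokhod_space" "skorokhod_dist x y < e / (\<bar>L\<bar> + 1)" by (auto simp: skorokhod.in_mball)
      then have "(\<bar>L\<bar> + 1) * skorokhod_dist x y < e" by (simp add: pos_less_divide_eq mult.commute)
      moreover have "L * skorokhod_dist x y \<le> (\<bar>L\<bar> + 1) * skorokhod_dist x y" by (rule mult_right_mono) auto
      ultimately have "\<bar>g x - g y\<bar> < e" using assms[OF x(1) y(1)] by linarith
      then show "y \<in> {x \<in> skorokhod_space. g x \<in> U}" using e(2)[of "g y"] y by (simp add: dist_real_def)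
    qed
  qed
  then show "openin skorokhod_topology {x \<in> topspace skorokhod_topology. g x \<in> U}"
    unfolding skorokhod_topology_def skorokhod.openin_mtopology
    by (auto simp flip: skorokhod_topology_def)
qed simp

lemma integrable_bounded_random_element:
  fixes g :: "'c \<Rightarrow> real"
  assumes "finite_measure M" "X \<in> M \<rightarrow>\<^sub>M borel_of_topology T" "continuous_map T euclideanreal g"
    and "\<And>x. x \<in> topspace T \<Longrightarrow> \<bar>g x\<bar> \<le> C"
  shows "integrable M (\<lambda>\<omega>. g (X \<omega>))"
proof -
  have sp: "space (borel_of_topology T) = topspace T"
    by (simp add: borel_of_topology_def space_measure_of_conv)
  have "(\<lambda>\<omega>. g (X \<omega>)) \<in> borel_measurable M"
    using measurable_compose[OF assms(2) continuous_map_borel_measurable[OF assms(3)]] .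
  moreover have "X \<omega> \<in> topspace T" if "\<omega> \<in> space M" for \<omega>
    using measurable_space[OF assms(2) that] sp by simp
  ultimately show ?thesis using assms
    by (intro finite_measure.integrable_const_bound[of M _ C]) auto
qed

text \<open>The regularisation \<open>x \<mapsto> inf\<^sub>y (f y + m d(x, y))\<close> replaces a bounded continuous
  function by Lipschitz functions increasing to it.\<close>

lemma converges_in_distribution_lipschitzI:
  fixes M :: "nat \<Rightarrow> 'a measure" and N :: "'b measure"
  assumes X: "\<And>n. X n \<in> M n \<rightarrow>\<^sub>M borel_of_topology skorokhod_topology"
    and Y: "Y \<in> N \<rightarrow>\<^sub>M borel_of_topology skorokhod_topology"
    and M: "\<And>n. n \<ge> 1 \<Longrightarrow> prob_space (M n)" and N: "prob_space N"
    and lim: "\<And>g L C. \<lbrakk>\<And>x y. x \<in> skorokhod_space \<Longrightarrow> y \<in> skorokhod_space \<Longrightarrow> \<bar>g x - g y\<bar> \<le> L * skorokhod_dist x y;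
        \<And>x. x \<in> skorokhod_space \<Longrightarrow> \<bar>g x\<bar> \<le> C; 0 \<le> L\<rbrakk>
        \<Longrightarrow> (\<lambda>n. \<integral>\<omega>. g (X n \<omega>) \<partial>M n) \<longlonglongrightarrow> (\<integral>\<omega>. g (Y \<omega>) \<partial>N)"
  shows "converges_in_distribution skorokhod_topology M X N Y"
proof -
  interpret N: prob_space N by (rule N)
  \<comment> \<open>A lower bound passes from the Lipschitz function to \<open>f\<close> because
    \<open>F m \<le> f\<close>; applied to \<open>- f\<close> it becomes the upper bound.\<close>
  have lower: "eventually (\<lambda>n. (\<integral>\<omega>. f (X n \<omega>) \<partial>M n) > (\<integral>\<omega>. f (Y \<omega>) \<partial>N) - e) sequentially"
    if f: "continuous_map skorokhod_topology euclideanreal f"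
      and C: "\<And>x. x \<in> skorokhod_space \<Longrightarrow> \<bar>f x\<bar> \<le> C" and e: "e > 0" for f C e
  proof -
    define F where "F m x = (INF y\<in>skorokhod_space. f y + real m * skorokhod_dist x y)" for m x
    have nn: "0 \<le> real m * skorokhod_dist x y" for m x y by simp
    have bdd: "bdd_below ((\<lambda>y. f y + real m * skorokhod_dist x y) ` skorokhod_space)" for m x
    proof (rule bdd_belowI2)
      fix y assume y: "y \<in> skorokhod_space"
      show "- C \<le> f y + real m * skorokhod_dist x y"
        using C[OF y] nn[of m x y] by linarith
    qed
    have F_le: "F m x \<le> f y + real m * skorokhod_dist x y" if "y \<in> skorokhod_space" for m x y
      unfolding F_def by (rule cINF_lower[OF bdd that])
    have F_le_f: "F m x \<le> f x" if x: "x \<in> skorokhod_space" for m x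
      using F_le[OF x, of m x] x by simp
    have F_ge: "c \<le> F m x" if "x \<in> skorokhod_space" "\<And>y. y \<in> skorokhod_space \<Longrightarrow> c \<le> f y + real m * skorokhod_dist x y" for c m x
      unfolding F_def using that by (intro cINF_greatest) auto
    have F_bound: "\<bar>F m x\<bar> \<le> C" if x: "x \<in> skorokhod_space" for m x
    proof -
      have "- C \<le> F m x"
      proof (rule F_ge[OF x])
        fix y assume y: "y \<in> skorokhod_space"
        show "- C \<le> f y + real m * skorokhod_dist x y"
          using C[OF y] nn[of m x y] by linarith
      qed
      with F_le_f[OF x, of m] C[OF x] show ?thesis by linarith
    qed
    have F_lip1: "F m x \<le> F m y + real m * skorokhod_dist x y"
      if x: "x \<in> skorokhod_space" and y: "y \<in> skorokhod_space" for m x y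
    proof -
      have "F m x - real m * skorokhod_dist x y \<le> F m y"
      proof (rule F_ge[OF y])
        fix z assume z: "z \<in> skorokhod_space"
        have "F m x \<le> f z + real m * skorokhod_dist x z" by (rule F_le[OF z])
        also have "\<dots> \<le> f z + real m * (skorokhod_dist x y + skorokhod_dist y z)"
          using skorokhod.triangle[OF x y z] by (intro add_left_mono mult_left_mono) auto
        finally show "F m x - real m * skorokhod_dist x y \<le> f z + real m * skorokhod_dist y z"
          by (simp add: algebra_simps)
      qed
      then show ?thesis by simp
    qed
    have F_lip: "\<bar>F m x - F m y\<bar> \<le> real m * skorokhod_dist x y"
      if "x \<in> skorokhod_space" "y \<in> skorokhod_space" for m x y
      using F_lip1[OF that, of m] F_lip1[OF that(2,1), of m] skorokhod.commute[of x y] by simp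
    have F_cont: "continuous_map skorokhod_topology euclideanreal (F m)" for m
      by (rule lipschitz_continuous_map_skorokhod[OF F_lip])
    have F_lim: "(\<lambda>m. F m x) \<longlonglongrightarrow> f x" if x: "x \<in> skorokhod_space" for x
    proof (rule LIMSEQ_I)
      fix r :: real assume r: "r > 0"
      have "openin skorokhod_topology {y \<in> topspace skorokhod_topology. f y \<in> {f x - r / 2<..}}"
        using f by (rule openin_continuous_map_preimage) auto
      then obtain d where d: "d > 0" "skorokhod.mball x d \<subseteq> {y \<in> skorokhod_space. f y \<in> {f x - r / 2<..}}"
        using x r unfolding skorokhod_topology_def skorokhod.openin_mtopology
        by (auto simp flip: skorokhod_topology_def)
      \<comment> \<open>Once \<open>m * d \<ge> 2 * C\<close>, a point at distance at least
        \<open>d\<close> pays as much for its distance as \<open>f\<close> can possibly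
        gain.\<close>
      obtain m0 :: nat where m0: "2 * C / d < m0" using reals_Archimedean2 by blast
      have "norm (F m x - f x) < r" if m: "m \<ge> m0" for m
      proof -
        have "f x - r / 2 \<le> F m x"
        proof (rule F_ge[OF x])
          fix y assume y: "y \<in> skorokhod_space"
          show "f x - r / 2 \<le> f y + real m * skorokhod_dist x y"
          proof (cases "skorokhod_dist x y < d")
            case True
            then have "y \<in> skorokhod.mball x d" using x y by (simp add: skorokhod.in_mball)
            then have "f x - r / 2 < f y" using d by auto
            then show ?thesis using nn[of m x y] r by linarith
          next
            case False
            have "2 * C / d \<le> m" using m m0 by linarith
            then have "2 * C \<le> m * d" using d by (simp add: field_simps)
            also have "\<dots> \<le> m * skorokhod_dist x y" using False by (intro mult_left_mono) auto
            finally show ?thesis using C[OF x] C[OF y] r by linarith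
          qed
        qed
        then show ?thesis using F_le_f[OF x, of m] r by simp
      qed
      then show "\<exists>no. \<forall>n\<ge>no. norm (F n x - f x) < r" by blast
    qed
    have Yin: "Y \<omega> \<in> skorokhod_space" if "\<omega> \<in> space N" for \<omega>
      using measurable_space[OF Y that] by simp
    have "(\<lambda>m. \<integral>\<omega>. F m (Y \<omega>) \<partial>N) \<longlonglongrightarrow> (\<integral>\<omega>. f (Y \<omega>) \<partial>N)"
    proof (rule integral_dominated_convergence[where w = "\<lambda>_. C"])
      show "(\<lambda>\<omega>. f (Y \<omega>)) \<in> borel_measurable N"
        using measurable_compose[OF Y continuous_map_borel_measurable[OF f]] .
      show "(\<lambda>\<omega>. F m (Y \<omega>)) \<in> borel_measurable N" for m
        using measurable_compose[OF Y continuous_map_borel_measurable[OF F_cont]] .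
    qed (use Yin F_lim F_bound in auto)
    then have "eventually (\<lambda>m. (\<integral>\<omega>. F m (Y \<omega>) \<partial>N) > (\<integral>\<omega>. f (Y \<omega>) \<partial>N) - e / 2) sequentially"
      by (rule order_tendstoD) (use e in simp)
    then obtain m where m: "(\<integral>\<omega>. F m (Y \<omega>) \<partial>N) > (\<integral>\<omega>. f (Y \<omega>) \<partial>N) - e / 2"
      unfolding eventually_sequentially by blast
    have "(\<lambda>n. \<integral>\<omega>. F m (X n \<omega>) \<partial>M n) \<longlonglongrightarrow> (\<integral>\<omega>. F m (Y \<omega>) \<partial>N)"
      by (rule lim[OF F_lip F_bound]) auto
    then have "eventually (\<lambda>n. (\<integral>\<omega>. F m (X n \<omega>) \<partial>M n) > (\<integral>\<omega>. F m (Y \<omega>) \<partial>N) - e / 2) sequentially"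
      by (rule order_tendstoD) (use e in simp)
    \<comment> \<open>\<open>M 0\<close> may be any measure, so integrability is available from n =
      1 on.\<close>
    moreover have "eventually (\<lambda>n::nat. n \<ge> 1) sequentially" by (rule eventually_ge_at_top)
    ultimately show ?thesis
    proof eventually_elim
      case (elim n)
      interpret prob_space "M n" by (rule M) (use elim in simp)
      have "(\<integral>\<omega>. F m (X n \<omega>) \<partial>M n) \<le> (\<integral>\<omega>. f (X n \<omega>) \<partial>M n)"
      proof (rule integral_mono)
        show "integrable (M n) (\<lambda>\<omega>. F m (X n \<omega>))"
          by (rule integrable_bounded_random_element[OF _ X F_cont, where C=C]) (use F_bound in \<open>auto intro: finite_measure_axioms\<close>)
        show "integrable (M n) (\<lambda>\<omega>. f (X n \<omega>))"
          by (rule integrable_bounded_random_element[OF _ X f, where C=C]) (use C in \<open>auto intro: finite_measure_axioms\<close>)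
        show "F m (X n \<omega>) \<le> f (X n \<omega>)" if "\<omega> \<in> space (M n)" for \<omega>
          using measurable_space[OF X that] by (intro F_le_f) simp
      qed
      with elim m show ?case by linarith
    qed
  qed
  show ?thesis unfolding converges_in_distribution_def
  proof (intro conjI allI impI)
    fix f :: "(real \<Rightarrow> real) \<Rightarrow> real"
    assume f: "continuous_map skorokhod_topology euclideanreal f \<and> bounded (f ` topspace skorokhod_topology)"
    then obtain C where C: "\<And>x. x \<in> skorokhod_space \<Longrightarrow> \<bar>f x\<bar> \<le> C"
      unfolding bounded_real by auto
    have f': "continuous_map skorokhod_topology euclideanreal (\<lambda>x. - f x)"
      using f by (auto intro: continuous_map_minus)
    show "(\<lambda>n. \<integral>\<omega>. f (X n \<omega>) \<partial>M n) \<longlonglongrightarrow> (\<integral>\<omega>. f (Y \<omega>) \<partial>N)"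
    proof (rule order_tendstoI)
      fix a assume "a < (\<integral>\<omega>. f (Y \<omega>) \<partial>N)"
      then show "eventually (\<lambda>n. a < (\<integral>\<omega>. f (X n \<omega>) \<partial>M n)) sequentially"
        using lower[of f C "(\<integral>\<omega>. f (Y \<omega>) \<partial>N) - a"] f C by simp
    next
      fix a assume a: "a > (\<integral>\<omega>. f (Y \<omega>) \<partial>N)"
      have "eventually (\<lambda>n. (\<integral>\<omega>. - f (X n \<omega>) \<partial>M n) > (\<integral>\<omega>. - f (Y \<omega>) \<partial>N) - (a - (\<integral>\<omega>. f (Y \<omega>) \<partial>N))) sequentially"
        by (rule lower[OF f', of C]) (use C a in auto)
      then show "eventually (\<lambda>n. (\<integral>\<omega>. f (X n \<omega>) \<partial>M n) < a) sequentially" by simp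
    qed
  qed (use X Y in auto)
qed

section \<open>Trigonometric polynomials in finitely many coordinates\<close>

text \<open>The real span of the functions cos(c.x + b). The phase b supplies sines and constants,
  so convergence of the integrals of these functions amounts to convergence of characteristic
  functions.\<close>

inductive_set trig_polys :: "nat \<Rightarrow> ((nat \<Rightarrow> real) \<Rightarrow> real) set" for k where
  cos: "(\<lambda>x. a * cos ((\<Sum>j<k. c j * x j) + b)) \<in> trig_polys k"
| add: "f \<in> trig_polys k \<Longrightarrow> g \<in> trig_polys k \<Longrightarrow> (\<lambda>x. f x + g x) \<in> trig_polys k"

text \<open>The product-to-sum formula for cosines makes the span an algebra, as the
  Stone-Weierstrass theorem requires.\<close>

lemma trig_polys_mult:
  assumes "f \<in> trig_polys k" "g \<in> trig_polys k"
  shows "(\<lambda>x. f x * g x) \<in> trig_polys k"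
  using assms
proof (induction f)
  case (cos a c b)
  from cos(1) show ?case
  proof (induction g)
    case (cos a' c' b')
    have eq: "a * cos ((\<Sum>j<k. c j * x j) + b) * (a' * cos ((\<Sum>j<k. c' j * x j) + b')) =
       a * a' / 2 * cos ((\<Sum>j<k. (c j - c' j) * x j) + (b - b')) +
       a * a' / 2 * cos ((\<Sum>j<k. (c j + c' j) * x j) + (b + b'))" for x
    proof -
      define u v where "u = (\<Sum>j<k. c j * x j) + b" and "v = (\<Sum>j<k. c' j * x j) + b'"
      have "(\<Sum>j<k. (c j - c' j) * x j) + (b - b') = u - v" "(\<Sum>j<k. (c j + c' j) * x j) + (b + b') = u + v"
        by (simp_all add: u_def v_def algebra_simps sum.distrib sum_subtractf)
      then show ?thesis unfolding u_def[symmetric] v_def[symmetric]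
        by (simp only: cos_add cos_diff) (simp add: algebra_simps)
    qed
    show ?case unfolding eq by (intro trig_polys.intros)
  next
    case (add f g)
    then show ?case by (simp add: distrib_left trig_polys.add)
  qed
next
  case (add f g')
  then show ?case by (simp add: distrib_right trig_polys.add)
qed

text \<open>Integrability is carried through the induction because splitting the integral of a sum
  requires it.\<close>

lemma trig_polys_tendsto:
  fixes M :: "nat \<Rightarrow> 'a measure" and N :: "'b measure"
  assumes f: "f \<in> trig_polys k"
    and M: "\<And>n. n \<ge> 1 \<Longrightarrow> prob_space (M n)" and N: "prob_space N"
    and V: "\<And>n j. n \<ge> 1 \<Longrightarrow> j < k \<Longrightarrow> (\<lambda>\<omega>. V n \<omega> j) \<in> borel_measurable (M n)"
    and W: "\<And>j. j < k \<Longrightarrow> (\<lambda>\<omega>. W \<omega> j) \<in> borel_measurable N"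
    and lim: "\<And>c b. (\<lambda>n. \<integral>\<omega>. cos ((\<Sum>j<k. c j * V n \<omega> j) + b) \<partial>M n) \<longlonglongrightarrow> (\<integral>\<omega>. cos ((\<Sum>j<k. c j * W \<omega> j) + b) \<partial>N)"
  shows "(\<forall>n\<ge>1. integrable (M n) (\<lambda>\<omega>. f (V n \<omega>))) \<and> integrable N (\<lambda>\<omega>. f (W \<omega>)) \<and>
    (\<lambda>n. \<integral>\<omega>. f (V n \<omega>) \<partial>M n) \<longlonglongrightarrow> (\<integral>\<omega>. f (W \<omega>) \<partial>N)"
  using f
proof induction
  case (cos a c b)
  have "integrable (M n) (\<lambda>\<omega>. a * cos ((\<Sum>j<k. c j * V n \<omega> j) + b))" if n: "n \<ge> 1" for n
  proof -
    interpret prob_space "M n" by (rule M[OF n])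
    note V[OF n, measurable]
    show ?thesis by (intro integrable_mult_right integrable_const_bound[of _ 1]) auto
  qed
  moreover have "integrable N (\<lambda>\<omega>. a * cos ((\<Sum>j<k. c j * W \<omega> j) + b))"
  proof -
    interpret prob_space N by (rule N)
    note W[measurable]
    show ?thesis by (intro integrable_mult_right integrable_const_bound[of _ 1]) auto
  qed
  ultimately show ?case using tendsto_mult_left[OF lim, of a] by simp
next
  case (add f g)
  then have "(\<lambda>n. (\<integral>\<omega>. f (V n \<omega>) \<partial>M n) + (\<integral>\<omega>. g (V n \<omega>) \<partial>M n)) \<longlonglongrightarrow> (\<integral>\<omega>. f (W \<omega>) + g (W \<omega>) \<partial>N)"
    by (auto intro: tendsto_add)
  moreover have "eventually (\<lambda>n. (\<integral>\<omega>. f (V n \<omega>) \<partial>M n) + (\<integral>\<omega>. g (V n \<omega>) \<partial>M n) = (\<integral>\<omega>. f (V n \<omega>) + g (V n \<omega>) \<partial>M n)) sequentially"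
    using eventually_ge_at_top[of 1] by eventually_elim (use add in auto)
  ultimately show ?case using add by (auto intro: Lim_transform_eventually)
qed

text \<open>The substitution y_j = sin(\<theta> x_j) maps the box of half-width \<open>B\<close>
  injectively into a cube, where polynomials in y approximate the pulled-back function uniformly;
  read in x these are trigonometric polynomials. Since sines always lie in the cube, the bound
  \<open>C + e\<close> holds on the whole space and not only on the box.\<close>

lemma trig_approx:
  fixes h :: "(nat \<Rightarrow> real) \<Rightarrow> real"
  assumes h: "continuous_on UNIV h" and dep: "\<And>x y. (\<And>j. j < k \<Longrightarrow> x j = y j) \<Longrightarrow> h x = h y"
    and C: "\<And>x. \<bar>h x\<bar> \<le> C" and e: "e > 0" and B: "B > 0"
  shows "\<exists>f\<in>trig_polys k. (\<forall>x. \<bar>f x\<bar> \<le> C + e) \<and> (\<forall>x. (\<forall>j<k. \<bar>x j\<bar> \<le> B) \<longrightarrow> \<bar>f x - h x\<bar> \<le> e)"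
proof -
  \<comment> \<open>A quarter period matches \<open>B\<close> exactly, so that \<open>arcsin\<close>
    inverts the substitution on the box.\<close>
  define \<theta> where "\<theta> = pi / (2 * B)"
  have \<theta>: "\<theta> > 0" using B by (simp add: \<theta>_def)
  \<comment> \<open>Coordinates from \<open>k\<close> on are pinned to 0, so \<open>S\<close> is
    compact in the infinite product and its points are separated by the first \<open>k\<close>
    coordinates.\<close>
  define S :: "(nat \<Rightarrow> real) set" where "S = PiE UNIV (\<lambda>j. if j < k then {-1..1} else {0})"
  define s where "s x = (\<lambda>j. if j < k then sin (\<theta> * x j) else 0)" for x :: "nat \<Rightarrow> real"
  have sS: "s x \<in> S" for x by (auto simp: s_def S_def)
  have memS: "y j \<in> (if j < k then {-1..1} else {0})" if "y \<in> S" for y j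
    using that unfolding S_def by (rule PiE_mem) simp
  have "compact S"
  proof -
    have "compactin (product_topology (\<lambda>_. euclideanreal) UNIV) S"
      unfolding S_def by (subst compactin_PiE) auto
    then show ?thesis by (simp add: euclidean_product_topology)
  qed
  define R where "R = {p. continuous_on S p \<and> (\<lambda>x. p (s x)) \<in> trig_polys k}"
  have const: "(\<lambda>_. c) \<in> trig_polys k" for c :: real
    using trig_polys.cos[where a = c and c = "\<lambda>_. 0" and b = 0 and k = k] by simp
  have coord: "(\<lambda>y. y j) \<in> R" if j: "j < k" for j
  proof -
    have "(\<Sum>i<k. (if i = j then \<theta> else 0) * x i) = \<theta> * x j" for x :: "nat \<Rightarrow> real"
    proof -
      have "(\<Sum>i<k. (if i = j then \<theta> else 0) * x i) = (\<Sum>i<k. if i = j then \<theta> * x i else 0)"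
        by (rule sum.cong) auto
      with j show ?thesis by simp
    qed
    then have "(\<lambda>x. s x j) = (\<lambda>x. 1 * cos ((\<Sum>i<k. (if i = j then \<theta> else 0) * x i) + (- pi / 2)))"
      using j by (simp add: s_def cos_diff)
    moreover have "continuous_on S (\<lambda>y. y j)"
      by (rule continuous_on_subset[OF continuous_on_product_coordinates]) simp
    ultimately show ?thesis unfolding R_def mem_Collect_eq
      by (simp only: trig_polys.cos simp_thms)
  qed
  have add: "(\<lambda>x. f x + g x) \<in> R" if "f \<in> R" "g \<in> R" for f g
    using that unfolding R_def mem_Collect_eq
    by (elim conjE, intro conjI continuous_on_add trig_polys.add)
  have mult: "(\<lambda>x. f x * g x) \<in> R" if "f \<in> R" "g \<in> R" for f g
    using that unfolding R_def mem_Collect_eq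
    by (elim conjE, intro conjI continuous_on_mult trig_polys_mult)
  interpret function_ring_on R S
  proof (rule function_ring_on.intro)
    show "compact S" by fact
    show "\<exists>f\<in>R. f x \<noteq> f y" if "x \<in> S" "y \<in> S" "x \<noteq> y" for x y
    proof -
      from that obtain j where j: "x j \<noteq> y j" by auto
      moreover have "j < k"
      proof (rule ccontr)
        assume "\<not> j < k"
        with memS[OF that(1), of j] memS[OF that(2), of j] j show False by simp
      qed
      ultimately show ?thesis by (intro bexI[of _ "\<lambda>y. y j"] coord)
    qed
    show "continuous_on S f" if "f \<in> R" for f using that by (simp add: R_def)
    show "(\<lambda>_. c) \<in> R" for c by (simp add: R_def const)
  qed (fact add mult)+
  \<comment> \<open>\<open>h\<close> read through \<open>arcsin\<close>: on the image of the box it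
    recovers \<open>h\<close>, and it is bounded by \<open>C\<close> everywhere.\<close>
  define H where "H y = h (\<lambda>j. if j < k then arcsin (y j) / \<theta> else 0)" for y
  have "continuous_on S H" unfolding H_def
  proof (rule continuous_on_compose2[OF h _ subset_UNIV], rule continuous_on_coordinatewise_then_product)
    fix j show "continuous_on S (\<lambda>y. if j < k then arcsin (y j) / \<theta> else 0)"
    proof (cases "j < k")
      case True
      have "y j \<in> {-1..1}" if "y \<in> S" for y
        using memS[OF that, of j] True by simp
      moreover have "continuous_on S (\<lambda>y. y j)"
        using coord[OF True] by (simp add: R_def)
      ultimately show ?thesis using True \<theta> by (auto intro!: continuous_intros)
    qed simp
  qed
  from Stone_Weierstrass[OF this] obtain F where F: "F \<in> UNIV \<rightarrow> R" "uniform_limit S F H sequentially" by blast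
  from uniform_limitD[OF F(2) e] obtain n where n: "\<forall>y\<in>S. dist (F n y) (H y) < e"
    unfolding eventually_sequentially by blast
  show ?thesis
  proof (intro bexI[of _ "\<lambda>x. F n (s x)"] conjI allI impI)
    show "(\<lambda>x. F n (s x)) \<in> trig_polys k" using F(1) by (auto simp: R_def)
    fix x
    have d: "\<bar>F n (s x) - H (s x)\<bar> < e" using n sS by (auto simp: dist_real_def)
    moreover have "\<bar>H (s x)\<bar> \<le> C" unfolding H_def by (rule C)
    ultimately show "\<bar>F n (s x)\<bar> \<le> C + e" by linarith
    assume x: "\<forall>j<k. \<bar>x j\<bar> \<le> B"
    have "H (s x) = h x" unfolding H_def
    proof (rule dep)
      fix j assume j: "j < k"
      have "\<bar>\<theta> * x j\<bar> \<le> \<theta> * B" using x j \<theta> by (simp add: abs_mult)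
      also have "\<dots> = pi / 2" using B by (simp add: \<theta>_def)
      finally have "arcsin (sin (\<theta> * x j)) = \<theta> * x j" by (intro arcsin_sin) auto
      then show "(if j < k then arcsin (s x j) / \<theta> else 0) = x j" using j \<theta> by (simp add: s_def)
    qed
    with d show "\<bar>F n (s x) - h x\<bar> \<le> e" by simp
  qed
qed

section \<open>Tightness from increment moments\<close>

text \<open>Cosines of linear combinations decide the limit for every bounded continuous function of
  k coordinates. A trigonometric polynomial is close to \<open>h\<close> on a large box, and the
  second moments make the mass outside the box small, uniformly in n, as in Chebyshev's
  inequality.\<close>

lemma fdd_tendsto:
  fixes M :: "nat \<Rightarrow> 'a measure" and N :: "'b measure"
    and V :: "nat \<Rightarrow> 'a \<Rightarrow> nat \<Rightarrow> real" and W :: "'b \<Rightarrow> nat \<Rightarrow> real"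
    and h :: "(nat \<Rightarrow> real) \<Rightarrow> real" and K C :: real and k n0 :: nat
  assumes M: "\<And>n. n \<ge> 1 \<Longrightarrow> prob_space (M n)" and N: "prob_space N"
    and V: "\<And>n j. n \<ge> 1 \<Longrightarrow> (\<lambda>\<omega>. V n \<omega> j) \<in> borel_measurable (M n)"
    and W: "\<And>j. (\<lambda>\<omega>. W \<omega> j) \<in> borel_measurable N"
    and V2: "\<And>n j. n \<ge> n0 \<Longrightarrow> j < k \<Longrightarrow> integrable (M n) (\<lambda>\<omega>. (V n \<omega> j)\<^sup>2) \<and> (\<integral>\<omega>. (V n \<omega> j)\<^sup>2 \<partial>M n) \<le> K"
    and W2: "\<And>j. j < k \<Longrightarrow> integrable N (\<lambda>\<omega>. (W \<omega> j)\<^sup>2) \<and> (\<integral>\<omega>. (W \<omega> j)\<^sup>2 \<partial>N) \<le> K"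
    and lim: "\<And>c b. (\<lambda>n. \<integral>\<omega>. cos ((\<Sum>j<k. c j * V n \<omega> j) + b) \<partial>M n) \<longlonglongrightarrow> (\<integral>\<omega>. cos ((\<Sum>j<k. c j * W \<omega> j) + b) \<partial>N)"
    and h: "continuous_on UNIV h"
    and dep: "\<And>x y. (\<And>j. j < k \<Longrightarrow> x j = y j) \<Longrightarrow> h x = h y"
    and C: "\<And>x. \<bar>h x\<bar> \<le> C"
  shows "(\<lambda>n. \<integral>\<omega>. h (V n \<omega>) \<partial>M n) \<longlonglongrightarrow> (\<integral>\<omega>. h (W \<omega>) \<partial>N)"
proof (rule LIMSEQ_I)
  fix e :: real assume e: "e > 0"
  have C0: "C \<ge> 0" using C[of "\<lambda>_. 0"] by linarith
  \<comment> \<open>A bound for the distance between \<open>f\<close> and \<open>h\<close> off the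
    box: \<open>C + e / 8\<close> for one and \<open>C\<close> for the other.\<close>
  define D where "D = 2 * C + e / 8"
  have D: "D > 0" using C0 e by (simp add: D_def)
  \<comment> \<open>Chosen such that \<open>D * (k * \<bar>K\<bar>) / B^2 \<le> e / 8\<close>; the
    added 1 keeps \<open>B\<close> positive.\<close>
  define B where "B = sqrt (8 * D * (real k * \<bar>K\<bar> + 1) / e)"
  have B2: "B\<^sup>2 = 8 * D * (real k * \<bar>K\<bar> + 1) / e" unfolding B_def using D e by (intro real_sqrt_pow2) auto
  have Bpos: "B > 0" unfolding B_def using D e by (auto intro!: divide_pos_pos mult_pos_pos add_nonneg_pos)
  obtain f where f: "f \<in> trig_polys k" "\<And>x. \<bar>f x\<bar> \<le> C + e / 8"
    "\<And>x. (\<forall>j<k. \<bar>x j\<bar> \<le> B) \<Longrightarrow> \<bar>f x - h x\<bar> \<le> e / 8"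
    using trig_approx[OF h dep C, where e = "e / 8" and B = B and k = k] e Bpos by auto
  \<comment> \<open>Off the box some coordinate satisfies \<open>(x j)^2 / B^2 \<ge> 1\<close>, so
    the sum dominates the indicator of the complement of the box.\<close>
  have pt: "\<bar>f x - h x\<bar> \<le> e / 8 + D * (\<Sum>j<k. (x j)\<^sup>2 / B\<^sup>2)" for x
  proof (cases "\<forall>j<k. \<bar>x j\<bar> \<le> B")
    case True
    have "0 \<le> D * (\<Sum>j<k. (x j)\<^sup>2 / B\<^sup>2)" using D by (intro mult_nonneg_nonneg sum_nonneg) auto
    with f(3)[OF True] show ?thesis by linarith
  next
    case False
    then obtain j where j: "j < k" "\<bar>x j\<bar> > B" by force
    then have "1 \<le> (x j)\<^sup>2 / B\<^sup>2" using Bpos power_mono[of B "\<bar>x j\<bar>" 2] by simp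
    also have "\<dots> \<le> (\<Sum>j<k. (x j)\<^sup>2 / B\<^sup>2)" using j by (intro member_le_sum) auto
    finally have "D * 1 \<le> D * (\<Sum>j<k. (x j)\<^sup>2 / B\<^sup>2)" using D by (intro mult_left_mono) auto
    moreover have "\<bar>f x - h x\<bar> \<le> D" using f(2)[of x] C[of x] unfolding D_def by linarith
    ultimately show ?thesis using e by linarith
  qed
  have main: "\<bar>(\<integral>\<omega>. f (Z \<omega>) \<partial>P) - (\<integral>\<omega>. h (Z \<omega>) \<partial>P)\<bar> \<le> e / 4"
    if P: "prob_space P" and Z: "\<And>j. (\<lambda>\<omega>. Z \<omega> j) \<in> borel_measurable P"
      and Z2: "\<And>j. j < k \<Longrightarrow> integrable P (\<lambda>\<omega>. (Z \<omega> j)\<^sup>2) \<and> (\<integral>\<omega>. (Z \<omega> j)\<^sup>2 \<partial>P) \<le> K"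
      and If: "integrable P (\<lambda>\<omega>. f (Z \<omega>))" for P :: "'z measure" and Z
  proof -
    interpret prob_space P by (rule P)
    have "Z \<in> borel_measurable P" using measurable_coordinatewise_then_product[OF Z] .
    then have "(\<lambda>\<omega>. h (Z \<omega>)) \<in> borel_measurable P"
      using borel_measurable_continuous_onI[OF h] by (rule measurable_compose)
    then have Ih: "integrable P (\<lambda>\<omega>. h (Z \<omega>))" using C by (intro integrable_const_bound[of _ C]) auto
    have IZ: "integrable P (\<lambda>\<omega>. (Z \<omega> j)\<^sup>2 / B\<^sup>2)" if "j \<in> {..<k}" for j
      using Z2[of j] that by simp
    have ID: "integrable P (\<lambda>\<omega>. D * (\<Sum>j<k. (Z \<omega> j)\<^sup>2 / B\<^sup>2))"
      by (intro integrable_mult_right Bochner_Integration.integrable_sum IZ)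
    have "\<bar>(\<integral>\<omega>. f (Z \<omega>) \<partial>P) - (\<integral>\<omega>. h (Z \<omega>) \<partial>P)\<bar> = \<bar>\<integral>\<omega>. f (Z \<omega>) - h (Z \<omega>) \<partial>P\<bar>"
      using If Ih by simp
    also have "\<dots> \<le> (\<integral>\<omega>. \<bar>f (Z \<omega>) - h (Z \<omega>)\<bar> \<partial>P)" by (rule integral_abs_bound)
    also have "\<dots> \<le> (\<integral>\<omega>. e / 8 + D * (\<Sum>j<k. (Z \<omega> j)\<^sup>2 / B\<^sup>2) \<partial>P)"
      using If Ih ID by (intro integral_mono pt) auto
    also have "\<dots> = e / 8 + D * (\<Sum>j<k. (\<integral>\<omega>. (Z \<omega> j)\<^sup>2 \<partial>P) / B\<^sup>2)"
    proof -
      have "(\<integral>\<omega>. (\<Sum>j<k. (Z \<omega> j)\<^sup>2 / B\<^sup>2) \<partial>P) = (\<Sum>j<k. (\<integral>\<omega>. (Z \<omega> j)\<^sup>2 / B\<^sup>2 \<partial>P))"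
        using IZ by (intro Bochner_Integration.integral_sum) auto
      then show ?thesis using ID by (simp add: prob_space)
    qed
    also have "\<dots> \<le> e / 8 + D * (\<Sum>j<k. \<bar>K\<bar> / B\<^sup>2)"
    proof (intro add_left_mono mult_left_mono sum_mono divide_right_mono)
      fix j assume "j \<in> {..<k}"
      with Z2[of j] show "(\<integral>\<omega>. (Z \<omega> j)\<^sup>2 \<partial>P) \<le> \<bar>K\<bar>" by auto
    qed (use D in auto)
    also have "D * (\<Sum>j<k. \<bar>K\<bar> / B\<^sup>2) = D * (real k * \<bar>K\<bar>) / B\<^sup>2" by simp
    also have "\<dots> \<le> e / 8"
    proof -
      have "D * (real k * \<bar>K\<bar>) \<le> D * (real k * \<bar>K\<bar> + 1)" using D by (intro mult_left_mono) auto
      also have "\<dots> = e / 8 * B\<^sup>2" unfolding B2 using e by simp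
      finally show ?thesis using Bpos by (simp add: divide_le_eq)
    qed
    finally show ?thesis by simp
  qed
  note T = trig_polys_tendsto[OF f(1) M N V W lim]
  then have "(\<lambda>n. \<integral>\<omega>. f (V n \<omega>) \<partial>M n) \<longlonglongrightarrow> (\<integral>\<omega>. f (W \<omega>) \<partial>N)" by blast
  from LIMSEQ_D[OF this, of "e / 4"] e obtain n1 where
    n1: "\<And>n. n \<ge> n1 \<Longrightarrow> \<bar>(\<integral>\<omega>. f (V n \<omega>) \<partial>M n) - (\<integral>\<omega>. f (W \<omega>) \<partial>N)\<bar> < e / 4" by auto
  show "\<exists>no. \<forall>n\<ge>no. norm ((\<integral>\<omega>. h (V n \<omega>) \<partial>M n) - (\<integral>\<omega>. h (W \<omega>) \<partial>N)) < e"
  proof (intro exI[of _ "max (max n0 n1) 1"] allI impI)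
    fix n assume n: "n \<ge> max (max n0 n1) 1"
    have "\<bar>(\<integral>\<omega>. f (V n \<omega>) \<partial>M n) - (\<integral>\<omega>. h (V n \<omega>) \<partial>M n)\<bar> \<le> e / 4"
      by (rule main) (use n M V V2 T in auto)
    moreover have "\<bar>(\<integral>\<omega>. f (W \<omega>) \<partial>N) - (\<integral>\<omega>. h (W \<omega>) \<partial>N)\<bar> \<le> e / 4"
      by (rule main) (use N W W2 T in auto)
    ultimately show "norm ((\<integral>\<omega>. h (V n \<omega>) \<partial>M n) - (\<integral>\<omega>. h (W \<omega>) \<partial>N)) < e"
      using n1[of n] n unfolding real_norm_def by linarith
  qed
qed

section \<open>Dyadic chaining\<close>

definition dyadic_floor :: "nat \<Rightarrow> real \<Rightarrow> real" where
  "dyadic_floor p t = of_int \<lfloor>2 ^ p * t\<rfloor> / 2 ^ p"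

text \<open>Halving the mesh moves the dyadic floor by at most one step of the finer grid, so the
  difference telescopes with at most one increment per level.\<close>

lemma dyadic_chain:
  fixes x :: "real \<Rightarrow> real" and d :: "nat \<Rightarrow> real"
  assumes pK: "p \<le> K" and t: "t \<in> {0..1}"
    and inc: "\<And>j i. p < j \<Longrightarrow> j \<le> K \<Longrightarrow> i < 2 ^ j \<Longrightarrow> \<bar>x ((real i + 1) / 2 ^ j) - x (real i / 2 ^ j)\<bar> \<le> d j"
    and d: "\<And>j. 0 \<le> d j"
  shows "\<bar>x (dyadic_floor K t) - x (dyadic_floor p t)\<bar> \<le> (\<Sum>j\<in>{p<..K}. d j)"
  using pK inc
proof (induction K rule: dec_induct)
  case (step K)
  define u v where "u = \<lfloor>2 ^ Suc K * t\<rfloor>" and "v = \<lfloor>2 ^ K * t\<rfloor>"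
  have v: "of_int v \<le> 2 ^ K * t" "2 ^ K * t < of_int v + 1" unfolding v_def by linarith+
  have "of_int (2 * v) \<le> 2 ^ Suc K * t" "2 ^ Suc K * t < of_int (2 * v) + 2" using v by simp_all
  \<comment> \<open>The finer floor is twice the coarser one or one more; only the second case
    contributes an increment.\<close>
  then have "u = 2 * v \<or> u = 2 * v + 1" unfolding u_def by linarith
  then have "\<bar>x (dyadic_floor (Suc K) t) - x (dyadic_floor K t)\<bar> \<le> d (Suc K)"
  proof
    assume "u = 2 * v"
    then have "dyadic_floor (Suc K) t = dyadic_floor K t"
      unfolding dyadic_floor_def u_def[symmetric] v_def[symmetric] by simp
    with d show ?thesis by simp
  next
    assume u: "u = 2 * v + 1"
    have "v \<ge> 0" using t by (simp add: v_def)
    moreover have "u \<le> 2 ^ Suc K"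
    proof -
      have "2 ^ Suc K * t \<le> 2 ^ Suc K" using t by simp
      then have "of_int u \<le> (2 ^ Suc K :: real)" unfolding u_def by linarith
      then have "of_int u \<le> (of_int (2 ^ Suc K) :: real)" by simp
      then show ?thesis by (simp only: of_int_le_iff)
    qed
    ultimately have i: "nat (2 * v) < 2 ^ Suc K" using u by (simp add: nat_less_iff)
    have "real (nat (2 * v)) = 2 * of_int v" using \<open>v \<ge> 0\<close> by simp
    then have "\<bar>x ((2 * of_int v + 1) / 2 ^ Suc K) - x (2 * of_int v / 2 ^ Suc K)\<bar> \<le> d (Suc K)"
      using step.prems[of "Suc K" "nat (2 * v)"] i step.hyps by simp
    moreover have "dyadic_floor (Suc K) t = (2 * of_int v + 1) / 2 ^ Suc K" "dyadic_floor K t = 2 * of_int v / 2 ^ Suc K"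
      unfolding dyadic_floor_def u_def[symmetric] v_def[symmetric] u by simp_all
    ultimately show ?thesis by simp
  qed
  moreover have "\<bar>x (dyadic_floor K t) - x (dyadic_floor p t)\<bar> \<le> (\<Sum>j\<in>{p<..K}. d j)"
    using step by simp
  moreover have "(\<Sum>j\<in>{p<..Suc K}. d j) = (\<Sum>j\<in>{p<..K}. d j) + d (Suc K)"
  proof -
    have "{p<..Suc K} = insert (Suc K) {p<..K}" using step.hyps by auto
    then show ?thesis by simp
  qed
  ultimately show ?case by linarith
qed simp

lemma (in prob_space) markov_fourth_moment:
  fixes Z :: "'a \<Rightarrow> real"
  assumes [measurable]: "Z \<in> borel_measurable M" and int: "integrable M (\<lambda>\<omega>. Z \<omega> ^ 4)" and d: "d > 0"
  shows "prob {\<omega> \<in> space M. \<bar>Z \<omega>\<bar> > d} \<le> (\<integral>\<omega>. Z \<omega> ^ 4 \<partial>M) / d ^ 4"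
proof -
  let ?A = "{\<omega> \<in> space M. \<bar>Z \<omega>\<bar> > d}"
  have "d ^ 4 * prob ?A = (\<integral>\<omega>. d ^ 4 * indicator ?A \<omega> \<partial>M)" by simp
  also have "\<dots> \<le> (\<integral>\<omega>. Z \<omega> ^ 4 \<partial>M)"
  proof (rule integral_mono[OF _ int])
    fix \<omega> assume "\<omega> \<in> space M"
    show "d ^ 4 * indicator ?A \<omega> \<le> Z \<omega> ^ 4"
      using power_mono[of d "\<bar>Z \<omega>\<bar>" 4] d by (auto simp: indicator_def power_even_abs)
  qed (auto intro!: integrable_real_indicator simp: emeasure_eq_measure)
  finally show ?thesis using d by (simp add: field_simps)
qed

text \<open>Kolmogorov's chaining, stopped at the level K with 2^K \<le> n < 2^(K+1), beyond which
  no moment bound is assumed. Level j has 2^j increments, each exceeding \<open>d j\<close> with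
  probability at most \<open>C / (4 ^ j * d j ^ 4)\<close>, and geometric thresholds make both the
  probabilities and the thresholds summable. In the last cell \<open>mono\<close> takes over: a
  value far below the left end, or far above the right end, would force too steep a descent.\<close>

lemma (in prob_space) increment_modulus:
  fixes X :: "'a \<Rightarrow> real \<Rightarrow> real" and n :: nat
  assumes meas: "\<And>s. s \<in> {0..1} \<Longrightarrow> (\<lambda>\<omega>. X \<omega> s) \<in> borel_measurable M"
    and mono: "\<And>\<omega> a s. \<omega> \<in> space M \<Longrightarrow> 0 \<le> a \<Longrightarrow> a \<le> s \<Longrightarrow> s \<le> 1 \<Longrightarrow>
       X \<omega> s - X \<omega> a \<ge> - sqrt n * (s - a) - 1 / sqrt n"
    and mom: "\<And>s t. 0 \<le> s \<Longrightarrow> t \<le> 1 \<Longrightarrow> 1 / n \<le> t - s \<Longrightarrow>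
       integrable M (\<lambda>\<omega>. (X \<omega> t - X \<omega> s) ^ 4) \<and> (\<integral>\<omega>. (X \<omega> t - X \<omega> s) ^ 4 \<partial>M) \<le> C * (t - s)\<^sup>2"
    and n: "2 ^ p \<le> n" "3 / sqrt n \<le> e" and e: "e > 0" and C: "C \<ge> 0"
  shows "\<exists>E\<in>sets M. prob E \<le> 5 * C / (e ^ 4 * 2 ^ p) \<and>
    (\<forall>\<omega>\<in>space M - E. \<forall>t\<in>{0..1}. \<bar>X \<omega> t - X \<omega> (dyadic_floor p t)\<bar> \<le> 12 * e)"
proof -
  have n0: "n > 0" using n(1) by (metis gr0I not_less zero_less_numeral zero_less_power)
  obtain K where K: "2 ^ K \<le> n" "n < 2 ^ Suc K"
    using ex_power_ivl1[of 2 n] n0 by auto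
  have pK: "p \<le> K"
  proof (rule ccontr)
    assume "\<not> p \<le> K"
    then have "Suc K \<le> p" by simp
    then have "(2::nat) ^ Suc K \<le> 2 ^ p" by (rule power_increasing) simp
    with n(1) K show False by simp
  qed
  \<comment> \<open>The ratio needs l < 1 for the thresholds and 2 l^4 > 1 for the probabilities;
    9/10 gives sums of at most 10 and 5.\<close>
  define l :: real where "l = 9 / 10"
  define d where "d j = e * l ^ (j - p)" for j
  have d: "d j > 0" for j using e by (simp add: d_def l_def)
  define E where "E j i = {\<omega> \<in> space M. \<bar>X \<omega> ((real i + 1) / 2 ^ j) - X \<omega> (real i / 2 ^ j)\<bar> > d j}" for j i
  have rng: "real i / 2 ^ j \<in> {0..1}" "(real i + 1) / 2 ^ j \<in> {0..1}" if "i < 2 ^ j" for i j :: nat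
  proof -
    have "real i + 1 \<le> 2 ^ j" using that by (metis Suc_leI of_nat_Suc add.commute of_nat_le_numeral_power_cancel_iff)
    moreover from this have "real i \<le> 2 ^ j" by linarith
    ultimately show "real i / 2 ^ j \<in> {0..1}" "(real i + 1) / 2 ^ j \<in> {0..1}" by (auto simp: divide_le_eq)
  qed
  have Emeas: "E j i \<in> sets M" if "i < 2 ^ j" for i j
  proof -
    note meas[OF rng(1)[OF that], measurable] meas[OF rng(2)[OF that], measurable]
    show ?thesis unfolding E_def by measurable
  qed
  have EP: "prob (E j i) \<le> C / (4 ^ j * d j ^ 4)" if i: "i < 2 ^ j" and j: "j \<le> K" for i j
  proof -
    have len: "(real i + 1) / 2 ^ j - real i / 2 ^ j = 1 / 2 ^ j" by (simp add: diff_divide_distrib[symmetric])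
    have "real n \<ge> 2 ^ j"
    proof -
      have "(2::nat) ^ j \<le> 2 ^ K" using j by (intro power_increasing) auto
      with K have "2 ^ j \<le> n" by linarith
      then show ?thesis by (metis of_nat_le_iff of_nat_numeral of_nat_power)
    qed
    then have "1 / n \<le> (real i + 1) / 2 ^ j - real i / 2 ^ j" unfolding len by (intro divide_left_mono) (use n0 in auto)
    then have m: "integrable M (\<lambda>\<omega>. (X \<omega> ((real i + 1) / 2 ^ j) - X \<omega> (real i / 2 ^ j)) ^ 4)"
      "(\<integral>\<omega>. (X \<omega> ((real i + 1) / 2 ^ j) - X \<omega> (real i / 2 ^ j)) ^ 4 \<partial>M) \<le> C * (1 / 2 ^ j)\<^sup>2"
      using mom[of "real i / 2 ^ j" "(real i + 1) / 2 ^ j"] rng[OF i] unfolding len by auto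
    have "prob (E j i) \<le> (\<integral>\<omega>. (X \<omega> ((real i + 1) / 2 ^ j) - X \<omega> (real i / 2 ^ j)) ^ 4 \<partial>M) / d j ^ 4"
      unfolding E_def using rng[OF i] by (intro markov_fourth_moment borel_measurable_diff meas m d) auto
    also have "\<dots> \<le> C * (1 / 2 ^ j)\<^sup>2 / d j ^ 4" using m(2) d[of j] by (intro divide_right_mono) auto
    also have "\<dots> = C / (4 ^ j * d j ^ 4)" by (simp add: power_divide power_mult_distrib power2_eq_square flip: power_mult_distrib)
    finally show ?thesis .
  qed
  have ratio: "1 / (2 * (9/10) ^ 4 :: real) \<le> 4 / 5" by (simp add: power_numeral_reduce divide_simps)
  define EE where "EE = (\<Union>j\<in>{p..K}. \<Union>i\<in>{..<2^j}. E j i)"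
  have EEm: "EE \<in> sets M" unfolding EE_def using Emeas by (intro sets.finite_UN) auto
  have "prob EE \<le> (\<Sum>j\<in>{p..K}. prob (\<Union>i\<in>{..<2^j}. E j i))"
    unfolding EE_def using Emeas by (intro finite_measure_subadditive_finite) auto
  also have "\<dots> \<le> (\<Sum>j\<in>{p..K}. \<Sum>i\<in>{..<2^j}. prob (E j i))"
    using Emeas by (intro sum_mono finite_measure_subadditive_finite) auto
  also have "\<dots> \<le> (\<Sum>j\<in>{p..K}. \<Sum>i\<in>{..<(2::nat)^j}. C / (4 ^ j * d j ^ 4))"
    using EP by (intro sum_mono) auto
  also have "\<dots> = (\<Sum>j\<in>{p..K}. C / (e ^ 4 * 2 ^ p) * (1 / (2 * l ^ 4)) ^ (j - p))"
  proof (intro sum.cong refl)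
    fix j assume j: "j \<in> {p..K}"
    have "(2::real) ^ j = 2 ^ p * 2 ^ (j - p)" using j by (simp add: power_add[symmetric])
    moreover have "(4::real) ^ j = 2 ^ j * 2 ^ j" by (simp flip: power_mult_distrib)
    moreover have "l > 0" by (simp add: l_def)
    ultimately show "(\<Sum>i\<in>{..<(2::nat)^j}. C / (4 ^ j * d j ^ 4)) = C / (e ^ 4 * 2 ^ p) * (1 / (2 * l ^ 4)) ^ (j - p)"
      using e by (simp add: d_def power_mult_distrib power_divide field_simps power_mult[symmetric])
  qed
  also have "\<dots> \<le> (\<Sum>j\<in>{p..K}. C / (e ^ 4 * 2 ^ p) * (4 / 5) ^ (j - p))"
    using ratio C e unfolding l_def by (intro sum_mono mult_left_mono power_mono) auto
  also have "\<dots> = C / (e ^ 4 * 2 ^ p) * (\<Sum>j\<in>{p..K}. (4 / 5) ^ (j - p))" by (simp add: sum_distrib_left)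
  also have "\<dots> \<le> C / (e ^ 4 * 2 ^ p) * 5"
  proof (rule mult_left_mono)
    have "(\<Sum>j\<in>{p..K}. (4 / 5 :: real) ^ (j - p)) = (\<Sum>i\<le>K - p. (4 / 5) ^ i)"
      by (rule sum.reindex_bij_witness[of _ "\<lambda>i. i + p" "\<lambda>j. j - p"]) (use pK in auto)
    also have "\<dots> \<le> 5"
      using sum_le_suminf[OF summable_geometric[of "4/5::real"], of "{..K - p}"] suminf_geometric[of "4/5::real"] by simp
    finally show "(\<Sum>j\<in>{p..K}. (4 / 5 :: real) ^ (j - p)) \<le> 5" .
  qed (use C e in auto)
  finally have "prob EE \<le> C / (e ^ 4 * 2 ^ p) * 5" .
  moreover have "\<bar>X \<omega> t - X \<omega> (dyadic_floor p t)\<bar> \<le> 12 * e"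
    if \<omega>: "\<omega> \<in> space M - EE" and t: "t \<in> {0..1}" for \<omega> t
  proof -
    have good: "\<bar>X \<omega> ((real i + 1) / 2 ^ j) - X \<omega> (real i / 2 ^ j)\<bar> \<le> d j" if "p \<le> j" "j \<le> K" "i < 2 ^ j" for i j
      using \<omega> that unfolding EE_def E_def by force
    have "\<bar>X \<omega> (dyadic_floor K t) - X \<omega> (dyadic_floor p t)\<bar> \<le> (\<Sum>j\<in>{p<..K}. d j)"
      by (rule dyadic_chain[OF pK t]) (use good d in \<open>auto intro: less_imp_le\<close>)
    also have "\<dots> \<le> (\<Sum>j\<in>{p..K}. d j)" using d by (intro sum_mono2) (auto intro: less_imp_le)
    also have "\<dots> = e * (\<Sum>j\<in>{p..K}. l ^ (j - p))" by (simp add: d_def sum_distrib_left)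
    also have "(\<Sum>j\<in>{p..K}. l ^ (j - p)) = (\<Sum>i\<le>K - p. l ^ i)"
      by (rule sum.reindex_bij_witness[of _ "\<lambda>i. i + p" "\<lambda>j. j - p"]) (use pK in auto)
    also have "\<dots> \<le> 10"
      using sum_le_suminf[OF summable_geometric[of l], of "{..K - p}"] suminf_geometric[of l] by (simp add: l_def)
    finally have 1: "\<bar>X \<omega> (dyadic_floor K t) - X \<omega> (dyadic_floor p t)\<bar> \<le> 10 * e" using e by simp
    have 2: "\<bar>X \<omega> t - X \<omega> (dyadic_floor K t)\<bar> \<le> 2 * e"
    proof (cases "t = 1")
      case True
      \<comment> \<open>1 is a dyadic point itself and has no cell to its right.\<close>
      have "dyadic_floor K t = t" using floor_of_int[of "2 ^ K", where ?'a = real] by (simp add: True dyadic_floor_def)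
      with e show ?thesis by simp
    next
      case False
      define v where "v = \<lfloor>2 ^ K * t\<rfloor>"
      have v: "of_int v \<le> 2 ^ K * t" "2 ^ K * t < of_int v + 1" unfolding v_def by linarith+
      have v0: "v \<ge> 0" using t by (simp add: v_def)
      have "2 ^ K * t < 2 ^ K" using t False by simp
      with v have "of_int v < (2 ^ K :: real)" by linarith
      then have "of_int v < (of_int (2 ^ K) :: real)" by simp
      then have "v < 2 ^ K" by (simp only: of_int_less_iff)
      then have i: "nat v < 2 ^ K" using v0 by (simp add: nat_less_iff)
      have a: "dyadic_floor K t = real (nat v) / 2 ^ K" using v0 by (simp add: dyadic_floor_def v_def)
      define b where "b = (real (nat v) + 1) / 2 ^ K"
      have tb: "dyadic_floor K t \<le> t" "t \<le> b" "0 \<le> dyadic_floor K t" "b \<le> 1"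
        using v v0 rng[OF i] unfolding a b_def by (auto simp: field_simps)
      have ba: "b - dyadic_floor K t = 1 / 2 ^ K" unfolding a b_def by (simp add: diff_divide_distrib[symmetric])
      have sn: "sqrt n > 0" using n0 by simp
      \<comment> \<open>By n < 2^(K+1), a cell of length 2^-K allows a descent of at most 2 / sqrt
        n, to which the slack 1 / sqrt n is added.\<close>
      have le: "sqrt n * (1 / 2 ^ K) + 1 / sqrt n \<le> 3 / sqrt n"
      proof -
        have "real n \<le> 2 * 2 ^ K" using K(2) by (metis of_nat_less_iff less_imp_le of_nat_numeral of_nat_power power_Suc)
        then have "sqrt n * sqrt n \<le> 2 * 2 ^ K" by simp
        then show ?thesis using sn by (simp add: field_simps)
      qed
      have de: "d K \<le> e" using e by (simp add: d_def l_def power_le_one mult_left_le)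
      have g: "\<bar>X \<omega> b - X \<omega> (dyadic_floor K t)\<bar> \<le> e"
        using good[OF pK order_refl i] de unfolding a b_def by linarith
      have \<omega>': "\<omega> \<in> space M" using \<omega> by simp
      \<comment> \<open>\<open>m1\<close> bounds the value at \<open>t\<close> from below by the
        left end, \<open>m2\<close> from above by the right end, and by \<open>g\<close> the two
        ends differ by at most \<open>e\<close>.\<close>
      have m1: "X \<omega> t - X \<omega> (dyadic_floor K t) \<ge> - sqrt n * (t - dyadic_floor K t) - 1 / sqrt n"
        using tb by (intro mono[OF \<omega>']) auto
      have m2: "X \<omega> b - X \<omega> t \<ge> - sqrt n * (b - t) - 1 / sqrt n"
        using tb t by (intro mono[OF \<omega>']) auto
      have "sqrt n * (t - dyadic_floor K t) \<le> sqrt n * (1 / 2 ^ K)" "sqrt n * (b - t) \<le> sqrt n * (1 / 2 ^ K)"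
        using tb ba sn by (intro mult_left_mono; linarith)+
      with m1 m2 g le n(2) e show ?thesis by (simp add: abs_le_iff)
    qed
    from 1 2 show ?thesis by linarith
  qed
  ultimately show ?thesis using EEm by (intro bexI[of _ EE]) (auto simp: mult.commute)
qed

section \<open>The functional limit criterion\<close>

text \<open>Three comparisons through paths sampled at 2^p points. Outside an event of small
  probability \<open>X n\<close> is within \<open>12 * e\<close> of its samples, uniformly in time,
  so a Lipschitz function barely distinguishes them. The sampled functional depends on finitely many
  times and converges by \<open>fdd_tendsto\<close>. The samples of \<open>Y\<close> converge to
  \<open>Y\<close> in the Skorokhod metric, and dominated convergence applies.\<close>

lemma functional_limit:
  fixes M :: "nat \<Rightarrow> 'a measure" and N :: "'b measure" and C K :: real and n0 :: nat
    and X :: "nat \<Rightarrow> 'a \<Rightarrow> real \<Rightarrow> real" and Y :: "'b \<Rightarrow> real \<Rightarrow> real"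
  assumes M: "\<And>n. n \<ge> 1 \<Longrightarrow> prob_space (M n)" and N: "prob_space N"
    and X: "\<And>n \<omega>. \<omega> \<in> space (M n) \<Longrightarrow> X n \<omega> \<in> skorokhod_space"
    and Y: "\<And>\<omega>. \<omega> \<in> space N \<Longrightarrow> Y \<omega> \<in> skorokhod_space"
    and Xm: "\<And>n s. s \<in> {0..1} \<Longrightarrow> (\<lambda>\<omega>. X n \<omega> s) \<in> borel_measurable (M n)"
    and Ym: "\<And>s. s \<in> {0..1} \<Longrightarrow> (\<lambda>\<omega>. Y \<omega> s) \<in> borel_measurable N"
    and mono: "\<And>n \<omega> a s. n \<ge> 1 \<Longrightarrow> \<omega> \<in> space (M n) \<Longrightarrow> 0 \<le> a \<Longrightarrow> a \<le> s \<Longrightarrow> s \<le> 1 \<Longrightarrow>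
       X n \<omega> s - X n \<omega> a \<ge> - sqrt n * (s - a) - 1 / sqrt n"
    and mom: "\<And>n s t. n \<ge> n0 \<Longrightarrow> 0 \<le> s \<Longrightarrow> t \<le> 1 \<Longrightarrow> 1 / n \<le> t - s \<Longrightarrow>
       integrable (M n) (\<lambda>\<omega>. (X n \<omega> t - X n \<omega> s) ^ 4) \<and> (\<integral>\<omega>. (X n \<omega> t - X n \<omega> s) ^ 4 \<partial>M n) \<le> C * (t - s)\<^sup>2"
    and X2: "\<And>n s. n \<ge> n0 \<Longrightarrow> s \<in> {0..1} \<Longrightarrow> integrable (M n) (\<lambda>\<omega>. (X n \<omega> s)\<^sup>2) \<and> (\<integral>\<omega>. (X n \<omega> s)\<^sup>2 \<partial>M n) \<le> K"
    and Y2: "\<And>s. s \<in> {0..1} \<Longrightarrow> integrable N (\<lambda>\<omega>. (Y \<omega> s)\<^sup>2) \<and> (\<integral>\<omega>. (Y \<omega> s)\<^sup>2 \<partial>N) \<le> K"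
    and lim: "\<And>(k::nat) s c b. (\<And>j. j < k \<Longrightarrow> s j \<in> {0..1}) \<Longrightarrow>
       (\<lambda>n. \<integral>\<omega>. cos ((\<Sum>j<k. c j * X n \<omega> (s j)) + b) \<partial>M n) \<longlonglongrightarrow> (\<integral>\<omega>. cos ((\<Sum>j<k. c j * Y \<omega> (s j)) + b) \<partial>N)"
  shows "converges_in_distribution skorokhod_topology M X N Y"
proof (rule converges_in_distribution_lipschitzI[OF _ _ M N])
  show "X n \<in> M n \<rightarrow>\<^sub>M borel_of_topology skorokhod_topology" for n by (rule measurable_skorokhod[OF X Xm])
  show "Y \<in> N \<rightarrow>\<^sub>M borel_of_topology skorokhod_topology" by (rule measurable_skorokhod[OF Y Ym])
  fix g :: "(real \<Rightarrow> real) \<Rightarrow> real" and L G :: real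
  assume lip: "\<And>x y. x \<in> skorokhod_space \<Longrightarrow> y \<in> skorokhod_space \<Longrightarrow> \<bar>g x - g y\<bar> \<le> L * skorokhod_dist x y"
    and G: "\<And>x. x \<in> skorokhod_space \<Longrightarrow> \<bar>g x\<bar> \<le> G" and L: "0 \<le> L"
  interpret N: prob_space N by (rule N)
  have gc: "continuous_map skorokhod_topology euclideanreal g" by (rule lipschitz_continuous_map_skorokhod[OF lip])
  define P :: "nat \<Rightarrow> (real \<Rightarrow> real) \<Rightarrow> real \<Rightarrow> real"
    where "P k x = step_path k (\<lambda>j. if j \<le> k then x (j / k) else 0)" for k x
  have P_eq: "P k x = step_path k (\<lambda>j. x (j / k))" for k x
  proof
    fix t show "P k x t = step_path k (\<lambda>j. x (j / k)) t"
    proof (cases "t \<in> {0..1}")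
      case True
      then have "real k * t \<le> k" by (simp add: mult_left_le)
      then have "nat \<lfloor>real k * t\<rfloor> \<le> k" using floor_mono[of "real k * t" k] by simp
      then show ?thesis by (simp add: P_def step_path_def)
    qed (simp only: P_def step_path_def restrict_apply if_False)
  qed
  have PS: "P k x \<in> skorokhod_space" for k x by (simp add: P_def step_path_in_skorokhod_space)
  have C0: "C \<ge> 0"
  proof -
    have "0 \<le> (\<integral>\<omega>. (X (max n0 1) \<omega> 1 - X (max n0 1) \<omega> 0) ^ 4 \<partial>M (max n0 1))" by simp
    also have "\<dots> \<le> C * (1 - 0)\<^sup>2" using mom[of "max n0 1" 0 1] by (auto simp: divide_le_eq)
    finally show ?thesis by simp
  qed
  have G0: "G \<ge> 0" using G[OF PS[of 0 "\<lambda>_. 0"]] by linarith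
  have PX: "integrable (M n) (\<lambda>\<omega>. g (P k (X n \<omega>)))" "integrable (M n) (\<lambda>\<omega>. g (X n \<omega>))" if n: "n \<ge> 1" for n k
  proof -
    interpret prob_space "M n" by (rule M[OF n])
    have "(\<lambda>\<omega>. P k (X n \<omega>)) \<in> M n \<rightarrow>\<^sub>M borel_of_topology skorokhod_topology"
      unfolding P_def
    proof (rule measurable_step_path)
      show "(\<lambda>\<omega>. if j \<le> k then X n \<omega> (j / k) else 0) \<in> borel_measurable (M n)" for j
        by (cases "j \<le> k") (auto intro!: Xm simp: divide_le_eq)
    qed
    then show "integrable (M n) (\<lambda>\<omega>. g (P k (X n \<omega>)))"
      by (intro integrable_bounded_random_element[OF finite_measure_axioms _ gc]) (use G in auto)
    show "integrable (M n) (\<lambda>\<omega>. g (X n \<omega>))"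
      by (intro integrable_bounded_random_element[OF finite_measure_axioms measurable_skorokhod[OF X Xm] gc]) (use G in auto)
  qed
  have lim1: "(\<lambda>k. \<integral>\<omega>. g (P k (Y \<omega>)) \<partial>N) \<longlonglongrightarrow> (\<integral>\<omega>. g (Y \<omega>) \<partial>N)"
  proof (rule integral_dominated_convergence[where w = "\<lambda>_. G"])
    have "Y \<in> N \<rightarrow>\<^sub>M borel_of_topology skorokhod_topology" by (rule measurable_skorokhod[OF Y Ym])
    then show "(\<lambda>\<omega>. g (Y \<omega>)) \<in> borel_measurable N"
      using continuous_map_borel_measurable[OF gc] by (rule measurable_compose)
    show "(\<lambda>\<omega>. g (P k (Y \<omega>))) \<in> borel_measurable N" for k
    proof (rule measurable_compose[OF _ continuous_map_borel_measurable[OF gc]])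
      show "(\<lambda>\<omega>. P k (Y \<omega>)) \<in> N \<rightarrow>\<^sub>M borel_of_topology skorokhod_topology"
        unfolding P_def
      proof (rule measurable_step_path)
        show "(\<lambda>\<omega>. if j \<le> k then Y \<omega> (j / k) else 0) \<in> borel_measurable N" for j
          by (cases "j \<le> k") (auto intro!: Ym simp: divide_le_eq)
      qed
    qed
    have "(\<lambda>k. g (P k (Y \<omega>))) \<longlonglongrightarrow> g (Y \<omega>)" if \<omega>: "\<omega> \<in> space N" for \<omega>
    proof (rule LIMSEQ_I)
      fix r :: real assume r: "r > 0"
      then have "r / (L + 1) > 0" using L by simp
      from step_path_tendsto_skorokhod[OF Y[OF \<omega>] this] obtain k0
        where k0: "\<And>k. k \<ge> k0 \<Longrightarrow> skorokhod_dist (P k (Y \<omega>)) (Y \<omega>) < r / (L + 1)"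
        unfolding eventually_sequentially P_eq by blast
      have "norm (g (P k (Y \<omega>)) - g (Y \<omega>)) < r" if "k \<ge> k0" for k
      proof -
        have "(L + 1) * skorokhod_dist (P k (Y \<omega>)) (Y \<omega>) < r"
          using k0[OF that] L by (simp add: pos_less_divide_eq mult.commute)
        moreover have "L * skorokhod_dist (P k (Y \<omega>)) (Y \<omega>) \<le> (L + 1) * skorokhod_dist (P k (Y \<omega>)) (Y \<omega>)"
          by (rule mult_right_mono) auto
        ultimately show ?thesis using lip[OF PS Y[OF \<omega>], of k "Y \<omega>"] by simp
      qed
      then show "\<exists>no. \<forall>n\<ge>no. norm (g (P n (Y \<omega>)) - g (Y \<omega>)) < r" by blast
    qed
    then show "AE \<omega> in N. (\<lambda>k. g (P k (Y \<omega>))) \<longlonglongrightarrow> g (Y \<omega>)" by simp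
    show "AE \<omega> in N. norm (g (P k (Y \<omega>))) \<le> G" for k using G[OF PS] by simp
  qed simp
  have lim2: "(\<lambda>n. \<integral>\<omega>. g (P k (X n \<omega>)) \<partial>M n) \<longlonglongrightarrow> (\<integral>\<omega>. g (P k (Y \<omega>)) \<partial>N)" for k
  proof -
    define s where "s j = (if j \<le> k then real j / k else 0)" for j
    have s: "s j \<in> {0..1}" for j by (auto simp: s_def divide_le_eq)
    define V where "V n \<omega> j = X n \<omega> (s j)" for n \<omega> j
    define W where "W \<omega> j = Y \<omega> (s j)" for \<omega> j
    define h where "h a = g (step_path k a)" for a
    have st: "step_path k a = step_path k b" if "\<And>j. j < Suc k \<Longrightarrow> a j = b j" for a b
    proof
      fix t show "step_path k a t = step_path k b t"
      proof (cases "t \<in> {0..1}")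
        case True
        then have "real k * t \<le> k" by (simp add: mult_left_le)
        then have "nat \<lfloor>real k * t\<rfloor> \<le> k" using floor_mono[of "real k * t" k] by simp
        then show ?thesis using that by (simp add: step_path_def)
      qed (simp only: step_path_def restrict_apply if_False)
    qed
    have "(\<lambda>n. \<integral>\<omega>. h (V n \<omega>) \<partial>M n) \<longlonglongrightarrow> (\<integral>\<omega>. h (W \<omega>) \<partial>N)"
    proof (rule fdd_tendsto[OF M N, where V = V and W = W and h = h and k = "Suc k" and K = K and ?n0.0 = n0 and C = G])
      show "continuous_on UNIV h"
        unfolding continuous_on_open_vimage[OF open_UNIV]
      proof (intro allI impI)
        fix B :: "real set" assume "open B"
        then have "openin skorokhod_topology {x \<in> topspace skorokhod_topology. g x \<in> B}"
          using gc by (auto simp: continuous_map_def)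
        from open_vimage_step_path[OF this, of k] show "open (h -` B \<inter> UNIV)"
          by (simp add: h_def vimage_def step_path_in_skorokhod_space)
      qed
      show "h x = h y" if "\<And>j. j < Suc k \<Longrightarrow> x j = y j" for x y
        unfolding h_def using st[OF that] by simp
      show "\<bar>h x\<bar> \<le> G" for x unfolding h_def by (rule G) (rule step_path_in_skorokhod_space)
      show "(\<lambda>n. \<integral>\<omega>. cos ((\<Sum>j<Suc k. c j * V n \<omega> j) + b) \<partial>M n) \<longlonglongrightarrow> (\<integral>\<omega>. cos ((\<Sum>j<Suc k. c j * W \<omega> j) + b) \<partial>N)" for c b
        unfolding V_def W_def by (rule lim[where k = "Suc k" and s = s and c = c and b = b, OF s])
    qed (unfold V_def W_def, (rule Xm[OF s] Ym[OF s] X2[OF _ s] Y2[OF s] | assumption)+)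
    moreover have "h (V n \<omega>) = g (P k (X n \<omega>))" for n \<omega>
      unfolding h_def P_eq by (rule arg_cong[of _ _ g], rule st) (auto simp: V_def s_def)
    moreover have "h (W \<omega>) = g (P k (Y \<omega>))" for \<omega>
      unfolding h_def P_eq by (rule arg_cong[of _ _ g], rule st) (auto simp: W_def s_def)
    ultimately show ?thesis by simp
  qed
  show "(\<lambda>n. \<integral>\<omega>. g (X n \<omega>) \<partial>M n) \<longlonglongrightarrow> (\<integral>\<omega>. g (Y \<omega>) \<partial>N)"
  proof (rule LIMSEQ_I)
    fix r :: real assume r: "r > 0"
    \<comment> \<open>Makes the Lipschitz error \<open>L * (12 * e)\<close> at most r/4;
      \<open>L + 1\<close> avoids a division by 0.\<close>
    define e where "e = r / (48 * (L + 1))"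
    have e: "e > 0" using r L by (simp add: e_def)
    have Le: "L * (12 * e) \<le> r / 4"
    proof -
      have "L * (12 * e) \<le> (L + 1) * (12 * e)" using e by (intro mult_right_mono) auto
      also have "\<dots> = r / 4" using L by (simp add: e_def field_simps)
      finally show ?thesis .
    qed
    have "eventually (\<lambda>k. \<bar>(\<integral>\<omega>. g (P k (Y \<omega>)) \<partial>N) - (\<integral>\<omega>. g (Y \<omega>) \<partial>N)\<bar> < r / 4) sequentially"
      using tendstoD[OF lim1, of "r / 4"] r by (simp add: dist_real_def)
    then obtain k0 where k0: "\<And>k. k \<ge> k0 \<Longrightarrow> \<bar>(\<integral>\<omega>. g (P k (Y \<omega>)) \<partial>N) - (\<integral>\<omega>. g (Y \<omega>) \<partial>N)\<bar> < r / 4"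
      unfolding eventually_sequentially by blast
    \<comment> \<open>One p serves two purposes: 2^p lies beyond \<open>k0\<close>, and the
      exceptional event costs at most r/8.\<close>
    obtain p :: nat where p: "max (real k0) (2 * G * (5 * C / e ^ 4) * (8 / r)) < 2 ^ p"
      using real_arch_pow[of 2 "max (real k0) (2 * G * (5 * C / e ^ 4) * (8 / r))"] by auto
    define k where "k = (2::nat) ^ p"
    have "real k0 < real k" using p by (simp add: k_def)
    then have k: "k \<ge> k0" by simp
    have small: "2 * G * (5 * C / (e ^ 4 * 2 ^ p)) \<le> r / 8"
      using p r e by (simp add: field_simps)
    obtain n1 where n1: "\<And>n. n \<ge> n1 \<Longrightarrow> \<bar>(\<integral>\<omega>. g (P k (X n \<omega>)) \<partial>M n) - (\<integral>\<omega>. g (P k (Y \<omega>)) \<partial>N)\<bar> < r / 4"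
      using LIMSEQ_D[OF lim2[of k], of "r / 4"] r by auto
    obtain n2 :: nat where n2: "(3 / e)\<^sup>2 < n2" using reals_Archimedean2 by blast
    have "norm ((\<integral>\<omega>. g (X n \<omega>) \<partial>M n) - (\<integral>\<omega>. g (Y \<omega>) \<partial>N)) < r"
      if n: "n \<ge> max (max 1 n0) (max (max n1 n2) (2 ^ p))" for n
    proof -
      have n': "n \<ge> 1" "n \<ge> n0" "n \<ge> n1" "n \<ge> n2" "n \<ge> 2 ^ p" using n by auto
      interpret prob_space "M n" by (rule M[OF n'(1)])
      have en: "3 / sqrt n \<le> e"
      proof -
        have "(3 / e)\<^sup>2 \<le> n" using n2 n' by linarith
        then have "3 / e \<le> sqrt n" by (rule real_le_rsqrt)
        then show ?thesis using e n' by (simp add: field_simps)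
      qed
      obtain E where E: "E \<in> sets (M n)" "prob E \<le> 5 * C / (e ^ 4 * 2 ^ p)"
        "\<And>\<omega> t. \<omega> \<in> space (M n) - E \<Longrightarrow> t \<in> {0..1} \<Longrightarrow> \<bar>X n \<omega> t - X n \<omega> (dyadic_floor p t)\<bar> \<le> 12 * e"
        using increment_modulus[of "X n" n C p e, OF Xm mono[OF n'(1)] mom[OF n'(2)] n'(5) en e C0] by blast
      have pt: "\<bar>g (X n \<omega>) - g (P k (X n \<omega>))\<bar> \<le> r / 4 + 2 * G * indicator E \<omega>" if \<omega>: "\<omega> \<in> space (M n)" for \<omega>
      proof (cases "\<omega> \<in> E")
        case True
        then show ?thesis using G[OF X[OF \<omega>]] G[OF PS[of k "X n \<omega>"]] r by simp
      next
        case False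
        have "skorokhod_dist (X n \<omega>) (P k (X n \<omega>)) \<le> 12 * e"
        proof (rule skorokhod_dist_le_sup[OF X[OF \<omega>] PS])
          fix t :: real assume t: "t \<in> {0..1}"
          have "real (nat \<lfloor>2 ^ p * t\<rfloor>) = of_int \<lfloor>2 ^ p * t\<rfloor>" using t by simp
          then have "P k (X n \<omega>) t = X n \<omega> (dyadic_floor p t)"
            using t by (simp add: P_eq step_path_def k_def dyadic_floor_def)
          then show "\<bar>X n \<omega> t - P k (X n \<omega>) t\<bar> \<le> 12 * e" using E(3)[of \<omega> t] False \<omega> t by simp
        qed (use e in simp)
        then have "L * skorokhod_dist (X n \<omega>) (P k (X n \<omega>)) \<le> L * (12 * e)" using L by (rule mult_left_mono)
        with lip[OF X[OF \<omega>] PS, of k "X n \<omega>"] Le False show ?thesis by simp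
      qed
      have "\<bar>(\<integral>\<omega>. g (X n \<omega>) \<partial>M n) - (\<integral>\<omega>. g (P k (X n \<omega>)) \<partial>M n)\<bar> = \<bar>\<integral>\<omega>. g (X n \<omega>) - g (P k (X n \<omega>)) \<partial>M n\<bar>"
        using PX[OF n'(1)] by simp
      also have "\<dots> \<le> (\<integral>\<omega>. \<bar>g (X n \<omega>) - g (P k (X n \<omega>))\<bar> \<partial>M n)" by (rule integral_abs_bound)
      also have "\<dots> \<le> (\<integral>\<omega>. r / 4 + 2 * G * indicator E \<omega> \<partial>M n)"
        using PX[OF n'(1)] E(1) by (intro integral_mono pt) (auto simp: emeasure_eq_measure)
      also have "\<dots> = r / 4 + 2 * G * prob E"
        using E(1) by (subst Bochner_Integration.integral_add) (auto simp: prob_space emeasure_eq_measure)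
      also have "\<dots> \<le> r / 4 + 2 * G * (5 * C / (e ^ 4 * 2 ^ p))"
        using E(2) G0 by (intro add_left_mono mult_left_mono) auto
      finally have "\<bar>(\<integral>\<omega>. g (X n \<omega>) \<partial>M n) - (\<integral>\<omega>. g (P k (X n \<omega>)) \<partial>M n)\<bar> \<le> r / 4 + r / 8"
        using small by linarith
      \<comment> \<open>The errors add up to r/4 + r/8 + r/4 + r/4 < r.\<close>
      with n1[OF n'(3)] k0[OF k] r show ?thesis unfolding real_norm_def by linarith
    qed
    then show "\<exists>no. \<forall>n\<ge>no. norm ((\<integral>\<omega>. g (X n \<omega>) \<partial>M n) - (\<integral>\<omega>. g (Y \<omega>) \<partial>N)) < r" by blast
  qed
qed simp

section \<open>The first column of a Haar matrix\<close>

lemma mat_adjoint_index: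
  fixes A :: "complex mat"
  assumes "A \<in> carrier_mat n n" "i < n" "j < n"
  shows "mat_adjoint A $$ (i, j) = cnj (A $$ (j, i))"
  using assms unfolding mat_adjoint_def by (simp add: mat_of_rows_def)

lemma mat_adjoint_carrier [simp]: "A \<in> carrier_mat n n \<Longrightarrow> mat_adjoint A \<in> carrier_mat n n"
  unfolding mat_adjoint_def by auto

lemma mat_adjoint_dim:
  fixes A :: "complex mat"
  assumes "A \<in> carrier_mat n n"
  shows "dim_row (mat_adjoint A) = n" "dim_col (mat_adjoint A) = n"
  using mat_adjoint_carrier[OF assms] by auto

lemma index_mult_mat_lessThan:
  fixes A :: "'a :: comm_semiring_0 mat"
  assumes "A \<in> carrier_mat n n" "B \<in> carrier_mat n n" "i < n" "j < n"
  shows "(A * B) $$ (i, j) = (\<Sum>l<n. A $$ (i, l) * B $$ (l, j))"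
  using assms by (auto simp: scalar_prod_def lessThan_atLeast0 intro!: sum.cong)

lemma mat_adjoint_mult:
  fixes A B :: "complex mat"
  assumes "A \<in> carrier_mat n n" "B \<in> carrier_mat n n"
  shows "mat_adjoint (A * B) = mat_adjoint B * mat_adjoint A"
proof (rule eq_matI)
  have AB: "A * B \<in> carrier_mat n n" using assms by simp
  have D: "mat_adjoint (A * B) \<in> carrier_mat n n" "mat_adjoint B * mat_adjoint A \<in> carrier_mat n n"
    using assms AB mult_carrier_mat[OF mat_adjoint_carrier mat_adjoint_carrier, OF assms(2,1)] by auto
  then show "dim_row (mat_adjoint (A * B)) = dim_row (mat_adjoint B * mat_adjoint A)"
    "dim_col (mat_adjoint (A * B)) = dim_col (mat_adjoint B * mat_adjoint A)" by auto
  fix i j assume "i < dim_row (mat_adjoint B * mat_adjoint A)" "j < dim_col (mat_adjoint B * mat_adjoint A)"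
  then have ij: "i < n" "j < n" using D by auto
  show "mat_adjoint (A * B) $$ (i, j) = (mat_adjoint B * mat_adjoint A) $$ (i, j)"
    using assms ij unfolding mat_adjoint_index[OF AB ij]
    by (simp add: mat_adjoint_index[of _ n] index_mult_mat_lessThan[of _ n] mult.commute del: index_mult_mat(1))
qed

lemma unitary_group_mult:
  assumes A: "A \<in> unitary_group n" and B: "B \<in> unitary_group n"
  shows "A * B \<in> unitary_group n"
proof -
  have c: "A \<in> carrier_mat n n" "B \<in> carrier_mat n n" "mat_adjoint A \<in> carrier_mat n n" "mat_adjoint B \<in> carrier_mat n n"
    using A B by (auto simp: unitary_group_def)
  have "A * B * (mat_adjoint B * mat_adjoint A) = A * (B * (mat_adjoint B * mat_adjoint A))"
    by (rule assoc_mult_mat[OF c(1,2) mult_carrier_mat[OF c(4,3)]])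
  also have "B * (mat_adjoint B * mat_adjoint A) = B * mat_adjoint B * mat_adjoint A"
    using c(2,4,3) by (rule assoc_mult_mat[symmetric])
  also have "A * (B * mat_adjoint B * mat_adjoint A) = 1\<^sub>m n"
    using A B left_mult_one_mat[OF c(3)] by (simp add: unitary_group_def)
  finally have 1: "A * B * mat_adjoint (A * B) = 1\<^sub>m n" using c by (simp add: mat_adjoint_mult)
  have AB: "A * B \<in> carrier_mat n n" using c by simp
  have "mat_adjoint (A * B) * (A * B) = 1\<^sub>m n"
    by (rule mat_mult_left_right_inverse[OF AB mat_adjoint_carrier[OF AB] 1])
  with 1 AB show ?thesis by (simp add: unitary_group_def)
qed

text \<open>Orthonormal rows suffice, because a one-sided inverse of a square matrix is
  two-sided.\<close>

lemma unitary_groupI: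
  assumes A: "A \<in> carrier_mat n n"
    and on: "\<And>i k. i < n \<Longrightarrow> k < n \<Longrightarrow> (\<Sum>j<n. A $$ (i, j) * cnj (A $$ (k, j))) = (if i = k then 1 else 0)"
  shows "A \<in> unitary_group n"
proof -
  have 1: "A * mat_adjoint A = 1\<^sub>m n"
  proof (rule eq_matI)
    fix i j assume "i < dim_row (1\<^sub>m n)" "j < dim_col (1\<^sub>m n)"
    then show "(A * mat_adjoint A) $$ (i, j) = 1\<^sub>m n $$ (i, j)"
      using A on by (simp add: index_mult_mat_lessThan[of _ n] mat_adjoint_index[OF A] del: index_mult_mat(1))
  qed (use A mat_adjoint_dim[OF A] in auto)
  then show ?thesis
    using A mat_mult_left_right_inverse[OF A mat_adjoint_carrier[OF A] 1] by (simp add: unitary_group_def)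
qed

text \<open>For real entries the adjoint is the transpose. Viewing orthogonal matrices as unitary
  ones with real entries lets both cases share one argument.\<close>

lemma orthogonal_group_eq:
  "orthogonal_group n = {A \<in> unitary_group n. \<forall>i<n. \<forall>j<n. A $$ (i, j) \<in> \<real>}"
proof -
  have "mat_adjoint A = transpose_mat A"
    if "A \<in> carrier_mat n n" "\<forall>i<n. \<forall>j<n. A $$ (i, j) \<in> \<real>" for A :: "complex mat"
  proof (rule eq_matI)
    fix i j assume "i < dim_row (transpose_mat A)" "j < dim_col (transpose_mat A)"
    then show "mat_adjoint A $$ (i, j) = transpose_mat A $$ (i, j)"
      using that by (simp add: mat_adjoint_index[OF that(1)] Reals_cnj_iff)
  qed (use that mat_adjoint_dim[OF that(1)] in auto)
  then show ?thesis by (auto simp: orthogonal_group_def unitary_group_def)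
qed

lemma unitary_column_norm:
  assumes "A \<in> unitary_group n" "0 < n"
  shows "(\<Sum>i<n. (cmod (A $$ (i, 0)))\<^sup>2) = 1"
proof -
  have A: "A \<in> carrier_mat n n" and eq: "mat_adjoint A * A = 1\<^sub>m n" using assms by (auto simp: unitary_group_def)
  have "(\<Sum>i<n. cnj (A $$ (i, 0)) * A $$ (i, 0)) = (mat_adjoint A * A) $$ (0, 0)"
    using assms A by (simp add: index_mult_mat_lessThan[of _ n] mat_adjoint_index[OF A] del: index_mult_mat(1))
  also have "\<dots> = 1" using assms unfolding eq by simp
  finally have "of_real (\<Sum>i<n. (cmod (A $$ (i, 0)))\<^sup>2) = (1 :: complex)"
    unfolding of_real_sum complex_norm_square by (simp add: mult.commute)
  then show ?thesis using of_real_eq_1_iff by blast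
qed

text \<open>One family for both cases: \<open>F = UNIV\<close> for the unitary group,
  \<open>F = \<real>\<close> for the orthogonal group.\<close>

definition entry_group :: "nat \<Rightarrow> complex set \<Rightarrow> complex mat set" where
  "entry_group n F = {A \<in> unitary_group n. \<forall>i<n. \<forall>j<n. A $$ (i, j) \<in> F}"

lemma entry_group_mult:
  assumes F: "F = UNIV \<or> F = \<real>" and A: "A \<in> entry_group n F" and B: "B \<in> entry_group n F"
  shows "A * B \<in> entry_group n F"
proof -
  have c: "A \<in> carrier_mat n n" "B \<in> carrier_mat n n" using A B by (auto simp: entry_group_def unitary_group_def)
  have "(A * B) $$ (i, j) \<in> F" if "i < n" "j < n" for i j
    using F
  proof
    assume "F = \<real>"
    then show ?thesis using A B that
      by (auto simp: index_mult_mat_lessThan[OF c that] entry_group_def simp del: index_mult_mat(1) intro!: sum_in_Reals Reals_mult)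
  qed simp
  then show ?thesis using unitary_group_mult A B by (simp add: entry_group_def)
qed

section \<open>Permutations and plane rotations\<close>

text \<open>Row i selects coordinate \<open>\<pi> i\<close>, so a column v becomes
  \<open>v \<circ> \<pi>\<close>.\<close>

definition perm_mat :: "nat \<Rightarrow> (nat \<Rightarrow> nat) \<Rightarrow> complex mat" where
  "perm_mat n \<pi> = mat n n (\<lambda>(i, j). if j = \<pi> i then 1 else 0)"

lemma perm_mat_in_entry_group:
  assumes \<pi>: "\<pi> permutes {..<n}" and F: "F = UNIV \<or> F = \<real>"
  shows "perm_mat n \<pi> \<in> entry_group n F"
proof -
  have "(\<Sum>j<n. (if j = \<pi> i then 1 else 0) * cnj (if j = \<pi> k then 1 else 0)) = (if i = k then 1 else (0::complex))"
    if "i < n" "k < n" for i k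
  proof -
    have "(\<Sum>j<n. (if j = \<pi> i then 1 else 0) * cnj (if j = \<pi> k then 1 else 0)) =
      (\<Sum>j<n. if j = \<pi> i then (if \<pi> i = \<pi> k then 1 else (0::complex)) else 0)"
      by (rule sum.cong) auto
    also have "\<dots> = (if \<pi> i = \<pi> k then 1 else 0)" using permutes_in_image[OF \<pi>, of i] that by simp
    also have "\<dots> = (if i = k then 1 else 0)" using permutes_inj[OF \<pi>] by (auto dest: injD)
    finally show ?thesis .
  qed
  then have "perm_mat n \<pi> \<in> unitary_group n"
    by (intro unitary_groupI) (simp_all add: perm_mat_def)
  then show ?thesis using F by (auto simp: entry_group_def perm_mat_def)
qed

text \<open>A rotation by 45 degrees with phase p in the plane of the coordinates i and k: v_i
  becomes (v_i + p v_k) / sqrt 2, and v_k becomes (v_k - cnj p v_i) / sqrt 2. Equal weights on both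
  coordinates and a free phase are what the averaging identities below require.\<close>

definition plane_rotation :: "nat \<Rightarrow> nat \<Rightarrow> nat \<Rightarrow> complex \<Rightarrow> complex mat" where
  "plane_rotation n i k p = mat n n (\<lambda>(l, j).
     if l = i then (if j = i then 1 / complex_of_real (sqrt 2) else if j = k then p / complex_of_real (sqrt 2) else 0)
     else if l = k then (if j = i then - cnj p / complex_of_real (sqrt 2) else if j = k then 1 / complex_of_real (sqrt 2) else 0)
     else if j = l then 1 else 0)"

lemma sum_split2:
  fixes f :: "nat \<Rightarrow> 'a :: comm_monoid_add"
  assumes "i < n" "k < n" "i \<noteq> k"
  shows "(\<Sum>j<n. f j) = f i + (f k + (\<Sum>j\<in>{..<n} - {i} - {k}. f j))"
proof -
  have "(\<Sum>j<n. f j) = f i + (\<Sum>j\<in>{..<n} - {i}. f j)" using assms by (intro sum.remove) auto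
  also have "(\<Sum>j\<in>{..<n} - {i}. f j) = f k + (\<Sum>j\<in>{..<n} - {i} - {k}. f j)" using assms by (intro sum.remove) auto
  finally show ?thesis .
qed

lemma plane_rotation_in_entry_group:
  assumes ik: "i < n" "k < n" "i \<noteq> k" and p: "cmod p = 1" "p \<in> F" and F: "F = UNIV \<or> F = \<real>"
  shows "plane_rotation n i k p \<in> entry_group n F"
proof -
  let ?H = "plane_rotation n i k p"
  have s2: "complex_of_real (sqrt 2) * complex_of_real (sqrt 2) = 2"
    by (metis of_real_mult of_real_numeral real_sqrt_mult_self abs_numeral)
  have pp: "p * cnj p = 1" "cnj p * p = 1" using p by (simp_all add: complex_norm_square[symmetric] mult.commute[of "cnj p"])
  have H: "?H $$ (l, j) = (if l = i then (if j = i then 1 / complex_of_real (sqrt 2) else if j = k then p / complex_of_real (sqrt 2) else 0)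
     else if l = k then (if j = i then - cnj p / complex_of_real (sqrt 2) else if j = k then 1 / complex_of_real (sqrt 2) else 0)
     else if j = l then 1 else 0)" if "l < n" "j < n" for l j
    using that by (simp add: plane_rotation_def)
  have "(\<Sum>j<n. ?H $$ (l, j) * cnj (?H $$ (m, j))) = (if l = m then 1 else 0)" if lm: "l < n" "m < n" for l m
  proof -
    define t where "t = 1 / complex_of_real (sqrt 2)"
    have t: "t * t = 1 / 2" "cnj t = t" by (simp_all add: t_def s2)
    have Hi: "?H $$ (l, i) = (if l = i then t else if l = k then - cnj p * t else 0)" if "l < n" for l
      using that ik by (simp add: plane_rotation_def t_def)
    have Hk: "?H $$ (l, k) = (if l = i then p * t else if l = k then t else 0)" if "l < n" for l
      using that ik by (simp add: plane_rotation_def t_def)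
    have Hj: "?H $$ (l, j) = (if j = l then 1 else 0)" if "l < n" "j < n" "j \<noteq> i" "j \<noteq> k" for l j
      using that by (simp add: plane_rotation_def)
    have "(\<Sum>j\<in>{..<n} - {i} - {k}. ?H $$ (l, j) * cnj (?H $$ (m, j))) =
      (\<Sum>j\<in>{..<n} - {i} - {k}. if j = l then (if l = m then 1 else 0) else 0)"
      using lm by (intro sum.cong) (auto simp: Hj)
    also have "\<dots> = (if l = m \<and> l \<noteq> i \<and> l \<noteq> k then 1 else 0)" using lm by simp
    finally have rest: "(\<Sum>j\<in>{..<n} - {i} - {k}. ?H $$ (l, j) * cnj (?H $$ (m, j))) =
      (if l = m \<and> l \<noteq> i \<and> l \<noteq> k then 1 else 0)" .
    have "t * cnj t + p * t * cnj (p * t) = t * t * (1 + p * cnj p)"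
      "- cnj p * t * cnj (- cnj p * t) + t * cnj t = t * t * (1 + p * cnj p)"
      by (simp_all add: t(2) algebra_simps)
    then have f: "t * cnj t + p * t * cnj (p * t) = 1" "- cnj p * t * cnj (- cnj p * t) + t * cnj t = 1"
      unfolding t(1) pp by simp_all
    have g: "t * cnj (- cnj p * t) + p * t * cnj t = 0" "- cnj p * t * cnj t + t * cnj (p * t) = 0"
      by (simp_all add: t(2))
    note eqs = sum_split2[OF ik] rest Hi[OF lm(1)] Hi[OF lm(2)] Hk[OF lm(1)] Hk[OF lm(2)]
    consider "l = i" "m = i" | "l = i" "m = k" | "l = k" "m = i" | "l = k" "m = k"
      | "l \<noteq> i" "l \<noteq> k" | "m \<noteq> i" "m \<noteq> k" by blast
    then show ?thesis
    proof cases
      case 1 then show ?thesis unfolding eqs using f(1) by (simp only: if_True simp_thms if_False add_0_right)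
    next
      case 2 then show ?thesis unfolding eqs using g(1) ik(3) by (simp only: if_True simp_thms if_False not_sym add_0_right)
    next
      case 3 then show ?thesis unfolding eqs using g(2) ik(3) by (simp only: if_True simp_thms if_False not_sym add_0_right)
    next
      case 4 then show ?thesis unfolding eqs using f(2) ik(3) by (simp only: if_True simp_thms if_False not_sym add_0_right)
    next
      case 5 then show ?thesis unfolding eqs by (simp only: if_False mult_zero_left add_0_left simp_thms not_False_eq_True)
    next
      case 6
      then have "(l = m \<and> l \<noteq> i \<and> l \<noteq> k) \<longleftrightarrow> l = m" by blast
      with 6 show ?thesis unfolding eqs by (simp only: if_False complex_cnj_zero mult_zero_right add_0_left)
    qed
  qed
  moreover have "?H \<in> carrier_mat n n" by (simp add: plane_rotation_def)
  ultimately have "?H \<in> unitary_group n" by (intro unitary_groupI)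
  moreover have "?H $$ (l, j) \<in> F" if "l < n" "j < n" for l j
    using F
  proof
    assume "F = \<real>"
    with p have "cnj p = p" by (simp add: Reals_cnj_iff)
    then show ?thesis using p \<open>F = \<real>\<close> unfolding H[OF that] by (auto intro!: Reals_divide)
  qed simp
  ultimately show ?thesis by (simp add: entry_group_def)
qed

section \<open>The law of the first column\<close>

lemma measurable_entry:
  assumes "U \<in> M \<rightarrow>\<^sub>M restrict_space (mat_borel n) G" "i < n" "j < n"
  shows "(\<lambda>\<omega>. U \<omega> $$ (i, j)) \<in> borel_measurable M"
proof -
  have "U \<in> M \<rightarrow>\<^sub>M mat_borel n" using assms(1) by (simp add: measurable_restrict_space2_iff)
  moreover have "(\<lambda>A. \<lambda>(i, j)\<in>{..<n} \<times> {..<n}. A $$ (i, j)) \<in> mat_borel n \<rightarrow>\<^sub>M (\<Pi>\<^sub>M _\<in>{..<n} \<times> {..<n}. borel :: complex measure)"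
    unfolding mat_borel_def by (rule measurable_vimage_algebra1) (auto simp: space_PiM)
  ultimately have "(\<lambda>\<omega>. \<lambda>(i, j)\<in>{..<n} \<times> {..<n}. U \<omega> $$ (i, j)) \<in> M \<rightarrow>\<^sub>M (\<Pi>\<^sub>M _\<in>{..<n} \<times> {..<n}. borel)"
    by (rule measurable_compose)
  from measurable_compose[OF this measurable_component_singleton[of "(i, j)"]] assms show ?thesis by simp
qed

lemma measurable_matI:
  assumes "\<And>\<omega>. \<omega> \<in> space M \<Longrightarrow> U \<omega> \<in> G" "G \<subseteq> carrier_mat n n"
    and e: "\<And>i j. i < n \<Longrightarrow> j < n \<Longrightarrow> (\<lambda>\<omega>. U \<omega> $$ (i, j)) \<in> borel_measurable M"
  shows "U \<in> M \<rightarrow>\<^sub>M restrict_space (mat_borel n) G"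
proof (rule measurable_restrict_space2)
  show "U \<in> M \<rightarrow>\<^sub>M mat_borel n" unfolding mat_borel_def
  proof (rule measurable_vimage_algebra2)
    show "(\<lambda>\<omega>. \<lambda>(i, j)\<in>{..<n} \<times> {..<n}. U \<omega> $$ (i, j)) \<in> M \<rightarrow>\<^sub>M (\<Pi>\<^sub>M _\<in>{..<n} \<times> {..<n}. borel :: complex measure)"
      by (rule measurable_restrict) (auto intro: e)
  qed (use assms in auto)
qed (use assms in auto)

text \<open>Extended by 0 to all indices, so that columns of every size live in the one type
  \<open>nat \<Rightarrow> complex\<close> with its product Borel structure.\<close>

definition first_column :: "nat \<Rightarrow> complex mat \<Rightarrow> nat \<Rightarrow> complex" where
  "first_column n A i = (if i < n then A $$ (i, 0) else 0)"

lemma measurable_first_column: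
  assumes n: "n \<ge> 1"
  shows "first_column n \<in> borel_measurable (restrict_space (mat_borel n) G)"
proof (rule measurable_coordinatewise_then_product)
  fix i show "(\<lambda>A. first_column n A i) \<in> borel_measurable (restrict_space (mat_borel n) G)"
  proof (cases "i < n")
    case True
    have "(\<lambda>A. (\<lambda>x. x) A $$ (i, 0)) \<in> borel_measurable (restrict_space (mat_borel n) G)"
      by (rule measurable_entry[OF measurable_ident_sets[OF refl] True]) (use n in simp)
    with True show ?thesis by (simp add: first_column_def)
  qed (simp add: first_column_def)
qed

text \<open>The first column of \<open>B * U\<close> is \<open>B\<close> applied to the first column
  of \<open>U\<close>, so invariance of the law of the matrix restricts to the column.\<close>

lemma haar_first_column_invariant:
  fixes f :: "(nat \<Rightarrow> complex) \<Rightarrow> real"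
  assumes F: "F = UNIV \<or> F = \<real>" and U: "haar_distributed M n (entry_group n F) U" and n: "n \<ge> 1"
    and B: "B \<in> entry_group n F" and f: "f \<in> borel_measurable borel"
  shows "(\<integral>\<omega>. f (\<lambda>i. if i < n then \<Sum>j<n. B $$ (i, j) * first_column n (U \<omega>) j else 0) \<partial>M) =
    (\<integral>\<omega>. f (first_column n (U \<omega>)) \<partial>M)"
proof -
  let ?S = "restrict_space (mat_borel n) (entry_group n F)"
  have Gc: "entry_group n F \<subseteq> carrier_mat n n" by (auto simp: entry_group_def unitary_group_def)
  have Um: "U \<in> M \<rightarrow>\<^sub>M ?S" and eq: "distr M ?S (\<lambda>\<omega>. B * U \<omega>) = distr M ?S U"
    using U B by (auto simp: haar_distributed_def)
  have UG: "U \<omega> \<in> entry_group n F" if "\<omega> \<in> space M" for \<omega>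
    using Um that by (auto simp: measurable_restrict_space2_iff)
  have ent: "(B * U \<omega>) $$ (i, j) = (\<Sum>l<n. B $$ (i, l) * U \<omega> $$ (l, j))" if "\<omega> \<in> space M" "i < n" "j < n" for \<omega> i j
    using UG[OF that(1)] B Gc that by (intro index_mult_mat_lessThan) auto
  have BUm: "(\<lambda>\<omega>. B * U \<omega>) \<in> M \<rightarrow>\<^sub>M ?S"
  proof (rule measurable_matI[OF _ Gc])
    fix i j assume ij: "i < n" "j < n"
    have "(\<lambda>\<omega>. \<Sum>l<n. B $$ (i, l) * U \<omega> $$ (l, j)) \<in> borel_measurable M"
      using ij by (intro borel_measurable_sum borel_measurable_times borel_measurable_const measurable_entry[OF Um]) auto
    then show "(\<lambda>\<omega>. (B * U \<omega>) $$ (i, j)) \<in> borel_measurable M"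
      by (rule measurable_cong[THEN iffD1, rotated]) (use ent ij in simp)
  qed (use entry_group_mult[OF F B UG] in auto)
  have col: "first_column n \<in> borel_measurable ?S" by (rule measurable_first_column[OF n])
  have fm: "(\<lambda>A. f (first_column n A)) \<in> borel_measurable ?S" by (rule measurable_compose[OF col f])
  have "(\<integral>\<omega>. f (first_column n (B * U \<omega>)) \<partial>M) = (\<integral>A. f (first_column n A) \<partial>distr M ?S (\<lambda>\<omega>. B * U \<omega>))"
    by (rule integral_distr[OF BUm fm, symmetric])
  also have "\<dots> = (\<integral>\<omega>. f (first_column n (U \<omega>)) \<partial>M)"
    unfolding eq by (rule integral_distr[OF Um fm])
  finally have "(\<integral>\<omega>. f (first_column n (B * U \<omega>)) \<partial>M) = (\<integral>\<omega>. f (first_column n (U \<omega>)) \<partial>M)" .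
  moreover have "(\<integral>\<omega>. f (first_column n (B * U \<omega>)) \<partial>M) =
      (\<integral>\<omega>. f (\<lambda>i. if i < n then \<Sum>j<n. B $$ (i, j) * first_column n (U \<omega>) j else 0) \<partial>M)"
  proof (rule Bochner_Integration.integral_cong[OF refl])
    fix \<omega> assume \<omega>: "\<omega> \<in> space M"
    have "first_column n (B * U \<omega>) = (\<lambda>i. if i < n then \<Sum>j<n. B $$ (i, j) * first_column n (U \<omega>) j else 0)"
    proof
      fix i show "first_column n (B * U \<omega>) i = (if i < n then \<Sum>j<n. B $$ (i, j) * first_column n (U \<omega>) j else 0)"
        using ent[OF \<omega>, of i 0] n by (simp add: first_column_def)
    qed
    then show "f (first_column n (B * U \<omega>)) = f (\<lambda>i. if i < n then \<Sum>j<n. B $$ (i, j) * first_column n (U \<omega>) j else 0)"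
      by simp
  qed
  ultimately show ?thesis by simp
qed

section \<open>Moments of the squared moduli\<close>

text \<open>What later arguments use about the Haar measure. \<open>contract\<close> is the rotation
  identity, with a factor \<open>g\<close> that does not see the coordinates i and k; \<kappa> is 2
  in the unitary and 3 in the orthogonal case. \<open>eighth\<close> concerns fourth moments of the
  weights, hence eighth moments of the matrix entries, and is only an inequality with a generous
  constant.\<close>

locale haar_weights = prob_space M for M :: "'a measure" +
  fixes n :: nat and \<kappa> :: real and A :: "'a \<Rightarrow> nat \<Rightarrow> real"
  assumes kappa: "1 \<le> \<kappa>"
    and A_meas [measurable]: "(\<lambda>\<omega>. A \<omega> i) \<in> borel_measurable M"
    and A_nonneg: "0 \<le> A \<omega> i"
    and A_out: "n \<le> i \<Longrightarrow> A \<omega> i = 0"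
    and A_sum: "\<omega> \<in> space M \<Longrightarrow> (\<Sum>i<n. A \<omega> i) = 1"
    and exch: "\<And>\<pi> f. \<pi> permutes {..<n} \<Longrightarrow> f \<in> borel_measurable borel \<Longrightarrow>
      (\<integral>\<omega>. f (\<lambda>i. A \<omega> (\<pi> i)) \<partial>M) = ((\<integral>\<omega>. f (A \<omega>) \<partial>M) :: real)"
    and contract: "\<And>i k g C. i < n \<Longrightarrow> k < n \<Longrightarrow> i \<noteq> k \<Longrightarrow> g \<in> borel_measurable borel \<Longrightarrow>
      (\<And>a x y. g (a(i := x, k := y)) = g a) \<Longrightarrow> (\<And>\<omega>. \<bar>g (A \<omega>)\<bar> \<le> C) \<Longrightarrow>
      (\<integral>\<omega>. (A \<omega> i)\<^sup>2 * g (A \<omega>) \<partial>M) = \<kappa> * ((\<integral>\<omega>. A \<omega> i * A \<omega> k * g (A \<omega>) \<partial>M) :: real)"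
    and eighth: "2 \<le> n \<Longrightarrow> (\<integral>\<omega>. (A \<omega> 0) ^ 4 \<partial>M) \<le> 28 * (\<integral>\<omega>. (A \<omega> 0)\<^sup>2 * (A \<omega> 1)\<^sup>2 \<partial>M)"

lemma plane_rotation_first_column:
  assumes ik: "i < n" "k < n" "i \<noteq> k"
  shows "(\<lambda>l. if l < n then \<Sum>j<n. plane_rotation n i k p $$ (l, j) * first_column n u j else 0) =
    (first_column n u)(i := (first_column n u i + p * first_column n u k) / sqrt 2,
      k := (first_column n u k - cnj p * first_column n u i) / sqrt 2)"
proof
  fix l
  let ?v = "first_column n u"
  show "(if l < n then \<Sum>j<n. plane_rotation n i k p $$ (l, j) * ?v j else 0) =
    (?v(i := (?v i + p * ?v k) / sqrt 2, k := (?v k - cnj p * ?v i) / sqrt 2)) l"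
  proof (cases "l < n")
    case True
    have "(\<Sum>j\<in>{..<n} - {i} - {k}. plane_rotation n i k p $$ (l, j) * ?v j) =
        (\<Sum>j\<in>{..<n} - {i} - {k}. if j = l then ?v l else 0)"
      using True by (intro sum.cong) (auto simp: plane_rotation_def)
    also have "\<dots> = (if l \<noteq> i \<and> l \<noteq> k then ?v l else 0)" using True by simp
    finally have rest: "(\<Sum>j\<in>{..<n} - {i} - {k}. plane_rotation n i k p $$ (l, j) * ?v j) =
        (if l \<noteq> i \<and> l \<noteq> k then ?v l else 0)" .
    have Hi: "plane_rotation n i k p $$ (l, i) = (if l = i then 1 / complex_of_real (sqrt 2) else if l = k then - cnj p / complex_of_real (sqrt 2) else 0)"
      and Hk: "plane_rotation n i k p $$ (l, k) = (if l = i then p / complex_of_real (sqrt 2) else if l = k then 1 / complex_of_real (sqrt 2) else 0)"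
      using True ik by (simp_all add: plane_rotation_def)
    show ?thesis using True ik unfolding sum_split2[OF ik] rest Hi Hk
      by (auto simp: add_divide_distrib diff_divide_distrib)
  next
    case False
    then show ?thesis using ik by (auto simp: first_column_def)
  qed
qed

section \<open>Averages over phases and signs\<close>

text \<open>Averaging over the fourth roots of unity removes every term that is not balanced in the
  phase of b. With x = E A_i^2 g and y = E A_i A_k g, the mixed coefficient 4 leads to 4x = 2x + 4y,
  hence to \<kappa> = 2.\<close>

lemma phase_average_4:
  fixes a b :: complex
  shows "cmod (a + b) ^ 4 + cmod (a - b) ^ 4 + cmod (a + \<i> * b) ^ 4 + cmod (a - \<i> * b) ^ 4 =
    4 * (cmod a ^ 4 + cmod b ^ 4 + 4 * ((cmod a)\<^sup>2 * (cmod b)\<^sup>2))"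
proof -
  have 4: "x ^ 4 = (x\<^sup>2)\<^sup>2" for x :: real by simp
  show ?thesis unfolding 4 cmod_power2 by (simp add: power2_eq_square algebra_simps)
qed

text \<open>Real phases are only signs. The mixed coefficient is 6 instead of 4, which leads to 4x =
  2x + 6y and \<kappa> = 3.\<close>

lemma sign_average_4:
  fixes a b :: complex
  assumes "a \<in> \<real>" "b \<in> \<real>"
  shows "cmod (a + b) ^ 4 + cmod (a - b) ^ 4 = 2 * (cmod a ^ 4 + cmod b ^ 4 + 6 * ((cmod a)\<^sup>2 * (cmod b)\<^sup>2))"
proof -
  have 4: "x ^ 4 = (x\<^sup>2)\<^sup>2" for x :: real by simp
  show ?thesis using assms unfolding 4 cmod_power2 by (simp add: complex_is_Real_iff power2_eq_square algebra_simps)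
qed

text \<open>With T = 2 Re(a cnj b) the average is (A + B)^4 + 6 (A + B)^2 T^2 + T^4, and T^2 \<le> 4
  A B by Cauchy-Schwarz. Signs alone are enough for both groups. The coefficient of the pure powers
  must stay below 8 to be absorbed later, so A^3 B is split unevenly: 28 A^3 B \<le> 14 (A^4 / 8 + 8
  A^2 B^2), and likewise for A B^3. This gives 1 + 14/8 = 11/4 and 70 + 224 = 294.\<close>

lemma sign_average_8:
  fixes a b :: complex
  defines "A \<equiv> (cmod a)\<^sup>2" and "B \<equiv> (cmod b)\<^sup>2"
  shows "(cmod (a + b) ^ 8 + cmod (a - b) ^ 8) / 2 \<le> 11 / 4 * (A ^ 4 + B ^ 4) + 294 * (A\<^sup>2 * B\<^sup>2)"
proof -
  define T where "T = 2 * (Re a * Re b + Im a * Im b)"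
  have AB0: "A \<ge> 0" "B \<ge> 0" by (simp_all add: A_def B_def)
  have p: "(cmod (a + b))\<^sup>2 = A + B + T" "(cmod (a - b))\<^sup>2 = A + B - T"
    unfolding A_def B_def T_def cmod_power2 by (simp_all add: power2_eq_square algebra_simps)
  have "4 * (A * B) - T\<^sup>2 = 4 * (Re a * Im b - Im a * Re b)\<^sup>2"
    unfolding A_def B_def T_def cmod_power2 by (simp add: power2_eq_square algebra_simps)
  then have T: "T\<^sup>2 \<le> 4 * (A * B)" using zero_le_power2[of "Re a * Im b - Im a * Re b"] by linarith
  have T4: "T ^ 4 \<le> 16 * (A\<^sup>2 * B\<^sup>2)"
  proof -
    have "(T\<^sup>2)\<^sup>2 \<le> (4 * (A * B))\<^sup>2" by (rule power_mono[OF T]) simp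
    then show ?thesis by (simp add: power_mult_distrib flip: power_mult)
  qed
  have 8: "x ^ 8 = (x\<^sup>2) ^ 4" for x :: real by simp
  have "(cmod (a + b) ^ 8 + cmod (a - b) ^ 8) / 2 = (A + B) ^ 4 + 6 * ((A + B)\<^sup>2 * T\<^sup>2) + T ^ 4"
    unfolding 8 p by (simp add: power_numeral_reduce algebra_simps)
  also have "\<dots> \<le> (A + B) ^ 4 + 6 * ((A + B)\<^sup>2 * (4 * (A * B))) + 16 * (A\<^sup>2 * B\<^sup>2)"
    using T T4 by (intro add_mono mult_left_mono) auto
  also have "\<dots> = A ^ 4 + B ^ 4 + 28 * (A\<^sup>2 * (A * B) + B\<^sup>2 * (A * B)) + 70 * (A\<^sup>2 * B\<^sup>2)"
    by (simp add: power_numeral_reduce algebra_simps)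
  also have "\<dots> \<le> 11 / 4 * (A ^ 4 + B ^ 4) + 294 * (A\<^sup>2 * B\<^sup>2)"
  proof -
    have "2 * (A\<^sup>2 * (A * B)) \<le> A ^ 4 / 8 + 8 * (A\<^sup>2 * B\<^sup>2)"
      using zero_le_power2[of "A\<^sup>2 - 8 * (A * B)"] by (simp add: power_numeral_reduce algebra_simps)
    moreover have "2 * (B\<^sup>2 * (A * B)) \<le> B ^ 4 / 8 + 8 * (A\<^sup>2 * B\<^sup>2)"
      using zero_le_power2[of "B\<^sup>2 - 8 * (A * B)"] by (simp add: power_numeral_reduce algebra_simps)
    moreover have "z + w + 28 * (x + y) + 70 * q \<le> 11 / 4 * (z + w) + 294 * q"
      if "2 * x \<le> z / 8 + 8 * q" "2 * y \<le> w / 8 + 8 * q" for x y z w q :: real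
      using that by (simp add: field_simps)
    ultimately show ?thesis by blast
  qed
  finally show ?thesis .
qed

lemma borel_measurable_modulus_squares: "(\<lambda>v i. (cmod (v i))\<^sup>2) \<in> borel_measurable (borel :: (nat \<Rightarrow> complex) measure)"
  by (intro measurable_coordinatewise_then_product borel_measurable_continuous_onI continuous_intros continuous_on_product_coordinates)

lemma haar_weights_entry_group:
  assumes F: "F = UNIV \<and> \<kappa> = 2 \<or> F = \<real> \<and> \<kappa> = 3"
    and U: "haar_distributed M n (entry_group n F) U" and n: "n \<ge> 1"
  shows "haar_weights M n \<kappa> (\<lambda>\<omega> i. if \<omega> \<in> space M then (cmod (first_column n (U \<omega>) i))\<^sup>2 else if i = 0 then 1 else 0)"
proof -
  have F': "F = UNIV \<or> F = \<real>" using F by blast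
  interpret prob_space M using U by (simp add: haar_distributed_def)
  \<comment> \<open>Nothing is known about \<open>U\<close> outside \<open>space M\<close>; the
    first unit vector there makes the weights lie in [0, 1] and add up to 1 at every point.\<close>
  define v where "v \<omega> = (if \<omega> \<in> space M then first_column n (U \<omega>) else (\<lambda>i. if i = 0 then 1 else 0))" for \<omega>
  define A where "A \<omega> i = (cmod (v \<omega> i))\<^sup>2" for \<omega> i
  have A_eq: "(\<lambda>\<omega> i. if \<omega> \<in> space M then (cmod (first_column n (U \<omega>) i))\<^sup>2 else if i = 0 then 1 else 0) = A"
    by (auto simp: A_def v_def fun_eq_iff)
  have Um: "U \<in> M \<rightarrow>\<^sub>M restrict_space (mat_borel n) (entry_group n F)"
    using U by (simp add: haar_distributed_def)
  have UG: "U \<omega> \<in> entry_group n F" if "\<omega> \<in> space M" for \<omega>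
    using Um that by (auto simp: measurable_restrict_space2_iff)
  have vm [measurable]: "(\<lambda>\<omega>. v \<omega> i) \<in> borel_measurable M" for i
  proof -
    have "(\<lambda>\<omega>. first_column n (U \<omega>) i) \<in> borel_measurable M"
      using measurable_entry[OF Um, of i 0] n by (cases "i < n") (simp_all add: first_column_def)
    then show ?thesis by (rule measurable_cong[THEN iffD1, rotated]) (simp add: v_def)
  qed
  have vm': "v \<in> borel_measurable M" by (rule measurable_coordinatewise_then_product[OF vm])
  have Am [measurable]: "(\<lambda>\<omega>. A \<omega> i) \<in> borel_measurable M" for i unfolding A_def using vm[of i] by measurable
  have Am': "A \<in> borel_measurable M" using measurable_coordinatewise_then_product[OF Am] .
  have A0: "0 \<le> A \<omega> i" for \<omega> i by (simp add: A_def)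
  have Asum: "(\<Sum>i<n. A \<omega> i) = 1" for \<omega>
  proof (cases "\<omega> \<in> space M")
    case True
    with UG have "U \<omega> \<in> unitary_group n" by (simp add: entry_group_def)
    from unitary_column_norm[OF this] n True show ?thesis by (simp add: A_def v_def first_column_def)
  next
    case False
    then have "A \<omega> i = (if i = 0 then 1 else 0)" for i by (simp add: A_def v_def)
    with n show ?thesis by simp
  qed
  have Aout: "A \<omega> i = 0" if "n \<le> i" for \<omega> i
    using that n by (auto simp: A_def v_def first_column_def)
  have A1: "A \<omega> i \<le> 1" for \<omega> i
  proof (cases "i < n")
    case True
    then have "A \<omega> i \<le> (\<Sum>i<n. A \<omega> i)" by (intro member_le_sum A0) auto
    with Asum show ?thesis by simp
  qed (use Aout in simp)
  have inv: "(\<integral>\<omega>. f (\<lambda>i. if i < n then \<Sum>j<n. B $$ (i, j) * v \<omega> j else 0) \<partial>M) = (\<integral>\<omega>. f (v \<omega>) \<partial>M)"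
    if "B \<in> entry_group n F" "f \<in> borel_measurable borel" for B and f :: "(nat \<Rightarrow> complex) \<Rightarrow> real"
  proof -
    have v: "v \<omega> = first_column n (U \<omega>)" if "\<omega> \<in> space M" for \<omega> using that by (simp add: v_def)
    have "(\<integral>\<omega>. f (\<lambda>i. if i < n then \<Sum>j<n. B $$ (i, j) * v \<omega> j else 0) \<partial>M) =
        (\<integral>\<omega>. f (\<lambda>i. if i < n then \<Sum>j<n. B $$ (i, j) * first_column n (U \<omega>) j else 0) \<partial>M)"
      by (rule Bochner_Integration.integral_cong[OF refl]) (simp only: v)
    also have "\<dots> = (\<integral>\<omega>. f (first_column n (U \<omega>)) \<partial>M)"
      by (rule haar_first_column_invariant[OF F' U n that])
    also have "\<dots> = (\<integral>\<omega>. f (v \<omega>) \<partial>M)"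
      by (rule Bochner_Integration.integral_cong[OF refl]) (simp add: v_def)
    finally show ?thesis .
  qed
  have exch: "(\<integral>\<omega>. f (\<lambda>i. A \<omega> (\<pi> i)) \<partial>M) = (\<integral>\<omega>. f (A \<omega>) \<partial>M)"
    if \<pi>: "\<pi> permutes {..<n}" and f: "f \<in> borel_measurable borel" for \<pi> and f :: "(nat \<Rightarrow> real) \<Rightarrow> real"
  proof -
    have fm: "(\<lambda>v. f (\<lambda>i. (cmod (v i))\<^sup>2)) \<in> borel_measurable borel"
      by (rule measurable_compose[OF borel_measurable_modulus_squares f])
    have "(if i < n then \<Sum>j<n. perm_mat n \<pi> $$ (i, j) * v \<omega> j else 0) = v \<omega> (\<pi> i)" if \<omega>: "\<omega> \<in> space M" for \<omega> i
    proof (cases "i < n")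
      case True
      have "(\<Sum>j<n. perm_mat n \<pi> $$ (i, j) * v \<omega> j) = (\<Sum>j<n. if j = \<pi> i then v \<omega> (\<pi> i) else 0)"
        using True by (intro sum.cong) (auto simp: perm_mat_def)
      also have "\<dots> = v \<omega> (\<pi> i)" using permutes_in_image[OF \<pi>, of i] True by simp
      finally show ?thesis using True by simp
    next
      case False
      then have "\<pi> i = i" using permutes_not_in[OF \<pi>, of i] by simp
      with False \<omega> show ?thesis by (simp add: v_def first_column_def)
    qed
    then show ?thesis using inv[OF perm_mat_in_entry_group[OF \<pi> F'] fm]
      unfolding A_def by (simp cong: Bochner_Integration.integral_cong)
  qed
  have rot: "(\<integral>\<omega>. f ((v \<omega>)(i := (v \<omega> i + p * v \<omega> k) / sqrt 2, k := (v \<omega> k - cnj p * v \<omega> i) / sqrt 2)) \<partial>M) = (\<integral>\<omega>. f (v \<omega>) \<partial>M)"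
    if "i < n" "k < n" "i \<noteq> k" "cmod p = 1" "p \<in> F" "f \<in> borel_measurable borel" for i k p and f :: "(nat \<Rightarrow> complex) \<Rightarrow> real"
  proof -
    have "(\<integral>\<omega>. f ((v \<omega>)(i := (v \<omega> i + p * v \<omega> k) / sqrt 2, k := (v \<omega> k - cnj p * v \<omega> i) / sqrt 2)) \<partial>M) =
      (\<integral>\<omega>. f (\<lambda>l. if l < n then \<Sum>j<n. plane_rotation n i k p $$ (l, j) * v \<omega> j else 0) \<partial>M)"
    proof (rule Bochner_Integration.integral_cong[OF refl])
      fix \<omega> assume "\<omega> \<in> space M"
      then have "v \<omega> = first_column n (U \<omega>)" by (simp add: v_def)
      then show "f ((v \<omega>)(i := (v \<omega> i + p * v \<omega> k) / sqrt 2, k := (v \<omega> k - cnj p * v \<omega> i) / sqrt 2)) =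
          f (\<lambda>l. if l < n then \<Sum>j<n. plane_rotation n i k p $$ (l, j) * v \<omega> j else 0)"
        using arg_cong[OF plane_rotation_first_column[OF that(1-3), of p "U \<omega>"], of f] by (simp only:)
    qed
    also have "\<dots> = (\<integral>\<omega>. f (v \<omega>) \<partial>M)"
      by (rule inv[OF plane_rotation_in_entry_group[OF that(1-5) F'] that(6)])
    finally show ?thesis .
  qed
  have bnd: "integrable M (\<lambda>\<omega>. h \<omega>)" if "h \<in> borel_measurable M" "\<And>\<omega>. \<bar>h \<omega>\<bar> \<le> c" for h :: "'a \<Rightarrow> real" and c
    using that by (intro integrable_const_bound[of _ c]) auto
  have gm: "(\<lambda>\<omega>. g (A \<omega>)) \<in> borel_measurable M" if "g \<in> borel_measurable borel" for g :: "(nat \<Rightarrow> real) \<Rightarrow> real"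
    by (rule measurable_compose[OF Am' that])
  \<comment> \<open>The rotation replaces |v_i|^2 by |v_i + p v_k|^2 / 2, while \<open>g\<close>
    ignores the two coordinates that move; \<open>2 ^ m\<close> undoes the normalization.\<close>
  have rotm: "(\<integral>\<omega>. cmod (v \<omega> i + p * v \<omega> k) ^ (2 * m) * g (A \<omega>) \<partial>M) = 2 ^ m * (\<integral>\<omega>. A \<omega> i ^ m * g (A \<omega>) \<partial>M)"
    if "i < n" "k < n" "i \<noteq> k" "cmod p = 1" "p \<in> F" and g: "g \<in> borel_measurable borel"
      and ind: "\<And>a x y. g (a(i := x, k := y)) = g a" for i k p m and g :: "(nat \<Rightarrow> real) \<Rightarrow> real"
  proof -
    have fm: "(\<lambda>v. ((cmod (v i))\<^sup>2) ^ m * g (\<lambda>j. (cmod (v j))\<^sup>2)) \<in> borel_measurable borel"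
      by (intro borel_measurable_times measurable_compose[OF borel_measurable_modulus_squares g]
          borel_measurable_continuous_onI continuous_intros continuous_on_product_coordinates)
    have upd: "(\<lambda>j. (cmod (((v \<omega>)(i := x, k := y)) j))\<^sup>2) = (A \<omega>)(i := (cmod x)\<^sup>2, k := (cmod y)\<^sup>2)" for \<omega> x y
      by (auto simp: A_def)
    have "cmod (v \<omega> i + p * v \<omega> k) ^ (2 * m) * g (A \<omega>) / 2 ^ m =
      ((cmod (((v \<omega>)(i := (v \<omega> i + p * v \<omega> k) / sqrt 2, k := (v \<omega> k - cnj p * v \<omega> i) / sqrt 2)) i))\<^sup>2) ^ m *
      g (\<lambda>j. (cmod (((v \<omega>)(i := (v \<omega> i + p * v \<omega> k) / sqrt 2, k := (v \<omega> k - cnj p * v \<omega> i) / sqrt 2)) j))\<^sup>2)" for \<omega>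
      unfolding upd ind using that(3) by (simp add: norm_divide power_divide power_mult)
    then have "(\<integral>\<omega>. cmod (v \<omega> i + p * v \<omega> k) ^ (2 * m) * g (A \<omega>) / 2 ^ m \<partial>M) = (\<integral>\<omega>. A \<omega> i ^ m * g (A \<omega>) \<partial>M)"
      using rot[OF that(1-5) fm] by (simp only: A_def[abs_def])
    then show ?thesis by (simp add: divide_eq_eq mult.commute)
  qed
  have contract: "(\<integral>\<omega>. (A \<omega> i)\<^sup>2 * g (A \<omega>) \<partial>M) = \<kappa> * (\<integral>\<omega>. A \<omega> i * A \<omega> k * g (A \<omega>) \<partial>M)"
    if ik: "i < n" "k < n" "i \<noteq> k" and g: "g \<in> borel_measurable borel"
      and ind: "\<And>a x y. g (a(i := x, k := y)) = g a" and C: "\<And>\<omega>. \<bar>g (A \<omega>)\<bar> \<le> C"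
    for i k C and g :: "(nat \<Rightarrow> real) \<Rightarrow> real"
  proof -
    let ?x = "\<integral>\<omega>. (A \<omega> i)\<^sup>2 * g (A \<omega>) \<partial>M" and ?y = "\<integral>\<omega>. A \<omega> i * A \<omega> k * g (A \<omega>) \<partial>M"
    have b1: "\<bar>(A \<omega> j)\<^sup>2 * g (A \<omega>)\<bar> \<le> 1 * C" for \<omega> j
      unfolding abs_mult using A0 A1 C by (intro mult_mono) (auto simp: power_le_one)
    have b2: "\<bar>A \<omega> i * A \<omega> k * g (A \<omega>)\<bar> \<le> 1 * C" for \<omega>
      unfolding abs_mult using A0 A1 C by (intro mult_mono) (auto simp: mult_le_one)
    have I: "integrable M (\<lambda>\<omega>. (A \<omega> j)\<^sup>2 * g (A \<omega>))" for j
      by (rule bnd[OF _ b1]) (intro borel_measurable_times borel_measurable_power Am gm g)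
    have I2: "integrable M (\<lambda>\<omega>. A \<omega> i * A \<omega> k * g (A \<omega>))"
      by (rule bnd[OF _ b2]) (intro borel_measurable_times borel_measurable_power Am gm g)
    \<comment> \<open>Exchangeability identifies the moment at k with the one at i, so the averaged
      identity has only the unknowns \<open>?x\<close> and \<open>?y\<close>.\<close>
    have swap: "(\<integral>\<omega>. (A \<omega> k)\<^sup>2 * g (A \<omega>) \<partial>M) = ?x"
    proof -
      have "(\<lambda>a. (a i)\<^sup>2 * g a) \<in> borel_measurable borel"
        by (intro borel_measurable_times g borel_measurable_continuous_onI continuous_intros continuous_on_product_coordinates)
      note exch[OF permutes_swap_id[of i "{..<n}" k] this]
      moreover have "(\<lambda>j. A \<omega> (Transposition.transpose i k j)) = (A \<omega>)(i := A \<omega> k, k := A \<omega> i)" for \<omega>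
        using ik by (auto simp: Transposition.transpose_def)
      ultimately show ?thesis using ik ind by simp
    qed
    have cm: "cmod (v \<omega> j) ^ 4 = (A \<omega> j)\<^sup>2" for \<omega> j by (simp add: A_def)
    have r: "(\<integral>\<omega>. cmod (v \<omega> i + p * v \<omega> k) ^ 4 * g (A \<omega>) \<partial>M) = 4 * ?x" if "cmod p = 1" "p \<in> F" for p
      using rotm[OF ik that g ind, of 2] by simp
    have b4: "\<bar>cmod (v \<omega> i + p * v \<omega> k) ^ 4 * g (A \<omega>)\<bar> \<le> 16 * C" if "cmod p = 1" for p \<omega>
    proof -
      have "cmod (v \<omega> i + p * v \<omega> k) \<le> cmod (v \<omega> i) + cmod (v \<omega> k)"
        using norm_triangle_ineq[of "v \<omega> i" "p * v \<omega> k"] that by (simp add: norm_mult)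
      also have "\<dots> \<le> 1 + 1" using A1[of \<omega> i] A1[of \<omega> k] by (intro add_mono) (simp_all add: A_def power2_le_iff_abs_le abs_square_le_1)
      finally have "cmod (v \<omega> i + p * v \<omega> k) ^ 4 \<le> 2 ^ 4" by (intro power_mono) auto
      then show ?thesis unfolding abs_mult using C by (intro mult_mono) auto
    qed
    have I4: "integrable M (\<lambda>\<omega>. cmod (v \<omega> i + p * v \<omega> k) ^ 4 * g (A \<omega>))" if "cmod p = 1" for p
      by (rule bnd[OF _ b4[OF that]]) (use gm[OF g] in measurable)
    from F show ?thesis
    proof
      assume c: "F = UNIV \<and> \<kappa> = 2"
      \<comment> \<open>Four phases give \<open>16 * ?x = 8 * ?x + 16 * ?y\<close>.\<close>
      have "16 * ?x = (\<integral>\<omega>. cmod (v \<omega> i + 1 * v \<omega> k) ^ 4 * g (A \<omega>) \<partial>M) + (\<integral>\<omega>. cmod (v \<omega> i + (-1) * v \<omega> k) ^ 4 * g (A \<omega>) \<partial>M)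
         + (\<integral>\<omega>. cmod (v \<omega> i + \<i> * v \<omega> k) ^ 4 * g (A \<omega>) \<partial>M) + (\<integral>\<omega>. cmod (v \<omega> i + (-\<i>) * v \<omega> k) ^ 4 * g (A \<omega>) \<partial>M)"
        using r[of 1] r[of "-1"] r[of \<i>] r[of "-\<i>"] c by simp
      also have "\<dots> = (\<integral>\<omega>. cmod (v \<omega> i + 1 * v \<omega> k) ^ 4 * g (A \<omega>) + cmod (v \<omega> i + (-1) * v \<omega> k) ^ 4 * g (A \<omega>)
         + cmod (v \<omega> i + \<i> * v \<omega> k) ^ 4 * g (A \<omega>) + cmod (v \<omega> i + (-\<i>) * v \<omega> k) ^ 4 * g (A \<omega>) \<partial>M)"
        using I4[of 1] I4[of "-1"] I4[of \<i>] I4[of "-\<i>"] by simp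
      also have "\<dots> = (\<integral>\<omega>. 4 * ((A \<omega> i)\<^sup>2 * g (A \<omega>)) + 4 * ((A \<omega> k)\<^sup>2 * g (A \<omega>)) + 16 * (A \<omega> i * A \<omega> k * g (A \<omega>)) \<partial>M)"
      proof (rule Bochner_Integration.integral_cong[OF refl])
        fix \<omega>
        have "cmod (v \<omega> i + 1 * v \<omega> k) ^ 4 * g (A \<omega>) + cmod (v \<omega> i + (-1) * v \<omega> k) ^ 4 * g (A \<omega>)
           + cmod (v \<omega> i + \<i> * v \<omega> k) ^ 4 * g (A \<omega>) + cmod (v \<omega> i + (-\<i>) * v \<omega> k) ^ 4 * g (A \<omega>)
          = (cmod (v \<omega> i + v \<omega> k) ^ 4 + cmod (v \<omega> i - v \<omega> k) ^ 4 + cmod (v \<omega> i + \<i> * v \<omega> k) ^ 4 + cmod (v \<omega> i - \<i> * v \<omega> k) ^ 4) * g (A \<omega>)"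
          by (simp add: algebra_simps)
        also have "\<dots> = 4 * ((A \<omega> i)\<^sup>2 * g (A \<omega>)) + 4 * ((A \<omega> k)\<^sup>2 * g (A \<omega>)) + 16 * (A \<omega> i * A \<omega> k * g (A \<omega>))"
          unfolding phase_average_4 cm by (simp add: A_def algebra_simps)
        finally show "cmod (v \<omega> i + 1 * v \<omega> k) ^ 4 * g (A \<omega>) + cmod (v \<omega> i + (-1) * v \<omega> k) ^ 4 * g (A \<omega>)
           + cmod (v \<omega> i + \<i> * v \<omega> k) ^ 4 * g (A \<omega>) + cmod (v \<omega> i + (-\<i>) * v \<omega> k) ^ 4 * g (A \<omega>)
          = 4 * ((A \<omega> i)\<^sup>2 * g (A \<omega>)) + 4 * ((A \<omega> k)\<^sup>2 * g (A \<omega>)) + 16 * (A \<omega> i * A \<omega> k * g (A \<omega>))" .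
      qed
      also have "\<dots> = 4 * ?x + 4 * (\<integral>\<omega>. (A \<omega> k)\<^sup>2 * g (A \<omega>) \<partial>M) + 16 * ?y" using I I2 by simp
      finally show ?thesis using swap c by simp
    next
      assume c: "F = \<real> \<and> \<kappa> = 3"
      have vr: "v \<omega> j \<in> \<real>" for \<omega> j
        using UG[of \<omega>] c n by (auto simp: v_def first_column_def entry_group_def)
      \<comment> \<open>Two signs give \<open>8 * ?x = 4 * ?x + 12 * ?y\<close>.\<close>
      have "8 * ?x = (\<integral>\<omega>. cmod (v \<omega> i + 1 * v \<omega> k) ^ 4 * g (A \<omega>) \<partial>M) + (\<integral>\<omega>. cmod (v \<omega> i + (-1) * v \<omega> k) ^ 4 * g (A \<omega>) \<partial>M)"
        using r[of 1] r[of "-1"] c by simp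
      also have "\<dots> = (\<integral>\<omega>. cmod (v \<omega> i + 1 * v \<omega> k) ^ 4 * g (A \<omega>) + cmod (v \<omega> i + (-1) * v \<omega> k) ^ 4 * g (A \<omega>) \<partial>M)"
        using I4[of 1] I4[of "-1"] by simp
      also have "\<dots> = (\<integral>\<omega>. 2 * ((A \<omega> i)\<^sup>2 * g (A \<omega>)) + 2 * ((A \<omega> k)\<^sup>2 * g (A \<omega>)) + 12 * (A \<omega> i * A \<omega> k * g (A \<omega>)) \<partial>M)"
      proof (rule Bochner_Integration.integral_cong[OF refl])
        fix \<omega>
        have "cmod (v \<omega> i + 1 * v \<omega> k) ^ 4 * g (A \<omega>) + cmod (v \<omega> i + (-1) * v \<omega> k) ^ 4 * g (A \<omega>)
          = (cmod (v \<omega> i + v \<omega> k) ^ 4 + cmod (v \<omega> i - v \<omega> k) ^ 4) * g (A \<omega>)"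
          by (simp add: algebra_simps)
        also have "\<dots> = 2 * ((A \<omega> i)\<^sup>2 * g (A \<omega>)) + 2 * ((A \<omega> k)\<^sup>2 * g (A \<omega>)) + 12 * (A \<omega> i * A \<omega> k * g (A \<omega>))"
          unfolding sign_average_4[OF vr vr] cm by (simp add: A_def algebra_simps)
        finally show "cmod (v \<omega> i + 1 * v \<omega> k) ^ 4 * g (A \<omega>) + cmod (v \<omega> i + (-1) * v \<omega> k) ^ 4 * g (A \<omega>)
          = 2 * ((A \<omega> i)\<^sup>2 * g (A \<omega>)) + 2 * ((A \<omega> k)\<^sup>2 * g (A \<omega>)) + 12 * (A \<omega> i * A \<omega> k * g (A \<omega>))" .
      qed
      also have "\<dots> = 2 * ?x + 2 * (\<integral>\<omega>. (A \<omega> k)\<^sup>2 * g (A \<omega>) \<partial>M) + 12 * ?y" using I I2 by simp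
      finally show ?thesis using swap c by simp
    qed
  qed
  have eighth: "(\<integral>\<omega>. (A \<omega> 0) ^ 4 \<partial>M) \<le> 28 * (\<integral>\<omega>. (A \<omega> 0)\<^sup>2 * (A \<omega> 1)\<^sup>2 \<partial>M)" if n2: "2 \<le> n"
  proof -
    let ?x = "\<integral>\<omega>. (A \<omega> 0) ^ 4 \<partial>M" and ?y = "\<integral>\<omega>. (A \<omega> 0)\<^sup>2 * (A \<omega> 1)\<^sup>2 \<partial>M"
    have ik: "0 < n" "1 < n" "(0::nat) \<noteq> 1" using n2 by auto
    have 1: "1 \<in> F" "-1 \<in> F" using F' by auto
    have r: "(\<integral>\<omega>. cmod (v \<omega> 0 + p * v \<omega> 1) ^ 8 \<partial>M) = 16 * ?x" if "cmod p = 1" "p \<in> F" for p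
      using rotm[OF ik that, of "\<lambda>_. 1" 4] by simp
    have swap: "(\<integral>\<omega>. (A \<omega> 1) ^ 4 \<partial>M) = ?x"
    proof -
      have "(\<lambda>a :: nat \<Rightarrow> real. (a 0) ^ 4) \<in> borel_measurable borel"
        by (intro borel_measurable_continuous_onI continuous_intros continuous_on_product_coordinates)
      from exch[OF permutes_swap_id[of 0 "{..<n}" 1] this] show ?thesis
        using ik by (simp add: Transposition.transpose_def)
    qed
    have I: "integrable M (\<lambda>\<omega>. (A \<omega> j) ^ 4)" for j
      by (rule bnd[of _ 1]) (use A0 A1 in \<open>auto intro!: borel_measurable_power Am simp: power_le_one\<close>)
    have I2: "integrable M (\<lambda>\<omega>. (A \<omega> 0)\<^sup>2 * (A \<omega> 1)\<^sup>2)"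
      by (rule bnd[of _ 1]) (use A0 A1 in \<open>auto intro!: borel_measurable_power borel_measurable_times Am mult_le_one simp: power_le_one\<close>)
    have I8: "integrable M (\<lambda>\<omega>. cmod (v \<omega> 0 + p * v \<omega> 1) ^ 8)" if "cmod p = 1" for p
    proof (rule bnd[of _ "2 ^ 8"])
      show "(\<lambda>\<omega>. cmod (v \<omega> 0 + p * v \<omega> 1) ^ 8) \<in> borel_measurable M"
        by measurable
      fix \<omega>
      have "cmod (v \<omega> 0 + p * v \<omega> 1) \<le> cmod (v \<omega> 0) + cmod (v \<omega> 1)"
        using norm_triangle_ineq[of "v \<omega> 0" "p * v \<omega> 1"] that by (simp add: norm_mult)
      also have "\<dots> \<le> 1 + 1" using A1[of \<omega> 0] A1[of \<omega> 1] by (intro add_mono) (simp_all add: A_def abs_square_le_1)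
      finally have "cmod (v \<omega> 0 + p * v \<omega> 1) ^ 8 \<le> 2 ^ 8" by (intro power_mono) auto
      then show "\<bar>cmod (v \<omega> 0 + p * v \<omega> 1) ^ 8\<bar> \<le> 2 ^ 8" by simp
    qed
    \<comment> \<open>The chain ends in \<open>16 * ?x \<le> 11 / 2 * ?x + 294 * ?y\<close>, and 294
      divided by 21/2 is 28.\<close>
    have "16 * ?x = (\<integral>\<omega>. (cmod (v \<omega> 0 + 1 * v \<omega> 1) ^ 8 + cmod (v \<omega> 0 + (-1) * v \<omega> 1) ^ 8) / 2 \<partial>M)"
      using r[of 1] r[of "-1"] 1 I8[of 1] I8[of "-1"] by simp
    also have "\<dots> \<le> (\<integral>\<omega>. 11 / 4 * ((A \<omega> 0) ^ 4 + (A \<omega> 1) ^ 4) + 294 * ((A \<omega> 0)\<^sup>2 * (A \<omega> 1)\<^sup>2) \<partial>M)"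
    proof (rule integral_mono)
      show "integrable M (\<lambda>\<omega>. (cmod (v \<omega> 0 + 1 * v \<omega> 1) ^ 8 + cmod (v \<omega> 0 + (-1) * v \<omega> 1) ^ 8) / 2)"
        using I8[of 1] I8[of "-1"] by simp
      show "integrable M (\<lambda>\<omega>. 11 / 4 * ((A \<omega> 0) ^ 4 + (A \<omega> 1) ^ 4) + 294 * ((A \<omega> 0)\<^sup>2 * (A \<omega> 1)\<^sup>2))"
        using I I2 by simp
      show "(cmod (v \<omega> 0 + 1 * v \<omega> 1) ^ 8 + cmod (v \<omega> 0 + (-1) * v \<omega> 1) ^ 8) / 2
         \<le> 11 / 4 * ((A \<omega> 0) ^ 4 + (A \<omega> 1) ^ 4) + 294 * ((A \<omega> 0)\<^sup>2 * (A \<omega> 1)\<^sup>2)" for \<omega>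
        using sign_average_8[of "v \<omega> 0" "v \<omega> 1"] by (simp add: A_def)
    qed
    also have "\<dots> = 11 / 4 * (?x + (\<integral>\<omega>. (A \<omega> 1) ^ 4 \<partial>M)) + 294 * ?y" using I I2 by simp
    finally show ?thesis unfolding swap by (simp add: field_simps)
  qed
  show ?thesis unfolding A_eq
  proof (unfold_locales, goal_cases)
    case 1 show ?case using F by auto
  next
    case (2 i) show ?case by (rule Am)
  next
    case (3 \<omega> i) show ?case by (rule A0)
  next
    case (4 i \<omega>) then show ?case by (rule Aout)
  next
    case (5 \<omega>) show ?case by (rule Asum)
  next
    case (6 \<pi> f) then show ?case by (rule exch)
  next
    case (7 i k g C) then show ?case by (rule contract)
  next
    case 8 then show ?case by (rule eighth)
  qed
qed

section \<open>Second and fourth moments of the weights\<close>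

lemma borel_measurable_coordinate: "(\<lambda>a. a i) \<in> borel_measurable (borel :: (nat \<Rightarrow> real) measure)"
  by (intro borel_measurable_continuous_onI continuous_on_product_coordinates)

text \<open>Bounds the mean square of \<open>n * Q - \<kappa>\<close> term by term: the diagonal of
  n^2 E Q^2, its off-diagonal pairs, the exactly known mean of \<open>n * Q\<close>, and
  \<kappa>^2.\<close>

definition Q_variance_bound :: "nat \<Rightarrow> real \<Rightarrow> real" where
  "Q_variance_bound n \<kappa> = 84 * \<kappa>\<^sup>2 / n + \<kappa>\<^sup>2 * (real n)\<^sup>2 * (real n - 1) / ((n + \<kappa> - 1) * ((real n - 2) * (real n - 3)))
     - 2 * \<kappa>\<^sup>2 * n / (n + \<kappa> - 1) + \<kappa>\<^sup>2"

context haar_weights begin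

declare borel_measurable_coordinate [measurable]

lemma A_le_1: "\<omega> \<in> space M \<Longrightarrow> A \<omega> i \<le> 1"
proof (cases "i < n")
  case True
  assume "\<omega> \<in> space M"
  have "A \<omega> i \<le> (\<Sum>i<n. A \<omega> i)" using True by (intro member_le_sum A_nonneg) auto
  with A_sum[OF \<open>\<omega> \<in> space M\<close>] show ?thesis by simp
qed (use A_out[of i] in auto)

lemma A_integrableI:
  assumes "h \<in> borel_measurable M" "\<And>\<omega>. \<omega> \<in> space M \<Longrightarrow> \<bar>h \<omega>\<bar> \<le> (c::real)"
  shows "integrable M h"
  using assms by (intro integrable_const_bound[of _ c]) auto

lemma A_integrable_power: "integrable M (\<lambda>\<omega>. A \<omega> i ^ m)"
  by (rule A_integrableI[of _ 1]) (auto simp: A_nonneg A_le_1 power_le_one)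

lemma A_integrable_mult: "integrable M (\<lambda>\<omega>. A \<omega> i ^ l * A \<omega> k ^ m)"
  by (rule A_integrableI[of _ 1]) (auto simp: A_nonneg A_le_1 power_le_one abs_mult intro!: mult_le_one)

lemma A_integrable [simp]: "integrable M (\<lambda>\<omega>. A \<omega> i)"
  using A_integrable_power[of i 1] by simp

lemma n_pos: "n > 0"
proof -
  obtain \<omega> where "\<omega> \<in> space M" using not_empty by blast
  from A_sum[OF this] show ?thesis by (cases "n = 0") auto
qed

lemma contract_pair:
  assumes "i < n" "k < n" "i \<noteq> k"
  shows "(\<integral>\<omega>. (A \<omega> i)\<^sup>2 \<partial>M) = \<kappa> * (\<integral>\<omega>. A \<omega> i * A \<omega> k \<partial>M)"
  using contract[OF assms, of "\<lambda>_. 1" 1] by simp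

lemma second_moment_eq:
  assumes "i < n" "k < n"
  shows "(\<integral>\<omega>. (A \<omega> i)\<^sup>2 \<partial>M) = (\<integral>\<omega>. (A \<omega> k)\<^sup>2 \<partial>M)"
  using contract_pair[of i k] contract_pair[of k i] assms by (cases "i = k") (simp_all add: mult.commute)

text \<open>Expanding the square of the total mass 1 gives n diagonal terms a and n (n - 1)
  off-diagonal terms a / \<kappa>, which determines a.\<close>

lemma second_moment:
  assumes i: "i < n"
  shows "(\<integral>\<omega>. (A \<omega> i)\<^sup>2 \<partial>M) = \<kappa> / (n * (n + \<kappa> - 1))"
proof -
  let ?a = "\<integral>\<omega>. (A \<omega> i)\<^sup>2 \<partial>M"
  have p: "(\<integral>\<omega>. A \<omega> j * A \<omega> k \<partial>M) = (if j = k then ?a else ?a / \<kappa>)" if "j < n" "k < n" for j k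
  proof (cases "j = k")
    case True
    then show ?thesis using second_moment_eq[OF that(1) i] by (simp add: power2_eq_square)
  next
    case False
    then show ?thesis using contract_pair[OF that] second_moment_eq[OF that(1) i] kappa by (simp add: field_simps)
  qed
  have I: "integrable M (\<lambda>\<omega>. A \<omega> j * A \<omega> k)" for j k using A_integrable_mult[of j 1 k 1] by simp
  have "1 = (\<integral>\<omega>. (\<Sum>j<n. \<Sum>k<n. A \<omega> j * A \<omega> k) \<partial>M)"
  proof -
    have "(\<integral>\<omega>. (\<Sum>j<n. \<Sum>k<n. A \<omega> j * A \<omega> k) \<partial>M) = (\<integral>\<omega>. 1 \<partial>M)"
      by (rule Bochner_Integration.integral_cong[OF refl]) (simp add: A_sum flip: sum_product)
    then show ?thesis by (simp add: prob_space)
  qed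
  also have "\<dots> = (\<Sum>j<n. \<Sum>k<n. (\<integral>\<omega>. A \<omega> j * A \<omega> k \<partial>M))" using I by simp
  also have "\<dots> = (\<Sum>j<n. \<Sum>k<n. (if j = k then ?a - ?a / \<kappa> else 0) + ?a / \<kappa>)"
    using p by (intro sum.cong) auto
  also have "\<dots> = n * (?a - ?a / \<kappa>) + n * (n * (?a / \<kappa>))" by (simp add: sum.distrib distrib_left)
  finally have "1 = n * (?a - ?a / \<kappa>) + n * (n * (?a / \<kappa>))" .
  then have "\<kappa> = ?a * (n * (n + \<kappa> - 1))" using kappa by (simp add: field_simps)
  moreover have "n * (n + \<kappa> - 1) > 0" using n_pos kappa by (intro mult_pos_pos) auto
  ultimately show ?thesis by (metis less_irrefl nonzero_eq_divide_eq)
qed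

lemma second_moment_le:
  assumes "i < n" shows "(\<integral>\<omega>. (A \<omega> i)\<^sup>2 \<partial>M) \<le> \<kappa> / (real n)\<^sup>2"
  unfolding second_moment[OF assms] power2_eq_square[of "real n"] using n_pos kappa
  by (intro divide_left_mono mult_left_mono mult_pos_pos) auto

text \<open>Two contractions turn A_i^2 A_k^2 into \<kappa>^2 times a product of four distinct
  weights. Averaging over the (n - 2)(n - 3) choices of the two new indices and enlarging to all
  pairs by nonnegativity, both sums collapse because the weights add up to 1.\<close>

lemma fourth_mixed_moment:
  assumes ik: "i < n" "k < n" "i \<noteq> k" and n4: "4 \<le> n"
  shows "(real n - 2) * (real n - 3) * (\<integral>\<omega>. (A \<omega> i)\<^sup>2 * (A \<omega> k)\<^sup>2 \<partial>M) \<le> \<kappa> * (\<integral>\<omega>. (A \<omega> i)\<^sup>2 \<partial>M)"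
proof -
  let ?b = "\<integral>\<omega>. (A \<omega> i)\<^sup>2 * (A \<omega> k)\<^sup>2 \<partial>M"
  define I where "I = {..<n} - {i, k}"
  have cI: "card I = n - 2" unfolding I_def using ik by (subst card_Diff_subset) auto
  have e: "?b = \<kappa>\<^sup>2 * (\<integral>\<omega>. A \<omega> i * A \<omega> k * (A \<omega> l * A \<omega> m) \<partial>M)" if lm: "l \<in> I" "m \<in> I - {l}" for l m
  proof -
    have d: "l < n" "m < n" "l \<noteq> i" "l \<noteq> k" "m \<noteq> i" "m \<noteq> k" "l \<noteq> m" using lm by (auto simp: I_def)
    \<comment> \<open>\<open>contract\<close> asks for a bound on \<open>g\<close> at every point,
      whereas \<open>A \<le> 1\<close> is known only on \<open>space M\<close>; hence the truncation
      by 1.\<close>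
    have "?b = \<kappa> * (\<integral>\<omega>. A \<omega> i * A \<omega> l * (min (A \<omega> k) 1)\<^sup>2 \<partial>M)"
    proof -
      have "(\<integral>\<omega>. (A \<omega> i)\<^sup>2 * (min (A \<omega> k) 1)\<^sup>2 \<partial>M) = \<kappa> * (\<integral>\<omega>. A \<omega> i * A \<omega> l * (min (A \<omega> k) 1)\<^sup>2 \<partial>M)"
        by (rule contract[where C = 1 and g = "\<lambda>a. (min (a k) 1)\<^sup>2"]) (use d ik in \<open>auto simp: A_nonneg abs_square_le_1\<close>)
      moreover have "(\<integral>\<omega>. (A \<omega> i)\<^sup>2 * (min (A \<omega> k) 1)\<^sup>2 \<partial>M) = ?b"
        by (rule Bochner_Integration.integral_cong[OF refl]) (simp add: A_le_1)
      ultimately show ?thesis by simp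
    qed
    also have "(\<integral>\<omega>. A \<omega> i * A \<omega> l * (min (A \<omega> k) 1)\<^sup>2 \<partial>M) =
        (\<integral>\<omega>. (A \<omega> k)\<^sup>2 * (min (A \<omega> i) 1 * min (A \<omega> l) 1) \<partial>M)"
      by (rule Bochner_Integration.integral_cong[OF refl]) (simp add: A_le_1)
    also have "\<dots> = \<kappa> * (\<integral>\<omega>. A \<omega> k * A \<omega> m * (min (A \<omega> i) 1 * min (A \<omega> l) 1) \<partial>M)"
      by (rule contract[where C = 1 and g = "\<lambda>a. min (a i) 1 * min (a l) 1"])
        (use d ik in \<open>auto simp: A_nonneg abs_mult intro!: mult_le_one\<close>)
    also have "(\<integral>\<omega>. A \<omega> k * A \<omega> m * (min (A \<omega> i) 1 * min (A \<omega> l) 1) \<partial>M) = (\<integral>\<omega>. A \<omega> i * A \<omega> k * (A \<omega> l * A \<omega> m) \<partial>M)"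
      by (rule Bochner_Integration.integral_cong[OF refl]) (simp add: A_le_1)
    finally show ?thesis by (simp add: power2_eq_square)
  qed
  have Int: "integrable M (\<lambda>\<omega>. A \<omega> i * A \<omega> k * (A \<omega> l * A \<omega> m))" for l m
    by (rule A_integrableI[of _ 1]) (auto simp: A_nonneg A_le_1 abs_mult intro!: mult_le_one mult_nonneg_nonneg)
  have "(real n - 2) * (real n - 3) * ?b = (\<Sum>l\<in>I. \<Sum>m\<in>I - {l}. ?b)"
  proof -
    have "(\<Sum>l\<in>I. \<Sum>m\<in>I - {l}. ?b) = (\<Sum>l\<in>I. (real n - 3) * ?b)"
    proof (rule sum.cong[OF refl])
      fix l assume l: "l \<in> I"
      have "card (I - {l}) = n - 3" using cI l by (simp add: card_Diff_singleton)
      then show "(\<Sum>m\<in>I - {l}. ?b) = (real n - 3) * ?b" using n4 by (simp add: of_nat_diff)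
    qed
    then show ?thesis using cI n4 by (simp add: of_nat_diff)
  qed
  also have "\<dots> = (\<Sum>l\<in>I. \<Sum>m\<in>I - {l}. \<kappa>\<^sup>2 * (\<integral>\<omega>. A \<omega> i * A \<omega> k * (A \<omega> l * A \<omega> m) \<partial>M))"
    using e by (intro sum.cong) auto
  also have "\<dots> \<le> (\<Sum>l<n. \<Sum>m<n. \<kappa>\<^sup>2 * (\<integral>\<omega>. A \<omega> i * A \<omega> k * (A \<omega> l * A \<omega> m) \<partial>M))"
  proof -
    have nn: "0 \<le> \<kappa>\<^sup>2 * (\<integral>\<omega>. A \<omega> i * A \<omega> k * (A \<omega> l * A \<omega> m) \<partial>M)" for l m
      by (intro mult_nonneg_nonneg integral_nonneg_AE AE_I2 A_nonneg) simp
    have "(\<Sum>l\<in>I. \<Sum>m\<in>I - {l}. \<kappa>\<^sup>2 * (\<integral>\<omega>. A \<omega> i * A \<omega> k * (A \<omega> l * A \<omega> m) \<partial>M))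
      \<le> (\<Sum>l\<in>I. \<Sum>m<n. \<kappa>\<^sup>2 * (\<integral>\<omega>. A \<omega> i * A \<omega> k * (A \<omega> l * A \<omega> m) \<partial>M))"
      by (intro sum_mono sum_mono2 nn) (auto simp: I_def)
    also have "\<dots> \<le> (\<Sum>l<n. \<Sum>m<n. \<kappa>\<^sup>2 * (\<integral>\<omega>. A \<omega> i * A \<omega> k * (A \<omega> l * A \<omega> m) \<partial>M))"
      by (intro sum_mono2 sum_nonneg nn) (auto simp: I_def)
    finally show ?thesis .
  qed
  also have "\<dots> = \<kappa>\<^sup>2 * (\<integral>\<omega>. (\<Sum>l<n. \<Sum>m<n. A \<omega> i * A \<omega> k * (A \<omega> l * A \<omega> m)) \<partial>M)"
    using Int by (simp add: sum_distrib_left)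
  also have "(\<integral>\<omega>. (\<Sum>l<n. \<Sum>m<n. A \<omega> i * A \<omega> k * (A \<omega> l * A \<omega> m)) \<partial>M) = (\<integral>\<omega>. A \<omega> i * A \<omega> k \<partial>M)"
    by (rule Bochner_Integration.integral_cong[OF refl]) (simp add: A_sum flip: sum_distrib_left sum_product)
  also have "\<kappa>\<^sup>2 * (\<integral>\<omega>. A \<omega> i * A \<omega> k \<partial>M) = \<kappa> * (\<integral>\<omega>. (A \<omega> i)\<^sup>2 \<partial>M)"
    using contract_pair[OF ik] by (simp add: power2_eq_square)
  finally show ?thesis .
qed

lemma fourth_moment_eq: "i < n \<Longrightarrow> (\<integral>\<omega>. A \<omega> i ^ 4 \<partial>M) = (\<integral>\<omega>. A \<omega> 0 ^ 4 \<partial>M)"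
  using exch[OF permutes_swap_id[of 0 "{..<n}" i], of "\<lambda>a. a 0 ^ 4"] n_pos
  by (simp add: Transposition.transpose_def)

lemma falling_le:
  assumes "6 \<le> n" shows "(real n)\<^sup>2 / 3 \<le> (real n - 2) * (real n - 3)"
proof -
  \<comment> \<open>The two sides differ by (n - 6)(2 n - 3) / 3, the origin of the threshold
    6.\<close>
  have "0 \<le> (real n - 6) * (2 * real n - 3)" using assms by (intro mult_nonneg_nonneg) auto
  then show ?thesis by (simp add: power2_eq_square field_simps)
qed

text \<open>84 = 28 * 3: the constant of \<open>eighth\<close> times the factor 3 lost in
  \<open>falling_le\<close>.\<close>

lemma fourth_moment:
  assumes i: "i < n" and n6: "6 \<le> n"
  shows "(\<integral>\<omega>. A \<omega> i ^ 4 \<partial>M) \<le> 84 * \<kappa>\<^sup>2 / real n ^ 4"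
proof -
  let ?b = "\<integral>\<omega>. (A \<omega> 0)\<^sup>2 * (A \<omega> 1)\<^sup>2 \<partial>M"
  have b0: "0 \<le> ?b" by (intro integral_nonneg_AE AE_I2) simp
  have "(real n)\<^sup>2 / 3 * ?b \<le> (real n - 2) * (real n - 3) * ?b"
    by (rule mult_right_mono[OF falling_le[OF n6] b0])
  also have "\<dots> \<le> \<kappa> * (\<integral>\<omega>. (A \<omega> 0)\<^sup>2 \<partial>M)" by (rule fourth_mixed_moment) (use n6 in auto)
  also have "\<dots> \<le> \<kappa> * (\<kappa> / (real n)\<^sup>2)" using second_moment_le[of 0] n6 kappa by (intro mult_left_mono) auto
  finally have "?b \<le> 3 * \<kappa>\<^sup>2 / real n ^ 4" using n_pos by (simp add: field_simps power_numeral_reduce)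
  moreover have "(\<integral>\<omega>. A \<omega> i ^ 4 \<partial>M) \<le> 28 * ?b" using eighth n6 fourth_moment_eq[OF i] by simp
  ultimately show ?thesis by simp
qed

section \<open>Concentration of the sum of squares\<close>

definition Q where "Q \<omega> = (\<Sum>i<n. (A \<omega> i)\<^sup>2)"

lemma expectation_Q: "(\<integral>\<omega>. n * Q \<omega> \<partial>M) = \<kappa> * n / (n + \<kappa> - 1)"
proof -
  have "(\<integral>\<omega>. n * Q \<omega> \<partial>M) = n * (\<Sum>i<n. (\<integral>\<omega>. (A \<omega> i)\<^sup>2 \<partial>M))"
    unfolding Q_def using A_integrable_power[of _ 2] by simp
  also have "\<dots> = n * (n * (\<kappa> / (n * (n + \<kappa> - 1))))" by (simp add: second_moment)
  also have "\<dots> = \<kappa> * n / (n + \<kappa> - 1)" using n_pos by simp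
  finally show ?thesis .
qed

lemma Q_integrable: "integrable M Q"
  unfolding Q_def[abs_def] using A_integrable_power[of _ 2] by simp

lemma Q2_integrable: "integrable M (\<lambda>\<omega>. (Q \<omega>)\<^sup>2)"
proof -
  have "(Q \<omega>)\<^sup>2 = (\<Sum>i<n. \<Sum>k<n. A \<omega> i ^ 2 * A \<omega> k ^ 2)" for \<omega>
    by (simp add: Q_def power2_eq_square[of "sum _ _"] sum_product)
  then show ?thesis using A_integrable_mult by simp
qed

text \<open>The mean of \<open>n * Q\<close> is known exactly, so an upper bound on the second
  moment of \<open>Q\<close> is enough: \<open>fourth_moment\<close> bounds the diagonal and
  \<open>fourth_mixed_moment\<close> the other pairs.\<close>

lemma Q_variance:
  assumes n6: "6 \<le> n"
  shows "(\<integral>\<omega>. (n * Q \<omega> - \<kappa>)\<^sup>2 \<partial>M) \<le> Q_variance_bound n \<kappa>"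
proof -
  let ?D = "(real n - 2) * (real n - 3)"
  have D: "?D > 0" using n6 by (intro mult_pos_pos) auto
  have "(Q \<omega>)\<^sup>2 = (\<Sum>i<n. \<Sum>k<n. A \<omega> i ^ 2 * A \<omega> k ^ 2)" for \<omega>
    by (simp add: Q_def power2_eq_square[of "sum _ _"] sum_product)
  then have "(\<integral>\<omega>. (Q \<omega>)\<^sup>2 \<partial>M) = (\<Sum>i<n. \<Sum>k<n. (\<integral>\<omega>. (A \<omega> i)\<^sup>2 * (A \<omega> k)\<^sup>2 \<partial>M))"
    using A_integrable_mult by simp
  also have "\<dots> \<le> (\<Sum>i<n. \<Sum>k<n. (if i = k then 84 * \<kappa>\<^sup>2 / real n ^ 4 - \<kappa>\<^sup>2 / (n * (n + \<kappa> - 1) * ?D) else 0)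
       + \<kappa>\<^sup>2 / (n * (n + \<kappa> - 1) * ?D))"
  proof (intro sum_mono)
    fix i k assume ik: "i \<in> {..<n}" "k \<in> {..<n}"
    show "(\<integral>\<omega>. (A \<omega> i)\<^sup>2 * (A \<omega> k)\<^sup>2 \<partial>M) \<le> (if i = k then 84 * \<kappa>\<^sup>2 / real n ^ 4 - \<kappa>\<^sup>2 / (n * (n + \<kappa> - 1) * ?D) else 0)
       + \<kappa>\<^sup>2 / (n * (n + \<kappa> - 1) * ?D)"
    proof (cases "i = k")
      case True
      have "(\<integral>\<omega>. (A \<omega> i)\<^sup>2 * (A \<omega> k)\<^sup>2 \<partial>M) = (\<integral>\<omega>. A \<omega> i ^ 4 \<partial>M)" using True by (simp flip: power_add)
      then show ?thesis using fourth_moment[of i] ik n6 True by simp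
    next
      case False
      have "?D * (\<integral>\<omega>. (A \<omega> i)\<^sup>2 * (A \<omega> k)\<^sup>2 \<partial>M) \<le> \<kappa> * (\<kappa> / (n * (n + \<kappa> - 1)))"
        using fourth_mixed_moment[of i k] second_moment[of i] ik False n6 by simp
      then show ?thesis using False D
        by (simp add: pos_le_divide_eq[symmetric] mult.commute[of ?D] power2_eq_square)
    qed
  qed
  also have "\<dots> = n * (84 * \<kappa>\<^sup>2 / real n ^ 4 - \<kappa>\<^sup>2 / (n * (n + \<kappa> - 1) * ?D)) + n * (n * (\<kappa>\<^sup>2 / (n * (n + \<kappa> - 1) * ?D)))"
    by (simp add: sum.distrib distrib_left)
  finally have Q2: "(\<integral>\<omega>. (Q \<omega>)\<^sup>2 \<partial>M) \<le>
     n * (84 * \<kappa>\<^sup>2 / real n ^ 4 - \<kappa>\<^sup>2 / (n * (n + \<kappa> - 1) * ?D)) + n * (n * (\<kappa>\<^sup>2 / (n * (n + \<kappa> - 1) * ?D)))" .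
  have "(\<integral>\<omega>. (n * Q \<omega> - \<kappa>)\<^sup>2 \<partial>M) = (\<integral>\<omega>. (real n)\<^sup>2 * (Q \<omega>)\<^sup>2 - 2 * \<kappa> * (n * Q \<omega>) + \<kappa>\<^sup>2 \<partial>M)"
    by (rule Bochner_Integration.integral_cong[OF refl]) (simp add: power2_eq_square algebra_simps)
  also have "\<dots> = (real n)\<^sup>2 * (\<integral>\<omega>. (Q \<omega>)\<^sup>2 \<partial>M) - 2 * \<kappa> * (\<integral>\<omega>. n * Q \<omega> \<partial>M) + \<kappa>\<^sup>2"
    using Q2_integrable Q_integrable by (simp add: prob_space)
  also have "\<dots> \<le> (real n)\<^sup>2 * (n * (84 * \<kappa>\<^sup>2 / real n ^ 4 - \<kappa>\<^sup>2 / (n * (n + \<kappa> - 1) * ?D)) + n * (n * (\<kappa>\<^sup>2 / (n * (n + \<kappa> - 1) * ?D))))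
       - 2 * \<kappa> * (\<kappa> * n / (n + \<kappa> - 1)) + \<kappa>\<^sup>2"
    unfolding expectation_Q using Q2 by (intro add_right_mono diff_right_mono mult_left_mono) auto
  also have "\<dots> = Q_variance_bound n \<kappa>"
  proof -
    define E where "E = n + \<kappa> - 1"
    have E: "E > 0" using n_pos kappa by (simp add: E_def)
    show ?thesis unfolding Q_variance_bound_def E_def[symmetric] using D E n_pos
      by (simp add: divide_simps) (simp add: power_numeral_reduce algebra_simps)
  qed
  finally show ?thesis .
qed

end

section \<open>Normalized weights and their partial sums\<close>

lemma power4_diff_le: "(x - y) ^ 4 \<le> 8 * (x ^ 4 + y ^ 4)" for x y :: real
proof -
  have "(x - y)\<^sup>2 \<le> 2 * (x\<^sup>2 + y\<^sup>2)"
    using zero_le_power2[of "x + y"] by (simp add: power2_eq_square algebra_simps)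
  then have "((x - y)\<^sup>2)\<^sup>2 \<le> (2 * (x\<^sup>2 + y\<^sup>2))\<^sup>2" by (rule power_mono) simp
  also have "\<dots> \<le> 8 * (x ^ 4 + y ^ 4)"
    using zero_le_power2[of "x\<^sup>2 - y\<^sup>2"] by (simp add: power_numeral_reduce algebra_simps)
  finally show ?thesis by (simp flip: power_mult)
qed

text \<open>Young's inequality weighted by d leaves the coefficient 1/(2 d) on S^4: summed over the
  d indices of a set it consumes half of the fourth moment, which can then be absorbed on the other
  side. The fourth powers of the two local quantities pay for the rest.\<close>

lemma swap_remainder_bound:
  fixes S \<Delta> w d :: real
  assumes d: "d \<ge> 1"
  shows "3 * S\<^sup>2 * \<Delta> * w + 3 * S * \<Delta>\<^sup>2 * w + \<Delta> ^ 3 * w \<le> S ^ 4 / (2 * d) + 8 * d * (\<Delta> ^ 4 + w ^ 4)"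
proof -
  have young: "x * y \<le> x\<^sup>2 / (4 * d) + d * y\<^sup>2" for x y
  proof -
    have "x\<^sup>2 / (4 * d) + d * y\<^sup>2 - x * y = (x - 2 * d * y)\<^sup>2 / (4 * d)"
      using d by (simp add: power2_eq_square field_simps)
    moreover have "0 \<le> (x - 2 * d * y)\<^sup>2 / (4 * d)" using d by simp
    ultimately show ?thesis by linarith
  qed
  have \<Delta>w: "\<Delta>\<^sup>2 * w\<^sup>2 \<le> (\<Delta> ^ 4 + w ^ 4) / 2"
    using zero_le_power2[of "\<Delta>\<^sup>2 - w\<^sup>2"] by (simp add: power_numeral_reduce algebra_simps)
  define P where "P = \<Delta> ^ 4 + w ^ 4"
  have P: "P \<ge> 0" "\<Delta> ^ 4 \<le> P" by (simp_all add: P_def)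
  have 1: "3 * S\<^sup>2 * \<Delta> * w \<le> S ^ 4 / (4 * d) + d * (9 / 2 * P)"
  proof -
    have "S\<^sup>2 * (3 * \<Delta> * w) \<le> (S\<^sup>2)\<^sup>2 / (4 * d) + d * (3 * \<Delta> * w)\<^sup>2" by (rule young)
    also have "(3 * \<Delta> * w)\<^sup>2 = 9 * (\<Delta>\<^sup>2 * w\<^sup>2)" by (simp add: power_mult_distrib)
    also have "(S\<^sup>2)\<^sup>2 / (4 * d) + d * (9 * (\<Delta>\<^sup>2 * w\<^sup>2)) \<le> (S\<^sup>2)\<^sup>2 / (4 * d) + d * (9 * (P / 2))"
      using \<Delta>w d unfolding P_def by (intro add_left_mono mult_left_mono) auto
    finally show ?thesis by (simp add: mult_ac flip: power_mult)
  qed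
  have 2: "3 * S * \<Delta>\<^sup>2 * w \<le> S ^ 4 / (4 * d) + d * (1 / 4 * P) + 9 / 4 * P"
  proof -
    have "2 * ((S * \<Delta>) * (3 * \<Delta> * w)) \<le> (S * \<Delta>)\<^sup>2 + (3 * \<Delta> * w)\<^sup>2"
      using zero_le_power2[of "S * \<Delta> - 3 * \<Delta> * w"] by (simp add: power2_eq_square algebra_simps)
    then have "2 * (3 * S * \<Delta>\<^sup>2 * w) \<le> (S * \<Delta>)\<^sup>2 + (3 * \<Delta> * w)\<^sup>2"
      by (simp add: power2_eq_square mult_ac)
    moreover have "(3 * \<Delta> * w)\<^sup>2 \<le> 9 * (P / 2)" using \<Delta>w by (simp add: power_mult_distrib P_def)
    moreover have "(S * \<Delta>)\<^sup>2 / 2 \<le> S ^ 4 / (4 * d) + d * (P / 4)"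
    proof -
      have "S\<^sup>2 * (\<Delta>\<^sup>2 / 2) \<le> (S\<^sup>2)\<^sup>2 / (4 * d) + d * (\<Delta>\<^sup>2 / 2)\<^sup>2" by (rule young)
      also have "\<dots> \<le> (S\<^sup>2)\<^sup>2 / (4 * d) + d * (P / 4)"
        using P d by (intro add_left_mono mult_left_mono) (auto simp: power_divide simp flip: power_mult)
      finally show ?thesis by (simp add: power_mult_distrib flip: power_mult)
    qed
    ultimately show ?thesis by (simp add: field_simps)
  qed
  have 3: "\<Delta> ^ 3 * w \<le> P"
  proof -
    have "2 * (\<Delta>\<^sup>2 * (\<Delta> * w)) \<le> (\<Delta>\<^sup>2)\<^sup>2 + (\<Delta> * w)\<^sup>2"
      using zero_le_power2[of "\<Delta>\<^sup>2 - \<Delta> * w"] by (simp add: power2_eq_square algebra_simps)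
    then have "2 * (\<Delta> ^ 3 * w) \<le> \<Delta> ^ 4 + \<Delta>\<^sup>2 * w\<^sup>2" by (simp add: power_numeral_reduce mult_ac)
    moreover have "z \<le> p" if "2 * z \<le> a + c" "c \<le> p / 2" "a \<le> p" "0 \<le> p" for z a c p :: real
      using that by linarith
    ultimately show ?thesis using \<Delta>w P unfolding P_def by blast
  qed
  \<comment> \<open>This puts the constants 9/2, 1/4, 9/4 and 1 on the same scale; they add up to
    8.\<close>
  have "P \<le> d * P" using d P mult_right_mono[of 1 d P] by simp
  with 1 2 3 have "3 * S\<^sup>2 * \<Delta> * w + 3 * S * \<Delta>\<^sup>2 * w + \<Delta> ^ 3 * w \<le> S ^ 4 / (2 * d) + 8 * (d * P)"
    by (simp add: field_simps)
  then show ?thesis by (simp add: P_def mult.assoc)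
qed

context haar_weights begin

text \<open>One normalization for both processes: \<open>c = 1\<close> centers the weights for the
  partial sums, and \<open>c = 0\<close> leaves them as they are for the randomized process, whose
  indicators are already centered.\<close>

definition W where "W c \<omega> i = sqrt n * (A \<omega> i - c / n)"

lemma W_measurable [measurable]: "(\<lambda>\<omega>. W c \<omega> i) \<in> borel_measurable M"
  unfolding W_def by measurable

lemma W_bounded:
  assumes "\<omega> \<in> space M" "0 \<le> c" "c \<le> 1"
  shows "\<bar>W c \<omega> i\<bar> \<le> sqrt n"
proof -
  have "0 \<le> c / n" "c / n \<le> 1" using assms n_pos by (auto simp: divide_le_eq)
  then have "\<bar>A \<omega> i - c / n\<bar> \<le> 1" using A_nonneg[of \<omega> i] A_le_1[OF assms(1), of i] by linarith
  then show ?thesis unfolding W_def abs_mult using mult_left_mono[of _ 1 "sqrt n"] by simp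
qed

text \<open>The cross term - 2 c and the square c^2 combine to - c exactly for these two values.
  Here \<kappa> - 1 and \<kappa> part ways as limits of the sum of squares.\<close>

lemma W_sum_squares:
  assumes \<omega>: "\<omega> \<in> space M" and c: "c = 0 \<or> c = 1"
  shows "(\<Sum>i<n. (W c \<omega> i)\<^sup>2) = n * Q \<omega> - c"
proof -
  have "(\<Sum>i<n. (W c \<omega> i)\<^sup>2) = (\<Sum>i<n. n * (A \<omega> i)\<^sup>2 - 2 * c * A \<omega> i + c * c / n)"
    unfolding W_def power_mult_distrib using n_pos by (intro sum.cong) (auto simp: power2_eq_square field_simps)
  also have "\<dots> = n * Q \<omega> - 2 * c * (\<Sum>i<n. A \<omega> i) + c * c"
    using n_pos by (simp add: sum.distrib sum_subtractf Q_def flip: sum_distrib_left)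
  finally show ?thesis using A_sum[OF \<omega>] c by auto
qed

lemma W_integrable_power:
  assumes "0 \<le> c" "c \<le> 1" shows "integrable M (\<lambda>\<omega>. W c \<omega> i ^ m)"
  by (rule A_integrableI[of _ "sqrt n ^ m"]) (auto simp: power_abs intro!: power_mono W_bounded assms)

lemma W_fourth_moment:
  assumes i: "i < n" and n6: "6 \<le> n" and c: "0 \<le> c" "c \<le> 1"
  shows "(\<integral>\<omega>. W c \<omega> i ^ 4 \<partial>M) \<le> 680 * \<kappa>\<^sup>2 / (real n)\<^sup>2"
proof -
  have s4: "sqrt n ^ 4 = (real n)\<^sup>2"
    using real_sqrt_pow2[of n] power_mult[of "sqrt n" 2 2] by simp
  have "(\<integral>\<omega>. W c \<omega> i ^ 4 \<partial>M) \<le> (\<integral>\<omega>. (real n)\<^sup>2 * (8 * (A \<omega> i ^ 4 + (c / n) ^ 4)) \<partial>M)"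
  proof (rule integral_mono[OF W_integrable_power[OF c]])
    show "W c \<omega> i ^ 4 \<le> (real n)\<^sup>2 * (8 * (A \<omega> i ^ 4 + (c / n) ^ 4))" for \<omega>
      unfolding W_def power_mult_distrib s4 by (intro mult_left_mono power4_diff_le) simp
  qed (use A_integrable_power in simp)
  also have "\<dots> = (real n)\<^sup>2 * (8 * ((\<integral>\<omega>. A \<omega> i ^ 4 \<partial>M) + (c / n) ^ 4))"
    using A_integrable_power by (simp add: prob_space)
  \<comment> \<open>The origin of 680 = 8 * 85; \<open>1 \<le> \<kappa>^2\<close> brings the term
    from c / n under the common factor.\<close>
  also have "\<dots> \<le> (real n)\<^sup>2 * (8 * (84 * \<kappa>\<^sup>2 / real n ^ 4 + \<kappa>\<^sup>2 / real n ^ 4))"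
  proof (intro mult_left_mono add_mono fourth_moment[OF i n6])
    have "c ^ 4 \<le> 1" "1 \<le> \<kappa>\<^sup>2" using c kappa by (auto simp: power_le_one one_le_power)
    then show "(c / n) ^ 4 \<le> \<kappa>\<^sup>2 / real n ^ 4" unfolding power_divide by (intro divide_right_mono) auto
  qed auto
  also have "\<dots> = 680 * \<kappa>\<^sup>2 / (real n)\<^sup>2" using n_pos by (simp add: field_simps power_numeral_reduce)
  finally show ?thesis .
qed

definition S where "S J \<omega> = (\<Sum>i\<in>J. W 1 \<omega> i)"

lemma S_measurable [measurable]: "(\<lambda>\<omega>. S J \<omega>) \<in> borel_measurable M"
  unfolding S_def by measurable

lemma S_bounded: "\<omega> \<in> space M \<Longrightarrow> \<bar>S J \<omega>\<bar> \<le> card J * sqrt n"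
  unfolding S_def using sum_bounded_above[of J "\<lambda>i. \<bar>W 1 \<omega> i\<bar>" "sqrt n"] W_bounded[of \<omega> 1]
  by (intro order_trans[OF sum_abs]) auto

lemma S_all: "\<omega> \<in> space M \<Longrightarrow> S {..<n} \<omega> = 0"
  unfolding S_def W_def using A_sum[of \<omega>] n_pos by (simp add: sum_subtractf flip: sum_distrib_left)

lemma first_moment: "i < n \<Longrightarrow> (\<integral>\<omega>. A \<omega> i \<partial>M) = 1 / n"
proof -
  assume i: "i < n"
  have eq: "(\<integral>\<omega>. A \<omega> k \<partial>M) = (\<integral>\<omega>. A \<omega> i \<partial>M)" if "k < n" for k
    using exch[OF permutes_swap_id[of i "{..<n}" k], of "\<lambda>a. a i"] i that
    by (simp add: Transposition.transpose_def)
  have "1 = (\<integral>\<omega>. (\<Sum>k<n. A \<omega> k) \<partial>M)"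
  proof -
    have "(\<integral>\<omega>. (\<Sum>k<n. A \<omega> k) \<partial>M) = (\<integral>\<omega>. 1 \<partial>M)"
      by (rule Bochner_Integration.integral_cong[OF refl]) (simp add: A_sum)
    then show ?thesis by (simp add: prob_space)
  qed
  also have "\<dots> = (\<Sum>k<n. (\<integral>\<omega>. A \<omega> k \<partial>M))" by simp
  also have "\<dots> = n * (\<integral>\<omega>. A \<omega> i \<partial>M)" using eq by simp
  finally show ?thesis using n_pos by (simp add: field_simps)
qed

text \<open>The off-diagonal covariances are never positive, since E A_i A_k = 1 / (n (n + \<kappa>
  - 1)) \<le> 1 / n^2; only the diagonal contributes.\<close>

lemma S_second_moment:
  assumes J: "J \<subseteq> {..<n}"
  shows "(\<integral>\<omega>. (S J \<omega>)\<^sup>2 \<partial>M) \<le> card J * (\<kappa> / n)"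
proof -
  have fin: "finite J" using J finite_subset by blast
  have I: "integrable M (\<lambda>\<omega>. A \<omega> i * A \<omega> k)" for i k using A_integrable_mult[of i 1 k 1] by simp
  have WW: "(\<integral>\<omega>. W 1 \<omega> i * W 1 \<omega> k \<partial>M) = n * ((\<integral>\<omega>. A \<omega> i * A \<omega> k \<partial>M) - 1 / (real n)\<^sup>2)"
    if "i < n" "k < n" for i k
  proof -
    have "(\<integral>\<omega>. W 1 \<omega> i * W 1 \<omega> k \<partial>M) = (\<integral>\<omega>. n * (A \<omega> i * A \<omega> k - A \<omega> i / n - A \<omega> k / n + 1 / (real n)\<^sup>2) \<partial>M)"
    proof (rule Bochner_Integration.integral_cong[OF refl])
      fix \<omega>
      have "sqrt n * x * (sqrt n * y) = n * (x * y)" for x y by (simp add: mult_ac flip: mult.assoc[of "sqrt n"])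
      then show "W 1 \<omega> i * W 1 \<omega> k = n * (A \<omega> i * A \<omega> k - A \<omega> i / n - A \<omega> k / n + 1 / (real n)\<^sup>2)"
        unfolding W_def by (simp add: algebra_simps power2_eq_square)
    qed
    also have "\<dots> = n * ((\<integral>\<omega>. A \<omega> i * A \<omega> k \<partial>M) - 1 / n / n - 1 / n / n + 1 / (real n)\<^sup>2)"
      using I that by (simp add: first_moment prob_space)
    finally show ?thesis by (simp add: power2_eq_square)
  qed
  have le: "(\<integral>\<omega>. W 1 \<omega> i * W 1 \<omega> k \<partial>M) \<le> (if i = k then \<kappa> / n else 0)" if ik: "i \<in> J" "k \<in> J" for i k
  proof -
    have ikn: "i < n" "k < n" using ik J by auto
    show ?thesis
    proof (cases "i = k")
      case True
      have "(\<integral>\<omega>. A \<omega> i * A \<omega> k \<partial>M) \<le> \<kappa> / (real n)\<^sup>2"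
        using second_moment_le[OF ikn(1)] True by (simp add: power2_eq_square)
      then have "n * ((\<integral>\<omega>. A \<omega> i * A \<omega> k \<partial>M) - 1 / (real n)\<^sup>2) \<le> n * (\<kappa> / (real n)\<^sup>2)"
        by (intro mult_left_mono) (auto intro: order_trans[rotated])
      also have "\<dots> = \<kappa> / n" using n_pos by (simp add: power2_eq_square)
      finally show ?thesis using True WW[OF ikn] by simp
    next
      case False
      have "(\<integral>\<omega>. A \<omega> i * A \<omega> k \<partial>M) = 1 / (n * (n + \<kappa> - 1))"
      proof -
        have "\<kappa> * (\<integral>\<omega>. A \<omega> i * A \<omega> k \<partial>M) = \<kappa> * (1 / (n * (n + \<kappa> - 1)))"
          using contract_pair[OF ikn False] second_moment[OF ikn(1)] by simp
        then show ?thesis using kappa by (simp only: mult_left_cancel) 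
      qed
      also have "\<dots> \<le> 1 / (real n)\<^sup>2" unfolding power2_eq_square
        using n_pos kappa by (intro divide_left_mono mult_left_mono mult_pos_pos) auto
      finally have "n * ((\<integral>\<omega>. A \<omega> i * A \<omega> k \<partial>M) - 1 / (real n)\<^sup>2) \<le> 0" by (simp add: mult_nonneg_nonpos)
      then show ?thesis using False WW[OF ikn] by simp
    qed
  qed
  have IW: "integrable M (\<lambda>\<omega>. W 1 \<omega> i * W 1 \<omega> k)" for i k
    by (rule A_integrableI[of _ "sqrt n * sqrt n"]) (auto simp: abs_mult intro!: mult_mono W_bounded simp del: real_sqrt_mult_self)
  have "(\<integral>\<omega>. (S J \<omega>)\<^sup>2 \<partial>M) = (\<integral>\<omega>. (\<Sum>i\<in>J. \<Sum>k\<in>J. W 1 \<omega> i * W 1 \<omega> k) \<partial>M)"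
    by (simp add: S_def power2_eq_square sum_product)
  also have "\<dots> = (\<Sum>i\<in>J. \<Sum>k\<in>J. (\<integral>\<omega>. W 1 \<omega> i * W 1 \<omega> k \<partial>M))" using IW by simp
  also have "\<dots> \<le> (\<Sum>i\<in>J. \<Sum>k\<in>J. if i = k then \<kappa> / n else 0)" by (intro sum_mono le)
  also have "\<dots> = card J * (\<kappa> / n)" using fin by simp
  finally show ?thesis .
qed

lemma S_integrable_power: "integrable M (\<lambda>\<omega>. S J \<omega> ^ m)"
  by (rule A_integrableI[of _ "(card J * sqrt n) ^ m"]) (auto simp: power_abs intro!: power_mono S_bounded)

text \<open>Exchanging one index inside \<open>J\<close> with one outside turns the two expressions
  \<open>E S\<^sup>3 W\<^sub>i\<close> and \<open>E S\<^sup>3 W\<^sub>k\<close>, whose sums are \<open>E S\<^sup>4\<close> and \<open>- E S\<^sup>4\<close>, into each other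
  up to lower-order terms.\<close>

lemma S_fourth_moment:
  assumes J: "J \<subseteq> {..<n}" and n6: "6 \<le> n"
  shows "(\<integral>\<omega>. S J \<omega> ^ 4 \<partial>M) \<le> 184960 * \<kappa>\<^sup>2 * (card J / n)\<^sup>2"
proof (cases "J = {}")
  case False
  have fin: "finite J" using J finite_subset by blast
  define d where "d = card J"
  define K where "K = {..<n} - J"
  have d1: "d \<ge> 1" using False fin by (simp add: d_def Suc_le_eq card_gt_0_iff)
  have dn: "d \<le> n" using card_mono[OF _ J] by (simp add: d_def)
  have cK: "card K = n - d" unfolding K_def d_def using J fin by (simp add: card_Diff_subset)
  let ?w = "W 1" let ?S = "S J"
  let ?M = "\<integral>\<omega>. ?S \<omega> ^ 4 \<partial>M"
  \<comment> \<open>17 = 8 * 2 + 1 counts the fourth moments of single weights in the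
    remainder.\<close>
  define q where "q = 17 * (680 * \<kappa>\<^sup>2 / (real n)\<^sup>2)"
  have SK: "(\<Sum>k\<in>K. ?w \<omega> k) = - ?S \<omega>" if "\<omega> \<in> space M" for \<omega>
    using S_all[OF that] sum.subset_diff[of J "{..<n}" "?w \<omega>"] J unfolding S_def K_def by simp
  have bd: "\<bar>?w \<omega> i\<bar> \<le> sqrt n" if "\<omega> \<in> space M" for \<omega> i using W_bounded[OF that] by simp
  have I3: "integrable M (\<lambda>\<omega>. ?S \<omega> ^ 3 * ?w \<omega> i)" for i
    by (rule A_integrableI[of _ "(card J * sqrt n) ^ 3 * sqrt n"])
      (auto simp: abs_mult power_abs intro!: mult_mono power_mono S_bounded bd)
  have Irem: "integrable M (\<lambda>\<omega>. (?S \<omega> + (?w \<omega> k - ?w \<omega> i)) ^ 3 * ?w \<omega> k)" for i k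
  proof (rule A_integrableI[of _ "(card J * sqrt n + (sqrt n + sqrt n)) ^ 3 * sqrt n"])
    fix \<omega> assume \<omega>: "\<omega> \<in> space M"
    have "\<bar>?S \<omega> + (?w \<omega> k - ?w \<omega> i)\<bar> \<le> card J * sqrt n + (sqrt n + sqrt n)"
      using S_bounded[OF \<omega>, of J] bd[OF \<omega>, of k] bd[OF \<omega>, of i] by linarith
    then show "\<bar>(?S \<omega> + (?w \<omega> k - ?w \<omega> i)) ^ 3 * ?w \<omega> k\<bar> \<le> (card J * sqrt n + (sqrt n + sqrt n)) ^ 3 * sqrt n"
      unfolding abs_mult power_abs using bd[OF \<omega>] by (intro mult_mono power_mono) auto
  qed measurable
  have pair: "(\<integral>\<omega>. ?S \<omega> ^ 3 * ?w \<omega> i \<partial>M) \<le> (\<integral>\<omega>. ?S \<omega> ^ 3 * ?w \<omega> k \<partial>M) + (?M / (2 * d) + 8 * d * q)"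
    if ik: "i \<in> J" "k \<in> K" for i k
  proof -
    have ikn: "i < n" "k < n" "i \<noteq> k" "k \<notin> J" using ik J by (auto simp: K_def)
    define f where "f a = (\<Sum>j\<in>J. sqrt n * (a j - 1 / n)) ^ 3 * (sqrt n * (a i - 1 / n))" for a :: "nat \<Rightarrow> real"
    have fm: "f \<in> borel_measurable borel" unfolding f_def by measurable
    have "(\<integral>\<omega>. ?S \<omega> ^ 3 * ?w \<omega> i \<partial>M) = (\<integral>\<omega>. f (A \<omega>) \<partial>M)" by (simp add: f_def S_def W_def)
    also have "\<dots> = (\<integral>\<omega>. f (\<lambda>j. A \<omega> (Transposition.transpose i k j)) \<partial>M)"
      using exch[OF permutes_swap_id[of i "{..<n}" k] fm] ikn by simp
    also have "\<dots> = (\<integral>\<omega>. (?S \<omega> + (?w \<omega> k - ?w \<omega> i)) ^ 3 * ?w \<omega> k \<partial>M)"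
    proof (rule Bochner_Integration.integral_cong[OF refl])
      fix \<omega>
      \<comment> \<open>The transposition replaces the one summand with index \<open>i\<close> by
        the one with index \<open>k\<close> and leaves the others alone.\<close>
      have "(\<Sum>j\<in>J. sqrt n * (A \<omega> (Transposition.transpose i k j) - 1 / n)) =
        ?w \<omega> k + (\<Sum>j\<in>J - {i}. sqrt n * (A \<omega> (Transposition.transpose i k j) - 1 / n))"
        using fin ik by (subst sum.remove[of J i]) (auto simp: W_def Transposition.transpose_def)
      also have "(\<Sum>j\<in>J - {i}. sqrt n * (A \<omega> (Transposition.transpose i k j) - 1 / n)) = (\<Sum>j\<in>J - {i}. ?w \<omega> j)"
        using ikn by (intro sum.cong) (auto simp: W_def Transposition.transpose_def)
      also have "\<dots> = ?S \<omega> - ?w \<omega> i" unfolding S_def using fin ik by (simp add: sum_diff1)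
      finally have "(\<Sum>j\<in>J. sqrt n * (A \<omega> (Transposition.transpose i k j) - 1 / n)) = ?S \<omega> + (?w \<omega> k - ?w \<omega> i)"
        by simp
      then show "f (\<lambda>j. A \<omega> (Transposition.transpose i k j)) = (?S \<omega> + (?w \<omega> k - ?w \<omega> i)) ^ 3 * ?w \<omega> k"
        unfolding f_def by (simp only: W_def[of 1 \<omega> k] Transposition.transpose_apply_first)
    qed
    also have "\<dots> \<le> (\<integral>\<omega>. ?S \<omega> ^ 3 * ?w \<omega> k + (?S \<omega> ^ 4 / (2 * d) + 8 * d * (8 * (?w \<omega> k ^ 4 + ?w \<omega> i ^ 4) + ?w \<omega> k ^ 4)) \<partial>M)"
    proof (rule integral_mono[OF Irem])
      show "integrable M (\<lambda>\<omega>. ?S \<omega> ^ 3 * ?w \<omega> k + (?S \<omega> ^ 4 / (2 * d) + 8 * d * (8 * (?w \<omega> k ^ 4 + ?w \<omega> i ^ 4) + ?w \<omega> k ^ 4)))"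
        using I3 S_integrable_power[of J 4] W_integrable_power[of 1 _ 4] by simp
      fix \<omega>
      define \<Delta> where "\<Delta> = ?w \<omega> k - ?w \<omega> i"
      have "(?S \<omega> + \<Delta>) ^ 3 * ?w \<omega> k = ?S \<omega> ^ 3 * ?w \<omega> k +
          (3 * (?S \<omega>)\<^sup>2 * \<Delta> * ?w \<omega> k + 3 * ?S \<omega> * \<Delta>\<^sup>2 * ?w \<omega> k + \<Delta> ^ 3 * ?w \<omega> k)"
        by (simp add: power_numeral_reduce algebra_simps)
      also have "\<dots> \<le> ?S \<omega> ^ 3 * ?w \<omega> k + (?S \<omega> ^ 4 / (2 * d) + 8 * d * (\<Delta> ^ 4 + ?w \<omega> k ^ 4))"
        using swap_remainder_bound[of d "?S \<omega>" \<Delta> "?w \<omega> k"] d1 by simp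
      also have "\<dots> \<le> ?S \<omega> ^ 3 * ?w \<omega> k + (?S \<omega> ^ 4 / (2 * d) + 8 * d * (8 * (?w \<omega> k ^ 4 + ?w \<omega> i ^ 4) + ?w \<omega> k ^ 4))"
        unfolding \<Delta>_def by (intro add_left_mono mult_left_mono add_right_mono power4_diff_le) auto
      finally show "(?S \<omega> + (?w \<omega> k - ?w \<omega> i)) ^ 3 * ?w \<omega> k \<le>
          ?S \<omega> ^ 3 * ?w \<omega> k + (?S \<omega> ^ 4 / (2 * d) + 8 * d * (8 * (?w \<omega> k ^ 4 + ?w \<omega> i ^ 4) + ?w \<omega> k ^ 4))"
        unfolding \<Delta>_def .
    qed
    also have "\<dots> = (\<integral>\<omega>. ?S \<omega> ^ 3 * ?w \<omega> k \<partial>M) + (?M / (2 * d) +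
        8 * d * (8 * ((\<integral>\<omega>. ?w \<omega> k ^ 4 \<partial>M) + (\<integral>\<omega>. ?w \<omega> i ^ 4 \<partial>M)) + (\<integral>\<omega>. ?w \<omega> k ^ 4 \<partial>M)))"
      using I3 S_integrable_power[of J 4] W_integrable_power[of 1 _ 4] by simp
    also have "\<dots> \<le> (\<integral>\<omega>. ?S \<omega> ^ 3 * ?w \<omega> k \<partial>M) + (?M / (2 * d) + 8 * d * q)"
    proof (intro add_left_mono mult_left_mono)
      show "8 * ((\<integral>\<omega>. ?w \<omega> k ^ 4 \<partial>M) + (\<integral>\<omega>. ?w \<omega> i ^ 4 \<partial>M)) + (\<integral>\<omega>. ?w \<omega> k ^ 4 \<partial>M) \<le> q"
        using W_fourth_moment[of k 1] W_fourth_moment[of i 1] ikn n6 unfolding q_def by simp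
    qed simp
    finally show ?thesis .
  qed
  have s1: "(\<Sum>i\<in>J. (\<integral>\<omega>. ?S \<omega> ^ 3 * ?w \<omega> i \<partial>M)) = ?M"
  proof -
    have "(\<Sum>i\<in>J. (\<integral>\<omega>. ?S \<omega> ^ 3 * ?w \<omega> i \<partial>M)) = (\<integral>\<omega>. (\<Sum>i\<in>J. ?S \<omega> ^ 3 * ?w \<omega> i) \<partial>M)" using I3 by simp
    also have "\<dots> = ?M"
      unfolding sum_distrib_left[symmetric] S_def[symmetric] by (simp add: power_numeral_reduce mult_ac)
    finally show ?thesis .
  qed
  have s2: "(\<Sum>k\<in>K. (\<integral>\<omega>. ?S \<omega> ^ 3 * ?w \<omega> k \<partial>M)) = - ?M"
  proof -
    have "(\<Sum>k\<in>K. (\<integral>\<omega>. ?S \<omega> ^ 3 * ?w \<omega> k \<partial>M)) = (\<integral>\<omega>. (\<Sum>k\<in>K. ?S \<omega> ^ 3 * ?w \<omega> k) \<partial>M)" using I3 by simp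
    also have "\<dots> = (\<integral>\<omega>. - (?S \<omega> ^ 4) \<partial>M)"
      by (rule Bochner_Integration.integral_cong[OF refl]) (simp add: SK power_numeral_reduce mult_ac flip: sum_distrib_left)
    finally show ?thesis by simp
  qed
  \<comment> \<open>Over all pairs the left side is (n - d) E S^4, and the first terms on the right
    give - d E S^4. Hence n E S^4 is at most half of itself plus a remainder.\<close>
  have "(\<Sum>k\<in>K. \<Sum>i\<in>J. (\<integral>\<omega>. ?S \<omega> ^ 3 * ?w \<omega> i \<partial>M)) \<le>
      (\<Sum>k\<in>K. \<Sum>i\<in>J. (\<integral>\<omega>. ?S \<omega> ^ 3 * ?w \<omega> k \<partial>M) + (?M / (2 * d) + 8 * d * q))"
    by (intro sum_mono pair)
  also have "\<dots> = d * - ?M + (n - d) * (d * (?M / (2 * d) + 8 * d * q))"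
    using cK s2 by (simp add: sum.distrib d_def[symmetric] distrib_left of_nat_diff[OF dn] flip: sum_distrib_left)
  finally have "real (n - d) * ?M \<le> d * - ?M + real (n - d) * (d * (?M / (2 * d) + 8 * d * q))"
    using cK s1 by simp
  moreover have "real (n - d) * (d * (?M / (2 * d) + 8 * d * q)) \<le> n * (?M / 2 + 8 * (real d)\<^sup>2 * q)"
  proof -
    have "d * (?M / (2 * d) + 8 * d * q) = ?M / 2 + 8 * (real d)\<^sup>2 * q"
      using d1 by (simp add: field_simps power2_eq_square)
    moreover have "0 \<le> ?M / 2 + 8 * (real d)\<^sup>2 * q"
      by (intro add_nonneg_nonneg mult_nonneg_nonneg divide_nonneg_nonneg integral_nonneg_AE AE_I2) (auto simp: q_def)
    ultimately show ?thesis using mult_right_mono[of "real (n - d)" n] by simp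
  qed
  ultimately have "real (n - d) * ?M + d * ?M \<le> n * (?M / 2 + 8 * (real d)\<^sup>2 * q)" by simp
  then have "n * ?M \<le> n * (?M / 2 + 8 * (real d)\<^sup>2 * q)"
    using dn by (simp add: of_nat_diff algebra_simps)
  then have "?M \<le> ?M / 2 + 8 * (real d)\<^sup>2 * q" using n_pos by simp
  \<comment> \<open>16 * 17 * 680 = 184960.\<close>
  then have "?M \<le> 16 * (real d)\<^sup>2 * q" by simp
  also have "\<dots> = 184960 * \<kappa>\<^sup>2 * (card J / n)\<^sup>2" by (simp add: q_def d_def power_divide)
  finally show ?thesis .
qed (simp add: S_def)

end

section \<open>The conditional central limit theorem\<close>

text \<open>Independence makes the joint law a product measure, so Fubini's theorem applies; pulled
  back to \<open>M\<close>, conditioning becomes integration over a second sample point. Both orders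
  are used: freezing the column for the limit theorem, and freezing the uniform variables for
  exchangeability.\<close>

lemma decoupling:
  fixes h :: "'s \<times> 't \<Rightarrow> real"
  assumes M: "prob_space M" and ind: "independent_variables M S X T Y"
    and h: "h \<in> borel_measurable (S \<Otimes>\<^sub>M T)" and int: "integrable M (\<lambda>\<omega>. h (X \<omega>, Y \<omega>))"
  shows "(\<integral>\<omega>. h (X \<omega>, Y \<omega>) \<partial>M) = (\<integral>\<omega>. (\<integral>\<omega>'. h (X \<omega>, Y \<omega>') \<partial>M) \<partial>M)"
    and "(\<integral>\<omega>. h (X \<omega>, Y \<omega>) \<partial>M) = (\<integral>\<omega>'. (\<integral>\<omega>. h (X \<omega>, Y \<omega>') \<partial>M) \<partial>M)"
    and "integrable M (\<lambda>\<omega>. \<integral>\<omega>'. h (X \<omega>, Y \<omega>') \<partial>M)"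
    and "integrable M (\<lambda>\<omega>'. \<integral>\<omega>. h (X \<omega>, Y \<omega>') \<partial>M)"
proof -
  interpret prob_space M by (rule M)
  have X[measurable]: "X \<in> M \<rightarrow>\<^sub>M S" and Y[measurable]: "Y \<in> M \<rightarrow>\<^sub>M T"
    and ist: "indep_set {X -` A \<inter> space M | A. A \<in> sets S} {Y -` A \<inter> space M | A. A \<in> sets T}"
    using ind by (auto simp: independent_variables_def)
  let ?D1 = "distr M S X" and ?D2 = "distr M T Y" and ?D = "distr M (S \<Otimes>\<^sub>M T) (\<lambda>\<omega>. (X \<omega>, Y \<omega>))"
  interpret D1: prob_space ?D1 by (rule prob_space_distr[OF X])
  interpret D2: prob_space ?D2 by (rule prob_space_distr[OF Y])
  interpret P: pair_prob_space ?D1 ?D2 ..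
  have eq: "?D1 \<Otimes>\<^sub>M ?D2 = ?D"
  proof (rule pair_measure_eqI)
    fix A B assume "A \<in> sets ?D1" "B \<in> sets ?D2"
    then have AB[measurable]: "A \<in> sets S" "B \<in> sets T" by auto
    have "emeasure ?D (A \<times> B) = emeasure M ((X -` A \<inter> space M) \<inter> (Y -` B \<inter> space M))"
      by (subst emeasure_distr) (auto intro!: arg_cong[where f = "emeasure M"])
    also have "\<dots> = ennreal (prob (X -` A \<inter> space M) * prob (Y -` B \<inter> space M))"
      unfolding emeasure_eq_measure using AB by (subst indep_setD[OF ist]) auto
    also have "\<dots> = emeasure ?D1 A * emeasure ?D2 B"
      by (simp add: emeasure_distr emeasure_eq_measure ennreal_mult)
    finally show "emeasure ?D1 A * emeasure ?D2 B = emeasure ?D (A \<times> B)" by simp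
  qed (auto intro: D1.sigma_finite_measure_axioms D2.sigma_finite_measure_axioms)
  have pm: "(\<lambda>\<omega>. (X \<omega>, Y \<omega>)) \<in> M \<rightarrow>\<^sub>M S \<Otimes>\<^sub>M T" by measurable
  have I: "integrable (?D1 \<Otimes>\<^sub>M ?D2) h" unfolding eq using int by (subst integrable_distr_eq[OF pm h]) 
  have I': "integrable (?D1 \<Otimes>\<^sub>M ?D2) (\<lambda>(x, y). h (x, y))" using I by simp
  have E: "(\<integral>\<omega>. h (X \<omega>, Y \<omega>) \<partial>M) = (\<integral>z. h z \<partial>(?D1 \<Otimes>\<^sub>M ?D2))"
    unfolding eq by (rule integral_distr[OF pm h, symmetric])
  have sec1: "(\<lambda>y. h (x, y)) \<in> borel_measurable T" if "x \<in> space S" for x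
    using h that by simp
  have sec2: "(\<lambda>x. h (x, y)) \<in> borel_measurable S" if "y \<in> space T" for y
    using h that by simp
  have in1: "(\<integral>y. h (x, y) \<partial>?D2) = (\<integral>\<omega>'. h (x, Y \<omega>') \<partial>M)" if "x \<in> space S" for x
    by (rule integral_distr[OF Y sec1[OF that]])
  have in2: "(\<integral>x. h (x, y) \<partial>?D1) = (\<integral>\<omega>. h (X \<omega>, y) \<partial>M)" if "y \<in> space T" for y
    by (rule integral_distr[OF X sec2[OF that]])
  have m1: "(\<lambda>x. \<integral>y. h (x, y) \<partial>?D2) \<in> borel_measurable S"
    using D2.borel_measurable_lebesgue_integral[of "\<lambda>x y. h (x, y)" S] h by (simp cong: measurable_cong_sets)
  have m2: "(\<lambda>y. \<integral>x. h (x, y) \<partial>?D1) \<in> borel_measurable T"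
  proof -
    have "(\<lambda>(y, x). h (x, y)) \<in> borel_measurable (T \<Otimes>\<^sub>M S)" using h by measurable
    then show ?thesis
      using D1.borel_measurable_lebesgue_integral[of "\<lambda>y x. h (x, y)" T] by (simp cong: measurable_cong_sets)
  qed
  have "(\<integral>z. h z \<partial>(?D1 \<Otimes>\<^sub>M ?D2)) = (\<integral>x. \<integral>y. h (x, y) \<partial>?D2 \<partial>?D1)"
    by (rule P.integral_fst'[OF I, symmetric])
  also have "\<dots> = (\<integral>\<omega>. (\<integral>y. h (X \<omega>, y) \<partial>?D2) \<partial>M)"
    by (rule integral_distr[OF X m1])
  also have "\<dots> = (\<integral>\<omega>. (\<integral>\<omega>'. h (X \<omega>, Y \<omega>') \<partial>M) \<partial>M)"
    by (intro Bochner_Integration.integral_cong refl in1 measurable_space[OF X])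
  finally show "(\<integral>\<omega>. h (X \<omega>, Y \<omega>) \<partial>M) = (\<integral>\<omega>. (\<integral>\<omega>'. h (X \<omega>, Y \<omega>') \<partial>M) \<partial>M)" using E by simp
  have "(\<integral>z. h z \<partial>(?D1 \<Otimes>\<^sub>M ?D2)) = (\<integral>y. \<integral>x. h (x, y) \<partial>?D1 \<partial>?D2)"
    using P.integral_snd[of "\<lambda>x y. h (x, y)"] I' by simp
  also have "\<dots> = (\<integral>\<omega>'. (\<integral>x. h (x, Y \<omega>') \<partial>?D1) \<partial>M)"
    by (rule integral_distr[OF Y m2])
  also have "\<dots> = (\<integral>\<omega>'. (\<integral>\<omega>. h (X \<omega>, Y \<omega>') \<partial>M) \<partial>M)"
    by (intro Bochner_Integration.integral_cong refl in2 measurable_space[OF Y])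
  finally show "(\<integral>\<omega>. h (X \<omega>, Y \<omega>) \<partial>M) = (\<integral>\<omega>'. (\<integral>\<omega>. h (X \<omega>, Y \<omega>') \<partial>M) \<partial>M)" using E by simp
  have "integrable ?D1 (\<lambda>x. \<integral>y. h (x, y) \<partial>?D2)" by (rule P.integrable_fst'[OF I])
  then have "integrable M (\<lambda>\<omega>. \<integral>y. h (X \<omega>, y) \<partial>?D2)" by (subst (asm) integrable_distr_eq[OF X m1])
  then show "integrable M (\<lambda>\<omega>. \<integral>\<omega>'. h (X \<omega>, Y \<omega>') \<partial>M)"
    by (rule Bochner_Integration.integrable_cong[THEN iffD1, rotated 2]) (auto intro: in1 measurable_space[OF X])
  have "integrable ?D2 (\<lambda>y. \<integral>x. h (x, y) \<partial>?D1)"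
    using P.integrable_snd[of "\<lambda>x y. h (x, y)"] I' by simp
  then have "integrable M (\<lambda>\<omega>'. \<integral>x. h (x, Y \<omega>') \<partial>?D1)" by (subst (asm) integrable_distr_eq[OF Y m2])
  then show "integrable M (\<lambda>\<omega>'. \<integral>\<omega>. h (X \<omega>, Y \<omega>') \<partial>M)"
    by (rule Bochner_Integration.integrable_cong[THEN iffD1, rotated 2]) (auto intro: in2 measurable_space[OF Y])
qed

text \<open>Events of a function of \<open>X\<close> are among the events of \<open>X\<close>. The
  equation is asked for on \<open>space M\<close> only, so \<open>X'\<close> may take default values
  elsewhere.\<close>

lemma independent_variables_compose:
  assumes M: "prob_space M" and ind: "independent_variables M S X T Y" and f: "f \<in> S \<rightarrow>\<^sub>M S'"
    and X': "\<And>\<omega>. \<omega> \<in> space M \<Longrightarrow> X' \<omega> = f (X \<omega>)"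
  shows "independent_variables M S' X' T Y"
proof -
  interpret prob_space M by (rule M)
  have X: "X \<in> M \<rightarrow>\<^sub>M S" and Y: "Y \<in> M \<rightarrow>\<^sub>M T"
    and ist: "indep_set {X -` A \<inter> space M | A. A \<in> sets S} {Y -` A \<inter> space M | A. A \<in> sets T}"
    using ind by (auto simp: independent_variables_def)
  have "(\<lambda>\<omega>. f (X \<omega>)) \<in> M \<rightarrow>\<^sub>M S'" by (rule measurable_compose[OF X f])
  then have X'm: "X' \<in> M \<rightarrow>\<^sub>M S'" by (rule measurable_cong[THEN iffD1, rotated]) (simp add: X')
  have sub: "{X' -` A \<inter> space M | A. A \<in> sets S'} \<subseteq> {X -` A \<inter> space M | A. A \<in> sets S}"
  proof clarify
    fix A assume "A \<in> sets S'"
    then have "f -` A \<inter> space S \<in> sets S" by (rule measurable_sets[OF f])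
    moreover have "X' -` A \<inter> space M = X -` (f -` A \<inter> space S) \<inter> space M"
      using X' measurable_space[OF X] by auto
    ultimately show "\<exists>B. X' -` A \<inter> space M = X -` B \<inter> space M \<and> B \<in> sets S" by blast
  qed
  have "indep_set {X' -` A \<inter> space M | A. A \<in> sets S'} {Y -` A \<inter> space M | A. A \<in> sets T}"
    using ist unfolding indep_set_def
    by (rule indep_sets_mono_sets) (use sub in \<open>auto split: bool.splits\<close>)
  with X'm Y show ?thesis unfolding independent_variables_def by blast
qed

section \<open>Weighted sums of functions of the uniform variables\<close>

locale bridge_setting = haar_weights +
  fixes R :: "nat \<Rightarrow> 'a \<Rightarrow> real"
  assumes R_indep: "indep_vars (\<lambda>_. borel) R {..<n}"
    and R_unif: "\<And>i. i < n \<Longrightarrow> distr M borel (R i) = uniform_measure lborel {0..1}"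
    and A_R_indep: "independent_variables M borel A (\<Pi>\<^sub>M _\<in>{..<n}. borel) (\<lambda>\<omega>. \<lambda>i\<in>{..<n}. R i \<omega>)"
begin

lemma R_measurable: "i < n \<Longrightarrow> R i \<in> borel_measurable M"
  using R_indep unfolding indep_vars_def by auto

lemma R_integral:
  fixes f :: "real \<Rightarrow> 'c :: {banach, second_countable_topology}"
  assumes "i < n" "f \<in> borel_measurable borel"
  shows "(\<integral>\<omega>. f (R i \<omega>) \<partial>M) = (\<integral>x. f x \<partial>uniform_measure lborel {0..1})"
  using integral_distr[OF R_measurable[OF assms(1)] assms(2)] R_unif[OF assms(1)] by simp

text \<open>Induction on the index set. With a new independent summand z, every cross term that
  contains z or the old sum T to the first power vanishes. The surviving term 6 E z^2 E T^2 fits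
  into 3 \<delta>^2 times the square of the enlarged sum, and z^4 \<le> w_j^2 z^2 keeps a factor
  \<delta> in the rest.\<close>

lemma independent_sum_moments:
  fixes w :: "nat \<Rightarrow> real" and \<zeta> :: "real \<Rightarrow> real"
  assumes \<zeta>[measurable]: "\<zeta> \<in> borel_measurable borel" and b: "\<And>x. \<bar>\<zeta> x\<bar> \<le> 1"
    and m: "(\<integral>x. \<zeta> x \<partial>uniform_measure lborel {0..1}) = 0"
    and v: "(\<integral>x. (\<zeta> x)\<^sup>2 \<partial>uniform_measure lborel {0..1}) \<le> \<delta>"
    and I: "I \<subseteq> {..<n}"
  shows "(\<integral>\<omega>. (\<Sum>i\<in>I. w i * \<zeta> (R i \<omega>)) \<partial>M) = 0 \<and>
    (\<integral>\<omega>. (\<Sum>i\<in>I. w i * \<zeta> (R i \<omega>))\<^sup>2 \<partial>M) \<le> \<delta> * (\<Sum>i\<in>I. (w i)\<^sup>2) \<and>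
    (\<integral>\<omega>. (\<Sum>i\<in>I. w i * \<zeta> (R i \<omega>)) ^ 4 \<partial>M) \<le> 3 * \<delta>\<^sup>2 * (\<Sum>i\<in>I. (w i)\<^sup>2)\<^sup>2 + \<delta> * (\<Sum>i\<in>I. w i ^ 4)"
proof -
  have "finite I" using I finite_subset by blast
  then show ?thesis using I
  proof (induction I rule: finite_induct)
    case (insert j I)
    define T where "T \<omega> = (\<Sum>i\<in>I. w i * \<zeta> (R i \<omega>))" for \<omega>
    define z where "z \<omega> = w j * \<zeta> (R j \<omega>)" for \<omega>
    have jn: "j < n" and In: "I \<subseteq> {..<n}" using insert.prems by auto
    note R_measurable[OF jn, measurable]
    have Rm: "R i \<in> borel_measurable M" if "i \<in> I" for i using R_measurable In that by auto
    have Tm[measurable]: "T \<in> borel_measurable M"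
      unfolding T_def[abs_def]
      by (intro borel_measurable_sum borel_measurable_times borel_measurable_const measurable_compose[OF Rm \<zeta>])
    have zm[measurable]: "z \<in> borel_measurable M" unfolding z_def[abs_def] by measurable
    have zb: "\<bar>z \<omega>\<bar> \<le> \<bar>w j\<bar>" for \<omega> unfolding z_def abs_mult using mult_left_mono[OF b[of "R j \<omega>"], of "\<bar>w j\<bar>"] by simp
    have Tb: "\<bar>T \<omega>\<bar> \<le> (\<Sum>i\<in>I. \<bar>w i\<bar>)" for \<omega>
      unfolding T_def using b by (intro order_trans[OF sum_abs] sum_mono) (simp add: abs_mult mult_left_le)
    have Tp: "integrable M (\<lambda>\<omega>. T \<omega> ^ k)" for k
      by (rule A_integrableI[of _ "(\<Sum>i\<in>I. \<bar>w i\<bar>) ^ k"]) (auto simp: power_abs intro!: power_mono Tb)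
    have zp: "integrable M (\<lambda>\<omega>. z \<omega> ^ k)" for k
      by (rule A_integrableI[of _ "\<bar>w j\<bar> ^ k"]) (auto simp: power_abs intro!: power_mono zb)
    have "indep_vars (\<lambda>_. borel) (\<lambda>i \<omega>. w i * \<zeta> (R i \<omega>)) {..<n}"
      by (rule indep_vars_compose2[OF R_indep]) measurable
    then have "indep_vars (\<lambda>_. borel) (\<lambda>i \<omega>. w i * \<zeta> (R i \<omega>)) (insert j I)"
      by (rule indep_vars_subset) (use insert.prems in auto)
    from indep_vars_sum[OF insert.hyps this] have zT: "indep_var borel z borel T"
      unfolding z_def[abs_def] T_def[abs_def] by simp
    have prod: "(\<integral>\<omega>. z \<omega> ^ k * T \<omega> ^ l \<partial>M) = (\<integral>\<omega>. z \<omega> ^ k \<partial>M) * (\<integral>\<omega>. T \<omega> ^ l \<partial>M)"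
      and Ip: "integrable M (\<lambda>\<omega>. z \<omega> ^ k * T \<omega> ^ l)" for k l
    proof -
      have "indep_var borel ((\<lambda>x. x ^ k) \<circ> z) borel ((\<lambda>x. x ^ l) \<circ> T)"
        by (rule indep_var_compose[OF zT]) measurable
      then have i: "indep_var borel (\<lambda>\<omega>. z \<omega> ^ k) borel (\<lambda>\<omega>. T \<omega> ^ l)" by (simp add: comp_def)
      show "(\<integral>\<omega>. z \<omega> ^ k * T \<omega> ^ l \<partial>M) = (\<integral>\<omega>. z \<omega> ^ k \<partial>M) * (\<integral>\<omega>. T \<omega> ^ l \<partial>M)"
        by (rule indep_var_lebesgue_integral[OF i zp Tp])
      show "integrable M (\<lambda>\<omega>. z \<omega> ^ k * T \<omega> ^ l)" by (rule indep_var_integrable[OF i zp Tp])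
    qed
    have z1: "(\<integral>\<omega>. z \<omega> \<partial>M) = 0" using R_integral[OF jn \<zeta>] m by (simp add: z_def)
    have z2: "(\<integral>\<omega>. (z \<omega>)\<^sup>2 \<partial>M) \<le> \<delta> * (w j)\<^sup>2"
    proof -
      have "(\<integral>\<omega>. (z \<omega>)\<^sup>2 \<partial>M) = (w j)\<^sup>2 * (\<integral>x. (\<zeta> x)\<^sup>2 \<partial>uniform_measure lborel {0..1})"
        using R_integral[OF jn, of "\<lambda>x. (\<zeta> x)\<^sup>2"] by (simp add: z_def power_mult_distrib)
      also have "\<dots> \<le> (w j)\<^sup>2 * \<delta>" using v by (rule mult_left_mono) simp
      finally show ?thesis by (simp add: mult.commute)
    qed
    have z4: "(\<integral>\<omega>. z \<omega> ^ 4 \<partial>M) \<le> \<delta> * w j ^ 4"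
    proof -
      have "(\<integral>\<omega>. z \<omega> ^ 4 \<partial>M) \<le> (\<integral>\<omega>. (w j)\<^sup>2 * (z \<omega>)\<^sup>2 \<partial>M)"
      proof (rule integral_mono[OF zp])
        fix \<omega>
        have "(z \<omega>)\<^sup>2 \<le> (w j)\<^sup>2" using zb[of \<omega>] by (simp add: abs_le_square_iff)
        then have "(z \<omega>)\<^sup>2 * (z \<omega>)\<^sup>2 \<le> (w j)\<^sup>2 * (z \<omega>)\<^sup>2" by (rule mult_right_mono) simp
        then show "z \<omega> ^ 4 \<le> (w j)\<^sup>2 * (z \<omega>)\<^sup>2" by (simp flip: power_add)
      qed (use zp in simp)
      also have "\<dots> \<le> (w j)\<^sup>2 * (\<delta> * (w j)\<^sup>2)" using z2 zp[of 2] by (simp add: mult_left_mono)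
      finally show ?thesis by (simp add: power_numeral_reduce mult_ac)
    qed
    have IH: "(\<integral>\<omega>. T \<omega> \<partial>M) = 0" "(\<integral>\<omega>. (T \<omega>)\<^sup>2 \<partial>M) \<le> \<delta> * (\<Sum>i\<in>I. (w i)\<^sup>2)"
      "(\<integral>\<omega>. T \<omega> ^ 4 \<partial>M) \<le> 3 * \<delta>\<^sup>2 * (\<Sum>i\<in>I. (w i)\<^sup>2)\<^sup>2 + \<delta> * (\<Sum>i\<in>I. w i ^ 4)"
      using insert.IH[OF In] unfolding T_def by auto
    have sum: "(\<Sum>i\<in>insert j I. w i * \<zeta> (R i \<omega>)) = z \<omega> + T \<omega>" for \<omega>
      using insert.hyps by (simp add: z_def T_def)
    have e1: "(\<integral>\<omega>. z \<omega> + T \<omega> \<partial>M) = 0" using z1 IH zp[of 1] Tp[of 1] by simp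
    have "(\<integral>\<omega>. (z \<omega> + T \<omega>)\<^sup>2 \<partial>M) = (\<integral>\<omega>. z \<omega> ^ 2 * T \<omega> ^ 0 + 2 * (z \<omega> ^ 1 * T \<omega> ^ 1) + z \<omega> ^ 0 * T \<omega> ^ 2 \<partial>M)"
      by (simp add: power2_sum mult_ac add_ac)
    also have "\<dots> = (\<integral>\<omega>. z \<omega> ^ 2 \<partial>M) + (\<integral>\<omega>. T \<omega> ^ 2 \<partial>M)"
      using prod[of 1 1] Ip[of 2 0] Ip[of 1 1] Ip[of 0 2] z1 by simp
    finally have e2: "(\<integral>\<omega>. (z \<omega> + T \<omega>)\<^sup>2 \<partial>M) \<le> \<delta> * ((w j)\<^sup>2 + (\<Sum>i\<in>I. (w i)\<^sup>2))"
      using z2 IH by (simp add: distrib_left)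
    have "(\<integral>\<omega>. (z \<omega> + T \<omega>) ^ 4 \<partial>M) = (\<integral>\<omega>. z \<omega> ^ 4 * T \<omega> ^ 0 + 4 * (z \<omega> ^ 3 * T \<omega> ^ 1) + 6 * (z \<omega> ^ 2 * T \<omega> ^ 2)
        + 4 * (z \<omega> ^ 1 * T \<omega> ^ 3) + z \<omega> ^ 0 * T \<omega> ^ 4 \<partial>M)"
      by (rule Bochner_Integration.integral_cong[OF refl]) (simp add: power_numeral_reduce algebra_simps)
    also have "\<dots> = (\<integral>\<omega>. z \<omega> ^ 4 \<partial>M) + 6 * ((\<integral>\<omega>. z \<omega> ^ 2 \<partial>M) * (\<integral>\<omega>. T \<omega> ^ 2 \<partial>M)) + (\<integral>\<omega>. T \<omega> ^ 4 \<partial>M)"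
      using prod[of 3 1] prod[of 2 2] prod[of 1 3] Ip[of 4 0] Ip[of 3 1] Ip[of 2 2] Ip[of 1 3] Ip[of 0 4] z1 IH(1) by simp
    also have "\<dots> \<le> \<delta> * w j ^ 4 + 6 * ((\<delta> * (w j)\<^sup>2) * (\<delta> * (\<Sum>i\<in>I. (w i)\<^sup>2)))
        + (3 * \<delta>\<^sup>2 * (\<Sum>i\<in>I. (w i)\<^sup>2)\<^sup>2 + \<delta> * (\<Sum>i\<in>I. w i ^ 4))"
    proof (intro add_mono z4 IH mult_left_mono mult_mono z2)
      show "0 \<le> \<delta> * (w j)\<^sup>2" by (rule order_trans[OF _ z2]) (simp add: integral_nonneg_AE)
      show "0 \<le> (\<integral>\<omega>. T \<omega> ^ 2 \<partial>M)" by (simp add: integral_nonneg_AE)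
    qed simp
    also have "\<dots> \<le> 3 * \<delta>\<^sup>2 * ((w j)\<^sup>2 + (\<Sum>i\<in>I. (w i)\<^sup>2))\<^sup>2 + \<delta> * (w j ^ 4 + (\<Sum>i\<in>I. w i ^ 4))"
    proof -
      define s where "s = (\<Sum>i\<in>I. (w i)\<^sup>2)"
      have "0 \<le> 3 * \<delta>\<^sup>2 * ((w j)\<^sup>2)\<^sup>2" by simp
      then show ?thesis unfolding s_def[symmetric] by (simp add: power2_sum distrib_left power_numeral_reduce algebra_simps)
    qed
    finally show ?case using e1 e2 insert.hyps unfolding sum by simp
  qed simp
qed

text \<open>By independence the characteristic function is a product, and each factor is compared
  with a Gaussian one: the Taylor remainder costs B^3 |w|^3 / 6, and replacing 1 - y by exp(- y)
  with y = \<tau> w^2 / 2 costs y^2 / 2. All factors have modulus at most 1, so the errors of a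
  product merely add up. The phase is restored by multiplying with \<open>cis b'\<close> and taking
  real parts.\<close>

lemma characteristic_function_bound:
  fixes w :: "nat \<Rightarrow> real" and \<xi> :: "real \<Rightarrow> real"
  assumes \<xi>[measurable]: "\<xi> \<in> borel_measurable borel" and b: "\<And>x. \<bar>\<xi> x\<bar> \<le> B"
    and m: "(\<integral>x. \<xi> x \<partial>uniform_measure lborel {0..1}) = 0"
    and v: "(\<integral>x. (\<xi> x)\<^sup>2 \<partial>uniform_measure lborel {0..1}) = \<tau>"
  shows "\<bar>(\<integral>\<omega>. cos ((\<Sum>i<n. w i * \<xi> (R i \<omega>)) + b') \<partial>M) - exp (- (\<tau> * (\<Sum>i<n. (w i)\<^sup>2) / 2)) * cos b'\<bar>
    \<le> (\<Sum>i<n. B ^ 3 / 6 * \<bar>w i\<bar> ^ 3 + \<tau>\<^sup>2 / 8 * w i ^ 4)"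
proof -
  have B0: "B \<ge> 0" using b[of 0] by linarith
  have \<tau>0: "\<tau> \<ge> 0" unfolding v[symmetric] by (simp add: integral_nonneg_AE)
  have \<xi>R: "(\<lambda>\<omega>. \<xi> (R i \<omega>)) \<in> borel_measurable M" if "i < n" for i
    using measurable_compose[OF R_measurable[OF that] \<xi>] .
  define \<phi> where "\<phi> i = (\<integral>\<omega>. iexp (w i * \<xi> (R i \<omega>)) \<partial>M)" for i
  have prod: "(\<integral>\<omega>. iexp (\<Sum>i<n. w i * \<xi> (R i \<omega>)) \<partial>M) = (\<Prod>i<n. \<phi> i)"
  proof -
    have iv: "indep_vars (\<lambda>_. borel) (\<lambda>i \<omega>. iexp (w i * \<xi> (R i \<omega>))) {..<n}"
      by (rule indep_vars_compose2[OF R_indep]) measurable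
    have "(\<integral>\<omega>. (\<Prod>i<n. iexp (w i * \<xi> (R i \<omega>))) \<partial>M) = (\<Prod>i<n. \<phi> i)"
      unfolding \<phi>_def
    proof (rule indep_vars_lebesgue_integral[OF _ iv])
      fix i assume "i \<in> {..<n}"
      then have [measurable]: "(\<lambda>\<omega>. \<xi> (R i \<omega>)) \<in> borel_measurable M" using \<xi>R by simp
      show "integrable M (\<lambda>\<omega>. iexp (w i * \<xi> (R i \<omega>)))" by (rule integrable_const_bound[of _ 1]) auto
    qed simp
    moreover have "iexp (\<Sum>i<n. w i * \<xi> (R i \<omega>)) = (\<Prod>i<n. iexp (w i * \<xi> (R i \<omega>)))" for \<omega>
      by (simp add: exp_sum sum_distrib_left flip: of_real_mult)
    ultimately show ?thesis by simp
  qed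
  have factor: "cmod (\<phi> i - of_real (exp (- (\<tau> * (w i)\<^sup>2 / 2)))) \<le> B ^ 3 / 6 * \<bar>w i\<bar> ^ 3 + \<tau>\<^sup>2 / 8 * w i ^ 4"
    if i: "i < n" for i
  proof -
    note \<xi>R[OF i, measurable]
    have Ix: "integrable M (\<lambda>\<omega>. \<xi> (R i \<omega>))" by (rule integrable_const_bound[of _ B]) (use b in auto)
    have Ix2: "integrable M (\<lambda>\<omega>. (\<xi> (R i \<omega>))\<^sup>2)"
    proof (rule integrable_const_bound[of _ "B\<^sup>2"])
      have "(\<xi> x)\<^sup>2 \<le> B\<^sup>2" for x using power_mono[OF b[of x], of 2] by simp
      then show "AE \<omega> in M. norm ((\<xi> (R i \<omega>))\<^sup>2) \<le> B\<^sup>2" by simp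
    qed simp
    have Ie: "integrable M (\<lambda>\<omega>. iexp (w i * \<xi> (R i \<omega>)))" by (rule integrable_const_bound[of _ 1]) auto
    define p where "p \<omega> = 1 + \<i> * of_real (w i * \<xi> (R i \<omega>)) - of_real ((w i)\<^sup>2 * (\<xi> (R i \<omega>))\<^sup>2 / 2)" for \<omega>
    have Ip: "integrable M p" unfolding p_def[abs_def] using Ix Ix2
      by (intro Bochner_Integration.integrable_diff Bochner_Integration.integrable_add integrable_mult_right
          integrable_of_real integrable_const) auto
    have Ep: "(\<integral>\<omega>. p \<omega> \<partial>M) = of_real (1 - \<tau> * (w i)\<^sup>2 / 2)"
    proof -
      have c1: "integrable M (\<lambda>\<omega>. complex_of_real (w i * \<xi> (R i \<omega>)))"
        and c2: "integrable M (\<lambda>\<omega>. complex_of_real ((w i)\<^sup>2 * (\<xi> (R i \<omega>))\<^sup>2 / 2))"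
        using Ix Ix2 by (intro integrable_of_real; simp)+
      have c3: "integrable M (\<lambda>\<omega>. 1 + \<i> * complex_of_real (w i * \<xi> (R i \<omega>)))"
        using c1 by (intro Bochner_Integration.integrable_add integrable_mult_right) auto
      have "(\<integral>\<omega>. p \<omega> \<partial>M) = (\<integral>\<omega>. 1 + \<i> * complex_of_real (w i * \<xi> (R i \<omega>)) \<partial>M)
          - (\<integral>\<omega>. complex_of_real ((w i)\<^sup>2 * (\<xi> (R i \<omega>))\<^sup>2 / 2) \<partial>M)"
        unfolding p_def by (rule Bochner_Integration.integral_diff[OF c3 c2])
      also have "(\<integral>\<omega>. 1 + \<i> * complex_of_real (w i * \<xi> (R i \<omega>)) \<partial>M) = 1 + \<i> * (\<integral>\<omega>. complex_of_real (w i * \<xi> (R i \<omega>)) \<partial>M)"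
        using integrable_mult_right[OF c1, of \<i>] by (subst Bochner_Integration.integral_add) (auto simp: prob_space simp del: of_real_mult)
      finally have "(\<integral>\<omega>. p \<omega> \<partial>M) = 1 + \<i> * of_real (w i * (\<integral>\<omega>. \<xi> (R i \<omega>) \<partial>M)) - of_real ((w i)\<^sup>2 * (\<integral>\<omega>. (\<xi> (R i \<omega>))\<^sup>2 \<partial>M) / 2)"
        unfolding integral_complex_of_real by simp
      also have "(\<integral>\<omega>. \<xi> (R i \<omega>) \<partial>M) = 0" using R_integral[OF i \<xi>] m by simp
      also have "(\<integral>\<omega>. (\<xi> (R i \<omega>))\<^sup>2 \<partial>M) = \<tau>" using R_integral[OF i, of "\<lambda>x. (\<xi> x)\<^sup>2"] v by simp
      finally show ?thesis by (simp add: mult.commute)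
    qed
    have pt: "cmod (iexp (w i * \<xi> (R i \<omega>)) - p \<omega>) \<le> B ^ 3 / 6 * \<bar>w i\<bar> ^ 3" for \<omega>
    proof -
      define x where "x = w i * \<xi> (R i \<omega>)"
      have "p \<omega> = (\<Sum>k\<le>2. (\<i> * of_real x) ^ k / fact k)"
        by (simp add: p_def x_def numeral_2_eq_2 power_mult_distrib)
      then have "cmod (iexp x - p \<omega>) \<le> \<bar>x\<bar> ^ 3 / 6"
        using iexp_approx1[of x 2] by (simp add: numeral_3_eq_3 fact_numeral numeral_2_eq_2)
      also have "\<bar>x\<bar> ^ 3 \<le> (\<bar>w i\<bar> * B) ^ 3"
        unfolding x_def abs_mult using b by (intro power_mono mult_left_mono) auto
      finally show ?thesis by (simp add: x_def power_mult_distrib mult_ac divide_right_mono)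
    qed
    have "cmod (\<phi> i - of_real (1 - \<tau> * (w i)\<^sup>2 / 2)) = cmod (\<integral>\<omega>. iexp (w i * \<xi> (R i \<omega>)) - p \<omega> \<partial>M)"
      unfolding \<phi>_def Ep[symmetric] using Ie Ip by simp
    also have "\<dots> \<le> (\<integral>\<omega>. cmod (iexp (w i * \<xi> (R i \<omega>)) - p \<omega>) \<partial>M)" by (rule integral_norm_bound)
    also have "\<dots> \<le> (\<integral>\<omega>. B ^ 3 / 6 * \<bar>w i\<bar> ^ 3 \<partial>M)"
      using Ie Ip by (intro integral_mono pt integrable_norm Bochner_Integration.integrable_diff) auto
    finally have 1: "cmod (\<phi> i - of_real (1 - \<tau> * (w i)\<^sup>2 / 2)) \<le> B ^ 3 / 6 * \<bar>w i\<bar> ^ 3" by (simp add: prob_space)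
    define y where "y = \<tau> * (w i)\<^sup>2 / 2"
    have y0: "y \<ge> 0" using \<tau>0 by (simp add: y_def)
    have "\<bar>exp (- y) - (1 - y)\<bar> \<le> y\<^sup>2 / 2"
    proof -
      have "1 - y \<le> exp (- y)" using exp_ge_add_one_self[of "- y"] by simp
      moreover have "exp (- y) \<le> 1 - y + y\<^sup>2 / 2"
      proof (cases "y = 0")
        case False
        \<comment> \<open>For y \<ge> 0 the cubic remainder of the expansion at - y is not positive,
          which leaves the quadratic polynomial as an upper bound.\<close>
        obtain t where t: "\<bar>t\<bar> \<le> \<bar>- y\<bar>" "exp (- y) = (\<Sum>m<3. (- y) ^ m / fact m) + exp t / fact 3 * (- y) ^ 3"
          using Maclaurin_exp_le[of "- y" 3] by blast
        have "exp t / fact 3 * (- y) ^ 3 \<le> 0" using y0 by (intro mult_nonneg_nonpos) (auto simp: power3_eq_cube)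
        then show ?thesis using t(2) by (simp add: numeral_3_eq_3 power2_eq_square)
      qed simp
      ultimately show ?thesis by simp
    qed
    then have 2: "cmod (of_real (1 - y) - of_real (exp (- y))) \<le> y\<^sup>2 / 2"
      unfolding of_real_diff[symmetric] norm_of_real by (simp add: abs_minus_commute)
    have "y\<^sup>2 / 2 = \<tau>\<^sup>2 / 8 * w i ^ 4" by (simp add: y_def power2_eq_square power_numeral_reduce)
    with 1 2 norm_triangle_ineq[of "\<phi> i - of_real (1 - y)" "of_real (1 - y) - of_real (exp (- y))"]
    show ?thesis unfolding y_def by simp
  qed
  have n1: "cmod (\<phi> i) \<le> 1" if "i < n" for i
  proof -
    have "cmod (\<phi> i) \<le> (\<integral>\<omega>. cmod (iexp (w i * \<xi> (R i \<omega>))) \<partial>M)" unfolding \<phi>_def by (rule integral_norm_bound)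
    then show ?thesis by (simp add: prob_space)
  qed
  have n2: "cmod (of_real (exp (- (\<tau> * (w i)\<^sup>2 / 2)))) \<le> 1" for i using \<tau>0 by simp
  define E where "E = (\<integral>\<omega>. iexp (\<Sum>i<n. w i * \<xi> (R i \<omega>)) \<partial>M)"
  have pe: "(\<Prod>i<n. of_real (exp (- (\<tau> * (w i)\<^sup>2 / 2)))) = (of_real (exp (- (\<tau> * (\<Sum>i<n. (w i)\<^sup>2) / 2))) :: complex)"
    by (simp add: exp_sum[symmetric] sum_distrib_left sum_divide_distrib sum_negf flip: of_real_prod)
  have "cmod (E - of_real (exp (- (\<tau> * (\<Sum>i<n. (w i)\<^sup>2) / 2)))) \<le> (\<Sum>i<n. cmod (\<phi> i - of_real (exp (- (\<tau> * (w i)\<^sup>2 / 2)))))"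
    unfolding E_def prod pe[symmetric] by (rule norm_prod_diff) (use n1 n2 in auto)
  also have "\<dots> \<le> (\<Sum>i<n. B ^ 3 / 6 * \<bar>w i\<bar> ^ 3 + \<tau>\<^sup>2 / 8 * w i ^ 4)"
    by (intro sum_mono factor) simp
  finally have main: "cmod (E - of_real (exp (- (\<tau> * (\<Sum>i<n. (w i)\<^sup>2) / 2)))) \<le> (\<Sum>i<n. B ^ 3 / 6 * \<bar>w i\<bar> ^ 3 + \<tau>\<^sup>2 / 8 * w i ^ 4)" .
  have IE: "integrable M (\<lambda>\<omega>. iexp (\<Sum>i<n. w i * \<xi> (R i \<omega>)))"
  proof (rule integrable_const_bound[of _ 1])
    have [measurable]: "(\<lambda>\<omega>. \<Sum>i<n. w i * \<xi> (R i \<omega>)) \<in> borel_measurable M"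
      by (intro borel_measurable_sum borel_measurable_times borel_measurable_const \<xi>R) simp
    show "(\<lambda>\<omega>. iexp (\<Sum>i<n. w i * \<xi> (R i \<omega>))) \<in> borel_measurable M" by measurable
  qed simp
  have "(\<integral>\<omega>. cos ((\<Sum>i<n. w i * \<xi> (R i \<omega>)) + b') \<partial>M) = (\<integral>\<omega>. Re (cis b' * iexp (\<Sum>i<n. w i * \<xi> (R i \<omega>))) \<partial>M)"
  proof -
    have "cos (x + b') = Re (cis b' * iexp x)" for x
      by (simp add: cis_conv_exp[symmetric] cos_add mult.commute)
    then show ?thesis by (simp only:)
  qed
  also have "\<dots> = Re (cis b' * E)"
    unfolding E_def using IE by (subst integral_Re) auto
  finally have c: "(\<integral>\<omega>. cos ((\<Sum>i<n. w i * \<xi> (R i \<omega>)) + b') \<partial>M) - exp (- (\<tau> * (\<Sum>i<n. (w i)\<^sup>2) / 2)) * cos b' =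
      Re (cis b' * (E - of_real (exp (- (\<tau> * (\<Sum>i<n. (w i)\<^sup>2) / 2)))))"
    by (simp add: algebra_simps)
  show ?thesis unfolding c
    by (rule order_trans[OF abs_Re_le_cmod]) (use main in \<open>simp add: norm_mult\<close>)
qed

end

section \<open>Combinations of centered indicators\<close>

abbreviation unif01 :: "real measure" where "unif01 \<equiv> uniform_measure lborel {0..1}"

lemma prob_space_unif01: "prob_space unif01"
  by (rule prob_space_uniform_measure) auto

lemma measure_unif01_atMost: "s \<in> {0..1} \<Longrightarrow> measure unif01 {..s} = s"
proof -
  assume s: "s \<in> {0..1}"
  have "{0..1} \<inter> {..s} = {0..s}" using s by auto
  with s show ?thesis by (subst measure_uniform_measure) auto
qed

lemma integral_unif01_indicator:
  assumes "s \<in> {0..1}" shows "(\<integral>x. indicator {..s} x \<partial>unif01) = s"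
  using measure_unif01_atMost[OF assms] by (simp add: space_uniform_measure)

text \<open>The contribution of one uniform variable to a linear combination of values of the
  empirical process; the conditional limit theorem is applied to this bounded function.\<close>

definition step_combination :: "nat \<Rightarrow> (nat \<Rightarrow> real) \<Rightarrow> (nat \<Rightarrow> real) \<Rightarrow> real \<Rightarrow> real" where
  "step_combination k c s x = (\<Sum>j<k. c j * (indicator {..s j} x - s j))"

lemma step_combination_measurable [measurable]: "step_combination k c s \<in> borel_measurable borel"
  unfolding step_combination_def[abs_def] by measurable

lemma indicator_minus_bound: "s \<in> {0..1} \<Longrightarrow> \<bar>indicator {..s} x - s\<bar> \<le> (1::real)"
  by (auto simp: indicator_def)

lemma step_combination_bound:
  assumes "\<And>j. j < k \<Longrightarrow> s j \<in> {0..1}"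
  shows "\<bar>step_combination k c s x\<bar> \<le> (\<Sum>j<k. \<bar>c j\<bar>)"
  unfolding step_combination_def
proof (rule order_trans[OF sum_abs], rule sum_mono)
  fix j assume "j \<in> {..<k}"
  then show "\<bar>c j * (indicator {..s j} x - s j)\<bar> \<le> \<bar>c j\<bar>"
    using mult_left_mono[OF indicator_minus_bound[OF assms, of j x], of "\<bar>c j\<bar>"] by (simp add: abs_mult)
qed

lemma integrable_unif01_indicator: "integrable unif01 (\<lambda>x. indicator {..s} x :: real)"
proof -
  interpret prob_space unif01 by (rule prob_space_unif01)
  show ?thesis by (rule integrable_const_bound[of _ 1]) (auto simp: indicator_def)
qed

lemma step_combination_mean:
  assumes "\<And>j. j < k \<Longrightarrow> s j \<in> {0..1}"
  shows "(\<integral>x. step_combination k c s x \<partial>unif01) = 0"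
proof -
  interpret prob_space unif01 by (rule prob_space_unif01)
  show ?thesis unfolding step_combination_def
    using integrable_unif01_indicator assms
    by (subst Bochner_Integration.integral_sum) (auto simp: integral_unif01_indicator prob_space simp del: Bochner_Integration.integral_indicator)
qed

text \<open>Two indicators have covariance min a b - a b under the uniform law. This is where the
  covariance of the Brownian bridge comes from.\<close>

lemma step_combination_variance:
  assumes s: "\<And>j. j < k \<Longrightarrow> s j \<in> {0..1}"
  shows "(\<integral>x. (step_combination k c s x)\<^sup>2 \<partial>unif01) = (\<Sum>j<k. \<Sum>l<k. c j * c l * (min (s j) (s l) - s j * s l))"
proof -
  interpret prob_space unif01 by (rule prob_space_unif01)
  note I = integrable_unif01_indicator
  have I2: "integrable unif01 (\<lambda>x. (indicator {..a} x - a) * (indicator {..b} x - b) :: real)" for a b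
  proof (rule integrable_const_bound[of _ "(1 + \<bar>a\<bar>) * (1 + \<bar>b\<bar>)"])
    have "\<bar>indicator {..a} x - a\<bar> \<le> 1 + \<bar>a\<bar>" for a x :: real by (auto simp: indicator_def)
    then have "\<bar>indicator {..a} x - a\<bar> * \<bar>indicator {..b} x - b\<bar> \<le> (1 + \<bar>a\<bar>) * (1 + \<bar>b\<bar>)" for x
      by (intro mult_mono) auto
    then show "AE x in unif01. norm ((indicator {..a} x - a) * (indicator {..b} x - b)) \<le> (1 + \<bar>a\<bar>) * (1 + \<bar>b\<bar>)"
      by (simp add: abs_mult)
  qed measurable
  have E: "(\<integral>x. (indicator {..a} x - a) * (indicator {..b} x - b) \<partial>unif01) = min a b - a * b"
    if a: "a \<in> {0..1}" and b: "b \<in> {0..1}" for a b :: real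
  proof -
    have m: "min a b \<in> {0..1}" using a b by auto
    have "(\<integral>x. (indicator {..a} x - a) * (indicator {..b} x - b) \<partial>unif01) =
        (\<integral>x. indicator {..min a b} x - a * indicator {..b} x - b * indicator {..a} x + a * b \<partial>unif01)"
      by (rule Bochner_Integration.integral_cong[OF refl]) (auto simp: indicator_def algebra_simps)
    also have "\<dots> = min a b - a * b - b * a + a * b"
      using I integral_unif01_indicator[OF a] integral_unif01_indicator[OF b] integral_unif01_indicator[OF m]
      by (simp add: prob_space del: Bochner_Integration.integral_indicator)
    finally show ?thesis by simp
  qed
  have "(\<integral>x. (step_combination k c s x)\<^sup>2 \<partial>unif01) =
      (\<integral>x. (\<Sum>j<k. \<Sum>l<k. c j * c l * ((indicator {..s j} x - s j) * (indicator {..s l} x - s l))) \<partial>unif01)"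
    by (simp add: step_combination_def power2_eq_square sum_product mult_ac)
  also have "\<dots> = (\<Sum>j<k. \<Sum>l<k. c j * c l * (\<integral>x. (indicator {..s j} x - s j) * (indicator {..s l} x - s l) \<partial>unif01))"
  proof -
    have "(\<integral>x. (\<Sum>j<k. \<Sum>l<k. c j * c l * ((indicator {..s j} x - s j) * (indicator {..s l} x - s l))) \<partial>unif01) =
        (\<Sum>j<k. (\<integral>x. (\<Sum>l<k. c j * c l * ((indicator {..s j} x - s j) * (indicator {..s l} x - s l))) \<partial>unif01))"
      by (rule Bochner_Integration.integral_sum) (intro Bochner_Integration.integrable_sum integrable_mult_right I2)
    also have "\<dots> = (\<Sum>j<k. \<Sum>l<k. (\<integral>x. c j * c l * ((indicator {..s j} x - s j) * (indicator {..s l} x - s l)) \<partial>unif01))"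
      by (intro sum.cong refl Bochner_Integration.integral_sum integrable_mult_right I2)
    finally show ?thesis by simp
  qed
  also have "\<dots> = (\<Sum>j<k. \<Sum>l<k. c j * c l * (min (s j) (s l) - s j * s l))"
    by (intro sum.cong refl arg_cong2[where f = "(*)"] E s) auto
  finally show ?thesis .
qed

lemma sorting_permutation:
  fixes r :: "nat \<Rightarrow> real"
  obtains \<pi> where "\<pi> permutes {..<n}" "\<And>k l. k \<le> l \<Longrightarrow> l < n \<Longrightarrow> r (\<pi> k) \<le> r (\<pi> l)"
proof -
  define xs where "xs = sort_key r [0..<n]"
  have xs: "set xs = {..<n}" "distinct xs" "length xs = n" "sorted (map r xs)"
    by (auto simp: xs_def)
  define \<pi> where "\<pi> k = (if k < n then xs ! k else k)" for k
  have "bij_betw (\<lambda>k. xs ! k) {..<n} {..<n}" by (rule bij_betw_nth) (use xs in auto)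
  then have "bij_betw \<pi> {..<n} {..<n}" by (rule bij_betw_cong[THEN iffD1, rotated]) (simp add: \<pi>_def)
  then have "\<pi> permutes {..<n}" by (rule bij_imp_permutes) (simp add: \<pi>_def)
  moreover have "r (\<pi> k) \<le> r (\<pi> l)" if "k \<le> l" "l < n" for k l
    using sorted_nth_mono[OF xs(4), of k l] that xs(3) by (simp add: \<pi>_def)
  ultimately show ?thesis by (rule that)
qed

text \<open>The arithmetic-geometric mean inequality with a free scale \<delta>; it reduces first
  absolute moments to second moments.\<close>

lemma abs_le_square_div: "\<delta> > 0 \<Longrightarrow> \<bar>x\<bar> \<le> (\<delta> + x\<^sup>2 / \<delta>) / 2" for x \<delta> :: real
proof -
  assume d: "\<delta> > 0"
  have "0 \<le> (\<bar>x\<bar> - \<delta>)\<^sup>2 / \<delta>" using d by simp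
  also have "\<dots> = x\<^sup>2 / \<delta> - 2 * \<bar>x\<bar> + \<delta>" using d by (simp add: power2_eq_square field_simps flip: abs_mult)
  finally show ?thesis by simp
qed

text \<open>The three errors of the limit theorem: the cubic Taylor remainder, the passage from the
  quadratic polynomial to the exponential, and the deviation of the random conditional variance from
  its limit.\<close>

definition clt_error :: "nat \<Rightarrow> real \<Rightarrow> real \<Rightarrow> real \<Rightarrow> real" where
  "clt_error n \<kappa> B \<tau> = B ^ 3 / 6 * ((\<kappa> + 680 * \<kappa>\<^sup>2) / (2 * sqrt n)) + \<tau>\<^sup>2 / 8 * (680 * \<kappa>\<^sup>2 / n) + \<tau> / 2 * sqrt (Q_variance_bound n \<kappa>)"

context bridge_setting begin

text \<open>\<open>decoupling\<close> for a function of a weighted sum. The bound on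
  \<open>f\<close> is asked for only on the range of the sum, so that the fourth power qualifies as
  well as the cosine.\<close>

lemma weights_decouple:
  fixes f \<xi> :: "real \<Rightarrow> real"
  assumes c: "0 \<le> c" "c \<le> 1" and f: "f \<in> borel_measurable borel" and \<xi>: "\<xi> \<in> borel_measurable borel"
    and B: "\<And>x. \<bar>\<xi> x\<bar> \<le> B" and K: "\<And>x. \<bar>x\<bar> \<le> n * (sqrt n * B) \<Longrightarrow> \<bar>f x\<bar> \<le> K"
  shows "integrable M (\<lambda>\<omega>. f (\<Sum>i<n. W c \<omega> i * \<xi> (R i \<omega>)))"
    and "(\<integral>\<omega>. f (\<Sum>i<n. W c \<omega> i * \<xi> (R i \<omega>)) \<partial>M) = (\<integral>\<omega>. (\<integral>\<omega>'. f (\<Sum>i<n. W c \<omega> i * \<xi> (R i \<omega>')) \<partial>M) \<partial>M)"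
    and "(\<integral>\<omega>. f (\<Sum>i<n. W c \<omega> i * \<xi> (R i \<omega>)) \<partial>M) = (\<integral>\<omega>'. (\<integral>\<omega>. f (\<Sum>i<n. W c \<omega> i * \<xi> (R i \<omega>')) \<partial>M) \<partial>M)"
    and "integrable M (\<lambda>\<omega>. \<integral>\<omega>'. f (\<Sum>i<n. W c \<omega> i * \<xi> (R i \<omega>')) \<partial>M)"
    and "integrable M (\<lambda>\<omega>'. \<integral>\<omega>. f (\<Sum>i<n. W c \<omega> i * \<xi> (R i \<omega>')) \<partial>M)"
proof -
  let ?T = "\<Pi>\<^sub>M _\<in>{..<n}. (borel :: real measure)"
  define h where "h z = f (\<Sum>i<n. sqrt n * (fst z i - c / n) * \<xi> (snd z i))" for z :: "(nat \<Rightarrow> real) \<times> (nat \<Rightarrow> real)"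
  have "(\<lambda>z. \<Sum>i<n. sqrt n * (fst z i - c / n) * \<xi> (snd z i)) \<in> borel_measurable (borel \<Otimes>\<^sub>M ?T)"
  proof (rule borel_measurable_sum)
    fix i assume i: "i \<in> {..<n}"
    have "(\<lambda>z. (fst z :: nat \<Rightarrow> real) i) \<in> borel_measurable (borel \<Otimes>\<^sub>M ?T)"
      by (rule measurable_compose[OF measurable_fst borel_measurable_coordinate])
    moreover have "(\<lambda>z. \<xi> (snd z i)) \<in> borel_measurable (borel \<Otimes>\<^sub>M ?T)"
      by (rule measurable_compose[OF measurable_compose[OF measurable_snd measurable_component_singleton[OF i]] \<xi>])
    ultimately show "(\<lambda>z. sqrt n * (fst z i - c / n) * \<xi> (snd z i)) \<in> borel_measurable (borel \<Otimes>\<^sub>M ?T)" by measurable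
  qed
  then have h: "h \<in> borel_measurable (borel \<Otimes>\<^sub>M ?T)" unfolding h_def[abs_def] by (rule measurable_compose[OF _ f])
  have eq: "h (A \<omega>, \<lambda>i\<in>{..<n}. R i \<omega>') = f (\<Sum>i<n. W c \<omega> i * \<xi> (R i \<omega>'))" for \<omega> \<omega>'
    unfolding h_def W_def by (rule arg_cong[where f = f], rule sum.cong) auto
  have bd: "\<bar>f (\<Sum>i<n. W c \<omega> i * \<xi> (R i \<omega>'))\<bar> \<le> K" if \<omega>: "\<omega> \<in> space M" for \<omega> \<omega>'
  proof (rule K)
    have "\<bar>\<Sum>i<n. W c \<omega> i * \<xi> (R i \<omega>')\<bar> \<le> (\<Sum>i<n. sqrt n * B)"
      using W_bounded[OF \<omega> c] B by (intro order_trans[OF sum_abs] sum_mono) (auto simp: abs_mult intro!: mult_mono)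
    then show "\<bar>\<Sum>i<n. W c \<omega> i * \<xi> (R i \<omega>')\<bar> \<le> n * (sqrt n * B)" by simp
  qed
  have AY: "(\<lambda>\<omega>. (A \<omega>, \<lambda>i\<in>{..<n}. R i \<omega>)) \<in> M \<rightarrow>\<^sub>M borel \<Otimes>\<^sub>M ?T"
    using A_R_indep unfolding independent_variables_def by (intro measurable_Pair) auto
  show int: "integrable M (\<lambda>\<omega>. f (\<Sum>i<n. W c \<omega> i * \<xi> (R i \<omega>)))"
  proof (rule A_integrableI[of _ K])
    show "(\<lambda>\<omega>. f (\<Sum>i<n. W c \<omega> i * \<xi> (R i \<omega>))) \<in> borel_measurable M"
      using measurable_compose[OF AY h] by (simp only: eq)
  qed (rule bd)
  note D = decoupling[OF prob_space_axioms A_R_indep h, unfolded eq, OF int]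
  from D show "(\<integral>\<omega>. f (\<Sum>i<n. W c \<omega> i * \<xi> (R i \<omega>)) \<partial>M) = (\<integral>\<omega>. (\<integral>\<omega>'. f (\<Sum>i<n. W c \<omega> i * \<xi> (R i \<omega>')) \<partial>M) \<partial>M)"
    "(\<integral>\<omega>. f (\<Sum>i<n. W c \<omega> i * \<xi> (R i \<omega>)) \<partial>M) = (\<integral>\<omega>'. (\<integral>\<omega>. f (\<Sum>i<n. W c \<omega> i * \<xi> (R i \<omega>')) \<partial>M) \<partial>M)"
    "integrable M (\<lambda>\<omega>. \<integral>\<omega>'. f (\<Sum>i<n. W c \<omega> i * \<xi> (R i \<omega>')) \<partial>M)"
    "integrable M (\<lambda>\<omega>'. \<integral>\<omega>. f (\<Sum>i<n. W c \<omega> i * \<xi> (R i \<omega>')) \<partial>M)"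
    by blast+
qed

lemma sum_W4:
  assumes n6: "6 \<le> n" and c: "0 \<le> c" "c \<le> 1"
  shows "(\<integral>\<omega>. (\<Sum>i<n. W c \<omega> i ^ 4) \<partial>M) \<le> 680 * \<kappa>\<^sup>2 / n" and "integrable M (\<lambda>\<omega>. \<Sum>i<n. W c \<omega> i ^ 4)"
proof -
  have "(\<integral>\<omega>. (\<Sum>i<n. W c \<omega> i ^ 4) \<partial>M) = (\<Sum>i<n. (\<integral>\<omega>. W c \<omega> i ^ 4 \<partial>M))"
    using W_integrable_power[OF c] by simp
  also have "\<dots> \<le> (\<Sum>i<n. 680 * \<kappa>\<^sup>2 / (real n)\<^sup>2)" by (intro sum_mono W_fourth_moment n6 c) simp
  also have "\<dots> = 680 * \<kappa>\<^sup>2 / n" using n_pos by (simp add: power2_eq_square)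
  finally show "(\<integral>\<omega>. (\<Sum>i<n. W c \<omega> i ^ 4) \<partial>M) \<le> 680 * \<kappa>\<^sup>2 / n" .
  show "integrable M (\<lambda>\<omega>. \<Sum>i<n. W c \<omega> i ^ 4)" using W_integrable_power[OF c] by simp
qed

text \<open>Given the column, the sum is compared with a Gaussian whose variance is \<tau> times the
  random sum of squares; that sum is then replaced by \<kappa> - c, since exp(- x) is 1-Lipschitz
  for x \<ge> 0. Averaging over the column leaves moments that are already bounded.\<close>

lemma weighted_clt:
  assumes n6: "6 \<le> n" and c: "c = 0 \<or> c = 1"
    and \<xi>: "\<xi> \<in> borel_measurable borel" and B: "\<And>x. \<bar>\<xi> x\<bar> \<le> B"
    and m: "(\<integral>x. \<xi> x \<partial>unif01) = 0" and v: "(\<integral>x. (\<xi> x)\<^sup>2 \<partial>unif01) = \<tau>"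
  shows "\<bar>(\<integral>\<omega>. cos ((\<Sum>i<n. W c \<omega> i * \<xi> (R i \<omega>)) + b) \<partial>M) - exp (- (\<tau> * (\<kappa> - c) / 2)) * cos b\<bar> \<le> clt_error n \<kappa> B \<tau>"
proof -
  have c01: "0 \<le> c" "c \<le> 1" using c by auto
  have B0: "B \<ge> 0" using B[of 0] by linarith
  have \<tau>0: "\<tau> \<ge> 0" unfolding v[symmetric] by (simp add: integral_nonneg_AE)
  have cosm: "(\<lambda>x. cos (x + b)) \<in> borel_measurable borel" by measurable
  have cosb: "\<bar>cos (x + b)\<bar> \<le> 1" for x :: real by simp
  note D = weights_decouple[OF c01 cosm \<xi> B cosb]
  define s2 where "s2 \<omega> = (\<Sum>i<n. (W c \<omega> i)\<^sup>2)" for \<omega>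
  define F where "F \<omega> = (\<integral>\<omega>'. cos ((\<Sum>i<n. W c \<omega> i * \<xi> (R i \<omega>')) + b) \<partial>M)" for \<omega>
  have s2_eq: "s2 \<omega> = n * Q \<omega> - c" if "\<omega> \<in> space M" for \<omega>
    unfolding s2_def by (rule W_sum_squares[OF that c])
  have Is2: "integrable M s2" unfolding s2_def[abs_def] using W_integrable_power[OF c01] by simp
  have sn: "sqrt n > 0" using n_pos by simp
  have pt: "\<bar>F \<omega> - exp (- (\<tau> * (\<kappa> - c) / 2)) * cos b\<bar> \<le>
      B ^ 3 / 6 * ((s2 \<omega> / sqrt n + sqrt n * (\<Sum>i<n. W c \<omega> i ^ 4)) / 2) + \<tau>\<^sup>2 / 8 * (\<Sum>i<n. W c \<omega> i ^ 4) + \<tau> / 2 * \<bar>n * Q \<omega> - \<kappa>\<bar>"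
    if \<omega>: "\<omega> \<in> space M" for \<omega>
  proof -
    have "\<bar>F \<omega> - exp (- (\<tau> * s2 \<omega> / 2)) * cos b\<bar> \<le> (\<Sum>i<n. B ^ 3 / 6 * \<bar>W c \<omega> i\<bar> ^ 3 + \<tau>\<^sup>2 / 8 * W c \<omega> i ^ 4)"
      unfolding F_def s2_def by (rule characteristic_function_bound[OF \<xi> B m v])
    also have "\<dots> \<le> (\<Sum>i<n. B ^ 3 / 6 * (((W c \<omega> i)\<^sup>2 / sqrt n + sqrt n * W c \<omega> i ^ 4) / 2) + \<tau>\<^sup>2 / 8 * W c \<omega> i ^ 4)"
    proof (intro sum_mono add_right_mono mult_left_mono)
      fix i
      define x where "x = \<bar>W c \<omega> i\<bar>"
      \<comment> \<open>Interpolates the third absolute power between the second and the fourth. The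
        sums of squares and of fourth powers are of order 1 and 1/n, which the weights 1 / sqrt n
        and sqrt n balance.\<close>
      have "x \<le> (1 / sqrt n + x\<^sup>2 / (1 / sqrt n)) / 2"
        using abs_le_square_div[of "1 / sqrt n" x] sn by (simp add: x_def)
      then have "x\<^sup>2 * x \<le> x\<^sup>2 * ((1 / sqrt n + x\<^sup>2 / (1 / sqrt n)) / 2)" by (rule mult_left_mono) simp
      then have "x ^ 3 \<le> (x\<^sup>2 / sqrt n + sqrt n * x ^ 4) / 2"
        by (simp add: power_numeral_reduce algebra_simps)
      then show "\<bar>W c \<omega> i\<bar> ^ 3 \<le> ((W c \<omega> i)\<^sup>2 / sqrt n + sqrt n * W c \<omega> i ^ 4) / 2"
        by (simp add: x_def power_even_abs)
    qed (use B0 in simp)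
    also have "\<dots> = B ^ 3 / 6 * ((s2 \<omega> / sqrt n + sqrt n * (\<Sum>i<n. W c \<omega> i ^ 4)) / 2) + \<tau>\<^sup>2 / 8 * (\<Sum>i<n. W c \<omega> i ^ 4)"
      by (simp only: s2_def sum.distrib sum_distrib_left[symmetric] sum_divide_distrib[symmetric])
    finally have 1: "\<bar>F \<omega> - exp (- (\<tau> * s2 \<omega> / 2)) * cos b\<bar> \<le>
      B ^ 3 / 6 * ((s2 \<omega> / sqrt n + sqrt n * (\<Sum>i<n. W c \<omega> i ^ 4)) / 2) + \<tau>\<^sup>2 / 8 * (\<Sum>i<n. W c \<omega> i ^ 4)" .
    have lip: "\<bar>exp (- x) - exp (- y)\<bar> \<le> \<bar>x - y\<bar>" if "0 \<le> x" "0 \<le> y" for x y :: real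
    proof -
      have *: "exp (- x) - exp (- y) \<le> y - x" if "0 \<le> x" "x \<le> y" for x y :: real
      proof -
        have "exp (- x) - exp (- y) = exp (- x) * (1 - exp (- (y - x)))" by (simp add: right_diff_distrib flip: exp_add)
        also have "\<dots> \<le> 1 * (y - x)"
        proof (intro mult_mono)
          show "1 - exp (- (y - x)) \<le> y - x" using exp_ge_add_one_self[of "- (y - x)"] by linarith
        qed (use that in auto)
        finally show ?thesis by simp
      qed
      show ?thesis
      proof (cases "x \<le> y")
        case True
        then show ?thesis using *[OF that(1) True] by simp
      next
        case False
        then show ?thesis using *[OF that(2), of x] by simp
      qed
    qed
    have s20: "0 \<le> s2 \<omega>" unfolding s2_def by (intro sum_nonneg) simp
    have kc: "0 \<le> \<kappa> - c" using kappa c by auto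
    have "\<bar>exp (- (\<tau> * s2 \<omega> / 2)) * cos b - exp (- (\<tau> * (\<kappa> - c) / 2)) * cos b\<bar> =
        \<bar>exp (- (\<tau> * s2 \<omega> / 2)) - exp (- (\<tau> * (\<kappa> - c) / 2))\<bar> * \<bar>cos b\<bar>"
      by (simp add: left_diff_distrib flip: abs_mult)
    also have "\<dots> \<le> \<bar>\<tau> * s2 \<omega> / 2 - \<tau> * (\<kappa> - c) / 2\<bar> * 1"
      using s20 kc \<tau>0 by (intro mult_mono lip) auto
    also have "\<dots> = \<tau> / 2 * \<bar>n * Q \<omega> - \<kappa>\<bar>"
    proof -
      have "\<tau> * s2 \<omega> / 2 - \<tau> * (\<kappa> - c) / 2 = \<tau> / 2 * (n * Q \<omega> - \<kappa>)"
        unfolding s2_eq[OF \<omega>] by (simp add: field_simps)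
      then show ?thesis using \<tau>0 by (simp only: abs_mult mult_1_right abs_of_nonneg divide_nonneg_nonneg zero_le_numeral)
    qed
    finally have 2: "\<bar>exp (- (\<tau> * s2 \<omega> / 2)) * cos b - exp (- (\<tau> * (\<kappa> - c) / 2)) * cos b\<bar> \<le> \<tau> / 2 * \<bar>n * Q \<omega> - \<kappa>\<bar>" .
    from 1 2 show ?thesis by linarith
  qed
  have IF: "integrable M F" using D(4) unfolding F_def .
  have IQ: "integrable M (\<lambda>\<omega>. \<bar>n * Q \<omega> - \<kappa>\<bar>)" using Q_integrable by simp
  have IQ2: "integrable M (\<lambda>\<omega>. (n * Q \<omega> - \<kappa>)\<^sup>2)"
  proof -
    have "(n * Q \<omega> - \<kappa>)\<^sup>2 = (real n)\<^sup>2 * (Q \<omega>)\<^sup>2 - 2 * \<kappa> * (n * Q \<omega>) + \<kappa>\<^sup>2" for \<omega>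
      by (simp add: power2_eq_square algebra_simps)
    then show ?thesis using Q2_integrable Q_integrable by simp
  qed
  have EQ: "(\<integral>\<omega>. \<bar>n * Q \<omega> - \<kappa>\<bar> \<partial>M) \<le> sqrt (Q_variance_bound n \<kappa>)"
  proof -
    \<comment> \<open>Nonnegativity of the variance of
      \<open>\<bar>n * Q \<omega> - \<kappa>\<bar>\<close> bounds its mean by its root mean
      square.\<close>
    have "(\<integral>\<omega>. \<bar>n * Q \<omega> - \<kappa>\<bar> \<partial>M)\<^sup>2 \<le> (\<integral>\<omega>. (n * Q \<omega> - \<kappa>)\<^sup>2 \<partial>M)"
      using variance_eq[OF IQ] variance_positive[of "\<lambda>\<omega>. \<bar>n * Q \<omega> - \<kappa>\<bar>"] IQ2 by simp
    also have "\<dots> \<le> (Q_variance_bound n \<kappa>)" by (rule Q_variance[OF n6])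
    finally show ?thesis by (rule real_le_rsqrt)
  qed
  have Es2: "(\<integral>\<omega>. s2 \<omega> \<partial>M) \<le> \<kappa>"
  proof -
    have "(\<integral>\<omega>. s2 \<omega> \<partial>M) \<le> (\<integral>\<omega>. n * Q \<omega> \<partial>M)"
      using Is2 Q_integrable c01 s2_eq by (intro integral_mono) auto
    also have "\<dots> = \<kappa> * (n / (n + \<kappa> - 1))" unfolding expectation_Q by simp
    also have "\<dots> \<le> \<kappa> * 1" using kappa n_pos by (intro mult_left_mono) auto
    finally show ?thesis by simp
  qed
  note W4 = sum_W4[OF n6 c01]
  have "\<bar>(\<integral>\<omega>. cos ((\<Sum>i<n. W c \<omega> i * \<xi> (R i \<omega>)) + b) \<partial>M) - exp (- (\<tau> * (\<kappa> - c) / 2)) * cos b\<bar>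
      = \<bar>\<integral>\<omega>. F \<omega> - exp (- (\<tau> * (\<kappa> - c) / 2)) * cos b \<partial>M\<bar>"
    unfolding D(2) F_def[symmetric] using IF by (simp add: prob_space)
  also have "\<dots> \<le> (\<integral>\<omega>. \<bar>F \<omega> - exp (- (\<tau> * (\<kappa> - c) / 2)) * cos b\<bar> \<partial>M)" by (rule integral_abs_bound)
  also have "\<dots> \<le> (\<integral>\<omega>. B ^ 3 / 6 * ((s2 \<omega> / sqrt n + sqrt n * (\<Sum>i<n. W c \<omega> i ^ 4)) / 2) + \<tau>\<^sup>2 / 8 * (\<Sum>i<n. W c \<omega> i ^ 4) + \<tau> / 2 * \<bar>n * Q \<omega> - \<kappa>\<bar> \<partial>M)"
  proof (rule integral_mono[OF _ _ pt])
    show "integrable M (\<lambda>\<omega>. \<bar>F \<omega> - exp (- (\<tau> * (\<kappa> - c) / 2)) * cos b\<bar>)" using IF by simp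
    have "integrable M (\<lambda>\<omega>. (s2 \<omega> / sqrt n + sqrt n * (\<Sum>i<n. W c \<omega> i ^ 4)) / 2)"
      by (intro Bochner_Integration.integrable_add integrable_mult_right integrable_divide Is2 W4(2))
    then show "integrable M (\<lambda>\<omega>. B ^ 3 / 6 * ((s2 \<omega> / sqrt n + sqrt n * (\<Sum>i<n. W c \<omega> i ^ 4)) / 2) + \<tau>\<^sup>2 / 8 * (\<Sum>i<n. W c \<omega> i ^ 4) + \<tau> / 2 * \<bar>n * Q \<omega> - \<kappa>\<bar>)"
      by (intro Bochner_Integration.integrable_add integrable_mult_right IQ W4(2))
  qed
  also have "\<dots> = B ^ 3 / 6 * (((\<integral>\<omega>. s2 \<omega> \<partial>M) / sqrt n + sqrt n * (\<integral>\<omega>. (\<Sum>i<n. W c \<omega> i ^ 4) \<partial>M)) / 2)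
      + \<tau>\<^sup>2 / 8 * (\<integral>\<omega>. (\<Sum>i<n. W c \<omega> i ^ 4) \<partial>M) + \<tau> / 2 * (\<integral>\<omega>. \<bar>n * Q \<omega> - \<kappa>\<bar> \<partial>M)"
    using Is2 W4(2) IQ by (simp del: Bochner_Integration.integral_sum)
  also have "\<dots> \<le> B ^ 3 / 6 * ((\<kappa> / sqrt n + sqrt n * (680 * \<kappa>\<^sup>2 / n)) / 2) + \<tau>\<^sup>2 / 8 * (680 * \<kappa>\<^sup>2 / n) + \<tau> / 2 * sqrt (Q_variance_bound n \<kappa>)"
    using B0 \<tau>0 Es2 W4(1) EQ sn by (intro add_mono mult_left_mono divide_right_mono) auto
  also have "\<dots> = clt_error n \<kappa> B \<tau>"
  proof -
    have "sqrt n * (680 * \<kappa>\<^sup>2 / n) = 680 * \<kappa>\<^sup>2 / sqrt n"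
      using sn by (simp add: field_simps flip: real_sqrt_mult_self[of "real n"]) 
    then show ?thesis unfolding clt_error_def by (simp add: add_divide_distrib)
  qed
  finally show ?thesis .
qed

text \<open>Given the column, the fourth moment involves the squared sum of squares, which
  Cauchy-Schwarz reduces to n times the sum of fourth powers, so that \<open>sum_W4\<close> controls
  everything. The term \<delta> / n is harmless as long as \<delta> is at least 1/n.\<close>

lemma weighted_fourth_moment:
  assumes n6: "6 \<le> n" and c: "0 \<le> c" "c \<le> 1" and \<zeta>: "\<zeta> \<in> borel_measurable borel" and b: "\<And>x. \<bar>\<zeta> x\<bar> \<le> 1"
    and m: "(\<integral>x. \<zeta> x \<partial>unif01) = 0" and v: "(\<integral>x. (\<zeta> x)\<^sup>2 \<partial>unif01) \<le> \<delta>"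
  shows "integrable M (\<lambda>\<omega>. (\<Sum>i<n. W c \<omega> i * \<zeta> (R i \<omega>)) ^ 4)"
    and "(\<integral>\<omega>. (\<Sum>i<n. W c \<omega> i * \<zeta> (R i \<omega>)) ^ 4 \<partial>M) \<le> 680 * \<kappa>\<^sup>2 * (3 * \<delta>\<^sup>2 + \<delta> / n)"
proof -
  have fm: "(\<lambda>x::real. x ^ 4) \<in> borel_measurable borel" by measurable
  have K: "\<bar>x ^ 4\<bar> \<le> (n * (sqrt n * 1)) ^ 4" if "\<bar>x\<bar> \<le> n * (sqrt n * 1)" for x :: real
    using power_mono[OF that, of 4] by (simp add: power_abs)
  note D = weights_decouple[OF c fm \<zeta> b K]
  show "integrable M (\<lambda>\<omega>. (\<Sum>i<n. W c \<omega> i * \<zeta> (R i \<omega>)) ^ 4)" by (rule D(1))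
  have \<delta>0: "\<delta> \<ge> 0" by (rule order_trans[OF _ v]) (simp add: integral_nonneg_AE)
  note W4 = sum_W4[OF n6 c]
  have "(\<integral>\<omega>. (\<Sum>i<n. W c \<omega> i * \<zeta> (R i \<omega>)) ^ 4 \<partial>M) =
      (\<integral>\<omega>. (\<integral>\<omega>'. (\<Sum>i<n. W c \<omega> i * \<zeta> (R i \<omega>')) ^ 4 \<partial>M) \<partial>M)" by (rule D(2))
  also have "\<dots> \<le> (\<integral>\<omega>. (3 * \<delta>\<^sup>2 * n + \<delta>) * (\<Sum>i<n. W c \<omega> i ^ 4) \<partial>M)"
  proof (rule integral_mono[OF D(4)], assumption)
    fix \<omega>
    have "(\<integral>\<omega>'. (\<Sum>i<n. W c \<omega> i * \<zeta> (R i \<omega>')) ^ 4 \<partial>M) \<le> 3 * \<delta>\<^sup>2 * (\<Sum>i<n. (W c \<omega> i)\<^sup>2)\<^sup>2 + \<delta> * (\<Sum>i<n. W c \<omega> i ^ 4)"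
      by (rule independent_sum_moments[OF \<zeta> b m v order_refl, THEN conjunct2, THEN conjunct2])
    also have "3 * \<delta>\<^sup>2 * (\<Sum>i<n. (W c \<omega> i)\<^sup>2)\<^sup>2 \<le> 3 * \<delta>\<^sup>2 * (n * (\<Sum>i<n. W c \<omega> i ^ 4))"
      using sum_squared_le_sum_of_squares[of "\<lambda>i. (W c \<omega> i)\<^sup>2" "{..<n}"]
      by (intro mult_left_mono) (simp_all add: mult.commute flip: power_mult)
    finally show "(\<integral>\<omega>'. (\<Sum>i<n. W c \<omega> i * \<zeta> (R i \<omega>')) ^ 4 \<partial>M) \<le> (3 * \<delta>\<^sup>2 * n + \<delta>) * (\<Sum>i<n. W c \<omega> i ^ 4)"
      by (simp add: algebra_simps)
  qed (intro integrable_mult_right W4(2))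
  also have "\<dots> = (3 * \<delta>\<^sup>2 * n + \<delta>) * (\<integral>\<omega>. (\<Sum>i<n. W c \<omega> i ^ 4) \<partial>M)" by (rule integral_mult_right_zero)
  also have "\<dots> \<le> (3 * \<delta>\<^sup>2 * n + \<delta>) * (680 * \<kappa>\<^sup>2 / n)" using W4(1) \<delta>0 by (intro mult_left_mono) auto
  also have "\<dots> = 680 * \<kappa>\<^sup>2 * (3 * \<delta>\<^sup>2 + \<delta> / n)" using n_pos by (simp add: field_simps)
  finally show "(\<integral>\<omega>. (\<Sum>i<n. W c \<omega> i * \<zeta> (R i \<omega>)) ^ 4 \<partial>M) \<le> 680 * \<kappa>\<^sup>2 * (3 * \<delta>\<^sup>2 + \<delta> / n)" .
qed

end

section \<open>Exchangeability and the empirical counting process\<close>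

lemma abs_cos_diff_le: "\<bar>cos x - cos y\<bar> \<le> \<bar>x - y\<bar>" for x y :: real
proof -
  have "\<bar>cos x - cos y\<bar> = 2 * (\<bar>sin ((x + y) / 2)\<bar> * \<bar>sin ((y - x) / 2)\<bar>)"
    by (simp add: cos_diff_cos abs_mult)
  also have "\<dots> \<le> 2 * (1 * \<bar>(y - x) / 2\<bar>)"
    by (intro mult_left_mono mult_mono abs_sin_x_le_abs_x) auto
  finally show ?thesis by simp
qed

lemma downclosed_eq_lessThan:
  fixes D :: "nat set"
  assumes fin: "finite D" and down: "\<And>k l. k \<in> D \<Longrightarrow> l < k \<Longrightarrow> l \<in> D"
  shows "D = {..<card D}"
proof (cases "D = {}")
  case False
  have "D = {..<Suc (Max D)}"
  proof
    show "D \<subseteq> {..<Suc (Max D)}" using fin by (auto simp: less_Suc_eq_le)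
    show "{..<Suc (Max D)} \<subseteq> D"
    proof
      fix l assume "l \<in> {..<Suc (Max D)}"
      then have "l = Max D \<or> l < Max D" by auto
      then show "l \<in> D" using down[OF Max_in[OF fin False]] Max_in[OF fin False] by auto
    qed
  qed
  then show ?thesis by (metis card_lessThan)
qed simp

context bridge_setting begin

text \<open>For frozen \<open>r\<close>, one relabelling of the rows that makes \<open>r\<close>
  increasing turns the index sets for all thresholds \<open>s j\<close> into initial segments
  simultaneously; exchangeability leaves the integral unchanged.\<close>

lemma exchange_sorted:
  fixes r s c :: "nat \<Rightarrow> real"
  shows "(\<integral>\<omega>. cos ((\<Sum>i<n. W 1 \<omega> i * (\<Sum>j<k. c j * indicator {..s j} (r i))) + b) \<partial>M) =
    (\<integral>\<omega>. cos ((\<Sum>j<k. c j * S {..<card {i. i < n \<and> r i \<le> s j}} \<omega>) + b) \<partial>M)"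
proof -
  obtain \<pi> where \<pi>: "\<pi> permutes {..<n}" and sorted: "\<And>k l. k \<le> l \<Longrightarrow> l < n \<Longrightarrow> r (\<pi> k) \<le> r (\<pi> l)"
    using sorting_permutation[of n r] by blast
  define \<rho> where "\<rho> = inv_into UNIV \<pi>"
  have \<rho>: "\<rho> permutes {..<n}" unfolding \<rho>_def by (rule permutes_inv[OF \<pi>])
  have \<rho>\<pi>: "\<pi> (\<rho> i) = i" "\<rho> (\<pi> i) = i" for i unfolding \<rho>_def by (rule permutes_inverses[OF \<pi>])+
  define \<eta> where "\<eta> x = (\<Sum>j<k. c j * indicator {..s j} x)" for x :: real
  define g where "g a = cos ((\<Sum>i<n. sqrt n * (a i - 1 / n) * \<eta> (r i)) + b)" for a :: "nat \<Rightarrow> real"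
  have gm: "g \<in> borel_measurable borel" unfolding g_def by measurable
  have D: "{i. i < n \<and> r (\<pi> i) \<le> s j} = {..<card {i. i < n \<and> r i \<le> s j}}" for j
  proof -
    let ?D = "{i. i < n \<and> r (\<pi> i) \<le> s j}"
    have "?D = {..<card ?D}"
    proof (rule downclosed_eq_lessThan)
      fix k l assume "k \<in> ?D" "l < k"
      then show "l \<in> ?D" using sorted[of l k] by auto
    qed simp
    moreover have "\<pi> ` ?D = {i. i < n \<and> r i \<le> s j}"
    proof (intro equalityI subsetI)
      fix i assume i: "i \<in> {i. i < n \<and> r i \<le> s j}"
      have "\<pi> (\<rho> i) = i" by (rule \<rho>\<pi>)
      moreover have "\<rho> i < n" using permutes_in_image[OF \<rho>, of i] i by simp
      ultimately show "i \<in> \<pi> ` ?D" using i by (intro image_eqI[of _ _ "\<rho> i"]) auto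
    qed (use permutes_in_image[OF \<pi>] in auto)
    then have "card ?D = card {i. i < n \<and> r i \<le> s j}"
      using card_image[OF inj_on_subset[OF permutes_inj[OF \<pi>]], of ?D] by simp
    ultimately show ?thesis by simp
  qed
  have "(\<integral>\<omega>. cos ((\<Sum>i<n. W 1 \<omega> i * \<eta> (r i)) + b) \<partial>M) = (\<integral>\<omega>. g (A \<omega>) \<partial>M)"
    by (simp add: g_def W_def)
  also have "\<dots> = (\<integral>\<omega>. g (\<lambda>i. A \<omega> (\<rho> i)) \<partial>M)"
    by (rule exch[OF \<rho> gm, symmetric])
  also have "\<dots> = (\<integral>\<omega>. cos ((\<Sum>j<k. c j * S {..<card {i. i < n \<and> r i \<le> s j}} \<omega>) + b) \<partial>M)"
  proof (rule Bochner_Integration.integral_cong[OF refl])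
    fix \<omega>
    have "(\<Sum>i<n. sqrt n * (A \<omega> (\<rho> i) - 1 / n) * \<eta> (r i)) = (\<Sum>i<n. W 1 \<omega> (\<rho> i) * \<eta> (r i))"
      by (simp add: W_def)
    also have "\<dots> = (\<Sum>i<n. W 1 \<omega> i * \<eta> (r (\<pi> i)))"
      using sum.permute[OF \<pi>, of "\<lambda>i. W 1 \<omega> (\<rho> i) * \<eta> (r i)"] by (simp only: comp_def \<rho>\<pi>)
    also have "\<dots> = (\<Sum>i<n. \<Sum>j<k. c j * (W 1 \<omega> i * indicator {..s j} (r (\<pi> i))))"
    proof -
      have "W 1 \<omega> i * \<eta> x = (\<Sum>j<k. c j * (W 1 \<omega> i * indicator {..s j} x))" for i x
        unfolding \<eta>_def sum_distrib_left by (rule sum.cong[OF refl], rule mult.left_commute)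
      then show ?thesis by (simp only:)
    qed
    also have "\<dots> = (\<Sum>j<k. \<Sum>i<n. c j * (W 1 \<omega> i * indicator {..s j} (r (\<pi> i))))" by (rule sum.swap)
    also have "\<dots> = (\<Sum>j<k. c j * S {..<card {i. i < n \<and> r i \<le> s j}} \<omega>)"
    proof (rule sum.cong[OF refl])
      fix j
      have "(\<Sum>i<n. W 1 \<omega> i * indicator {..s j} (r (\<pi> i))) = (\<Sum>i\<in>{i. i < n \<and> r (\<pi> i) \<le> s j}. W 1 \<omega> i)"
        by (rule sum.mono_neutral_cong_right) (auto simp: indicator_def)
      then show "(\<Sum>i<n. c j * (W 1 \<omega> i * indicator {..s j} (r (\<pi> i)))) = c j * S {..<card {i. i < n \<and> r i \<le> s j}} \<omega>"
        unfolding D S_def sum_distrib_left[symmetric] by (simp only:)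
    qed
    finally have "(\<Sum>i<n. sqrt n * (A \<omega> (\<rho> i) - 1 / n) * \<eta> (r i)) = (\<Sum>j<k. c j * S {..<card {i. i < n \<and> r i \<le> s j}} \<omega>)" .
    then show "g (\<lambda>i. A \<omega> (\<rho> i)) = cos ((\<Sum>j<k. c j * S {..<card {i. i < n \<and> r i \<le> s j}} \<omega>) + b)"
      unfolding g_def by (rule arg_cong[where f = "\<lambda>x. cos (x + b)"])
  qed
  finally show ?thesis by (simp only: \<eta>_def)
qed

text \<open>A block of |p - q| centered weights has second moment at most |p - q| \<kappa> / n. The
  free \<delta> keeps the bound linear in |p - q|, which becomes random and is averaged
  afterwards.\<close>

lemma S_diff_bound:
  assumes "p \<le> n" "q \<le> n" and \<delta>: "\<delta> > 0"
  shows "(\<integral>\<omega>. \<bar>S {..<p} \<omega> - S {..<q} \<omega>\<bar> \<partial>M) \<le> (\<delta> + \<bar>real p - real q\<bar> * (\<kappa> / n) / \<delta>) / 2"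
proof -
  have *: "(\<integral>\<omega>. \<bar>S {..<p} \<omega> - S {..<q} \<omega>\<bar> \<partial>M) \<le> (\<delta> + \<bar>real p - real q\<bar> * (\<kappa> / n) / \<delta>) / 2"
    if pq: "q \<le> p" "p \<le> n" for p q
  proof -
    have eq: "S {..<p} \<omega> - S {..<q} \<omega> = S ({..<p} - {..<q}) \<omega>" for \<omega>
      unfolding S_def by (rule sum_diff[symmetric]) (use pq in auto)
    have I: "integrable M (\<lambda>\<omega>. S J \<omega>)" "integrable M (\<lambda>\<omega>. (S J \<omega>)\<^sup>2)" for J
      using S_integrable_power[of J 1] S_integrable_power[of J 2] by simp_all
    have IB: "integrable M (\<lambda>\<omega>. (\<delta> + (S J \<omega>)\<^sup>2 / \<delta>) / 2)" for J
      by (intro integrable_divide Bochner_Integration.integrable_add integrable_const I(2))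
    have "(\<integral>\<omega>. \<bar>S ({..<p} - {..<q}) \<omega>\<bar> \<partial>M) \<le> (\<integral>\<omega>. (\<delta> + (S ({..<p} - {..<q}) \<omega>)\<^sup>2 / \<delta>) / 2 \<partial>M)"
      by (rule integral_mono[OF integrable_abs[OF I(1)] IB abs_le_square_div[OF \<delta>]])
    also have "\<dots> = (\<delta> + (\<integral>\<omega>. (S ({..<p} - {..<q}) \<omega>)\<^sup>2 \<partial>M) / \<delta>) / 2"
      using I by (simp add: prob_space)
    also have "\<dots> \<le> (\<delta> + \<bar>real p - real q\<bar> * (\<kappa> / n) / \<delta>) / 2"
    proof -
      have "(\<integral>\<omega>. (S ({..<p} - {..<q}) \<omega>)\<^sup>2 \<partial>M) \<le> card ({..<p} - {..<q}) * (\<kappa> / n)"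
        by (rule S_second_moment) (use pq in auto)
      also have "real (card ({..<p} - {..<q})) = \<bar>real p - real q\<bar>"
        using pq by (subst card_Diff_subset) auto
      finally have "(\<integral>\<omega>. (S ({..<p} - {..<q}) \<omega>)\<^sup>2 \<partial>M) \<le> \<bar>real p - real q\<bar> * (\<kappa> / n)" .
      then show ?thesis using \<delta> by (intro divide_right_mono add_left_mono) auto
    qed
    finally show ?thesis unfolding eq .
  qed
  show ?thesis
  proof (cases "q \<le> p")
    case True
    show ?thesis by (rule *[OF True assms(1)])
  next
    case False
    have c: "\<bar>S {..<p} \<omega> - S {..<q} \<omega>\<bar> = \<bar>S {..<q} \<omega> - S {..<p} \<omega>\<bar>" for \<omega> by (rule abs_minus_commute)
    have d: "\<bar>real p - real q\<bar> = \<bar>real q - real p\<bar>" by (rule abs_minus_commute)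
    show ?thesis unfolding c d by (rule *) (use False assms in auto)
  qed
qed

text \<open>The count minus \<open>n * s\<close> is a sum of n independent centered variables
  bounded by 1, so its mean absolute value is at most sqrt n; rounding \<open>n * s\<close> down
  adds at most 1.\<close>

lemma empirical_count_bound:
  fixes s :: real
  assumes s: "s \<in> {0..1}"
  shows "integrable M (\<lambda>\<omega>. \<bar>real (card {i. i < n \<and> R i \<omega> \<le> s}) - real (nat \<lfloor>n * s\<rfloor>)\<bar>)"
    and "(\<integral>\<omega>. \<bar>real (card {i. i < n \<and> R i \<omega> \<le> s}) - real (nat \<lfloor>n * s\<rfloor>)\<bar> \<partial>M) \<le> sqrt n + 1"
proof -
  define \<zeta> where "\<zeta> x = indicator {..s} x - s" for x :: real
  have \<zeta>m[measurable]: "\<zeta> \<in> borel_measurable borel" unfolding \<zeta>_def[abs_def] by measurable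
  have b: "\<bar>\<zeta> x\<bar> \<le> 1" for x unfolding \<zeta>_def by (rule indicator_minus_bound[OF s])
  interpret u: prob_space unif01 by (rule prob_space_unif01)
  have m: "(\<integral>x. \<zeta> x \<partial>unif01) = 0"
    unfolding \<zeta>_def using integrable_unif01_indicator[of s] integral_unif01_indicator[OF s]
    by (simp add: u.prob_space del: Bochner_Integration.integral_indicator)
  have v: "(\<integral>x. (\<zeta> x)\<^sup>2 \<partial>unif01) \<le> 1"
  proof -
    have b2: "(\<zeta> x)\<^sup>2 \<le> 1" for x using power_mono[OF b[of x], of 2] by simp
    have "(\<integral>x. (\<zeta> x)\<^sup>2 \<partial>unif01) \<le> (\<integral>x. 1 \<partial>unif01)"
    proof (rule integral_mono[OF u.integrable_const_bound[of _ 1]])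
      show "(\<lambda>x. (\<zeta> x)\<^sup>2) \<in> borel_measurable unif01"
        using borel_measurable_power[OF \<zeta>m, of 2] by (simp cong: measurable_cong_sets)
    qed (simp_all add: b2)
    then show ?thesis by (simp add: u.prob_space)
  qed
  define Z where "Z \<omega> = (\<Sum>i<n. 1 * \<zeta> (R i \<omega>))" for \<omega>
  have Zm[measurable]: "Z \<in> borel_measurable M" unfolding Z_def[abs_def]
  proof (rule borel_measurable_sum)
    fix i assume "i \<in> {..<n}"
    then have "(\<lambda>\<omega>. \<zeta> (R i \<omega>)) \<in> borel_measurable M"
      by (intro measurable_compose[OF R_measurable \<zeta>m]) simp
    then show "(\<lambda>\<omega>. 1 * \<zeta> (R i \<omega>)) \<in> borel_measurable M" by simp
  qed
  have card_eq: "real (card {i. i < n \<and> R i \<omega> \<le> s}) = Z \<omega> + n * s" for \<omega>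
  proof -
    have "(\<Sum>i<n. indicator {..s} (R i \<omega>)) = (\<Sum>i\<in>{i. i < n \<and> R i \<omega> \<le> s}. (1::real))"
      by (rule sum.mono_neutral_cong_right) (auto simp: indicator_def)
    then show ?thesis by (simp add: Z_def \<zeta>_def sum_subtractf)
  qed
  have Zb: "\<bar>Z \<omega>\<bar> \<le> n" for \<omega>
  proof -
    have "\<bar>Z \<omega>\<bar> \<le> (\<Sum>i<n. \<bar>1 * \<zeta> (R i \<omega>)\<bar>)" unfolding Z_def by (rule sum_abs)
    also have "\<dots> \<le> (\<Sum>i<n. 1)" by (rule sum_mono) (simp add: b)
    finally show ?thesis by simp
  qed
  have IZ: "integrable M Z" by (rule A_integrableI[of _ n]) (auto intro: Zb)
  have IZ2: "integrable M (\<lambda>\<omega>. (Z \<omega>)\<^sup>2)"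
  proof (rule A_integrableI[of _ "(real n)\<^sup>2"])
    show "\<bar>(Z \<omega>)\<^sup>2\<bar> \<le> (real n)\<^sup>2" for \<omega> using power_mono[OF Zb[of \<omega>], of 2] by simp
  qed measurable
  have sn: "sqrt n > 0" using n_pos by simp
  show I: "integrable M (\<lambda>\<omega>. \<bar>real (card {i. i < n \<and> R i \<omega> \<le> s}) - real (nat \<lfloor>n * s\<rfloor>)\<bar>)"
    unfolding card_eq using IZ by simp
  have "(\<integral>\<omega>. \<bar>real (card {i. i < n \<and> R i \<omega> \<le> s}) - real (nat \<lfloor>n * s\<rfloor>)\<bar> \<partial>M) \<le>
      (\<integral>\<omega>. (sqrt n + (Z \<omega>)\<^sup>2 / sqrt n) / 2 + 1 \<partial>M)"
  proof (rule integral_mono[OF I])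
    show "integrable M (\<lambda>\<omega>. (sqrt n + (Z \<omega>)\<^sup>2 / sqrt n) / 2 + 1)" using IZ2 by simp
    fix \<omega>
    have "real (nat \<lfloor>n * s\<rfloor>) = of_int \<lfloor>n * s\<rfloor>" using s by simp
    then have "\<bar>n * s - real (nat \<lfloor>n * s\<rfloor>)\<bar> \<le> 1" by linarith
    then show "\<bar>real (card {i. i < n \<and> R i \<omega> \<le> s}) - real (nat \<lfloor>n * s\<rfloor>)\<bar> \<le> (sqrt n + (Z \<omega>)\<^sup>2 / sqrt n) / 2 + 1"
      unfolding card_eq using abs_le_square_div[OF sn, of "Z \<omega>"] by linarith
  qed
  also have "\<dots> = (sqrt n + (\<integral>\<omega>. (Z \<omega>)\<^sup>2 \<partial>M) / sqrt n) / 2 + 1" using IZ2 by (simp add: prob_space)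
  also have "\<dots> \<le> (sqrt n + n / sqrt n) / 2 + 1"
  proof -
    have "(\<integral>\<omega>. (Z \<omega>)\<^sup>2 \<partial>M) \<le> 1 * (\<Sum>i<n. 1\<^sup>2)"
      unfolding Z_def by (rule independent_sum_moments[OF \<zeta>m b m v order_refl, THEN conjunct2, THEN conjunct1])
    then show ?thesis using sn by (intro add_right_mono divide_right_mono add_left_mono) auto
  qed
  also have "\<dots> = sqrt n + 1" using sn by (simp add: real_div_sqrt)
  finally show "(\<integral>\<omega>. \<bar>real (card {i. i < n \<and> R i \<omega> \<le> s}) - real (nat \<lfloor>n * s\<rfloor>)\<bar> \<partial>M) \<le> sqrt n + 1" .
qed

lemma floor_index_le: "s \<in> {0..1} \<Longrightarrow> nat \<lfloor>real n * s\<rfloor> \<le> n"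
  using floor_mono[of "real n * s" n] by (simp add: mult_left_le)

text \<open>Averaging the first column over a random relabelling of the rows turns the sum over
  the rows with \<open>R\<^sub>i \<le> s\<close> into a partial sum with a random number of terms.\<close>

lemma bridge_clt:
  fixes s c :: "nat \<Rightarrow> real" and b :: real
  assumes n6: "6 \<le> n" and s: "\<And>j. j < k \<Longrightarrow> s j \<in> {0..1}" and \<delta>: "\<delta> > 0"
  defines "\<tau> \<equiv> (\<Sum>j<k. \<Sum>l<k. c j * c l * (min (s j) (s l) - s j * s l))"
  shows "\<bar>(\<integral>\<omega>. cos ((\<Sum>j<k. c j * S {..<nat \<lfloor>n * s j\<rfloor>} \<omega>) + b) \<partial>M) - exp (- (\<tau> * (\<kappa> - 1) / 2)) * cos b\<bar> \<le>
    clt_error n \<kappa> (\<Sum>j<k. \<bar>c j\<bar>) \<tau> + (\<Sum>j<k. \<bar>c j\<bar>) * ((\<delta> + (sqrt n + 1) * (\<kappa> / n) / \<delta>) / 2)"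
proof -
  define \<xi> where "\<xi> = step_combination k c s"
  define B where "B = (\<Sum>j<k. \<bar>c j\<bar>)"
  have \<xi>m: "\<xi> \<in> borel_measurable borel" unfolding \<xi>_def by measurable
  have \<xi>b: "\<bar>\<xi> x\<bar> \<le> B" for x unfolding \<xi>_def B_def by (rule step_combination_bound[OF s])
  have cosm: "(\<lambda>x. cos (x + b)) \<in> borel_measurable borel" by measurable
  have cosb: "\<bar>cos (x + b)\<bar> \<le> 1" for x :: real by simp
  note D = weights_decouple[OF zero_le_one order_refl cosm \<xi>m \<xi>b cosb]
  \<comment> \<open>Here the column is averaged while the uniform variables are frozen, the opposite
    order to the conditional limit theorem.\<close>
  define F where "F \<omega>' = (\<integral>\<omega>. cos ((\<Sum>i<n. W 1 \<omega> i * \<xi> (R i \<omega>')) + b) \<partial>M)" for \<omega>'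
  define N where "N j \<omega> = card {i. i < n \<and> R i \<omega> \<le> s j}" for j \<omega>
  define d where "d j = nat \<lfloor>n * s j\<rfloor>" for j
  define E0 where "E0 = (\<integral>\<omega>. cos ((\<Sum>j<k. c j * S {..<d j} \<omega>) + b) \<partial>M)"
  have Nn: "N j \<omega> \<le> n" for j \<omega>
    unfolding N_def using card_mono[of "{..<n}" "{i. i < n \<and> R i \<omega> \<le> s j}"] by auto
  have dn: "d j \<le> n" if "j < k" for j unfolding d_def by (rule floor_index_le[OF s[OF that]])
  have F_eq: "F \<omega>' = (\<integral>\<omega>. cos ((\<Sum>j<k. c j * S {..<N j \<omega>'} \<omega>) + b) \<partial>M)" for \<omega>'
  proof -
    have "F \<omega>' = (\<integral>\<omega>. cos ((\<Sum>i<n. W 1 \<omega> i * (\<Sum>j<k. c j * indicator {..s j} (R i \<omega>'))) + b) \<partial>M)"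
      unfolding F_def
    proof (rule Bochner_Integration.integral_cong[OF refl])
      fix \<omega> assume \<omega>: "\<omega> \<in> space M"
      \<comment> \<open>The centering of the indicators contributes a multiple of the sum of all
        centered weights, which is 0, so plain indicators remain.\<close>
      have "(\<Sum>i<n. W 1 \<omega> i * \<xi> (R i \<omega>')) = (\<Sum>i<n. W 1 \<omega> i * (\<Sum>j<k. c j * indicator {..s j} (R i \<omega>')) - W 1 \<omega> i * (\<Sum>j<k. c j * s j))"
        unfolding \<xi>_def step_combination_def by (simp add: right_diff_distrib sum_subtractf)
      also have "\<dots> = (\<Sum>i<n. W 1 \<omega> i * (\<Sum>j<k. c j * indicator {..s j} (R i \<omega>'))) - S {..<n} \<omega> * (\<Sum>j<k. c j * s j)"
        unfolding S_def by (simp add: sum_subtractf sum_distrib_right)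
      finally show "cos ((\<Sum>i<n. W 1 \<omega> i * \<xi> (R i \<omega>')) + b) = cos ((\<Sum>i<n. W 1 \<omega> i * (\<Sum>j<k. c j * indicator {..s j} (R i \<omega>'))) + b)"
        using S_all[OF \<omega>] by simp
    qed
    then show ?thesis unfolding N_def exchange_sorted .
  qed
  have Icos: "integrable M (\<lambda>\<omega>. cos ((\<Sum>j<k. c j * S {..<p j} \<omega>) + b))" for p
    by (rule A_integrableI[of _ 1]) auto
  have IS: "integrable M (\<lambda>\<omega>. \<bar>S {..<p} \<omega> - S {..<q} \<omega>\<bar>)" for p q
    using S_integrable_power[of "{..<p}" 1] S_integrable_power[of "{..<q}" 1] by simp
  have pt: "\<bar>F \<omega>' - E0\<bar> \<le> (\<Sum>j<k. \<bar>c j\<bar> * ((\<delta> + \<bar>real (N j \<omega>') - real (d j)\<bar> * (\<kappa> / n) / \<delta>) / 2))" for \<omega>'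
  proof -
    have "\<bar>F \<omega>' - E0\<bar> = \<bar>\<integral>\<omega>. cos ((\<Sum>j<k. c j * S {..<N j \<omega>'} \<omega>) + b) - cos ((\<Sum>j<k. c j * S {..<d j} \<omega>) + b) \<partial>M\<bar>"
      unfolding F_eq E0_def using Icos by simp
    also have "\<dots> \<le> (\<integral>\<omega>. \<bar>cos ((\<Sum>j<k. c j * S {..<N j \<omega>'} \<omega>) + b) - cos ((\<Sum>j<k. c j * S {..<d j} \<omega>) + b)\<bar> \<partial>M)"
      by (rule integral_abs_bound)
    also have "\<dots> \<le> (\<integral>\<omega>. (\<Sum>j<k. \<bar>c j\<bar> * \<bar>S {..<N j \<omega>'} \<omega> - S {..<d j} \<omega>\<bar>) \<partial>M)"
    proof (rule integral_mono)
      show "integrable M (\<lambda>\<omega>. \<bar>cos ((\<Sum>j<k. c j * S {..<N j \<omega>'} \<omega>) + b) - cos ((\<Sum>j<k. c j * S {..<d j} \<omega>) + b)\<bar>)"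
        by (intro integrable_abs Bochner_Integration.integrable_diff Icos)
      show "integrable M (\<lambda>\<omega>. \<Sum>j<k. \<bar>c j\<bar> * \<bar>S {..<N j \<omega>'} \<omega> - S {..<d j} \<omega>\<bar>)"
        by (intro Bochner_Integration.integrable_sum integrable_mult_right IS)
      fix \<omega>
      have "\<bar>cos ((\<Sum>j<k. c j * S {..<N j \<omega>'} \<omega>) + b) - cos ((\<Sum>j<k. c j * S {..<d j} \<omega>) + b)\<bar> \<le>
          \<bar>(\<Sum>j<k. c j * (S {..<N j \<omega>'} \<omega> - S {..<d j} \<omega>))\<bar>"
        by (rule order_trans[OF abs_cos_diff_le]) (simp add: right_diff_distrib sum_subtractf)
      also have "\<dots> \<le> (\<Sum>j<k. \<bar>c j\<bar> * \<bar>S {..<N j \<omega>'} \<omega> - S {..<d j} \<omega>\<bar>)"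
        by (rule order_trans[OF sum_abs]) (simp add: abs_mult)
      finally show "\<bar>cos ((\<Sum>j<k. c j * S {..<N j \<omega>'} \<omega>) + b) - cos ((\<Sum>j<k. c j * S {..<d j} \<omega>) + b)\<bar> \<le>
          (\<Sum>j<k. \<bar>c j\<bar> * \<bar>S {..<N j \<omega>'} \<omega> - S {..<d j} \<omega>\<bar>)" .
    qed
    also have "\<dots> = (\<Sum>j<k. \<bar>c j\<bar> * (\<integral>\<omega>. \<bar>S {..<N j \<omega>'} \<omega> - S {..<d j} \<omega>\<bar> \<partial>M))"
      using IS by (subst Bochner_Integration.integral_sum) auto
    also have "\<dots> \<le> (\<Sum>j<k. \<bar>c j\<bar> * ((\<delta> + \<bar>real (N j \<omega>') - real (d j)\<bar> * (\<kappa> / n) / \<delta>) / 2))"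
      by (intro sum_mono mult_left_mono S_diff_bound Nn dn \<delta>) auto
    finally show ?thesis .
  qed
  have IF: "integrable M F" unfolding F_def using D(5) .
  have IN: "integrable M (\<lambda>\<omega>. \<bar>real (N j \<omega>) - real (d j)\<bar>)" and EN: "(\<integral>\<omega>. \<bar>real (N j \<omega>) - real (d j)\<bar> \<partial>M) \<le> sqrt n + 1"
    if "j < k" for j
    using empirical_count_bound[OF s[OF that]] unfolding N_def d_def by auto
  have INj: "integrable M (\<lambda>\<omega>. \<bar>c j\<bar> * ((\<delta> + \<bar>real (N j \<omega>) - real (d j)\<bar> * (\<kappa> / n) / \<delta>) / 2))" if "j < k" for j
    by (intro integrable_mult_right integrable_divide Bochner_Integration.integrable_add integrable_const integrable_mult_left IN that)
  have "\<bar>(\<integral>\<omega>. F \<omega> \<partial>M) - E0\<bar> = \<bar>\<integral>\<omega>. F \<omega> - E0 \<partial>M\<bar>" using IF by (simp add: prob_space)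
  also have "\<dots> \<le> (\<integral>\<omega>. \<bar>F \<omega> - E0\<bar> \<partial>M)" by (rule integral_abs_bound)
  also have "\<dots> \<le> (\<integral>\<omega>. (\<Sum>j<k. \<bar>c j\<bar> * ((\<delta> + \<bar>real (N j \<omega>) - real (d j)\<bar> * (\<kappa> / n) / \<delta>) / 2)) \<partial>M)"
    using IF INj by (intro integral_mono pt Bochner_Integration.integrable_sum) auto
  also have "\<dots> = (\<Sum>j<k. (\<integral>\<omega>. \<bar>c j\<bar> * ((\<delta> + \<bar>real (N j \<omega>) - real (d j)\<bar> * (\<kappa> / n) / \<delta>) / 2) \<partial>M))"
    using INj by (intro Bochner_Integration.integral_sum) auto
  also have "\<dots> \<le> (\<Sum>j<k. \<bar>c j\<bar> * ((\<delta> + (sqrt n + 1) * (\<kappa> / n) / \<delta>) / 2))"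
  proof (rule sum_mono)
    fix j assume "j \<in> {..<k}"
    then have j: "j < k" by simp
    have "(\<integral>\<omega>. \<bar>c j\<bar> * ((\<delta> + \<bar>real (N j \<omega>) - real (d j)\<bar> * (\<kappa> / n) / \<delta>) / 2) \<partial>M) =
        \<bar>c j\<bar> * ((\<delta> + (\<integral>\<omega>. \<bar>real (N j \<omega>) - real (d j)\<bar> \<partial>M) * (\<kappa> / n) / \<delta>) / 2)"
      using IN[OF j] by (simp add: prob_space)
    also have "\<dots> \<le> \<bar>c j\<bar> * ((\<delta> + (sqrt n + 1) * (\<kappa> / n) / \<delta>) / 2)"
      using EN[OF j] \<delta> kappa by (intro mult_left_mono divide_right_mono add_left_mono mult_right_mono) auto
    finally show "(\<integral>\<omega>. \<bar>c j\<bar> * ((\<delta> + \<bar>real (N j \<omega>) - real (d j)\<bar> * (\<kappa> / n) / \<delta>) / 2) \<partial>M) \<le>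
        \<bar>c j\<bar> * ((\<delta> + (sqrt n + 1) * (\<kappa> / n) / \<delta>) / 2)" .
  qed
  also have "\<dots> = B * ((\<delta> + (sqrt n + 1) * (\<kappa> / n) / \<delta>) / 2)" unfolding B_def by (rule sum_distrib_right[symmetric])
  finally have 1: "\<bar>(\<integral>\<omega>. F \<omega> \<partial>M) - E0\<bar> \<le> B * ((\<delta> + (sqrt n + 1) * (\<kappa> / n) / \<delta>) / 2)" .
  \<comment> \<open>The same joint expectation is evaluated by \<open>weighted_clt\<close>, so
    \<open>E0\<close> inherits its limit up to the counting error.\<close>
  have "(\<integral>\<omega>. cos ((\<Sum>i<n. W 1 \<omega> i * \<xi> (R i \<omega>)) + b) \<partial>M) = (\<integral>\<omega>. F \<omega> \<partial>M)" unfolding F_def by (rule D(3))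
  moreover have "\<bar>(\<integral>\<omega>. cos ((\<Sum>i<n. W 1 \<omega> i * \<xi> (R i \<omega>)) + b) \<partial>M) - exp (- (\<tau> * (\<kappa> - 1) / 2)) * cos b\<bar> \<le> clt_error n \<kappa> B \<tau>"
  proof (rule weighted_clt[OF n6 _ \<xi>m \<xi>b])
    show "(\<integral>x. \<xi> x \<partial>unif01) = 0" unfolding \<xi>_def by (rule step_combination_mean[OF s])
    show "(\<integral>x. (\<xi> x)\<^sup>2 \<partial>unif01) = \<tau>" unfolding \<xi>_def \<tau>_def by (rule step_combination_variance[OF s])
  qed simp
  ultimately show ?thesis using 1 unfolding E0_def d_def B_def by linarith
qed

text \<open>Interchanging the sums makes this the case \<open>c = 0\<close> of
  \<open>weighted_clt\<close>: the weights stay uncentered and the full \<kappa> appears.\<close>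

lemma randomized_clt:
  fixes s c :: "nat \<Rightarrow> real" and b :: real
  assumes n6: "6 \<le> n" and s: "\<And>j. j < k \<Longrightarrow> s j \<in> {0..1}"
  defines "\<tau> \<equiv> (\<Sum>j<k. \<Sum>l<k. c j * c l * (min (s j) (s l) - s j * s l))"
  shows "\<bar>(\<integral>\<omega>. cos ((\<Sum>j<k. c j * (\<Sum>i<n. W 0 \<omega> i * (indicator {..s j} (R i \<omega>) - s j))) + b) \<partial>M) - exp (- (\<tau> * \<kappa> / 2)) * cos b\<bar> \<le>
    clt_error n \<kappa> (\<Sum>j<k. \<bar>c j\<bar>) \<tau>"
proof -
  have "(\<Sum>j<k. c j * (\<Sum>i<n. W 0 \<omega> i * (indicator {..s j} (R i \<omega>) - s j))) =
      (\<Sum>i<n. W 0 \<omega> i * step_combination k c s (R i \<omega>))" for \<omega>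
    unfolding step_combination_def sum_distrib_left by (subst sum.swap) (simp add: mult_ac)
  moreover have "\<bar>(\<integral>\<omega>. cos ((\<Sum>i<n. W 0 \<omega> i * step_combination k c s (R i \<omega>)) + b) \<partial>M) - exp (- (\<tau> * (\<kappa> - 0) / 2)) * cos b\<bar> \<le>
      clt_error n \<kappa> (\<Sum>j<k. \<bar>c j\<bar>) \<tau>"
    unfolding \<tau>_def
    by (rule weighted_clt[OF n6 _ step_combination_measurable step_combination_bound[OF s]
          step_combination_mean[OF s] step_combination_variance[OF s]]) auto
  ultimately show ?thesis by simp
qed

end

section \<open>The Brownian bridge\<close>

lemma std_normal_cos:
  assumes "prob_space N" and D: "distributed N lborel Z std_normal_density"
  shows "(\<integral>\<omega>. cos (t * Z \<omega> + a) \<partial>N) = exp (- (t\<^sup>2 / 2)) * cos a"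
proof -
  interpret prob_space N by fact
  have Zm: "Z \<in> N \<rightarrow>\<^sub>M lborel" using D by (rule distributed_measurable)
  then have Zm'[measurable]: "Z \<in> borel_measurable N" by simp
  have eq: "distr N lborel Z = std_normal_distribution" by (rule distributed_distr_eq_density[OF D])
  have int: "integrable N (\<lambda>\<omega>. iexp (t * Z \<omega>))" by (rule integrable_const_bound[of _ 1]) auto
  have "(\<integral>\<omega>. iexp (t * Z \<omega>) \<partial>N) = (\<integral>z. iexp (t * z) \<partial>distr N lborel Z)"
    by (rule integral_distr[symmetric, OF Zm]) measurable
  also have "\<dots> = char std_normal_distribution t" unfolding eq char_def ..
  also have "\<dots> = of_real (exp (- (t\<^sup>2 / 2)))" by (simp add: char_std_normal_distribution)
  finally have E: "(\<integral>\<omega>. iexp (t * Z \<omega>) \<partial>N) = of_real (exp (- (t\<^sup>2 / 2)))" .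
  have "cos (x + a) = Re (cis a * iexp x)" for x
    by (simp add: cis_conv_exp[symmetric] cos_add mult.commute)
  then have "(\<integral>\<omega>. cos (t * Z \<omega> + a) \<partial>N) = (\<integral>\<omega>. Re (cis a * iexp (t * Z \<omega>)) \<partial>N)" by (simp only:)
  also have "\<dots> = Re (cis a * (\<integral>\<omega>. iexp (t * Z \<omega>) \<partial>N))" using int by (subst integral_Re) auto
  finally show ?thesis unfolding E by simp
qed

text \<open>A centered normal variable is scaled to a standard one. A point mass with mean 0 sits at
  0, where the same formula holds with variance 0.\<close>

lemma gaussian_variable_properties:
  assumes "prob_space N" and X: "gaussian_variable N X"
  shows "integrable N X" "integrable N (\<lambda>\<omega>. (X \<omega>)\<^sup>2)"
    and "(\<integral>\<omega>. X \<omega> \<partial>N) = 0 \<Longrightarrow> (\<integral>\<omega>. cos (X \<omega> + a) \<partial>N) = exp (- ((\<integral>\<omega>. (X \<omega>)\<^sup>2 \<partial>N) / 2)) * cos a"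
proof -
  interpret prob_space N by fact
  have Xm[measurable]: "X \<in> borel_measurable N" using X by (simp add: gaussian_variable_def)
  from X obtain \<mu> \<sigma> where "(\<sigma> > 0 \<and> distributed N lborel X (normal_density \<mu> \<sigma>)) \<or> (AE \<omega> in N. X \<omega> = \<mu>)"
    by (auto simp: gaussian_variable_def)
  then have "integrable N X \<and> integrable N (\<lambda>\<omega>. (X \<omega>)\<^sup>2) \<and>
    ((\<integral>\<omega>. X \<omega> \<partial>N) = 0 \<longrightarrow> (\<integral>\<omega>. cos (X \<omega> + a) \<partial>N) = exp (- ((\<integral>\<omega>. (X \<omega>)\<^sup>2 \<partial>N) / 2)) * cos a)"
  proof
    assume "\<sigma> > 0 \<and> distributed N lborel X (normal_density \<mu> \<sigma>)"
    then have \<sigma>: "\<sigma> > 0" and D: "distributed N lborel X (normal_density \<mu> \<sigma>)" by auto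
    have I1: "integrable N (\<lambda>\<omega>. X \<omega> - \<mu>)"
      using distributed_integrable[OF D, of "\<lambda>x. x - \<mu>"] integrable_normal_moment[OF \<sigma>, of \<mu> 1] by simp
    have IX: "integrable N X" using Bochner_Integration.integrable_add[OF I1 integrable_const[of \<mu>]] by simp
    have I2: "integrable N (\<lambda>\<omega>. (X \<omega> - \<mu>)\<^sup>2)"
      using distributed_integrable[OF D, of "\<lambda>x. (x - \<mu>)\<^sup>2"] integrable_normal_moment[OF \<sigma>, of \<mu> 2] by simp
    have "(X \<omega>)\<^sup>2 = (X \<omega> - \<mu>)\<^sup>2 + (2 * \<mu> * X \<omega> - \<mu>\<^sup>2)" for \<omega> by (simp add: power2_eq_square algebra_simps)
    then have IX2: "integrable N (\<lambda>\<omega>. (X \<omega>)\<^sup>2)" using I2 IX by simp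
    have E: "expectation X = \<mu>" by (rule normal_distributed_expectation[OF \<sigma> D])
    have V: "variance X = \<sigma>\<^sup>2" by (rule normal_distributed_variance[OF \<sigma> D])
    have "(\<integral>\<omega>. cos (X \<omega> + a) \<partial>N) = exp (- ((\<integral>\<omega>. (X \<omega>)\<^sup>2 \<partial>N) / 2)) * cos a" if 0: "(\<integral>\<omega>. X \<omega> \<partial>N) = 0"
    proof -
      have \<mu>: "\<mu> = 0" using E 0 by simp
      have "distributed N lborel (\<lambda>\<omega>. (X \<omega> - \<mu>) / \<sigma>) std_normal_density"
        using D normal_standard_normal_convert[OF \<sigma>, of X \<mu>] by simp
      from std_normal_cos[OF \<open>prob_space N\<close> this, of \<sigma> a]
      have "(\<integral>\<omega>. cos (X \<omega> + a) \<partial>N) = exp (- (\<sigma>\<^sup>2 / 2)) * cos a" using \<sigma> \<mu> by simp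
      moreover have "(\<integral>\<omega>. (X \<omega>)\<^sup>2 \<partial>N) = \<sigma>\<^sup>2" using V 0 by simp
      ultimately show ?thesis by simp
    qed
    with IX IX2 show ?thesis by blast
  next
    assume ae: "AE \<omega> in N. X \<omega> = \<mu>"
    have IX: "integrable N X" using ae by (intro integrable_const_bound[of _ "\<bar>\<mu>\<bar>"]) auto
    have IX2: "integrable N (\<lambda>\<omega>. (X \<omega>)\<^sup>2)" using ae by (intro integrable_const_bound[of _ "\<mu>\<^sup>2"]) auto
    have E: "(\<integral>\<omega>. X \<omega> \<partial>N) = \<mu>"
      using integral_cong_AE[of X N "\<lambda>_. \<mu>"] ae by (simp add: prob_space)
    have E2: "(\<integral>\<omega>. (X \<omega>)\<^sup>2 \<partial>N) = \<mu>\<^sup>2"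
    proof -
      have "(\<integral>\<omega>. (X \<omega>)\<^sup>2 \<partial>N) = (\<integral>\<omega>. \<mu>\<^sup>2 \<partial>N)" by (rule integral_cong_AE) (use ae in auto)
      then show ?thesis by (simp add: prob_space)
    qed
    have "(\<integral>\<omega>. cos (X \<omega> + a) \<partial>N) = (\<integral>\<omega>. cos (\<mu> + a) \<partial>N)" by (rule integral_cong_AE) (use ae in auto)
    with IX IX2 E E2 show ?thesis by (simp add: prob_space)
  qed
  then show "integrable N X" "integrable N (\<lambda>\<omega>. (X \<omega>)\<^sup>2)"
    "(\<integral>\<omega>. X \<omega> \<partial>N) = 0 \<Longrightarrow> (\<integral>\<omega>. cos (X \<omega> + a) \<partial>N) = exp (- ((\<integral>\<omega>. (X \<omega>)\<^sup>2 \<partial>N) / 2)) * cos a" by blast+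
qed

text \<open>A Gaussian process is defined through finite sets of indices, whereas the times
  \<open>s j\<close> may repeat; the coefficients of equal times are collected first.\<close>

lemma gaussian_process_linear_combination:
  fixes s :: "nat \<Rightarrow> 'i"
  assumes X: "gaussian_process N I X" and s: "\<And>j. j < k \<Longrightarrow> s j \<in> I"
  shows "gaussian_variable N (\<lambda>\<omega>. \<Sum>j<k. c j * X (s j) \<omega>)"
proof -
  define J where "J = s ` {..<k}"
  define c' where "c' t = (\<Sum>j\<in>{j. j < k \<and> s j = t}. c j)" for t
  have "(\<Sum>j<k. c j * X (s j) \<omega>) = (\<Sum>t\<in>J. c' t * X t \<omega>)" for \<omega>
  proof -
    have "(\<Sum>j<k. c j * X (s j) \<omega>) = (\<Sum>t\<in>J. \<Sum>j\<in>{j. j \<in> {..<k} \<and> s j = t}. c j * X (s j) \<omega>)"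
      unfolding J_def by (rule sum.image_gen) simp
    also have "\<dots> = (\<Sum>t\<in>J. c' t * X t \<omega>)"
      unfolding c'_def sum_distrib_right by (intro sum.cong) auto
    finally show ?thesis .
  qed
  moreover have "finite J" "J \<subseteq> I" using s by (auto simp: J_def)
  ultimately show ?thesis using X by (simp add: gaussian_process_def)
qed

lemma brownian_bridge_moments:
  assumes B: "brownian_bridge N B" and s: "s \<in> {0..1}"
  shows "B s \<in> borel_measurable N" "integrable N (B s)" "integrable N (\<lambda>\<omega>. (B s \<omega>)\<^sup>2)"
proof -
  have g: "gaussian_process N {0..1} B" and N: "prob_space N"
    using B by (auto simp: brownian_bridge_def gaussian_process_def)
  have "gaussian_variable N (\<lambda>\<omega>. \<Sum>j<1::nat. 1 * B ((\<lambda>_. s) j) \<omega>)"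
    by (rule gaussian_process_linear_combination[OF g]) (use s in simp)
  then have v: "gaussian_variable N (B s)" by simp
  then show "B s \<in> borel_measurable N" by (simp add: gaussian_variable_def)
  show "integrable N (B s)" "integrable N (\<lambda>\<omega>. (B s \<omega>)\<^sup>2)"
    using gaussian_variable_properties[OF N v] by auto
qed

text \<open>The exponent contains the variance of \<open>step_combination\<close>, so the limits in
  \<open>bridge_clt\<close> and \<open>randomized_clt\<close> are matched by
  \<open>\<sigma>^2 = \<kappa> - 1\<close> and \<open>\<sigma>^2 = \<kappa>\<close>.\<close>

lemma brownian_bridge_cos:
  fixes s c :: "nat \<Rightarrow> real"
  assumes B: "brownian_bridge N B" and s: "\<And>j. j < k \<Longrightarrow> s j \<in> {0..1}"
  shows "(\<integral>\<omega>. cos ((\<Sum>j<k. c j * (\<sigma> * B (s j) \<omega>)) + b) \<partial>N) =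
    exp (- ((\<Sum>j<k. \<Sum>l<k. c j * c l * (min (s j) (s l) - s j * s l)) * \<sigma>\<^sup>2 / 2)) * cos b"
proof -
  have g: "gaussian_process N {0..1} B" and N: "prob_space N"
    and m: "\<And>s. s \<in> {0..1} \<Longrightarrow> (\<integral>\<omega>. B s \<omega> \<partial>N) = 0"
    and cv: "\<And>s t. s \<in> {0..1} \<Longrightarrow> t \<in> {0..1} \<Longrightarrow> (\<integral>\<omega>. B s \<omega> * B t \<omega> \<partial>N) = min s t - s * t"
    using B by (auto simp: brownian_bridge_def gaussian_process_def)
  define X where "X \<omega> = (\<Sum>j<k. c j * \<sigma> * B (s j) \<omega>)" for \<omega>
  have X: "gaussian_variable N X"
    unfolding X_def[abs_def] by (rule gaussian_process_linear_combination[OF g s])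
  note P = gaussian_variable_properties[OF N X]
  have I: "integrable N (B (s j))" if "j < k" for j using brownian_bridge_moments[OF B s[OF that]] by simp
  have I2: "integrable N (\<lambda>\<omega>. B (s j) \<omega> * B (s l) \<omega>)" if "j < k" "l < k" for j l
  proof (rule Bochner_Integration.integrable_bound)
    show "integrable N (\<lambda>\<omega>. (B (s j) \<omega>)\<^sup>2 + (B (s l) \<omega>)\<^sup>2)"
      using brownian_bridge_moments[OF B s] that by simp
    show "(\<lambda>\<omega>. B (s j) \<omega> * B (s l) \<omega>) \<in> borel_measurable N"
      using brownian_bridge_moments[OF B s] that by (intro borel_measurable_times) auto
    have "\<bar>x * y\<bar> \<le> x\<^sup>2 + y\<^sup>2" for x y :: real
    proof -
      have "2 * (\<bar>x\<bar> * \<bar>y\<bar>) \<le> x\<^sup>2 + y\<^sup>2"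
        using zero_le_power2[of "\<bar>x\<bar> - \<bar>y\<bar>"] by (simp add: power2_diff)
      then show ?thesis unfolding abs_mult using mult_nonneg_nonneg[of "\<bar>x\<bar>" "\<bar>y\<bar>"] by linarith
    qed
    then show "AE \<omega> in N. norm (B (s j) \<omega> * B (s l) \<omega>) \<le> norm ((B (s j) \<omega>)\<^sup>2 + (B (s l) \<omega>)\<^sup>2)" by simp
  qed
  have E: "(\<integral>\<omega>. X \<omega> \<partial>N) = 0"
  proof -
    have "(\<integral>\<omega>. X \<omega> \<partial>N) = (\<Sum>j<k. (\<integral>\<omega>. c j * \<sigma> * B (s j) \<omega> \<partial>N))"
      unfolding X_def by (rule Bochner_Integration.integral_sum) (simp add: I)
    then show ?thesis using m s by simp
  qed
  have "(\<integral>\<omega>. (X \<omega>)\<^sup>2 \<partial>N) = (\<integral>\<omega>. (\<Sum>j<k. \<Sum>l<k. c j * \<sigma> * (c l * \<sigma>) * (B (s j) \<omega> * B (s l) \<omega>)) \<partial>N)"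
    unfolding X_def power2_eq_square sum_product by (simp add: mult_ac)
  also have "\<dots> = (\<Sum>j<k. (\<integral>\<omega>. (\<Sum>l<k. c j * \<sigma> * (c l * \<sigma>) * (B (s j) \<omega> * B (s l) \<omega>)) \<partial>N))"
    by (rule Bochner_Integration.integral_sum) (intro Bochner_Integration.integrable_sum integrable_mult_right I2; simp)
  also have "\<dots> = (\<Sum>j<k. \<Sum>l<k. (\<integral>\<omega>. c j * \<sigma> * (c l * \<sigma>) * (B (s j) \<omega> * B (s l) \<omega>) \<partial>N))"
    by (intro sum.cong refl Bochner_Integration.integral_sum integrable_mult_right I2) auto
  also have "\<dots> = (\<Sum>j<k. \<Sum>l<k. c j * c l * (min (s j) (s l) - s j * s l)) * \<sigma>\<^sup>2"
    unfolding sum_distrib_right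
  proof (intro sum.cong refl)
    fix j l assume "j \<in> {..<k}" "l \<in> {..<k}"
    then have "(\<integral>\<omega>. B (s j) \<omega> * B (s l) \<omega> \<partial>N) = min (s j) (s l) - s j * s l" by (intro cv s) auto
    then show "(\<integral>\<omega>. c j * \<sigma> * (c l * \<sigma>) * (B (s j) \<omega> * B (s l) \<omega>) \<partial>N) = c j * c l * (min (s j) (s l) - s j * s l) * \<sigma>\<^sup>2"
      by (simp add: power2_eq_square)
  qed
  finally have V: "(\<integral>\<omega>. (X \<omega>)\<^sup>2 \<partial>N) = (\<Sum>j<k. \<Sum>l<k. c j * c l * (min (s j) (s l) - s j * s l)) * \<sigma>\<^sup>2" .
  have "(\<Sum>j<k. c j * (\<sigma> * B (s j) \<omega>)) = X \<omega>" for \<omega> by (simp add: X_def mult.assoc)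
  then show ?thesis using P(3)[OF E, of b] unfolding V by simp
qed

lemma skorokhod_spaceI:
  assumes r: "\<And>t. 0 \<le> t \<Longrightarrow> t < 1 \<Longrightarrow> (f \<longlongrightarrow> f t) (at_right t)"
    and l: "\<And>t. 0 < t \<Longrightarrow> t \<le> 1 \<Longrightarrow> \<exists>l. (f \<longlongrightarrow> l) (at_left t)"
  shows "(\<lambda>s\<in>{0..1}. f s) \<in> skorokhod_space"
  unfolding skorokhod_space_def
proof (intro CollectI conjI ballI)
  fix t :: real assume t: "t \<in> {0..<1}"
  have "eventually (\<lambda>s. f s = restrict f {0..1} s) (at_right t)"
    unfolding eventually_at_right_field using t by (intro exI[of _ 1]) auto
  moreover have "(f \<longlongrightarrow> f t) (at_right t)" using r t by simp
  ultimately have "(restrict f {0..1} \<longlongrightarrow> f t) (at_right t)" by (rule Lim_transform_eventually[rotated])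
  moreover have "restrict f {0..1} t = f t" using t by simp
  ultimately show "(restrict f {0..1} \<longlongrightarrow> restrict f {0..1} t) (at_right t)" by (simp only:)
next
  fix t :: real assume t: "t \<in> {0<..1}"
  then obtain l where l: "(f \<longlongrightarrow> l) (at_left t)" using l[of t] by auto
  have "eventually (\<lambda>s. f s = restrict f {0..1} s) (at_left t)"
    unfolding eventually_at_left_field using t by (intro exI[of _ 0]) auto
  from Lim_transform_eventually[OF l this] show "\<exists>l. (restrict f {0..1} \<longlongrightarrow> l) (at_left t)" by blast
qed simp

lemma continuous_in_skorokhod_space:
  assumes f: "continuous_on {0..1} f"
  shows "(\<lambda>s\<in>{0..1}. f s) \<in> skorokhod_space"
proof (rule skorokhod_spaceI)
  fix t :: real assume "0 \<le> t" "t < 1"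
  then have "(f \<longlongrightarrow> f t) (at t within {t..1})"
    using continuous_on_subset[OF f, of "{t..1}"] by (auto simp: continuous_on_def)
  with \<open>t < 1\<close> show "(f \<longlongrightarrow> f t) (at_right t)" by (simp add: at_within_Icc_at_right)
next
  fix t :: real assume "0 < t" "t \<le> 1"
  then have "(f \<longlongrightarrow> f t) (at t within {0..t})"
    using continuous_on_subset[OF f, of "{0..t}"] by (auto simp: continuous_on_def)
  with \<open>0 < t\<close> have "(f \<longlongrightarrow> f t) (at_left t)" by (simp add: at_within_Icc_at_left)
  then show "\<exists>l. (f \<longlongrightarrow> l) (at_left t)" by blast
qed

text \<open>On either side of t each indicator is constant near t; from the left its limit is the
  indicator of \<open>{..<t}\<close>, and the drift is continuous.\<close>

lemma weighted_empirical_in_skorokhod_space: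
  fixes a r :: "nat \<Rightarrow> real"
  shows "(\<lambda>s\<in>{0..1}. C * (\<Sum>i<n. a i * (indicator {..s} (r i) - s))) \<in> skorokhod_space"
proof (rule skorokhod_spaceI)
  fix t :: real
  have "((\<lambda>s. indicator {..s} x :: real) \<longlongrightarrow> indicator {..t} x) (at_right t)" for x
  proof (rule tendsto_eventually)
    show "eventually (\<lambda>s. indicator {..s} x = (indicator {..t} x :: real)) (at_right t)"
      unfolding eventually_at_right_field
      by (intro exI[of _ "if x \<le> t then t + 1 else x"]) (auto simp: indicator_def)
  qed
  then show "((\<lambda>s. C * (\<Sum>i<n. a i * (indicator {..s} (r i) - s))) \<longlongrightarrow> C * (\<Sum>i<n. a i * (indicator {..t} (r i) - t))) (at_right t)"
    by (intro tendsto_intros)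
  have "((\<lambda>s. indicator {..s} x :: real) \<longlongrightarrow> indicator {..<t} x) (at_left t)" for x
  proof (rule tendsto_eventually)
    show "eventually (\<lambda>s. indicator {..s} x = (indicator {..<t} x :: real)) (at_left t)"
      unfolding eventually_at_left_field
      by (intro exI[of _ "if x < t then x else t - 1"]) (auto simp: indicator_def)
  qed
  then have "((\<lambda>s. C * (\<Sum>i<n. a i * (indicator {..s} (r i) - s))) \<longlongrightarrow> C * (\<Sum>i<n. a i * (indicator {..<t} (r i) - t))) (at_left t)"
    by (intro tendsto_intros)
  then show "\<exists>l. ((\<lambda>s. C * (\<Sum>i<n. a i * (indicator {..s} (r i) - s))) \<longlongrightarrow> l) (at_left t)" by blast
qed

section \<open>Functional limits\<close>

context bridge_setting begin

section \<open>Increments of the two processes\<close>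

lemma bridge_increment_eq:
  "p \<le> q \<Longrightarrow> S {..<q} \<omega> - S {..<p} \<omega> = S {p..<q} \<omega>"
proof -
  assume "p \<le> q"
  then have "S {..<q} \<omega> = S {..<p} \<omega> + S {p..<q} \<omega>"
    unfolding S_def by (subst sum.union_disjoint[symmetric]) (auto simp: ivl_disj_un_one)
  then show ?thesis by simp
qed

lemma grid_increment_bounds:
  fixes a s :: real
  assumes "0 \<le> a" "a \<le> s"
  shows "nat \<lfloor>n * a\<rfloor> \<le> nat \<lfloor>n * s\<rfloor>" "real (nat \<lfloor>n * s\<rfloor> - nat \<lfloor>n * a\<rfloor>) \<le> n * (s - a) + 1"
proof -
  have le: "n * a \<le> n * s" using assms by (intro mult_left_mono) auto
  then show 1: "nat \<lfloor>n * a\<rfloor> \<le> nat \<lfloor>n * s\<rfloor>" by (intro nat_mono floor_mono)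
  have "0 \<le> n * a" "0 \<le> n * s" using assms by auto
  then have "real (nat \<lfloor>n * s\<rfloor>) = of_int \<lfloor>n * s\<rfloor>" "real (nat \<lfloor>n * a\<rfloor>) = of_int \<lfloor>n * a\<rfloor>" by auto
  with 1 have "real (nat \<lfloor>n * s\<rfloor> - nat \<lfloor>n * a\<rfloor>) = of_int \<lfloor>n * s\<rfloor> - of_int \<lfloor>n * a\<rfloor>" by (simp add: of_nat_diff)
  also have "\<dots> \<le> n * s - n * a + 1" by linarith
  finally show "real (nat \<lfloor>n * s\<rfloor> - nat \<lfloor>n * a\<rfloor>) \<le> n * (s - a) + 1" by (simp add: right_diff_distrib)
qed

text \<open>Every centered weight is at least - 1 / sqrt n after normalization, and at most n (s -
  a) + 1 of them lie between the two rounded times; the extra one produces the slack 1 / sqrt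
  n.\<close>

lemma bridge_increment_lower:
  fixes a s :: real
  assumes as: "0 \<le> a" "a \<le> s"
  shows "S {..<nat \<lfloor>n * s\<rfloor>} \<omega> - S {..<nat \<lfloor>n * a\<rfloor>} \<omega> \<ge> - sqrt n * (s - a) - 1 / sqrt n"
proof -
  define d where "d = nat \<lfloor>n * s\<rfloor> - nat \<lfloor>n * a\<rfloor>"
  note g = grid_increment_bounds[OF as]
  have sn: "sqrt n > 0" using n_pos by simp
  have "S {nat \<lfloor>n * a\<rfloor>..<nat \<lfloor>n * s\<rfloor>} \<omega> \<ge> (\<Sum>i\<in>{nat \<lfloor>n * a\<rfloor>..<nat \<lfloor>n * s\<rfloor>}. - (1 / sqrt n))"
    unfolding S_def
  proof (rule sum_mono)
    fix i
    have "- (1 / sqrt n) = sqrt n * (0 - 1 / n)" using sn by (simp add: real_sqrt_divide field_simps)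
    also have "\<dots> \<le> W 1 \<omega> i" unfolding W_def using A_nonneg by (intro mult_left_mono diff_right_mono) auto
    finally show "- (1 / sqrt n) \<le> W 1 \<omega> i" .
  qed
  then have "S {nat \<lfloor>n * a\<rfloor>..<nat \<lfloor>n * s\<rfloor>} \<omega> \<ge> - (d / sqrt n)" by (simp add: d_def)
  moreover have "d / sqrt n \<le> (n * (s - a) + 1) / sqrt n" unfolding d_def by (rule divide_right_mono[OF g(2)]) simp
  moreover have "(n * (s - a) + 1) / sqrt n = sqrt n * (s - a) + 1 / sqrt n"
    using sn by (simp add: add_divide_distrib real_div_sqrt flip: times_divide_eq_left)
  ultimately show ?thesis unfolding bridge_increment_eq[OF g(1)] by linarith
qed

text \<open>When t - s is at least 1/n, doubling absorbs the rounding error in the number of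
  summands; 739840 = 4 * 184960.\<close>

lemma bridge_increment_fourth_moment:
  fixes s t :: real
  assumes n6: "6 \<le> n" and st: "0 \<le> s" "t \<le> 1" "1 / n \<le> t - s"
  shows "integrable M (\<lambda>\<omega>. (S {..<nat \<lfloor>n * t\<rfloor>} \<omega> - S {..<nat \<lfloor>n * s\<rfloor>} \<omega>) ^ 4)"
    and "(\<integral>\<omega>. (S {..<nat \<lfloor>n * t\<rfloor>} \<omega> - S {..<nat \<lfloor>n * s\<rfloor>} \<omega>) ^ 4 \<partial>M) \<le> 739840 * \<kappa>\<^sup>2 * (t - s)\<^sup>2"
proof -
  have "0 \<le> 1 / real n" by simp
  then have le: "s \<le> t" using st by linarith
  note g = grid_increment_bounds[OF st(1) le]
  note eq = bridge_increment_eq[OF g(1)]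
  show "integrable M (\<lambda>\<omega>. (S {..<nat \<lfloor>n * t\<rfloor>} \<omega> - S {..<nat \<lfloor>n * s\<rfloor>} \<omega>) ^ 4)"
    unfolding eq by (rule S_integrable_power)
  have "(\<integral>\<omega>. S {nat \<lfloor>n * s\<rfloor>..<nat \<lfloor>n * t\<rfloor>} \<omega> ^ 4 \<partial>M) \<le> 184960 * \<kappa>\<^sup>2 * (card {nat \<lfloor>n * s\<rfloor>..<nat \<lfloor>n * t\<rfloor>} / n)\<^sup>2"
    by (rule S_fourth_moment[OF _ n6]) (use floor_index_le[of t] st le in auto)
  also have "\<dots> \<le> 184960 * \<kappa>\<^sup>2 * (2 * (t - s))\<^sup>2"
  proof (intro mult_left_mono power_mono)
    have "1 \<le> n * (t - s)" using st(3) n_pos by (simp add: field_simps)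
    then have "real (card {nat \<lfloor>n * s\<rfloor>..<nat \<lfloor>n * t\<rfloor>}) \<le> 2 * (t - s) * n"
      using g(2) unfolding card_atLeastLessThan by (simp add: algebra_simps)
    then show "card {nat \<lfloor>n * s\<rfloor>..<nat \<lfloor>n * t\<rfloor>} / n \<le> 2 * (t - s)"
      using n_pos by (subst pos_divide_le_eq) auto
  qed auto
  also have "\<dots> = 739840 * \<kappa>\<^sup>2 * (t - s)\<^sup>2" unfolding power_mult_distrib by simp
  finally show "(\<integral>\<omega>. (S {..<nat \<lfloor>n * t\<rfloor>} \<omega> - S {..<nat \<lfloor>n * s\<rfloor>} \<omega>) ^ 4 \<partial>M) \<le> 739840 * \<kappa>\<^sup>2 * (t - s)\<^sup>2"
    unfolding eq .
qed

lemma bridge_second_moment: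
  fixes s :: real
  assumes s: "s \<in> {0..1}"
  shows "integrable M (\<lambda>\<omega>. (S {..<nat \<lfloor>n * s\<rfloor>} \<omega>)\<^sup>2)" "(\<integral>\<omega>. (S {..<nat \<lfloor>n * s\<rfloor>} \<omega>)\<^sup>2 \<partial>M) \<le> \<kappa>"
proof -
  show "integrable M (\<lambda>\<omega>. (S {..<nat \<lfloor>n * s\<rfloor>} \<omega>)\<^sup>2)" by (rule S_integrable_power)
  have "(\<integral>\<omega>. (S {..<nat \<lfloor>n * s\<rfloor>} \<omega>)\<^sup>2 \<partial>M) \<le> card {..<nat \<lfloor>n * s\<rfloor>} * (\<kappa> / n)"
    by (rule S_second_moment) (use floor_index_le[OF s] in auto)
  also have "\<dots> \<le> n * (\<kappa> / n)" using floor_index_le[OF s] kappa by (intro mult_right_mono) auto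
  finally show "(\<integral>\<omega>. (S {..<nat \<lfloor>n * s\<rfloor>} \<omega>)\<^sup>2 \<partial>M) \<le> \<kappa>" using n_pos by simp
qed

definition rand_bridge :: "'a \<Rightarrow> real \<Rightarrow> real" where
  "rand_bridge \<omega> s = (\<Sum>i<n. W 0 \<omega> i * (indicator {..s} (R i \<omega>) - s))"

lemma rand_bridge_measurable: "(\<lambda>\<omega>. rand_bridge \<omega> s) \<in> borel_measurable M"
  unfolding rand_bridge_def
proof (rule borel_measurable_sum)
  fix i assume "i \<in> {..<n}"
  then have [measurable]: "R i \<in> borel_measurable M" by (simp add: R_measurable)
  have "(\<lambda>\<omega>. indicator {..s} (R i \<omega>) :: real) \<in> borel_measurable M"
    by (rule measurable_compose[of _ _ borel]) auto
  then show "(\<lambda>\<omega>. W 0 \<omega> i * (indicator {..s} (R i \<omega>) - s)) \<in> borel_measurable M"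
    by (intro borel_measurable_times borel_measurable_diff borel_measurable_const W_measurable)
qed

text \<open>The indicator part increases with the time; only the drift lowers the path, at rate sqrt
  n because the weights add up to 1. The slack 1 / sqrt n gives the bound the form it has for the
  other process.\<close>

lemma rand_bridge_lower:
  fixes a s :: real
  assumes \<omega>: "\<omega> \<in> space M" and as: "a \<le> s"
  shows "rand_bridge \<omega> s - rand_bridge \<omega> a \<ge> - sqrt n * (s - a) - 1 / sqrt n"
proof -
  have "rand_bridge \<omega> s - rand_bridge \<omega> a =
      (\<Sum>i<n. sqrt n * (A \<omega> i * (indicator {..s} (R i \<omega>) - indicator {..a} (R i \<omega>))) - sqrt n * (s - a) * A \<omega> i)"
    unfolding rand_bridge_def W_def by (simp add: algebra_simps flip: sum_subtractf)
  also have "\<dots> = (\<Sum>i<n. sqrt n * (A \<omega> i * (indicator {..s} (R i \<omega>) - indicator {..a} (R i \<omega>)))) - sqrt n * (s - a) * (\<Sum>i<n. A \<omega> i)"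
    by (simp only: sum_subtractf sum_distrib_left)
  also have "\<dots> \<ge> 0 - sqrt n * (s - a) * 1"
  proof (intro diff_mono)
    show "0 \<le> (\<Sum>i<n. sqrt n * (A \<omega> i * (indicator {..s} (R i \<omega>) - indicator {..a} (R i \<omega>))))"
      using as by (intro sum_nonneg mult_nonneg_nonneg A_nonneg) (auto simp: indicator_def)
  qed (simp add: A_sum[OF \<omega>])
  moreover have "0 \<le> 1 / sqrt n" by simp
  ultimately show ?thesis by linarith
qed

text \<open>An increment is a weighted sum of differences of two centered indicators, whose variance
  is at most \<delta> = t - s. The condition 1/n \<le> t - s turns \<delta> / n into \<delta>^2, so
  the constant is 680 * 4.\<close>

lemma rand_bridge_increment_fourth_moment:
  fixes s t :: real
  assumes n6: "6 \<le> n" and st: "0 \<le> s" "t \<le> 1" "1 / n \<le> t - s"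
  shows "integrable M (\<lambda>\<omega>. (rand_bridge \<omega> t - rand_bridge \<omega> s) ^ 4)"
    and "(\<integral>\<omega>. (rand_bridge \<omega> t - rand_bridge \<omega> s) ^ 4 \<partial>M) \<le> 2720 * \<kappa>\<^sup>2 * (t - s)\<^sup>2"
proof -
  have "0 \<le> 1 / real n" by simp
  then have le: "s \<le> t" using st by linarith
  define c :: "nat \<Rightarrow> real" where "c j = (if j = 0 then 1 else - 1)" for j
  define u where "u j = (if j = 0 then t else s)" for j :: nat
  define \<zeta> where "\<zeta> = step_combination 2 c u"
  have u: "u j \<in> {0..1}" if "j < 2" for j using st le by (auto simp: u_def)
  have \<zeta>_eq: "\<zeta> x = indicator {..t} x - t - (indicator {..s} x - s)" for x
    by (simp add: \<zeta>_def step_combination_def c_def u_def numeral_2_eq_2)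
  have eq: "rand_bridge \<omega> t - rand_bridge \<omega> s = (\<Sum>i<n. W 0 \<omega> i * \<zeta> (R i \<omega>))" for \<omega>
    unfolding rand_bridge_def \<zeta>_eq by (simp add: right_diff_distrib sum_subtractf)
  have b: "\<bar>\<zeta> x\<bar> \<le> 1" for x unfolding \<zeta>_eq using st le by (auto simp: indicator_def)
  have m: "(\<integral>x. \<zeta> x \<partial>unif01) = 0" unfolding \<zeta>_def by (rule step_combination_mean[OF u])
  have "(\<integral>x. (\<zeta> x)\<^sup>2 \<partial>unif01) = (\<Sum>j<2. \<Sum>l<2. c j * c l * (min (u j) (u l) - u j * u l))"
    unfolding \<zeta>_def by (rule step_combination_variance[OF u])
  also have "\<dots> = (t - s) - (t - s)\<^sup>2"
    using le by (simp add: c_def u_def numeral_2_eq_2 min_def power2_eq_square algebra_simps)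
  also have "\<dots> \<le> t - s" by simp
  finally have v: "(\<integral>x. (\<zeta> x)\<^sup>2 \<partial>unif01) \<le> t - s" .
  have \<zeta>m: "\<zeta> \<in> borel_measurable borel" unfolding \<zeta>_def by (rule step_combination_measurable)
  note P = weighted_fourth_moment[OF n6 order_refl zero_le_one \<zeta>m b m v]
  show "integrable M (\<lambda>\<omega>. (rand_bridge \<omega> t - rand_bridge \<omega> s) ^ 4)" unfolding eq by (rule P(1))
  have "(\<integral>\<omega>. (rand_bridge \<omega> t - rand_bridge \<omega> s) ^ 4 \<partial>M) \<le> 680 * \<kappa>\<^sup>2 * (3 * (t - s)\<^sup>2 + (t - s) / n)"
    unfolding eq by (rule P(2))
  also have "\<dots> \<le> 680 * \<kappa>\<^sup>2 * (4 * (t - s)\<^sup>2)"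
  proof (rule mult_left_mono)
    have "(t - s) * (1 / n) \<le> (t - s) * (t - s)" using st le by (intro mult_left_mono) auto
    then show "3 * (t - s)\<^sup>2 + (t - s) / n \<le> 4 * (t - s)\<^sup>2" by (simp add: power2_eq_square)
  qed simp
  finally show "(\<integral>\<omega>. (rand_bridge \<omega> t - rand_bridge \<omega> s) ^ 4 \<partial>M) \<le> 2720 * \<kappa>\<^sup>2 * (t - s)\<^sup>2" by simp
qed

text \<open>The fourth moment estimate and x^2 \<le> 1 + x^4 suffice, since any bound uniform in n
  and s will do.\<close>

lemma rand_bridge_second_moment:
  fixes s :: real
  assumes n6: "6 \<le> n" and s: "s \<in> {0..1}"
  shows "integrable M (\<lambda>\<omega>. (rand_bridge \<omega> s)\<^sup>2)" "(\<integral>\<omega>. (rand_bridge \<omega> s)\<^sup>2 \<partial>M) \<le> 1 + 2720 * \<kappa>\<^sup>2"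
proof -
  define \<zeta> where "\<zeta> x = indicator {..s} x - s" for x :: real
  interpret u: prob_space unif01 by (rule prob_space_unif01)
  have \<zeta>_eq: "\<zeta> = step_combination 1 (\<lambda>_. 1) (\<lambda>_. s)" by (auto simp: \<zeta>_def step_combination_def)
  have \<zeta>m: "\<zeta> \<in> borel_measurable borel" unfolding \<zeta>_eq by (rule step_combination_measurable)
  have b: "\<bar>\<zeta> x\<bar> \<le> 1" for x unfolding \<zeta>_def by (rule indicator_minus_bound[OF s])
  have m: "(\<integral>x. \<zeta> x \<partial>unif01) = 0" unfolding \<zeta>_eq by (rule step_combination_mean) (use s in auto)
  have "(\<integral>x. (\<zeta> x)\<^sup>2 \<partial>unif01) = s - s * s"
    unfolding \<zeta>_eq using step_combination_variance[of 1 "\<lambda>_. s" "\<lambda>_. 1"] s by simp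
  also have "\<dots> \<le> 1" using s zero_le_square[of s] unfolding atLeastAtMost_iff by linarith
  finally have v: "(\<integral>x. (\<zeta> x)\<^sup>2 \<partial>unif01) \<le> 1" .
  note P = weighted_fourth_moment[OF n6 order_refl zero_le_one \<zeta>m b m v]
  have eq: "rand_bridge \<omega> s = (\<Sum>i<n. W 0 \<omega> i * \<zeta> (R i \<omega>))" for \<omega> by (simp add: rand_bridge_def \<zeta>_def)
  have le: "(x\<^sup>2 :: real) \<le> 1 + x ^ 4" for x
  proof -
    have "0 \<le> (x\<^sup>2 - 1)\<^sup>2" "0 \<le> x\<^sup>2" by simp_all
    moreover have "(x\<^sup>2 - 1)\<^sup>2 = x ^ 4 - 2 * x\<^sup>2 + 1" by (simp add: power_numeral_reduce algebra_simps)
    ultimately show ?thesis by linarith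
  qed
  have I4: "integrable M (\<lambda>\<omega>. (rand_bridge \<omega> s) ^ 4)" unfolding eq by (rule P(1))
  show I2: "integrable M (\<lambda>\<omega>. (rand_bridge \<omega> s)\<^sup>2)"
  proof (rule Bochner_Integration.integrable_bound)
    show "integrable M (\<lambda>\<omega>. 1 + (rand_bridge \<omega> s) ^ 4)" using I4 by simp
    show "(\<lambda>\<omega>. (rand_bridge \<omega> s)\<^sup>2) \<in> borel_measurable M"
      by (intro borel_measurable_power rand_bridge_measurable)
    show "AE \<omega> in M. norm ((rand_bridge \<omega> s)\<^sup>2) \<le> norm (1 + (rand_bridge \<omega> s) ^ 4)"
      using le by (simp add: abs_of_nonneg)
  qed
  have "(\<integral>\<omega>. (rand_bridge \<omega> s)\<^sup>2 \<partial>M) \<le> (\<integral>\<omega>. 1 + (rand_bridge \<omega> s) ^ 4 \<partial>M)"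
    using I2 I4 le by (intro integral_mono) auto
  also have "\<dots> = 1 + (\<integral>\<omega>. (rand_bridge \<omega> s) ^ 4 \<partial>M)" using I4 by (simp add: prob_space)
  also have "\<dots> \<le> 1 + 680 * \<kappa>\<^sup>2 * (3 * 1\<^sup>2 + 1 / n)" unfolding eq using P(2) by simp
  also have "\<dots> \<le> 1 + 680 * \<kappa>\<^sup>2 * 4"
    using n_pos by (intro add_left_mono mult_left_mono) auto
  finally show "(\<integral>\<omega>. (rand_bridge \<omega> s)\<^sup>2 \<partial>M) \<le> 1 + 2720 * \<kappa>\<^sup>2" by simp
qed

end

lemma integral_bound_cong:
  fixes f g :: "'a \<Rightarrow> real"
  assumes "\<And>x. x \<in> space M \<Longrightarrow> f x = g x" "integrable M g" "(\<integral>x. g x \<partial>M) \<le> K"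
  shows "integrable M f \<and> (\<integral>x. f x \<partial>M) \<le> K"
  using assms(2,3) Bochner_Integration.integrable_cong[of M M f g] Bochner_Integration.integral_cong[of M M f g] assms(1)
  by auto

text \<open>The terms of \<open>Q_variance_bound\<close> tend to 0, \<kappa>^2, - 2 \<kappa>^2 and
  \<kappa>^2, so they cancel in the limit; the other two errors are of order 1 / sqrt n and 1 /
  n.\<close>

lemma clt_error_tendsto:
  assumes "\<kappa> = 2 \<or> \<kappa> = 3"
  shows "(\<lambda>n. clt_error n \<kappa> B \<tau>) \<longlonglongrightarrow> 0"
proof -
  have "(\<lambda>n. Q_variance_bound n 2) \<longlonglongrightarrow> 0" "(\<lambda>n. Q_variance_bound n 3) \<longlonglongrightarrow> 0"
    unfolding Q_variance_bound_def by real_asymp+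
  then have "(\<lambda>n. Q_variance_bound n \<kappa>) \<longlonglongrightarrow> 0" using assms by auto
  then have 1: "(\<lambda>n. sqrt (Q_variance_bound n \<kappa>)) \<longlonglongrightarrow> 0" using tendsto_real_sqrt by force
  have 2: "(\<lambda>n. (\<kappa> + 680 * \<kappa>\<^sup>2) / (2 * sqrt (real n))) \<longlonglongrightarrow> 0" using assms by (elim disjE; simp; real_asymp)
  have 3: "(\<lambda>n. 680 * \<kappa>\<^sup>2 / real n) \<longlonglongrightarrow> 0" by (rule lim_const_over_n)
  have "(\<lambda>n. clt_error n \<kappa> B \<tau>) \<longlonglongrightarrow> B ^ 3 / 6 * 0 + \<tau>\<^sup>2 / 8 * 0 + \<tau> / 2 * 0"
    unfolding clt_error_def by (intro tendsto_intros 1 2 3)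
  then show ?thesis by simp
qed

lemma tendsto_of_error_bound:
  fixes E e :: "nat \<Rightarrow> real"
  assumes "\<And>n. n \<ge> n0 \<Longrightarrow> \<bar>E n - L\<bar> \<le> e n" "e \<longlonglongrightarrow> 0"
  shows "E \<longlonglongrightarrow> L"
proof -
  have "(\<lambda>n. E n - L) \<longlonglongrightarrow> 0"
    by (rule Lim_null_comparison[OF _ assms(2)]) (use assms(1) in \<open>auto simp: eventually_sequentially\<close>)
  then show ?thesis by (rule LIM_zero_cancel)
qed

section \<open>From Haar matrices to the two limits\<close>

text \<open>On \<open>space M\<close> the weights are a measurable function of the matrix, so they
  inherit its independence from the uniform variables.\<close>

lemma haar_setting_bridge_setting:
  assumes F: "F = UNIV \<and> \<kappa> = 2 \<or> F = \<real> \<and> \<kappa> = 3"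
    and H: "haar_setting M n (entry_group n F) U R" and n: "n \<ge> 1"
  shows "bridge_setting M n \<kappa> (\<lambda>\<omega> i. if \<omega> \<in> space M then (cmod (first_column n (U \<omega>) i))\<^sup>2 else if i = 0 then 1 else 0) R"
proof -
  let ?A = "\<lambda>\<omega> i. if \<omega> \<in> space M then (cmod (first_column n (U \<omega>) i))\<^sup>2 else if i = 0 then 1 else (0::real)"
  have U: "haar_distributed M n (entry_group n F) U" and R: "iid_uniform M n R"
    and ind: "independent_variables M (restrict_space (mat_borel n) (entry_group n F)) U
       (\<Pi>\<^sub>M _\<in>{..<n}. borel) (\<lambda>\<omega>. \<lambda>i\<in>{..<n}. R i \<omega>)"
    using H by (auto simp: haar_setting_def)
  interpret haar_weights M n \<kappa> ?A by (rule haar_weights_entry_group[OF F U n])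
  show ?thesis
  proof (unfold_locales, goal_cases)
    case 1
    show ?case using R by (simp add: iid_uniform_def)
  next
    case (2 i)
    then show ?case using R by (simp add: iid_uniform_def)
  next
    case 3
    show ?case
    proof (rule independent_variables_compose[OF prob_space_axioms ind])
      show "(\<lambda>A i. (cmod (first_column n A i))\<^sup>2) \<in> borel_measurable (restrict_space (mat_borel n) (entry_group n F))"
        by (rule measurable_compose[OF measurable_first_column[OF n] borel_measurable_modulus_squares])
    qed auto
  qed
qed

text \<open>On \<open>space (M n)\<close> each process coincides with its abstract counterpart in
  \<open>bridge_setting\<close>, for which the hypotheses of \<open>functional_limit\<close> are
  established; the moment bounds set in at n = 6.\<close>

lemma bridge_limits:
  fixes M :: "nat \<Rightarrow> 'a measure" and N :: "'b measure"
  assumes \<kappa>: "\<kappa> = 2 \<or> \<kappa> = 3"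
    and setting: "\<And>n. n \<ge> 1 \<Longrightarrow> bridge_setting (M n) n \<kappa> (A n) (R n)"
    and AU: "\<And>n \<omega> i. n \<ge> 1 \<Longrightarrow> \<omega> \<in> space (M n) \<Longrightarrow> i < n \<Longrightarrow> A n \<omega> i = (cmod (U n \<omega> $$ (i, 0)))\<^sup>2"
    and B: "brownian_bridge N B\<^sub>0"
  shows "converges_in_distribution skorokhod_topology
           M (\<lambda>n \<omega>. \<lambda>s\<in>{0..1}. sqrt (real n) * bridge_process n (U n) \<omega> s)
           N (\<lambda>\<omega>. \<lambda>s\<in>{0..1}. sqrt (\<kappa> - 1) * B\<^sub>0 s \<omega>)" (is ?bridge)
    and "converges_in_distribution skorokhod_topology
           M (\<lambda>n \<omega>. \<lambda>s\<in>{0..1}. sqrt (real n) * randomized_bridge_process n (U n) (R n) \<omega> s)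
           N (\<lambda>\<omega>. \<lambda>s\<in>{0..1}. sqrt \<kappa> * B\<^sub>0 s \<omega>)" (is ?randomized)
proof -
  have M: "prob_space (M n)" if "n \<ge> 1" for n
  proof -
    interpret bridge_setting "M n" n \<kappa> "A n" "R n" by (rule setting[OF that])
    show ?thesis by (rule prob_space_axioms)
  qed
  have N: "prob_space N" using B by (auto simp: brownian_bridge_def gaussian_process_def)
  have cont: "continuous_on {0..1} (\<lambda>s. B\<^sub>0 s \<omega>)" if "\<omega> \<in> space N" for \<omega>
    using B that by (auto simp: brownian_bridge_def)
  have YD: "(\<lambda>s\<in>{0..1}. \<sigma> * B\<^sub>0 s \<omega>) \<in> skorokhod_space" if "\<omega> \<in> space N" for \<omega> \<sigma>
    by (rule continuous_in_skorokhod_space) (intro continuous_intros cont that)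
  have Ym: "(\<lambda>\<omega>. (\<lambda>s\<in>{0..1}. \<sigma> * B\<^sub>0 s \<omega>) s) \<in> borel_measurable N" if s: "s \<in> {0..1}" for s \<sigma>
    using brownian_bridge_moments(1)[OF B s] s by simp
  have Y2: "integrable N (\<lambda>\<omega>. ((\<lambda>s\<in>{0..1}. \<sigma> * B\<^sub>0 s \<omega>) s)\<^sup>2) \<and> (\<integral>\<omega>. ((\<lambda>s\<in>{0..1}. \<sigma> * B\<^sub>0 s \<omega>) s)\<^sup>2 \<partial>N) \<le> K"
    if s: "s \<in> {0..1}" and K: "\<sigma>\<^sup>2 \<le> K" for s \<sigma> K
  proof -
    have "(\<integral>\<omega>. (B\<^sub>0 s \<omega>)\<^sup>2 \<partial>N) = s - s * s"
      using B s by (auto simp: brownian_bridge_def power2_eq_square)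
    also have "\<dots> \<le> 1" using s zero_le_square[of s] unfolding atLeastAtMost_iff by linarith
    finally have "\<sigma>\<^sup>2 * (\<integral>\<omega>. (B\<^sub>0 s \<omega>)\<^sup>2 \<partial>N) \<le> \<sigma>\<^sup>2 * 1" by (rule mult_left_mono) simp
    then show ?thesis using brownian_bridge_moments(3)[OF B s] s K by (simp add: power_mult_distrib)
  qed
  have Ycos: "(\<integral>\<omega>. cos ((\<Sum>j<k. c j * (\<lambda>s\<in>{0..1}. \<sigma> * B\<^sub>0 s \<omega>) (s j)) + b) \<partial>N) =
      exp (- ((\<Sum>j<k. \<Sum>l<k. c j * c l * (min (s j) (s l) - s j * s l)) * \<sigma>\<^sup>2 / 2)) * cos b"
    if s: "\<And>j. j < k \<Longrightarrow> s j \<in> {0..1}" for k :: nat and s c b \<sigma>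
  proof -
    have "(\<Sum>j<k. c j * (\<lambda>s\<in>{0..1}. \<sigma> * B\<^sub>0 s \<omega>) (s j)) = (\<Sum>j<k. c j * (\<sigma> * B\<^sub>0 (s j) \<omega>))" for \<omega>
      using s by (intro sum.cong) auto
    then show ?thesis using brownian_bridge_cos[OF B, of k s c \<sigma> b] s by simp
  qed
  have n0: "sqrt (real 0) * bridge_process 0 (U 0) \<omega> s = 0" for \<omega> s by simp
  define X where "X n \<omega> = (\<lambda>s\<in>{0..1}. sqrt (real n) * bridge_process n (U n) \<omega> s)" for n \<omega>
  define Z where "Z n \<omega> = (\<lambda>s\<in>{0..1}. sqrt (real n) * randomized_bridge_process n (U n) (R n) \<omega> s)" for n \<omega>
  have X_eq: "X n \<omega> s = haar_weights.S n (A n) {..<nat \<lfloor>n * s\<rfloor>} \<omega>"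
    if n: "n \<ge> 1" and \<omega>: "\<omega> \<in> space (M n)" and s: "s \<in> {0..1}" for n \<omega> s
  proof -
    interpret bridge_setting "M n" n \<kappa> "A n" "R n" by (rule setting[OF n])
    have "nat \<lfloor>n * s\<rfloor> \<le> n" by (rule floor_index_le[OF s])
    then have "(\<Sum>i<nat \<lfloor>n * s\<rfloor>. sqrt n * ((cmod (U n \<omega> $$ (i, 0)))\<^sup>2 - 1 / n)) = (\<Sum>i<nat \<lfloor>n * s\<rfloor>. W 1 \<omega> i)"
      unfolding W_def using AU[OF n \<omega>] by (intro sum.cong) auto
    then show ?thesis using s by (simp add: X_def bridge_process_def S_def sum_distrib_left)
  qed
  have Z_eq: "Z n \<omega> s = bridge_setting.rand_bridge n (A n) (R n) \<omega> s"
    if n: "n \<ge> 1" and \<omega>: "\<omega> \<in> space (M n)" and s: "s \<in> {0..1}" for n \<omega> s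
  proof -
    interpret bridge_setting "M n" n \<kappa> "A n" "R n" by (rule setting[OF n])
    have "(\<Sum>i<n. sqrt n * ((cmod (U n \<omega> $$ (i, 0)))\<^sup>2 * (indicator {..s} (R n i \<omega>) - s))) = (\<Sum>i<n. W 0 \<omega> i * (indicator {..s} (R n i \<omega>) - s))"
      unfolding W_def using AU[OF n \<omega>] by (intro sum.cong) auto
    then show ?thesis using s by (simp add: Z_def randomized_bridge_process_def rand_bridge_def sum_distrib_left)
  qed
  have XD: "X n \<omega> \<in> skorokhod_space" for n \<omega>
  proof -
    have "X n \<omega> = step_path n (\<lambda>m. sqrt n * (\<Sum>i<m. (cmod (U n \<omega> $$ (i, 0)))\<^sup>2 - 1 / n))"
      by (simp add: X_def step_path_def bridge_process_def)
    then show ?thesis by (simp add: step_path_in_skorokhod_space)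
  qed
  have ZD: "Z n \<omega> \<in> skorokhod_space" for n \<omega>
    unfolding Z_def randomized_bridge_process_def by (rule weighted_empirical_in_skorokhod_space)
  have Xm: "(\<lambda>\<omega>. X n \<omega> s) \<in> borel_measurable (M n)" if s: "s \<in> {0..1}" for n s
  proof (cases "n = 0")
    case True
    \<comment> \<open>The factor sqrt 0 makes the path vanish, which settles measurability on the
      arbitrary space \<open>M 0\<close>.\<close>
    then have "X n \<omega> s = 0" for \<omega> using s by (simp add: X_def)
    then show ?thesis by simp
  next
    case False
    then have n: "n \<ge> 1" by simp
    interpret bridge_setting "M n" n \<kappa> "A n" "R n" by (rule setting[OF n])
    show ?thesis by (rule measurable_cong[THEN iffD1, OF _ S_measurable]) (use X_eq[OF n _ s] in simp)
  qed
  have Zm: "(\<lambda>\<omega>. Z n \<omega> s) \<in> borel_measurable (M n)" if s: "s \<in> {0..1}" for n s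
  proof (cases "n = 0")
    case True
    then have "Z n \<omega> s = 0" for \<omega> using s by (simp add: Z_def)
    then show ?thesis by simp
  next
    case False
    then have n: "n \<ge> 1" by simp
    interpret bridge_setting "M n" n \<kappa> "A n" "R n" by (rule setting[OF n])
    show ?thesis by (rule measurable_cong[THEN iffD1, OF _ rand_bridge_measurable]) (use Z_eq[OF n _ s] in simp)
  qed
  have "converges_in_distribution skorokhod_topology M X N (\<lambda>\<omega>. \<lambda>s\<in>{0..1}. sqrt (\<kappa> - 1) * B\<^sub>0 s \<omega>)"
  proof (rule functional_limit[where C = "739840 * \<kappa>\<^sup>2" and K = \<kappa> and ?n0.0 = 6, OF M N XD YD Xm Ym])
    fix n :: nat and \<omega> and a s :: real
    assume n: "n \<ge> 1" and \<omega>: "\<omega> \<in> space (M n)" and as: "0 \<le> a" "a \<le> s" "s \<le> 1"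
    interpret bridge_setting "M n" n \<kappa> "A n" "R n" by (rule setting[OF n])
    show "X n \<omega> s - X n \<omega> a \<ge> - sqrt n * (s - a) - 1 / sqrt n"
      using bridge_increment_lower[OF as(1,2), of \<omega>] X_eq[OF n \<omega>, of s] X_eq[OF n \<omega>, of a] as by simp
  next
    fix n :: nat and s t :: real
    assume n: "n \<ge> 6" and st: "0 \<le> s" "t \<le> 1" "1 / n \<le> t - s"
    interpret bridge_setting "M n" n \<kappa> "A n" "R n" by (rule setting) (use n in simp)
    have "0 \<le> 1 / real n" by simp
    then have r: "s \<in> {0..1}" "t \<in> {0..1}" using st unfolding atLeastAtMost_iff by linarith+
    have eq: "(X n \<omega> t - X n \<omega> s) ^ 4 = (S {..<nat \<lfloor>n * t\<rfloor>} \<omega> - S {..<nat \<lfloor>n * s\<rfloor>} \<omega>) ^ 4" if "\<omega> \<in> space (M n)" for \<omega>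
      using X_eq[OF _ that] r n by simp
    note P = bridge_increment_fourth_moment[OF n st]
    show "integrable (M n) (\<lambda>\<omega>. (X n \<omega> t - X n \<omega> s) ^ 4) \<and> (\<integral>\<omega>. (X n \<omega> t - X n \<omega> s) ^ 4 \<partial>M n) \<le> 739840 * \<kappa>\<^sup>2 * (t - s)\<^sup>2"
      by (rule integral_bound_cong[OF eq P])
  next
    fix n :: nat and s :: real
    assume n: "n \<ge> 6" and s: "s \<in> {0..1}"
    interpret bridge_setting "M n" n \<kappa> "A n" "R n" by (rule setting) (use n in simp)
    have eq: "(X n \<omega> s)\<^sup>2 = (S {..<nat \<lfloor>n * s\<rfloor>} \<omega>)\<^sup>2" if "\<omega> \<in> space (M n)" for \<omega>
      using X_eq[OF _ that s] n by simp
    show "integrable (M n) (\<lambda>\<omega>. (X n \<omega> s)\<^sup>2) \<and> (\<integral>\<omega>. (X n \<omega> s)\<^sup>2 \<partial>M n) \<le> \<kappa>"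
      by (rule integral_bound_cong[OF eq bridge_second_moment[OF s]])
  next
    fix s :: real assume "s \<in> {0..1}"
    then show "integrable N (\<lambda>\<omega>. ((\<lambda>s\<in>{0..1}. sqrt (\<kappa> - 1) * B\<^sub>0 s \<omega>) s)\<^sup>2) \<and> (\<integral>\<omega>. ((\<lambda>s\<in>{0..1}. sqrt (\<kappa> - 1) * B\<^sub>0 s \<omega>) s)\<^sup>2 \<partial>N) \<le> \<kappa>"
      by (rule Y2) (use \<kappa> in auto)
  next
    fix k :: nat and s c :: "nat \<Rightarrow> real" and b :: real
    assume s: "\<And>j. j < k \<Longrightarrow> s j \<in> {0..1}"
    define \<tau> where "\<tau> = (\<Sum>j<k. \<Sum>l<k. c j * c l * (min (s j) (s l) - s j * s l))"
    define D where "D = (\<Sum>j<k. \<bar>c j\<bar>)"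
    \<comment> \<open>The choice n^(-1/4) balances \<delta> against the counting error, which is of
      order n^(-1/2) / \<delta>.\<close>
    define \<delta> where "\<delta> n = 1 / sqrt (sqrt (real n))" for n :: nat
    have sq: "(sqrt (\<kappa> - 1))\<^sup>2 = \<kappa> - 1" using \<kappa> by auto
    have Yc: "(\<integral>\<omega>. cos ((\<Sum>j<k. c j * (\<lambda>s\<in>{0..1}. sqrt (\<kappa> - 1) * B\<^sub>0 s \<omega>) (s j)) + b) \<partial>N) = exp (- (\<tau> * (\<kappa> - 1) / 2)) * cos b"
      unfolding \<tau>_def using Ycos[where k = k and s = s and c = c and b = b and \<sigma> = "sqrt (\<kappa> - 1)"] s unfolding sq by simp
    show "(\<lambda>n. \<integral>\<omega>. cos ((\<Sum>j<k. c j * X n \<omega> (s j)) + b) \<partial>M n)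
        \<longlonglongrightarrow> (\<integral>\<omega>. cos ((\<Sum>j<k. c j * (\<lambda>s\<in>{0..1}. sqrt (\<kappa> - 1) * B\<^sub>0 s \<omega>) (s j)) + b) \<partial>N)"
      unfolding Yc
    proof (rule tendsto_of_error_bound[where ?n0.0 = 6])
      fix n :: nat assume n: "n \<ge> 6"
      interpret bridge_setting "M n" n \<kappa> "A n" "R n" by (rule setting) (use n in simp)
      have eq: "cos ((\<Sum>j<k. c j * X n \<omega> (s j)) + b) = cos ((\<Sum>j<k. c j * S {..<nat \<lfloor>n * s j\<rfloor>} \<omega>) + b)"
        if "\<omega> \<in> space (M n)" for \<omega>
      proof -
        have "(\<Sum>j<k. c j * X n \<omega> (s j)) = (\<Sum>j<k. c j * S {..<nat \<lfloor>n * s j\<rfloor>} \<omega>)"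
          using X_eq[OF _ that s] n by (intro sum.cong) auto
        then show ?thesis by simp
      qed
      have \<delta>: "\<delta> n > 0" using n by (simp add: \<delta>_def)
      have "\<bar>(\<integral>\<omega>. cos ((\<Sum>j<k. c j * S {..<nat \<lfloor>n * s j\<rfloor>} \<omega>) + b) \<partial>M n) - exp (- (\<tau> * (\<kappa> - 1) / 2)) * cos b\<bar> \<le>
          clt_error n \<kappa> D \<tau> + D * ((\<delta> n + (sqrt n + 1) * (\<kappa> / n) / \<delta> n) / 2)"
        unfolding \<tau>_def D_def by (rule bridge_clt[OF n s \<delta>])
      then show "\<bar>(\<integral>\<omega>. cos ((\<Sum>j<k. c j * X n \<omega> (s j)) + b) \<partial>M n) - exp (- (\<tau> * (\<kappa> - 1) / 2)) * cos b\<bar> \<le>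
          clt_error n \<kappa> D \<tau> + D * ((\<delta> n + (sqrt n + 1) * (\<kappa> / n) / \<delta> n) / 2)"
        by (subst Bochner_Integration.integral_cong[OF refl eq]) auto
    next
      have "(\<lambda>n. (\<delta> n + (sqrt n + 1) * (2 / n) / \<delta> n) / 2) \<longlonglongrightarrow> 0" "(\<lambda>n. (\<delta> n + (sqrt n + 1) * (3 / n) / \<delta> n) / 2) \<longlonglongrightarrow> 0"
        unfolding \<delta>_def by real_asymp+
      then have "(\<lambda>n. (\<delta> n + (sqrt n + 1) * (\<kappa> / n) / \<delta> n) / 2) \<longlonglongrightarrow> 0" using \<kappa> by auto
      then have "(\<lambda>n. clt_error n \<kappa> D \<tau> + D * ((\<delta> n + (sqrt n + 1) * (\<kappa> / n) / \<delta> n) / 2)) \<longlonglongrightarrow> 0 + D * 0"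
        by (intro tendsto_intros clt_error_tendsto[OF \<kappa>])
      then show "(\<lambda>n. clt_error n \<kappa> D \<tau> + D * ((\<delta> n + (sqrt n + 1) * (\<kappa> / n) / \<delta> n) / 2)) \<longlonglongrightarrow> 0" by simp
    qed
  qed
  then show ?bridge unfolding X_def[abs_def] .
  have "converges_in_distribution skorokhod_topology M Z N (\<lambda>\<omega>. \<lambda>s\<in>{0..1}. sqrt \<kappa> * B\<^sub>0 s \<omega>)"
  proof (rule functional_limit[where C = "2720 * \<kappa>\<^sup>2" and K = "1 + 2720 * \<kappa>\<^sup>2" and ?n0.0 = 6, OF M N ZD YD Zm Ym])
    fix n :: nat and \<omega> and a s :: real
    assume n: "n \<ge> 1" and \<omega>: "\<omega> \<in> space (M n)" and as: "0 \<le> a" "a \<le> s" "s \<le> 1"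
    interpret bridge_setting "M n" n \<kappa> "A n" "R n" by (rule setting[OF n])
    show "Z n \<omega> s - Z n \<omega> a \<ge> - sqrt n * (s - a) - 1 / sqrt n"
      using rand_bridge_lower[OF \<omega> as(2)] Z_eq[OF n \<omega>, of s] Z_eq[OF n \<omega>, of a] as by simp
  next
    fix n :: nat and s t :: real
    assume n: "n \<ge> 6" and st: "0 \<le> s" "t \<le> 1" "1 / n \<le> t - s"
    interpret bridge_setting "M n" n \<kappa> "A n" "R n" by (rule setting) (use n in simp)
    have "0 \<le> 1 / real n" by simp
    then have r: "s \<in> {0..1}" "t \<in> {0..1}" using st unfolding atLeastAtMost_iff by linarith+
    have eq: "(Z n \<omega> t - Z n \<omega> s) ^ 4 = (rand_bridge \<omega> t - rand_bridge \<omega> s) ^ 4" if "\<omega> \<in> space (M n)" for \<omega>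
      using Z_eq[OF _ that] r n by simp
    note P = rand_bridge_increment_fourth_moment[OF n st]
    show "integrable (M n) (\<lambda>\<omega>. (Z n \<omega> t - Z n \<omega> s) ^ 4) \<and> (\<integral>\<omega>. (Z n \<omega> t - Z n \<omega> s) ^ 4 \<partial>M n) \<le> 2720 * \<kappa>\<^sup>2 * (t - s)\<^sup>2"
      by (rule integral_bound_cong[OF eq P])
  next
    fix n :: nat and s :: real
    assume n: "n \<ge> 6" and s: "s \<in> {0..1}"
    interpret bridge_setting "M n" n \<kappa> "A n" "R n" by (rule setting) (use n in simp)
    have eq: "(Z n \<omega> s)\<^sup>2 = (rand_bridge \<omega> s)\<^sup>2" if "\<omega> \<in> space (M n)" for \<omega>
      using Z_eq[OF _ that s] n by simp
    show "integrable (M n) (\<lambda>\<omega>. (Z n \<omega> s)\<^sup>2) \<and> (\<integral>\<omega>. (Z n \<omega> s)\<^sup>2 \<partial>M n) \<le> 1 + 2720 * \<kappa>\<^sup>2"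
      by (rule integral_bound_cong[OF eq rand_bridge_second_moment[OF n s]])
  next
    fix s :: real assume "s \<in> {0..1}"
    then show "integrable N (\<lambda>\<omega>. ((\<lambda>s\<in>{0..1}. sqrt \<kappa> * B\<^sub>0 s \<omega>) s)\<^sup>2) \<and> (\<integral>\<omega>. ((\<lambda>s\<in>{0..1}. sqrt \<kappa> * B\<^sub>0 s \<omega>) s)\<^sup>2 \<partial>N) \<le> 1 + 2720 * \<kappa>\<^sup>2"
      by (rule Y2) (use \<kappa> in auto)
  next
    fix k :: nat and s c :: "nat \<Rightarrow> real" and b :: real
    assume s: "\<And>j. j < k \<Longrightarrow> s j \<in> {0..1}"
    define \<tau> where "\<tau> = (\<Sum>j<k. \<Sum>l<k. c j * c l * (min (s j) (s l) - s j * s l))"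
    define D where "D = (\<Sum>j<k. \<bar>c j\<bar>)"
    have sq: "(sqrt \<kappa>)\<^sup>2 = \<kappa>" using \<kappa> by auto
    have Yc: "(\<integral>\<omega>. cos ((\<Sum>j<k. c j * (\<lambda>s\<in>{0..1}. sqrt \<kappa> * B\<^sub>0 s \<omega>) (s j)) + b) \<partial>N) = exp (- (\<tau> * \<kappa> / 2)) * cos b"
      unfolding \<tau>_def using Ycos[where k = k and s = s and c = c and b = b and \<sigma> = "sqrt \<kappa>"] s unfolding sq by simp
    show "(\<lambda>n. \<integral>\<omega>. cos ((\<Sum>j<k. c j * Z n \<omega> (s j)) + b) \<partial>M n)
        \<longlonglongrightarrow> (\<integral>\<omega>. cos ((\<Sum>j<k. c j * (\<lambda>s\<in>{0..1}. sqrt \<kappa> * B\<^sub>0 s \<omega>) (s j)) + b) \<partial>N)"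
      unfolding Yc
    proof (rule tendsto_of_error_bound[where ?n0.0 = 6])
      fix n :: nat assume n: "n \<ge> 6"
      interpret bridge_setting "M n" n \<kappa> "A n" "R n" by (rule setting) (use n in simp)
      have eq: "cos ((\<Sum>j<k. c j * Z n \<omega> (s j)) + b) = cos ((\<Sum>j<k. c j * rand_bridge \<omega> (s j)) + b)"
        if "\<omega> \<in> space (M n)" for \<omega>
      proof -
        have "(\<Sum>j<k. c j * Z n \<omega> (s j)) = (\<Sum>j<k. c j * rand_bridge \<omega> (s j))"
          using Z_eq[OF _ that s] n by (intro sum.cong) auto
        then show ?thesis by simp
      qed
      have "\<bar>(\<integral>\<omega>. cos ((\<Sum>j<k. c j * rand_bridge \<omega> (s j)) + b) \<partial>M n) - exp (- (\<tau> * \<kappa> / 2)) * cos b\<bar> \<le> clt_error n \<kappa> D \<tau>"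
        unfolding \<tau>_def D_def rand_bridge_def by (rule randomized_clt[OF n s])
      then show "\<bar>(\<integral>\<omega>. cos ((\<Sum>j<k. c j * Z n \<omega> (s j)) + b) \<partial>M n) - exp (- (\<tau> * \<kappa> / 2)) * cos b\<bar> \<le> clt_error n \<kappa> D \<tau>"
        by (subst Bochner_Integration.integral_cong[OF refl eq]) auto
    qed (rule clt_error_tendsto[OF \<kappa>])
  qed
  then show ?randomized unfolding Z_def[abs_def] .
qed

theorem theorem3p1:
  fixes M :: "nat \<Rightarrow> 'a measure"
    and U :: "nat \<Rightarrow> 'a \<Rightarrow> complex mat"
    and R :: "nat \<Rightarrow> nat \<Rightarrow> 'a \<Rightarrow> real"
    and N :: "'b measure" and B\<^sub>0 :: "real \<Rightarrow> 'b \<Rightarrow> real"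
    and \<beta>' :: real
  assumes "(\<beta>' = 1 \<and> (\<forall>n\<ge>1. haar_setting (M n) n (unitary_group n) (U n) (R n))) \<or>
           (\<beta>' = 1 / 2 \<and> (\<forall>n\<ge>1. haar_setting (M n) n (orthogonal_group n) (U n) (R n)))"
    and "brownian_bridge N B\<^sub>0"
  shows "converges_in_distribution skorokhod_topology
           M (\<lambda>n \<omega>. \<lambda>s\<in>{0..1}. sqrt (real n) * bridge_process n (U n) \<omega> s)
           N (\<lambda>\<omega>. \<lambda>s\<in>{0..1}. sqrt (1 / \<beta>') * B\<^sub>0 s \<omega>) \<and>
         converges_in_distribution skorokhod_topology
           M (\<lambda>n \<omega>. \<lambda>s\<in>{0..1}. sqrt (real n) * randomized_bridge_process n (U n) (R n) \<omega> s)
           N (\<lambda>\<omega>. \<lambda>s\<in>{0..1}. sqrt (1 + 1 / \<beta>') * B\<^sub>0 s \<omega>)"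
proof -
  \<comment> \<open>2 for \<open>\<beta>' = 1\<close> and 3 for \<open>\<beta>' = 1 / 2\<close>; the
    factor in the first limit is \<open>\<kappa> - 1 = 1 / \<beta>'\<close>.\<close>
  define \<kappa> where "\<kappa> = 1 + 1 / \<beta>'"
  define F where "F = (if \<beta>' = 1 then UNIV else \<real> :: complex set)"
  have F: "F = UNIV \<and> \<kappa> = 2 \<or> F = \<real> \<and> \<kappa> = 3"
    using assms(1) unfolding F_def \<kappa>_def by (elim disjE conjE; hypsubst; simp)
  have "entry_group n UNIV = unitary_group n" "entry_group n \<real> = orthogonal_group n" for n
    by (auto simp: entry_group_def orthogonal_group_eq)
  then have H: "haar_setting (M n) n (entry_group n F) (U n) (R n)" if "n \<ge> 1" for n
    using assms(1) that by (auto simp: F_def)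
  note L = bridge_limits[OF _ haar_setting_bridge_setting[OF F H] _ assms(2), where U = U]
  have "\<kappa> = 2 \<or> \<kappa> = 3" using F by blast
  from L[OF this] show ?thesis unfolding \<kappa>_def by (simp add: first_column_def)
qed

end
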